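(* Let $K$ be algebraically closed with $\operatorname{char}(K)\neq 2$ and $\Lambda=P(\mathbb{L}_n)$. Then $\dim_K HH^0(\Lambda)=\dim_K HH_0(\Lambda)=2n$ and $\dim_K HH^i(\Lambda)=\dim_K HH_i(\Lambda)=n$ for all $i>0$.
   Context: Let $K$ be an algebraically closed field and $n\ge 1$. The preprojective algebra of type $\mathbb{L}_n$ is $\Lambda=P(\mathbb{L}_n)=KQ/I$, where the quiver $Q$ has vertices $1,\dots,n$, a loop $\epsilon$ at vertex $1$, and arrows $a_i:i\to i+1$ and $\bar a_i:i+1\to i$ for $1\le i\le n-1$. Paths are written from left to right. The ideal $I$ is generated by $\epsilon^2+a_1\bar a_1$, by $\bar a_{i-1}a_{i-1}+a_i\bar a_i$ for $2\le i\le n-1$, and by $\bar a_{n-1}a_{n-1}$ (when $n=1$ the only relation is $\epsilon^2$). $HH^i(\Lambda)=\operatorname{Ext}^i_{\Lambda^e}(\Lambda,\Lambda)$ and $HH_i(\Lambda)=\operatorname{Tor}_i^{\Lambda^e}(\Lambda,\Lambda)$ are the Hochschild cohomology and homology spaces, $\Lambda^e=\Lambda\otimes_K\Lambda^{op}$. *)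

theory Defs
  imports "HOL-Computational_Algebra.Polynomial" "HOL-Library.Function_Algebras"
begin

definition alg_closed :: "'k::field itself \<Rightarrow> bool" where
  "alg_closed _ \<longleftrightarrow> (\<forall>p::'k poly. degree p \<ge> 1 \<longrightarrow> (\<exists>x. poly p x = 0))"

datatype arr = Eps | Ar nat | Ab nat

fun asrc :: "arr \<Rightarrow> nat" where
  "asrc Eps = 1" | "asrc (Ar i) = i" | "asrc (Ab i) = Suc i"

fun atgt :: "arr \<Rightarrow> nat" where
  "atgt Eps = 1" | "atgt (Ar i) = Suc i" | "atgt (Ab i) = i"

fun valid_arr :: "nat \<Rightarrow> arr \<Rightarrow> bool" where
  "valid_arr n Eps = True"
| "valid_arr n (Ar i) = (1 \<le> i \<and> i < n)"
| "valid_arr n (Ab i) = (1 \<le> i \<and> i < n)"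

text \<open>Paths: trivial paths e_v, or nonempty composable arrow sequences (written left to right).\<close>
datatype path = Triv nat | Pth "arr list"

fun psrc :: "path \<Rightarrow> nat" where
  "psrc (Triv v) = v" | "psrc (Pth as) = asrc (hd as)"

fun ptgt :: "path \<Rightarrow> nat" where
  "ptgt (Triv v) = v" | "ptgt (Pth as) = atgt (last as)"

fun valid_path :: "nat \<Rightarrow> path \<Rightarrow> bool" where
  "valid_path n (Triv v) = (1 \<le> v \<and> v \<le> n)"
| "valid_path n (Pth as) = (as \<noteq> [] \<and> (\<forall>a\<in>set as. valid_arr n a) \<and>
      (\<forall>k. Suc k < length as \<longrightarrow> atgt (as ! k) = asrc (as ! Suc k)))"

fun pcat :: "path \<Rightarrow> path \<Rightarrow> path" where
  "pcat (Triv v) q = q"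
| "pcat p (Triv v) = p"
| "pcat (Pth as) (Pth bs) = Pth (as @ bs)"

definition pmult :: "path \<Rightarrow> path \<Rightarrow> path option" where
  "pmult p q = (if ptgt p = psrc q then Some (pcat p q) else None)"

type_synonym 'k kq = "path \<Rightarrow> 'k"

definition supp :: "('a \<Rightarrow> 'k::zero) \<Rightarrow> 'a set" where
  "supp x = {a. x a \<noteq> 0}"

definition smul :: "'k::times \<Rightarrow> ('a \<Rightarrow> 'k) \<Rightarrow> ('a \<Rightarrow> 'k)" where
  "smul c x = (\<lambda>a. c * x a)"

definition bp :: "path \<Rightarrow> 'k::zero_neq_one kq" where
  "bp p = (\<lambda>q. if q = p then 1 else 0)"

definition KQ :: "nat \<Rightarrow> 'k::zero kq set" where
  "KQ n = {x. finite (supp x) \<and> supp x \<subseteq> {p. valid_path n p}}"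

definition kqmult :: "'k::comm_ring_1 kq \<Rightarrow> 'k kq \<Rightarrow> 'k kq" where
  "kqmult x y = (\<lambda>r. \<Sum>(p,q) \<in> {(p,q). p \<in> supp x \<and> q \<in> supp y \<and> pmult p q = Some r}. x p * y q)"

definition pm :: "path \<Rightarrow> path \<Rightarrow> 'k::zero_neq_one kq" where
  "pm p q = (case pmult p q of Some r \<Rightarrow> bp r | None \<Rightarrow> 0)"

inductive_set lspan :: "('a \<Rightarrow> 'k::comm_ring_1) set \<Rightarrow> ('a \<Rightarrow> 'k) set" for S where
  lspan_zero: "0 \<in> lspan S"
| lspan_step: "x \<in> S \<Longrightarrow> y \<in> lspan S \<Longrightarrow> smul c x + y \<in> lspan S"

definition rel :: "nat \<Rightarrow> nat \<Rightarrow> 'k::comm_ring_1 kq" where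
  "rel n v = (if v = 1 then bp (Pth [Eps, Eps]) else bp (Pth [Ab (v - 1), Ar (v - 1)]))
           + (if v < n then bp (Pth [Ar v, Ab v]) else 0)"

definition Iideal :: "nat \<Rightarrow> 'k::field kq set" where
  "Iideal n = lspan {kqmult (kqmult (bp p) (rel n v)) (bp q) | p q v.
                       valid_path n p \<and> valid_path n q \<and> 1 \<le> v \<and> v \<le> n}"

type_synonym 'k ten = "path list \<Rightarrow> 'k"

definition tens :: "'k::comm_ring_1 kq list \<Rightarrow> 'k ten" where
  "tens xs = (\<lambda>w. if length w = length xs then (\<Prod>j<length xs. (xs ! j) (w ! j)) else 0)"

definition validw :: "nat \<Rightarrow> nat \<Rightarrow> path list \<Rightarrow> bool" where
  "validw n m w \<longleftrightarrow> length w = m \<and> (\<forall>p\<in>set w. valid_path n p)"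

definition Ten :: "nat \<Rightarrow> nat \<Rightarrow> 'k::zero ten set" where
  "Ten n m = {t. finite (supp t) \<and> supp t \<subseteq> {w. validw n m w}}"

text \<open>Kernel of KQ^{(x) m} -> Lambda^{(x) m}: spanned by tensors with one factor in I.\<close>
definition Nsub :: "nat \<Rightarrow> nat \<Rightarrow> 'k::field ten set" where
  "Nsub n m = lspan {tens (map bp ps1 @ [x] @ map bp ps2) | ps1 x ps2.
                 x \<in> Iideal n \<and> Suc (length ps1 + length ps2) = m \<and>
                 (\<forall>p\<in>set (ps1 @ ps2). valid_path n p)}"

section \<open>Hochschild chain complex: C_m = Lambda^{(x)(m+1)}\<close>

definition bbasis :: "nat \<Rightarrow> path list \<Rightarrow> 'k::comm_ring_1 ten" where
  "bbasis m w =
     (\<Sum>j<m. smul ((-1) ^ j)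
        (tens (map bp (take j w) @ [pm (w ! j) (w ! Suc j)] @ map bp (drop (Suc (Suc j)) w))))
   + smul ((-1) ^ m) (tens (pm (w ! m) (w ! 0) # map bp (take (m - 1) (drop 1 w))))"

definition bd :: "nat \<Rightarrow> 'k::comm_ring_1 ten \<Rightarrow> 'k ten" where
  "bd m t = (if m = 0 then 0 else (\<Sum>w\<in>supp t. smul (t w) (bbasis m w)))"

definition HHh_Z :: "nat \<Rightarrow> nat \<Rightarrow> 'k::field ten set" where
  "HHh_Z n i = {t \<in> Ten n (Suc i). bd i t \<in> Nsub n i}"

definition HHh_B :: "nat \<Rightarrow> nat \<Rightarrow> 'k::field ten set" where
  "HHh_B n i = {bd (Suc i) s + u | s u. s \<in> Ten n (Suc (Suc i)) \<and> u \<in> Nsub n (Suc i)}"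

section \<open>Hochschild cochain complex: C^m = Hom_K(Lambda^{(x) m}, Lambda)\<close>

text \<open>A cochain is given by its values (in KQ) on m-tuples of paths; it must send the
  kernel Nsub into I, and cochains with values in I represent zero.\<close>
type_synonym 'k coch = "path list \<times> path \<Rightarrow> 'k"

definition ev :: "'k coch \<Rightarrow> path list \<Rightarrow> 'k kq" where
  "ev f w = (\<lambda>p. f (w, p))"

definition fext :: "'k::comm_ring_1 coch \<Rightarrow> 'k ten \<Rightarrow> 'k kq" where
  "fext f t = (\<Sum>w\<in>supp t. smul (t w) (ev f w))"

definition Coch :: "nat \<Rightarrow> nat \<Rightarrow> 'k::field coch set" where
  "Coch n m = {f. (\<forall>w. ev f w \<in> KQ n) \<and> (\<forall>w. \<not> validw n m w \<longrightarrow> ev f w = 0)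
                 \<and> (\<forall>t\<in>Nsub n m. fext f t \<in> Iideal n)}"

definition cob :: "nat \<Rightarrow> nat \<Rightarrow> 'k::comm_ring_1 coch \<Rightarrow> 'k coch" where
  "cob n m f = (\<lambda>(w, p). if validw n (Suc m) w then
       (kqmult (bp (w ! 0)) (ev f (drop 1 w))
        + (\<Sum>j\<in>{1..m}. smul ((-1) ^ j)
             (fext f (tens (map bp (take (j - 1) w) @ [pm (w ! (j - 1)) (w ! j)] @ map bp (drop (Suc j) w)))))
        + smul ((-1) ^ Suc m) (kqmult (ev f (take m w)) (bp (w ! m)))) p
     else 0)"

definition HHc_Z :: "nat \<Rightarrow> nat \<Rightarrow> 'k::field coch set" where
  "HHc_Z n i = {f \<in> Coch n i. \<forall>w. ev (cob n i f) w \<in> Iideal n}"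

definition HHc_B :: "nat \<Rightarrow> nat \<Rightarrow> 'k::field coch set" where
  "HHc_B n i = {(if i = 0 then 0 else cob n (i - 1) g) + h | g h.
                  g \<in> Coch n (i - 1) \<and> h \<in> Coch n i \<and> (\<forall>w. ev h w \<in> Iideal n)}"

definition has_qdim :: "('a \<Rightarrow> 'k::field) set \<Rightarrow> ('a \<Rightarrow> 'k) set \<Rightarrow> nat \<Rightarrow> bool" where
  "has_qdim Z B d \<longleftrightarrow> (\<exists>S. S \<subseteq> Z \<and> finite S \<and> card S = d
      \<and> (\<forall>c. (\<Sum>s\<in>S. smul (c s) s) \<in> B \<longrightarrow> (\<forall>s\<in>S. c s = 0))
      \<and> (\<forall>z\<in>Z. \<exists>c. z - (\<Sum>s\<in>S. smul (c s) s) \<in> B))"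

definition dim_HH_coh_is :: "'k::field itself \<Rightarrow> nat \<Rightarrow> nat \<Rightarrow> nat \<Rightarrow> bool" where
  "dim_HH_coh_is _ n i d \<longleftrightarrow> has_qdim (HHc_Z n i :: 'k coch set) (HHc_B n i) d"

definition dim_HH_hom_is :: "'k::field itself \<Rightarrow> nat \<Rightarrow> nat \<Rightarrow> nat \<Rightarrow> bool" where
  "dim_HH_hom_is _ n i d \<longleftrightarrow> has_qdim (HHh_Z n i :: 'k ten set) (HHh_B n i) d"

end

theory Submission
  imports Defs "HOL-Library.Poly_Mapping"
begin

text \<open>After the sign change of the arrows \<open>a_i\<close>, the algebra has a basis of triples (source, target,
  degree) in which a product of basis elements is zero or a basis element, and it is symmetric for the
  pairing of a basis element with its dual.  Its bimodule resolution has period 3 up to a sign twist \<open>\<theta>\<close>,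
  so period 6.  A double complex contains both the cyclic bar complex and the small complex obtained from
  the periodic resolution, and two contracting homotopies, checked on leading terms only, show that
  both inclusions are quasi-isomorphisms.  A third such homotopy retracts the small complex
  onto explicit classes; it divides by 2.  Cohomology is dual to homology by the symmetry.\<close>

section \<open>Quotients of vector spaces\<close>

text \<open>Exactness of the resolution enters only as a matching of leading terms, which is
  arithmetic on triples; unipotence of Dh + hD does the rest. Since the given complexes are
  quotients of tensor powers of the path algebra, a further layer identifies them with words in the
  finite basis. The twist \<theta> is forced by the loop. After the sign change the relation at a
  vertex is a difference of two squares of arrows, and the Casimir map followed by the derivative of
  the relation vanishes only if an arrow and its reverse carry opposite signs. The loop is its own
  reverse, so passing it must cost a sign: \<theta> is -1 on the loop and 1 on the other arrows, and
  its exponent grows by one in each period. In the small complex the powers of \<theta> collect to 1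
  + (-1)^k or 1 - (-1)^k, hence to 0 or 2. This is where 2 must be invertible, and why the
  representatives, though not their number, depend on the parity of the period. Degree 0 is
  exceptional because no Casimir map leaves it: the n idempotents survive there next to the n odd
  powers of the loop.\<close>

abbreviation lookup :: "('a \<Rightarrow>\<^sub>0 'k::zero) \<Rightarrow> 'a \<Rightarrow> 'k" where "lookup \<equiv> Poly_Mapping.lookup"
abbreviation keys :: "('a \<Rightarrow>\<^sub>0 'k::zero) \<Rightarrow> 'a set" where "keys \<equiv> Poly_Mapping.keys"

definition scp :: "'k::field \<Rightarrow> ('a \<Rightarrow>\<^sub>0 'k) \<Rightarrow> ('a \<Rightarrow>\<^sub>0 'k)" where
  "scp c z = Poly_Mapping.map ((*) c) z"

definition sg :: "'a \<Rightarrow> ('a \<Rightarrow>\<^sub>0 'k::field)" where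
  "sg x = Poly_Mapping.single x 1"

lemma lookup_scp [simp]: "lookup (scp c z) x = c * lookup z x"
  by (simp add: scp_def Poly_Mapping.map.rep_eq when_def)

lemma lookup_sg: "lookup (sg x) y = (if x = y then 1 else 0)"
  by (simp add: sg_def lookup_single when_def)

lemma keys_sg [simp]: "keys (sg x :: 'a \<Rightarrow>\<^sub>0 'k::field) = {x}"
  by (simp add: sg_def)

interpretation pmv: vector_space "scp :: 'k::field \<Rightarrow> ('a \<Rightarrow>\<^sub>0 'k) \<Rightarrow> _"
  by unfold_locales (auto intro!: poly_mapping_eqI simp: lookup_add algebra_simps)

interpretation fnv: vector_space "smul :: 'k::field \<Rightarrow> ('a \<Rightarrow> 'k) \<Rightarrow> _"
  by unfold_locales (auto simp: smul_def fun_eq_iff algebra_simps)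

text \<open>The body of \<open>has_qdim\<close> with the scalar multiplication as a parameter, since
  dimensions are carried between finitely supported chains (\<open>scp\<close>) and plain functions
  (\<open>smul\<close>).\<close>

definition qdim :: "('k::field \<Rightarrow> 'v::ab_group_add \<Rightarrow> 'v) \<Rightarrow> 'v set \<Rightarrow> 'v set \<Rightarrow> nat \<Rightarrow> bool" where
  "qdim sc Z B d \<longleftrightarrow> (\<exists>S. S \<subseteq> Z \<and> finite S \<and> card S = d
      \<and> (\<forall>c. (\<Sum>s\<in>S. sc (c s) s) \<in> B \<longrightarrow> (\<forall>s\<in>S. c s = 0))
      \<and> (\<forall>z\<in>Z. \<exists>c. z - (\<Sum>s\<in>S. sc (c s) s) \<in> B))"

lemma has_qdim_qdim: "has_qdim Z B d \<longleftrightarrow> qdim smul Z B d"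
  by (simp add: has_qdim_def qdim_def)

text \<open>A linear relation that is total on both sides and matches \<open>B\<close> with
  \<open>B'\<close> induces an isomorphism of the quotients. Relations replace maps because chains
  are compared up to boundaries or through chosen representatives, where at best one direction is a
  function.\<close>

lemma qdim_rel:
  fixes sc :: "'k::field \<Rightarrow> 'v::ab_group_add \<Rightarrow> 'v" and sc' :: "'k \<Rightarrow> 'w::ab_group_add \<Rightarrow> 'w"
  assumes "vector_space sc" "vector_space sc'"
    and add: "\<And>x y x' y'. R x x' \<Longrightarrow> R y y' \<Longrightarrow> R (x + y) (x' + y')"
    and scl: "\<And>c x x'. R x x' \<Longrightarrow> R (sc c x) (sc' c x')"
    and lt: "\<And>x. x \<in> Z \<Longrightarrow> \<exists>x'\<in>Z'. R x x'"
    and rt: "\<And>x'. x' \<in> Z' \<Longrightarrow> \<exists>x\<in>Z. R x x'"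
    and RB: "\<And>x x'. R x x' \<Longrightarrow> x \<in> Z \<Longrightarrow> x' \<in> Z' \<Longrightarrow> x \<in> B \<longleftrightarrow> x' \<in> B'"
    and Z: "module.subspace sc Z" and Z': "module.subspace sc' Z'" and B'0: "0 \<in> B'"
    and q: "qdim sc Z B d"
  shows "qdim sc' Z' B' d"
proof -
  interpret V: vector_space sc by fact
  interpret W: vector_space sc' by fact
  obtain S where S: "S \<subseteq> Z" "finite S" "card S = d"
    and ind0: "\<forall>c. (\<Sum>s\<in>S. sc (c s) s) \<in> B \<longrightarrow> (\<forall>s\<in>S. c s = 0)"
    and spn0: "\<forall>z\<in>Z. \<exists>c. z - (\<Sum>s\<in>S. sc (c s) s) \<in> B"
    using q unfolding qdim_def by (elim exE conjE) (rule that)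
  note ind = ind0[THEN spec, THEN mp] and spn = bspec[OF spn0]
  have "\<forall>s\<in>S. \<exists>x'. x' \<in> Z' \<and> R s x'" using lt S by blast
  then obtain F where F: "\<And>s. s \<in> S \<Longrightarrow> F s \<in> Z'" "\<And>s. s \<in> S \<Longrightarrow> R s (F s)" by metis
  have R00: "R 0 0"
  proof -
    obtain x where "R 0 x" using lt[of 0] Z V.subspace_0 by blast
    then show ?thesis using scl[of 0 x 0] by simp
  qed
  have Rsum: "R (\<Sum>s\<in>T. sc (c s) s) (\<Sum>s\<in>T. sc' (c s) (F s))" if "T \<subseteq> S" for T c
    using finite_subset[OF that S(2)] that
    by (induction T rule: finite_induct) (auto simp: R00 intro!: add scl F)
  have ZS: "(\<Sum>s\<in>S. sc (c s) s) \<in> Z" for c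
    using S(1) by (intro V.subspace_sum[OF Z] V.subspace_scale[OF Z]) auto
  have Z'S: "(\<Sum>s\<in>S. sc' (c s) (F s)) \<in> Z'" for c
    using F(1) by (intro W.subspace_sum[OF Z'] W.subspace_scale[OF Z']) auto
  have ind': "\<forall>s\<in>S. c s = 0" if "(\<Sum>s\<in>S. sc' (c s) (F s)) \<in> B'" for c
    using RB[OF Rsum[OF subset_refl] ZS Z'S] ind[of c] that by simp
  have inj: "inj_on F S"
  proof (rule inj_onI, rule ccontr)
    fix s t assume st: "s \<in> S" "t \<in> S" "F s = F t" "s \<noteq> t"
    \<comment> \<open>Two members of \<open>S\<close> with the same image would give a relation with
      coefficients 1 and -1; so \<open>F\<close> is injective and the cardinality survives.\<close>
    define c where "c = (\<lambda>x. if x = s then 1 else if x = t then - 1 else (0::'k))"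
    have "(\<Sum>x\<in>S. sc' (c x) (F x)) = (\<Sum>x\<in>{s,t}. sc' (c x) (F x))"
      using st S(2) by (intro sum.mono_neutral_right) (auto simp: c_def)
    also have "\<dots> = 0" using st by (simp add: c_def)
    finally have "\<forall>x\<in>S. c x = 0" using ind' B'0 by simp
    then show False using st by (auto simp: c_def)
  qed
  have re: "(\<Sum>s\<in>F ` S. sc' (c s) s) = (\<Sum>s\<in>S. sc' (c (F s)) (F s))" for c
    using inj by (simp add: sum.reindex)
  show ?thesis unfolding qdim_def
  proof (intro exI[of _ "F ` S"] conjI allI impI ballI)
    show "F ` S \<subseteq> Z'" using F by blast
    show "finite (F ` S)" using S by simp
    show "card (F ` S) = d" using S inj by (simp add: card_image)
    show "c s = 0" if "(\<Sum>s\<in>F ` S. sc' (c s) s) \<in> B'" "s \<in> F ` S" for c s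
      using ind'[of "\<lambda>s. c (F s)"] that unfolding re by blast
  next
    fix z' assume z': "z' \<in> Z'"
    obtain z where z: "z \<in> Z" "R z z'" using rt[OF z'] by blast
    obtain c where c: "z - (\<Sum>s\<in>S. sc (c s) s) \<in> B" using spn[OF z(1)] by (rule exE)
    have "R (z + (\<Sum>s\<in>S. sc (- c s) s)) (z' + (\<Sum>s\<in>S. sc' (- c s) (F s)))"
      using z by (intro add Rsum) auto
    then have r: "R (z - (\<Sum>s\<in>S. sc (c s) s)) (z' - (\<Sum>s\<in>S. sc' (c s) (F s)))"
      by (simp add: sum_negf)
    have "z - (\<Sum>s\<in>S. sc (c s) s) \<in> Z" using z ZS by (intro V.subspace_diff[OF Z]) auto
    moreover have "z' - (\<Sum>s\<in>S. sc' (c s) (F s)) \<in> Z'"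
      using z' Z'S by (intro W.subspace_diff[OF Z']) auto
    ultimately have "z' - (\<Sum>s\<in>S. sc' (c s) (F s)) \<in> B'" using RB[OF r] c by blast
    moreover have "(\<Sum>s\<in>S. sc' (c s) (F s)) = (\<Sum>s\<in>F ` S. sc' ((c \<circ> inv_into S F) s) s)"
      unfolding re using inj by (intro sum.cong) auto
    ultimately show "\<exists>c. z' - (\<Sum>s\<in>F ` S. sc' (c s) s) \<in> B'" by metis
  qed
qed

lemma qdim_family:
  fixes sc :: "'k::field \<Rightarrow> 'v::ab_group_add \<Rightarrow> 'v"
  assumes "vector_space sc" "finite I"
    and ind: "\<And>c. (\<Sum>i\<in>I. sc (c i) (e i)) = 0 \<Longrightarrow> \<forall>i\<in>I. c i = 0"
    and W: "W = {\<Sum>i\<in>I. sc (c i) (e i) | c. True}"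
  shows "qdim sc W {0} (card I)"
proof -
  interpret V: vector_space sc by fact
  have inj: "inj_on e I"
  proof (rule inj_onI, rule ccontr)
    fix s t assume st: "s \<in> I" "t \<in> I" "e s = e t" "s \<noteq> t"
    define c where "c = (\<lambda>x. if x = s then 1 else if x = t then - 1 else (0::'k))"
    have "(\<Sum>x\<in>I. sc (c x) (e x)) = (\<Sum>x\<in>{s,t}. sc (c x) (e x))"
      using st assms(2) by (intro sum.mono_neutral_right) (auto simp: c_def)
    also have "\<dots> = 0" using st by (simp add: c_def)
    finally have "\<forall>x\<in>I. c x = 0" using ind by simp
    then show False using st by (auto simp: c_def)
  qed
  have re: "(\<Sum>s\<in>e ` I. sc (c s) s) = (\<Sum>s\<in>I. sc (c (e s)) (e s))" for c
    using inj by (simp add: sum.reindex)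
  show ?thesis unfolding qdim_def
  proof (intro exI[of _ "e ` I"] conjI allI impI ballI)
    show "e ` I \<subseteq> W"
    proof
      fix x assume "x \<in> e ` I"
      then obtain i where i: "i \<in> I" "x = e i" by blast
      have "(\<Sum>j\<in>I. sc (if j = i then 1 else 0) (e j)) = (\<Sum>j\<in>I. if j = i then e j else 0)"
        by (intro sum.cong) auto
      also have "\<dots> = x" using i assms(2) by (simp add: sum.delta')
      finally show "x \<in> W" unfolding W by (auto intro!: exI[of _ "\<lambda>j. if j = i then 1 else 0"])
    qed
    show "finite (e ` I)" using assms by simp
    show "card (e ` I) = card I" using inj by (simp add: card_image)
    show "c s = 0" if "(\<Sum>s\<in>e ` I. sc (c s) s) \<in> {0}" "s \<in> e ` I" for c s
      using ind[of "\<lambda>s. c (e s)"] that unfolding re by auto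
    show "\<exists>c. z - (\<Sum>s\<in>e ` I. sc (c s) s) \<in> {0}" if "z \<in> W" for z
    proof -
      from that obtain c where z: "z = (\<Sum>i\<in>I. sc (c i) (e i))" unfolding W by (elim CollectE exE conjE)
      have "(\<Sum>s\<in>I. sc (c s) (e s)) = (\<Sum>s\<in>e ` I. sc ((c \<circ> inv_into I e) s) s)"
        unfolding re using inj by (intro sum.cong) auto
      then show ?thesis unfolding z by (intro exI[of _ "c \<circ> inv_into I e"]) simp
    qed
  qed
qed

section \<open>Linear extension\<close>

definition lext :: "('a \<Rightarrow> ('b \<Rightarrow>\<^sub>0 'k::field)) \<Rightarrow> ('a \<Rightarrow>\<^sub>0 'k) \<Rightarrow> ('b \<Rightarrow>\<^sub>0 'k)" where
  "lext f z = (\<Sum>x\<in>keys z. scp (lookup z x) (f x))"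

lemma lext_superset: "finite A \<Longrightarrow> keys z \<subseteq> A \<Longrightarrow> lext f z = (\<Sum>x\<in>A. scp (lookup z x) (f x))"
  unfolding lext_def by (rule sum.mono_neutral_left) (auto simp: in_keys_iff)

lemma lext_0 [simp]: "lext f 0 = 0" by (simp add: lext_def)
lemma lext_sg [simp]: "lext f (sg x) = f x" by (simp add: lext_def lookup_sg)

lemma lext_add: "lext f (y + z) = lext f y + lext f z"
proof -
  have "lext f w = (\<Sum>x\<in>keys y \<union> keys z. scp (lookup w x) (f x))" if "w \<in> {y + z, y, z}" for w
    using that keys_add[of y z] by (intro lext_superset) auto
  then show ?thesis by (simp add: lookup_add pmv.scale_left_distrib sum.distrib)
qed

lemma keys_scp: "keys (scp c z) \<subseteq> keys z" by (auto simp: in_keys_iff)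

lemma lext_scp: "lext f (scp c z) = scp c (lext f z)"
  using lext_superset[of "keys z" "scp c z" f] lext_superset[of "keys z" z f] keys_scp[of c z]
  by (simp add: pmv.scale_sum_right)

lemma lext_uminus: "lext f (- z) = - lext f z"
  using lext_scp[of f "-1" z] by simp

lemma lext_diff: "lext f (y - z) = lext f y - lext f z"
  using lext_add[of f y "- z"] by (simp add: lext_uminus)

lemma lext_sum: "lext f (\<Sum>i\<in>I. g i) = (\<Sum>i\<in>I. lext f (g i))"
  by (induction I rule: infinite_finite_induct) (auto simp: lext_add)

lemmas lext_lin = lext_add lext_scp lext_uminus lext_diff lext_sum

lemma lext_cong: "(\<And>x. x \<in> keys z \<Longrightarrow> f x = g x) \<Longrightarrow> lext f z = lext g z"
  by (simp add: lext_def)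

lemma lext_lext: "lext g (lext f z) = lext (\<lambda>x. lext g (f x)) z"
  by (simp add: lext_def[of f] lext_lin) (simp add: lext_def)

lemma lext_plus: "lext (\<lambda>x. f x + g x) z = lext f z + lext g z"
  by (simp add: lext_def pmv.scale_right_distrib sum.distrib)
lemma lext_scpf: "lext (\<lambda>x. scp c (f x)) z = scp c (lext f z)"
  by (simp add: lext_def pmv.scale_sum_right mult.commute)
lemma lext_minusf: "lext (\<lambda>x. f x - g x) z = lext f z - lext g z"
  by (simp add: lext_def pmv.scale_right_diff_distrib sum_subtractf)
lemma lext_zerof [simp]: "lext (\<lambda>x. 0) z = 0" by (simp add: lext_def)
lemma lext_sgf [simp]: "lext sg z = z"
proof (rule poly_mapping_eqI)
  fix x
  have "lookup (lext sg z) x = (\<Sum>y\<in>keys z. if y = x then lookup z x else 0)"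
    unfolding lext_def lookup_sum lookup_scp by (intro sum.cong) (auto simp: lookup_sg)
  also have "\<dots> = lookup z x" by (simp add: in_keys_iff)
  finally show "lookup (lext sg z) x = lookup z x" .
qed

lemmas lext_linf = lext_plus lext_scpf lext_minusf

lemma lext_mem:
  assumes "module.subspace scp W" "\<And>x. x \<in> keys z \<Longrightarrow> f x \<in> W"
  shows "lext f z \<in> W"
  unfolding lext_def using assms by (intro pmv.subspace_sum pmv.subspace_scale) auto

definition vs :: "'a set \<Rightarrow> ('a \<Rightarrow>\<^sub>0 'k::field) set" where "vs X = {z. keys z \<subseteq> X}"

lemma subspace_vs [simp]: "pmv.subspace (vs X)"
proof (unfold pmv.subspace_def, intro conjI ballI allI)
  show "0 \<in> vs X" by (simp add: vs_def)
  fix x assume x: "x \<in> vs X"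
  show "scp c x \<in> vs X" for c using x keys_scp[of c x] by (auto simp: vs_def)
  show "x + y \<in> vs X" if "y \<in> vs X" for y using x that keys_add[of x y] by (auto simp: vs_def)
qed

lemma vs_mono: "X \<subseteq> Y \<Longrightarrow> z \<in> vs X \<Longrightarrow> z \<in> vs Y" by (auto simp: vs_def)
lemma sg_vs [simp]: "(sg x :: 'a \<Rightarrow>\<^sub>0 'k::field) \<in> vs X \<longleftrightarrow> x \<in> X" by (simp add: vs_def)

lemmas vs_intros = pmv.subspace_add[OF subspace_vs] pmv.subspace_scale[OF subspace_vs]
  pmv.subspace_diff[OF subspace_vs] pmv.subspace_neg[OF subspace_vs] pmv.subspace_0[OF subspace_vs]
  pmv.subspace_sum[OF subspace_vs]

lemma lext_vs: "z \<in> vs X \<Longrightarrow> (\<And>x. x \<in> X \<Longrightarrow> f x \<in> vs Y) \<Longrightarrow> lext f z \<in> vs Y"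
  by (rule lext_mem[OF subspace_vs]) (auto simp: vs_def)

lemma linear_lext: "Vector_Spaces.linear scp scp (lext f)"
  by unfold_locales (auto simp: lext_lin)

section \<open>Algebraic Morse theory\<close>

text \<open>Modulo \<open>W\<close> the operator Dh + hD is the identity plus a part of lower rank.
  If hDz = 0, then z equals D(hz) up to \<open>W\<close> and a remainder of lower rank that
  satisfies the same condition, so induction on the rank makes z a boundary plus an element of
  \<open>W\<close>.\<close>

lemma morse_reduce:
  fixes D h :: "'x \<Rightarrow> ('x \<Rightarrow>\<^sub>0 'k::field)" and rk :: "'x \<Rightarrow> nat"
  assumes h: "\<And>x. x \<in> X \<Longrightarrow> h x \<in> vs Y"
    and DD: "\<And>x. lext D (D x) = 0"
    and W: "pmv.subspace W"
    and DhW: "\<And>w. w \<in> W \<Longrightarrow> lext h (lext D w) = 0"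
    and loc: "\<And>x. x \<in> X \<Longrightarrow> \<exists>w\<in>W. \<exists>u\<in>vs {y\<in>X. rk y < rk x}.
                 lext D (h x) + lext h (D x) = sg x + w + u"
    and z: "z \<in> vs X" "lext h (lext D z) = 0"
  shows "\<exists>y\<in>vs Y. \<exists>w\<in>W. z = lext D y + w"
proof -
  have *: "\<exists>y\<in>vs Y. \<exists>w\<in>W. z = lext D y + w"
    if "z \<in> vs {x\<in>X. rk x < m}" "lext h (lext D z) = 0" for z m
    using that
  proof (induction m arbitrary: z)
    case 0
    then have "z = 0" by (auto simp: vs_def)
    then show ?case using pmv.subspace_0[OF W] by (intro bexI[of _ 0]) (auto simp: vs_intros)
  next
    case (Suc m)
    have "\<exists>p. fst p \<in> W \<and> snd p \<in> vs {y\<in>X. rk y < rk x} \<and>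
                 lext D (h x) + lext h (D x) = sg x + fst p + snd p" if "x \<in> X" for x
      using loc[OF that] by (elim bexE) (rule exI[of _ "(_, _)"], simp)
    then have "\<forall>x\<in>X. \<exists>p. fst p \<in> W \<and> snd p \<in> vs {y\<in>X. rk y < rk x} \<and>
                 lext D (h x) + lext h (D x) = sg x + fst p + snd p" by simp
    from bchoice[OF this] obtain p where p: "\<forall>x\<in>X. fst (p x) \<in> W \<and> snd (p x) \<in> vs {y\<in>X. rk y < rk x} \<and>
                 lext D (h x) + lext h (D x) = sg x + fst (p x) + snd (p x)" by (rule exE)
    define w u where "w x = fst (p x)" and "u x = snd (p x)" for x
    have wu: "\<And>x. x \<in> X \<Longrightarrow> w x \<in> W" "\<And>x. x \<in> X \<Longrightarrow> u x \<in> vs {y\<in>X. rk y < rk x}"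
      "\<And>x. x \<in> X \<Longrightarrow> lext D (h x) + lext h (D x) = sg x + w x + u x"
      using p by (simp_all add: w_def u_def)
    have kz: "x \<in> X \<and> rk x < Suc m" if "x \<in> keys z" for x using Suc.prems(1) that by (auto simp: vs_def)
    have "lext D (lext h z) + lext h (lext D z) = lext (\<lambda>x. lext D (h x) + lext h (D x)) z"
      by (simp add: lext_lext lext_plus)
    also have "\<dots> = lext (\<lambda>x. sg x + w x + u x) z" using kz wu(3) by (intro lext_cong) auto
    also have "\<dots> = z + lext w z + lext u z" by (simp add: lext_plus)
    finally have e: "lext D (lext h z) = z + lext w z + lext u z" using Suc.prems(2) by simp
    have wW: "lext w z \<in> W" using kz wu by (intro lext_mem W) auto
    have "lext u z \<in> vs {x\<in>X. rk x < m}"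
    proof (intro lext_mem subspace_vs)
      fix x assume x: "x \<in> keys z"
      have "{y\<in>X. rk y < rk x} \<subseteq> {x\<in>X. rk x < m}" using kz[OF x] by auto
      then show "u x \<in> vs {x\<in>X. rk x < m}" using vs_mono wu(2) kz[OF x] by blast
    qed
    \<comment> \<open>The boundary of the remainder is a combination of Dz and the boundary of an
      element of \<open>W\<close>; h kills both, so the induction applies.\<close>
    moreover have "lext h (lext D (lext u z)) = 0"
    proof -
      have "lext u z = lext D (lext h z) - z - lext w z" using e by (simp add: algebra_simps)
      then have "lext D (lext u z) = - lext D z - lext D (lext w z)"
        by (simp add: lext_lin lext_lext DD)
      then show ?thesis using DhW[OF wW] Suc.prems(2) by (simp add: lext_lin)
    qed
    ultimately obtain y w' where yw: "y \<in> vs Y" "w' \<in> W" "lext u z = lext D y + w'"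
      using Suc.IH by blast
    have "z = lext D (lext h z - y) + (- lext w z - w')" using e yw(3) by (simp add: lext_lin algebra_simps)
    moreover have "lext h z - y \<in> vs Y"
      using yw(1) kz h by (intro vs_intros lext_mem) auto
    moreover have "- lext w z - w' \<in> W" using wW yw(2) W by (simp add: pmv.subspace_diff pmv.subspace_neg)
    ultimately show ?case by blast
  qed
  \<comment> \<open>The rank may be unbounded on \<open>X\<close>; the finite support of z bounds it
    here.\<close>
  define m where "m = Suc (Max (insert 0 (rk ` keys z)))"
  have "z \<in> vs {x\<in>X. rk x < m}" using z(1)
    by (auto simp: vs_def m_def less_Suc_eq_le)
  then show ?thesis using * z(2) by blast
qed

definition cycles :: "(nat \<Rightarrow> 'x set) \<Rightarrow> ('x \<Rightarrow> ('x \<Rightarrow>\<^sub>0 'k::field)) \<Rightarrow> nat \<Rightarrow> ('x \<Rightarrow>\<^sub>0 'k) set" where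
  "cycles X D i = {z \<in> vs (X i). lext D z = 0}"

definition boundaries :: "(nat \<Rightarrow> 'x set) \<Rightarrow> ('x \<Rightarrow> ('x \<Rightarrow>\<^sub>0 'k::field)) \<Rightarrow> nat \<Rightarrow> ('x \<Rightarrow>\<^sub>0 'k) set" where
  "boundaries X D i = lext D ` vs (X (Suc i))"

lemma subspace_cycles [simp]: "pmv.subspace (cycles X D i)"
  unfolding cycles_def by (auto simp: pmv.subspace_def lext_lin vs_intros)

lemma subspace_boundaries [simp]: "pmv.subspace (boundaries X D i)"
  unfolding boundaries_def pmv.subspace_def
  by (auto simp: image_iff lext_lin vs_intros) (metis lext_0 vs_intros(5), metis lext_add vs_intros(1), metis lext_scp vs_intros(2))

text \<open>The subspaces W i form a subcomplex on which the homotopy h vanishes; modulo W the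
  map Dh + hD is unipotent.\<close>

theorem morse_quasi_iso:
  fixes D h :: "'x \<Rightarrow> ('x \<Rightarrow>\<^sub>0 'k::field)" and rk :: "'x \<Rightarrow> nat"
  assumes h: "\<And>i x. x \<in> X i \<Longrightarrow> h x \<in> vs (X (Suc i))"
    and DD: "\<And>x. lext D (D x) = 0"
    and W: "\<And>i. pmv.subspace (W i)" "\<And>i. W i \<subseteq> vs (X i)"
    and DW: "\<And>i w. w \<in> W (Suc i) \<Longrightarrow> lext D w \<in> W i"
    and DhW: "\<And>i w. w \<in> W i \<Longrightarrow> lext h (lext D w) = 0"
    and hW: "\<And>i w. w \<in> W i \<Longrightarrow> lext h w = 0"
    and loc: "\<And>i x. x \<in> X i \<Longrightarrow> \<exists>w\<in>W i. \<exists>u\<in>vs {y\<in>X i. rk y < rk x}.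
                 lext D (h x) + lext h (D x) = sg x + w + u"
  shows "qdim scp {w \<in> W i. lext D w = 0} (lext D ` W (Suc i)) d \<longleftrightarrow> qdim scp (cycles X D i) (boundaries X D i) d"
    (is "qdim scp ?Z ?B d \<longleftrightarrow> _")
proof -
  have red: "\<exists>y\<in>vs (X (Suc i)). \<exists>w\<in>W i. z = lext D y + w" if "z \<in> vs (X i)" "lext h (lext D z) = 0" for z i
    by (rule morse_reduce[where rk = rk, OF h DD W(1) DhW loc that])
  \<comment> \<open>Homologous in the large complex: neither side determines the other.\<close>
  define R where "R = (\<lambda>w z. w \<in> W i \<and> w - z \<in> boundaries X D i)"
  have Zs: "pmv.subspace ?Z" using W(1)[of i] by (auto simp: pmv.subspace_def lext_lin)
  have add: "R (x + y) (x' + y')" if "R x x'" "R y y'" for x y x' y'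
  proof -
    have "x + y - (x' + y') = (x - x') + (y - y')" by simp
    then show ?thesis using that W(1)[of i] pmv.subspace_add[OF subspace_boundaries] unfolding R_def
      by (metis pmv.subspace_add)
  qed
  have scl: "R (scp c x) (scp c x')" if "R x x'" for c x x'
    using that W(1)[of i] pmv.subspace_scale[OF subspace_boundaries, of "x - x'" X D i c] unfolding R_def
    by (auto simp: pmv.subspace_scale pmv.scale_right_diff_distrib)
  have BZ: "lext D b = 0" if "b \<in> boundaries X D i" for b using that by (auto simp: boundaries_def lext_lext DD)
  have lt: "\<exists>x'\<in>cycles X D i. R x x'" if "x \<in> ?Z" for x
    using that W(2)[of i] by (intro bexI[of _ x]) (auto simp: R_def cycles_def pmv.subspace_0)
  have rt: "\<exists>x\<in>?Z. R x x'" if x': "x' \<in> cycles X D i" for x'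
  proof -
    obtain y w where yw: "y \<in> vs (X (Suc i))" "w \<in> W i" "x' = lext D y + w"
      using red[of x' i] x' by (auto simp: cycles_def)
    have "w - x' = lext D (- y)" using yw(3) by (simp add: lext_lin)
    moreover have "- y \<in> vs (X (Suc i))" using yw(1) by (simp add: vs_intros)
    ultimately have wx: "w - x' \<in> boundaries X D i" by (auto simp: boundaries_def)
    moreover have "lext D w = 0" using BZ[OF wx] x' by (simp add: lext_lin cycles_def)
    ultimately show ?thesis using yw by (auto simp: R_def)
  qed
  have RB: "x \<in> ?B \<longleftrightarrow> x' \<in> boundaries X D i" if R: "R x x'" and "x' \<in> cycles X D i" for x x'
  proof
    assume "x \<in> ?B"
    then have "x \<in> boundaries X D i" using W(2)[of "Suc i"] by (auto simp: boundaries_def)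
    then have "x - (x - x') \<in> boundaries X D i" using R unfolding R_def by (metis pmv.subspace_diff subspace_boundaries)
    then show "x' \<in> boundaries X D i" by simp
  next
    assume "x' \<in> boundaries X D i"
    then have "x - x' + x' \<in> boundaries X D i" using R unfolding R_def by (metis pmv.subspace_add subspace_boundaries)
    then obtain y where y: "y \<in> vs (X (Suc i))" "x = lext D y" by (auto simp: boundaries_def)
    \<comment> \<open>Injectivity on homology: Dy lies in \<open>W\<close>, where h vanishes, so the
      reduction applies to y itself and replaces it by an element of \<open>W\<close> with the same
      boundary.\<close>
    have "lext h (lext D y) = 0" using hW R y by (auto simp: R_def)
    then obtain y' w where "w \<in> W (Suc i)" "y = lext D y' + w" using red[OF y(1)] by blast
    then have "x = lext D w" using y(2) by (simp add: lext_lin lext_lext DD)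
    then show "x \<in> ?B" using \<open>w \<in> W (Suc i)\<close> by blast
  qed
  show ?thesis
  proof
    assume "qdim scp ?Z ?B d"
    then show "qdim scp (cycles X D i) (boundaries X D i) d"
      by (rule qdim_rel[where R = R, rotated -1]) (use add scl lt rt RB Zs in \<open>auto simp: pmv.subspace_0 pmv.vector_space_axioms\<close>)
  next
    have "0 \<in> ?B" using pmv.subspace_0[OF W(1)[of "Suc i"]] by (metis imageI lext_0)
    moreover assume "qdim scp (cycles X D i) (boundaries X D i) d"
    ultimately show "qdim scp ?Z ?B d"
      by (rule_tac qdim_rel[where R = "\<lambda>x y. R y x" and Z = "cycles X D i" and B = "boundaries X D i"]) (use add scl lt rt RB Zs in \<open>auto simp: pmv.vector_space_axioms\<close>)
  qed
qed

text \<open>For \<open>W\<close> spanned by cells: on \<open>A\<close> both Dh and hD vanish, so the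
  local equation holds there with w = -x, and only the remaining cells have to be checked.\<close>

corollary morse_subcomplex:
  fixes D h :: "'x \<Rightarrow> ('x \<Rightarrow>\<^sub>0 'k::field)" and rk :: "'x \<Rightarrow> nat"
  assumes h: "\<And>i x. x \<in> X i \<Longrightarrow> x \<notin> A i \<Longrightarrow> h x \<in> vs (X (Suc i))"
    and h0: "\<And>i x. x \<in> A i \<Longrightarrow> h x = 0"
    and DD: "\<And>x. lext D (D x) = 0"
    and A: "\<And>i. A i \<subseteq> X i"
    and DA: "\<And>i x. x \<in> A (Suc i) \<Longrightarrow> D x \<in> vs (A i)"
    and DA0: "\<And>x. x \<in> A 0 \<Longrightarrow> D x = 0"
    and loc: "\<And>i x. x \<in> X i \<Longrightarrow> x \<notin> A i \<Longrightarrow> \<exists>w\<in>vs (A i). \<exists>u\<in>vs {y\<in>X i. rk y < rk x}.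
                 lext D (h x) + lext h (D x) = sg x + w + u"
  shows "qdim scp (cycles A D i) (boundaries A D i) d \<longleftrightarrow> qdim scp (cycles X D i) (boundaries X D i) d"
proof -
  have hW: "lext h w = 0" if "w \<in> vs (A i)" for w i
    using that h0[of _ i] by (auto simp: vs_def lext_def intro!: sum.neutral)
  have DhA: "lext h (D x) = 0" if "x \<in> A i" for x i
    using that hW DA DA0 by (cases i) auto
  have "qdim scp {w \<in> vs (A i). lext D w = 0} (lext D ` vs (A (Suc i))) d \<longleftrightarrow> qdim scp (cycles X D i) (boundaries X D i) d"
  proof (rule morse_quasi_iso[where rk = rk])
    show "h x \<in> vs (X (Suc i))" if "x \<in> X i" for i x
      using h h0 that by (cases "x \<in> A i") (auto simp: vs_intros)
    show "lext D w \<in> vs (A i)" if "w \<in> vs (A (Suc i))" for i w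
      using that DA by (rule lext_vs)
    show "lext h (lext D w) = 0" if "w \<in> vs (A i)" for i w
    proof -
      have "lext h (lext D w) = lext (\<lambda>x. 0) w" unfolding lext_lext
        using that DhA by (intro lext_cong) (auto simp: vs_def)
      then show ?thesis by simp
    qed
    show "\<exists>w\<in>vs (A i). \<exists>u\<in>vs {y\<in>X i. rk y < rk x}. lext D (h x) + lext h (D x) = sg x + w + u"
      if "x \<in> X i" for i x
    proof (cases "x \<in> A i")
      case True
      then have "lext D (h x) + lext h (D x) = sg x + (- sg x) + 0" using h0[OF True] DhA[OF True] by simp
      moreover have "- sg x \<in> vs (A i)" using True by (simp add: vs_intros)
      moreover have "0 \<in> vs {y\<in>X i. rk y < rk x}" by (simp add: vs_intros)
      ultimately show ?thesis by blast
    qed (use loc that in auto)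
  qed (use DD A hW in \<open>auto intro: vs_mono[rotated]\<close>)
  then show ?thesis by (simp add: cycles_def boundaries_def)
qed

section \<open>Duality\<close>

definition pair :: "('a \<Rightarrow> 'k::field) \<Rightarrow> ('a \<Rightarrow>\<^sub>0 'k) \<Rightarrow> 'k" where
  "pair g z = (\<Sum>x\<in>keys z. lookup z x * g x)"

lemma pair_superset: "finite A \<Longrightarrow> keys z \<subseteq> A \<Longrightarrow> pair g z = (\<Sum>x\<in>A. lookup z x * g x)"
  unfolding pair_def by (rule sum.mono_neutral_left) (auto simp: in_keys_iff)

lemma pair_0 [simp]: "pair g 0 = 0" by (simp add: pair_def)
lemma pair_sg [simp]: "pair g (sg x) = g x" by (simp add: pair_def lookup_sg)

lemma pair_add: "pair g (y + z) = pair g y + pair g z"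
proof -
  have "pair g w = (\<Sum>x\<in>keys y \<union> keys z. lookup w x * g x)" if "w \<in> {y + z, y, z}" for w
    using that keys_add[of y z] by (intro pair_superset) auto
  then show ?thesis by (simp add: lookup_add algebra_simps sum.distrib)
qed

lemma pair_scp: "pair g (scp c z) = c * pair g z"
  using pair_superset[of "keys z" "scp c z" g] pair_superset[of "keys z" z g] keys_scp[of c z]
  by (simp add: sum_distrib_left mult.assoc)

lemma pair_uminus: "pair g (- z) = - pair g z"
  using pair_scp[of g "-1" z] by simp
lemma pair_diff: "pair g (y - z) = pair g y - pair g z"
  using pair_add[of g y "- z"] by (simp add: pair_uminus)
lemma pair_sum: "pair f (\<Sum>i\<in>I. g i) = (\<Sum>i\<in>I. pair f (g i))"
  by (induction I rule: infinite_finite_induct) (auto simp: pair_add)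
lemmas pair_lin = pair_add pair_scp pair_uminus pair_diff pair_sum

lemma pair_lext: "pair g (lext f z) = pair (\<lambda>x. pair g (f x)) z"
  by (simp add: lext_def pair_lin) (simp add: pair_def)

lemma pair_cong: "(\<And>x. x \<in> keys z \<Longrightarrow> f x = g x) \<Longrightarrow> pair f z = pair g z"
  by (simp add: pair_def)

lemma pair_sumf: "pair (\<Sum>i\<in>I. smul (c i) (g i)) z = (\<Sum>i\<in>I. c i * pair (g i) z)"
proof -
  have app: "(\<Sum>i\<in>I. smul (c i) (g i)) x = (\<Sum>i\<in>I. c i * g i x)" for x
    by (induction I rule: infinite_finite_induct) (auto simp: smul_def)
  show ?thesis unfolding pair_def app sum_distrib_left
    by (subst sum.swap) (simp add: mult.left_commute)
qed

lemma pair_minusf: "pair (f - g) z = pair f z - pair g z"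
  by (simp add: pair_def algebra_simps sum_subtractf)

lemma linear_functional_pair:
  assumes "Vector_Spaces.linear scp (*) \<phi>"
  shows "\<phi> z = pair (\<lambda>x. \<phi> (sg x)) z"
proof -
  interpret L: Vector_Spaces.linear scp "(*)" \<phi> by fact
  have "\<phi> z = \<phi> (lext sg z)" by simp
  also have "\<dots> = (\<Sum>x\<in>keys z. lookup z x * \<phi> (sg x))" unfolding lext_def by (simp add: L.sum L.scale)
  finally show ?thesis by (simp add: pair_def)
qed

lemma vector_space_self: "vector_space ((*) :: 'k::field \<Rightarrow> 'k \<Rightarrow> 'k)"
  by unfold_locales (auto simp: algebra_simps)

text \<open>A basis of \<open>W\<close> extended by x carries a functional that is 1 at x and 0 on
  \<open>W\<close>. It supplies the dual basis in \<open>qdim_dual\<close>.\<close>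

lemma functional_separation:
  fixes x :: "'a \<Rightarrow>\<^sub>0 'k::field"
  assumes "pmv.subspace W" "x \<notin> W"
  shows "\<exists>g. pair g x = 1 \<and> (\<forall>w\<in>W. pair g w = 0)"
proof -
  interpret K: vector_space "(*) :: 'k \<Rightarrow> 'k \<Rightarrow> 'k" by (rule vector_space_self)
  interpret P: vector_space_pair "scp :: 'k \<Rightarrow> ('a \<Rightarrow>\<^sub>0 'k) \<Rightarrow> _" "(*) :: 'k \<Rightarrow> 'k \<Rightarrow> 'k" ..
  obtain B where B: "B \<subseteq> W" "pmv.independent B" "W \<subseteq> pmv.span B"
    using pmv.basis_exists[of W] by metis
  have sp: "pmv.span B = W" using B assms(1) by (simp add: pmv.span_minimal subset_antisym)
  have "pmv.independent (insert x B)" using B(2) assms(2) sp by (simp add: pmv.independent_insert)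
  then obtain \<phi> where \<phi>: "Vector_Spaces.linear scp (*) \<phi>" "\<forall>y\<in>insert x B. \<phi> y = (if y = x then 1 else 0)"
    using P.linear_independent_extend[of "insert x B" "\<lambda>y. if y = x then 1 else 0"] by blast
  have xB: "x \<notin> B" using B(1) assms(2) by blast
  have "\<phi> w = 0" if "w \<in> W" for w
  proof (rule P.linear_eq_0_on_span[OF \<phi>(1)])
    show "\<phi> y = 0" if "y \<in> B" for y using that \<phi>(2) xB by auto
    show "w \<in> pmv.span B" using that sp by simp
  qed
  then show ?thesis using \<phi>(2) linear_functional_pair[OF \<phi>(1)] by (metis insertI1)
qed

text \<open>Cocycles are functionals that vanish on boundaries, hence functionals on homology once
  those that vanish on cycles are divided out; over a field the latter factor through D. The
  functions are cut off outside \<open>X i\<close> so that a cochain is determined by its values on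
  cells.\<close>

theorem qdim_dual:
  fixes D :: "'x \<Rightarrow> ('x \<Rightarrow>\<^sub>0 'k::field)"
  assumes DD: "\<And>x. lext D (D x) = 0" and DX: "\<And>x. x \<in> X (Suc i) \<Longrightarrow> D x \<in> vs (X i)"
    and q: "qdim scp (cycles X D i) (boundaries X D i) d"
  shows "qdim smul {g. supp g \<subseteq> X i \<and> (\<forall>x\<in>X (Suc i). pair g (D x) = 0)}
                  {g. supp g \<subseteq> X i \<and> (\<exists>h. \<forall>x\<in>X i. g x = pair h (D x))} d" (is "qdim smul ?Z ?B d")
proof -
  obtain S where S: "S \<subseteq> cycles X D i" "finite S" "card S = d"
    and ind0: "\<forall>c. (\<Sum>s\<in>S. scp (c s) s) \<in> boundaries X D i \<longrightarrow> (\<forall>s\<in>S. c s = 0)"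
    and spn0: "\<forall>z\<in>cycles X D i. \<exists>c. z - (\<Sum>s\<in>S. scp (c s) s) \<in> boundaries X D i"
    using q unfolding qdim_def by (elim exE conjE) (rule that)
  note ind = ind0[THEN spec, THEN mp] and spn = bspec[OF spn0]
  have "\<exists>g. pair g s = 1 \<and> (\<forall>t\<in>S - {s}. pair g t = 0) \<and> (\<forall>b\<in>boundaries X D i. pair g b = 0)" if s: "s \<in> S" for s
  proof -
    \<comment> \<open>Boundaries together with all chosen classes except s; independence modulo
      boundaries says exactly that s lies outside.\<close>
    define W where "W = {b + (\<Sum>t\<in>S - {s}. scp (c t) t) | b c. b \<in> boundaries X D i}"
    have mem: "b + (\<Sum>t\<in>S - {s}. scp (c t) t) \<in> W" if "b \<in> boundaries X D i" for b c
      using that unfolding W_def by blast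
    have "pmv.subspace W"
    proof (unfold pmv.subspace_def, intro conjI ballI allI)
      show "0 \<in> W" using mem[of 0 "\<lambda>_. 0"] by (simp add: pmv.subspace_0)
      fix x assume "x \<in> W"
      then obtain b c where x: "x = b + (\<Sum>t\<in>S - {s}. scp (c t) t)" "b \<in> boundaries X D i" unfolding W_def by blast
      show "scp a x \<in> W" for a
        using mem[of "scp a b" "\<lambda>t. a * c t"] x pmv.subspace_scale[OF subspace_boundaries, of b X D i a]
        by (simp add: pmv.scale_right_distrib pmv.scale_sum_right)
      fix y assume "y \<in> W"
      then obtain b' c' where y: "y = b' + (\<Sum>t\<in>S - {s}. scp (c' t) t)" "b' \<in> boundaries X D i" unfolding W_def by blast
      show "x + y \<in> W"
        using mem[of "b + b'" "\<lambda>t. c t + c' t"] x y pmv.subspace_add[OF subspace_boundaries x(2) y(2)]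
        by (simp add: pmv.scale_left_distrib sum.distrib algebra_simps)
    qed
    moreover have "s \<notin> W"
    proof
      assume "s \<in> W"
      then obtain b c where x: "s = b + (\<Sum>t\<in>S - {s}. scp (c t) t)" "b \<in> boundaries X D i" unfolding W_def by blast
      define c' where "c' = (\<lambda>t. if t = s then 1 else - c t)"
      have "(\<Sum>t\<in>S. scp (c' t) t) = scp (c' s) s + (\<Sum>t\<in>S - {s}. scp (c' t) t)"
        using S(2) s by (simp add: sum.remove)
      also have "(\<Sum>t\<in>S - {s}. scp (c' t) t) = - (\<Sum>t\<in>S - {s}. scp (c t) t)"
        by (simp add: c'_def flip: sum_negf)
      also have "scp (c' s) s = s" by (simp add: c'_def)
      also have "s + - (\<Sum>t\<in>S - {s}. scp (c t) t) = b" using x(1) by (simp add: algebra_simps)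
      finally have "\<forall>t\<in>S. c' t = 0" using ind x(2) by simp
      then show False using s by (auto simp: c'_def)
    qed
    ultimately obtain g where g: "pair g s = 1" "\<And>w. w \<in> W \<Longrightarrow> pair g w = 0"
      using functional_separation by blast
    have "t \<in> W" if "t \<in> S - {s}" for t
    proof -
      have "(\<Sum>j\<in>S-{s}. scp (if j = t then 1 else 0) j) = (\<Sum>j\<in>S-{s}. if j = t then j else 0)"
        by (intro sum.cong) auto
      also have "\<dots> = t" using that S(2) by (simp add: sum.delta')
      finally show ?thesis using mem[of 0 "\<lambda>j. if j = t then 1 else 0"] by (simp add: pmv.subspace_0)
    qed
    moreover have "b \<in> W" if "b \<in> boundaries X D i" for b using mem[OF that, of "\<lambda>_. 0"] by simp
    ultimately show ?thesis using g by blast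
  qed
  then obtain G0 where G0: "\<And>s. s \<in> S \<Longrightarrow> pair (G0 s) s = 1"
    "\<And>s t. s \<in> S \<Longrightarrow> t \<in> S \<Longrightarrow> t \<noteq> s \<Longrightarrow> pair (G0 s) t = 0"
    "\<And>s b. s \<in> S \<Longrightarrow> b \<in> boundaries X D i \<Longrightarrow> pair (G0 s) b = 0" by (metis DiffI singletonD)
  define G where "G s = (\<lambda>x. if x \<in> X i then G0 s x else 0)" for s
  have pG: "pair (G s) z = pair (G0 s) z" if "z \<in> vs (X i)" for s z
    using that by (intro pair_cong) (auto simp: G_def vs_def)
  have SX: "s \<in> vs (X i)" if "s \<in> S" for s using that S(1) by (auto simp: cycles_def)
  have BX: "b \<in> vs (X i)" if "b \<in> boundaries X D i" for b
    using that DX by (auto simp: boundaries_def intro: lext_vs)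
  have G: "pair (G s) t = (if t = s then 1 else 0)" if "s \<in> S" "t \<in> S" for s t
    using that G0 by (simp add: pG SX)
  have GB: "pair (G s) b = 0" if "s \<in> S" "b \<in> boundaries X D i" for s b using that G0 by (simp add: pG BX)
  have DB: "D x \<in> boundaries X D i" if "x \<in> X (Suc i)" for x
    unfolding boundaries_def using that by (intro image_eqI[of _ _ "sg x"]) auto
  have GZ: "G s \<in> ?Z" if "s \<in> S" for s
    using that GB DB by (auto simp: G_def supp_def split: if_splits)
  have vanish: "g \<in> ?B" if sg: "supp g \<subseteq> X i" and gZ: "\<And>z. z \<in> cycles X D i \<Longrightarrow> pair g z = 0" for g
  proof -
    interpret P: vector_space_pair "scp :: 'k \<Rightarrow> ('x \<Rightarrow>\<^sub>0 'k) \<Rightarrow> _" "scp :: 'k \<Rightarrow> ('x \<Rightarrow>\<^sub>0 'k) \<Rightarrow> _" ..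
    \<comment> \<open>A linear section of D on its image: since g vanishes on cycles, g is the
      composite of D, r and g.\<close>
    obtain r where r: "range r \<subseteq> vs (X i)" "Vector_Spaces.linear scp scp r"
      "\<And>v. v \<in> lext D ` vs (X i) \<Longrightarrow> lext D (r v) = v"
      using P.linear_exists_right_inverse_on[OF linear_lext[of D] subspace_vs[of "X i"]] by blast
    interpret r: Vector_Spaces.linear scp scp r by fact
    define h where "h x = pair g (r (sg x))" for x
    have ph: "pair h y = pair g (r y)" for y
    proof -
      have "r y = r (lext sg y)" by simp
      also have "\<dots> = lext (\<lambda>x. r (sg x)) y" unfolding lext_def by (simp add: r.sum r.scale)
      finally show ?thesis by (simp add: pair_lext h_def[abs_def])
    qed
    have "g x = pair h (D x)" if x: "x \<in> X i" for x
    proof -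
      have "D x \<in> lext D ` vs (X i)" using x by (intro image_eqI[of _ _ "sg x"]) auto
      then have "lext D (r (D x) - sg x) = 0" using r(3) by (simp add: lext_lin)
      moreover have "r (D x) - sg x \<in> vs (X i)" using r(1) x by (intro vs_intros) auto
      ultimately have "pair g (r (D x) - sg x) = 0" using gZ by (simp add: cycles_def)
      then show ?thesis by (simp add: ph pair_lin)
    qed
    then show ?thesis using sg by blast
  qed
  have BZ: "pair g z = 0" if g: "g \<in> ?B" and z: "z \<in> cycles X D i" for g z
  proof -
    obtain h where h: "\<And>x. x \<in> X i \<Longrightarrow> g x = pair h (D x)" using g by blast
    have "pair g z = pair (\<lambda>x. pair h (D x)) z" using z h by (intro pair_cong) (auto simp: cycles_def vs_def)
    also have "\<dots> = pair h (lext D z)" by (simp add: pair_lext)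
    finally show ?thesis using z by (simp add: cycles_def)
  qed
  have pS: "pair (\<Sum>s\<in>S. smul (c s) (G s)) t = c t" if "t \<in> S" for c t
  proof -
    have "pair (\<Sum>s\<in>S. smul (c s) (G s)) t = (\<Sum>s\<in>S. if s = t then c s else 0)"
      unfolding pair_sumf using G that by (intro sum.cong) auto
    then show ?thesis using that S(2) by simp
  qed
  have inj: "inj_on G S"
  proof (rule inj_onI)
    fix s t assume "s \<in> S" "t \<in> S" "G s = G t"
    then show "s = t" using G[of s s] G[of t s] by (metis zero_neq_one)
  qed
  have re: "(\<Sum>s\<in>G ` S. smul (c s) s) = (\<Sum>s\<in>S. smul (c (G s)) (G s))" for c
    using inj by (simp add: sum.reindex)
  show ?thesis unfolding qdim_def
  proof (intro exI[of _ "G ` S"] conjI allI impI ballI)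
    show "G ` S \<subseteq> ?Z" using GZ by blast
    show "finite (G ` S)" using S by simp
    show "card (G ` S) = d" using S inj by (simp add: card_image)
    show "c s = 0" if "(\<Sum>s\<in>G ` S. smul (c s) s) \<in> ?B" "s \<in> G ` S" for c s
    proof -
      from that obtain t where t: "t \<in> S" "s = G t" by blast
      have "pair (\<Sum>s\<in>S. smul (c (G s)) (G s)) t = 0" using BZ[OF that(1)[unfolded re]] t S(1) by blast
      then show ?thesis using pS[of t "\<lambda>s. c (G s)"] t by simp
    qed
    show "\<exists>c. z - (\<Sum>s\<in>G ` S. smul (c s) s) \<in> ?B" if z: "z \<in> ?Z" for z
    proof -
      \<comment> \<open>Subtracting the dual basis makes y vanish on \<open>S\<close>; it also
        vanishes on boundaries, hence on all cycles.\<close>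
      define y where "y = z - (\<Sum>s\<in>S. smul (pair z s) (G s))"
      have "y x = 0" if "x \<notin> X i" for x
      proof -
        have "(\<Sum>s\<in>T. smul (pair z s) (G s)) x = 0" for T using that
          by (induction T rule: infinite_finite_induct) (auto simp: smul_def G_def)
        moreover have "z x = 0" using z that by (auto simp: supp_def)
        ultimately show ?thesis by (simp add: y_def)
      qed
      then have ys: "supp y \<subseteq> X i" by (auto simp: supp_def)
      have yS: "pair y s = 0" if "s \<in> S" for s using pS[OF that] by (simp add: y_def pair_minusf)
      have yB: "pair y b = 0" if b: "b \<in> boundaries X D i" for b
      proof -
        obtain t where t: "t \<in> vs (X (Suc i))" "b = lext D t" using b by (auto simp: boundaries_def)
        have "pair z b = pair (\<lambda>x. 0) t" unfolding t(2) pair_lext using z t(1)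
          by (intro pair_cong) (auto simp: vs_def)
        then show ?thesis using GB b by (simp add: y_def pair_minusf pair_sumf) (simp add: pair_def)
      qed
      have "pair y t = 0" if "t \<in> cycles X D i" for t
      proof -
        obtain c where c: "t - (\<Sum>s\<in>S. scp (c s) s) \<in> boundaries X D i" using spn \<open>t \<in> cycles X D i\<close> by blast
        show ?thesis using yB[OF c] yS by (simp add: pair_lin)
      qed
      then have "y \<in> ?B" using vanish[OF ys] by blast
      moreover have "(\<Sum>s\<in>S. smul (pair z s) (G s)) = (\<Sum>s\<in>G ` S. smul (((\<lambda>s. pair z s) \<circ> inv_into S G) s) s)"
        unfolding re using inj by (intro sum.cong) auto
      ultimately have "z - (\<Sum>s\<in>G ` S. smul (((\<lambda>s. pair z s) \<circ> inv_into S G) s) s) \<in> ?B"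
        unfolding y_def by simp
      then show ?thesis by (intro exI[of _ "pair z \<circ> inv_into S G"]) simp
    qed
  qed
qed

section \<open>The monomial basis\<close>

type_synonym tri = "nat \<times> nat \<times> nat"

locale lalg = fixes n :: nat and K :: "'k::field itself" assumes n1: "1 \<le> n"
begin

text \<open>The basis element (i,j,d) is the class of all paths from i to j of length d, up to sign.  The inequalities
  come from the double cover of type \<open>A\<close> with \<open>2n\<close> vertices: i lifts to \<open>n + i\<close> and to \<open>n + 1 - i\<close>, and the
  parity of \<open>i + j + d\<close> says whether a path changes the sheet.  The first predicate says that there is a path,
  the second that it is nonzero.  The triple \<open>Oz\<close>, which is not \<open>al\<close>, stands for zero.\<close>

fun walkable :: "tri \<Rightarrow> bool" where
  "walkable (i, j, d) \<longleftrightarrow> 1 \<le> i \<and> i \<le> n \<and> 1 \<le> j \<and> j \<le> n \<and>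
     (if even (i + j + d) then i \<le> j + d \<and> j \<le> i + d else i + j \<le> d + 1)"

fun unkilled :: "tri \<Rightarrow> bool" where
  "unkilled (i, j, d) \<longleftrightarrow>
     (if even (i + j + d) then d + i + j \<le> 2 * n else d + 1 + i \<le> 2 * n + j \<and> d + 1 + j \<le> 2 * n + i)"

definition al :: "tri \<Rightarrow> bool" where "al b \<longleftrightarrow> walkable b \<and> unkilled b"

lemma al_simps: "al (i, j, d) \<longleftrightarrow> 1 \<le> i \<and> i \<le> n \<and> 1 \<le> j \<and> j \<le> n \<and>
     (if even (i + j + d) then i \<le> j + d \<and> j \<le> i + d \<and> d + i + j \<le> 2 * n
      else i + j \<le> d + 1 \<and> d + 1 + i \<le> 2 * n + j \<and> d + 1 + j \<le> 2 * n + i)"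
  by (auto simp: al_def)

declare walkable.simps [simp del] unkilled.simps [simp del]

definition Oz :: tri where "Oz = (0, 0, 0)"

fun src :: "tri \<Rightarrow> nat" where "src (i, j, d) = i"
fun tgt :: "tri \<Rightarrow> nat" where "tgt (i, j, d) = j"
fun deg :: "tri \<Rightarrow> nat" where "deg (i, j, d) = d"

fun mu :: "tri \<Rightarrow> tri \<Rightarrow> tri" where
  "mu (i, j, d) (j', l, e) = (if j = j' \<and> al (i, j, d) \<and> al (j', l, e) \<and> al (i, l, d + e) then (i, l, d + e) else Oz)"

text \<open>The number of loops in a path has the parity of i + j + d, since every other arrow
  changes two of these parities. So this is the automorphism that sends \<epsilon> to -\<epsilon>
  and fixes the vertices and the other arrows.\<close>

definition theta :: "tri \<Rightarrow> 'k::field" where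
  "theta b = (case b of (i, j, d) \<Rightarrow> (-1) ^ (i + j + d))"

text \<open>The socle at each vertex lies in degree 2n - 1 and begins and ends at that vertex, so
  the complementary factor of a basis element runs backwards.\<close>

fun dual :: "tri \<Rightarrow> tri" where "dual (i, j, d) = (j, i, 2 * n - 1 - d)"

abbreviation idt :: "nat \<Rightarrow> tri" where "idt i \<equiv> (i, i, 0)"

lemma al_O [simp]: "\<not> al Oz" by (simp add: Oz_def al_simps)
lemma al_0 [simp]: "\<not> al (0, j, d)" "\<not> al (i, 0, d)" by (simp_all add: al_simps)

lemma al_neq_O: "al b \<Longrightarrow> b \<noteq> Oz" by auto

lemma mu_O [simp]: "mu Oz b = Oz" "mu b Oz = Oz"
  by (cases b; simp add: Oz_def)+

section \<open>Associativity of the product of basis elements\<close>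

lemma even_comp: "even (i + l + (d + e)) \<longleftrightarrow> (even (i + j + d) \<longleftrightarrow> even (j + l + (e::nat)))"
  by presburger

lemma walkable_comp:
  assumes "walkable (i, j, d)" "walkable (j, l, e)"
  shows "walkable (i, l, d + e)"
  using assms unfolding walkable.simps even_comp[of i l d e j]
  by (cases "even (i + j + d)"; cases "even (j + l + e)"; simp only: if_True if_False simp_thms; linarith)

text \<open>A factor of a nonzero path is nonzero: the upper bounds can only relax when a walk of
  length f is removed from the end.\<close>

lemma unkilled_left:
  assumes "unkilled (i, m, d + f)" "walkable (l, m, f)"
  shows "unkilled (i, l, d)"
  using assms unfolding walkable.simps unkilled.simps even_comp[of i m d f l]
  by (cases "even (i + l + d)"; cases "even (l + m + f)"; simp only: if_True if_False simp_thms; linarith)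

lemma al_sym: "al (i, j, d) \<longleftrightarrow> al (j, i, d)"
  by (auto simp: al_simps add.commute add.left_commute)

lemma al_left:
  assumes "al (i, j, d)" "al (j, l, e)" "walkable (l, m, f)" "al (i, m, d + e + f)"
  shows "al (i, l, d + e)"
  using assms walkable_comp unkilled_left unfolding al_def by blast

lemma al_right:
  assumes "al (i, j, d)" "al (j, l, e)" "al (l, m, f)" "al (i, m, d + (e + f))"
  shows "al (j, m, e + f)"
proof -
  have "al (m, l, f)" "al (l, j, e)" "walkable (j, i, d)" "al (m, i, f + e + d)"
    using assms al_sym[of l m f] al_sym[of j l e] al_sym[of i j d] al_sym[of i m "f + e + d"]
    by (simp_all add: add_ac al_def)
  then show ?thesis using al_left al_sym by (metis add.commute)
qed

text \<open>Either bracketing is nonzero exactly when the factors fit together and they and the full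
  product are basis elements; the partial products are then factors of a nonzero path.\<close>

lemma mu_assoc: "mu (mu a b) c = mu a (mu b c)"
proof (cases a, cases b, cases c)
  fix i j d j' l e l' m f
  assume a: "a = (i, j, d)" "b = (j', l, e)" "c = (l', m, f)"
  show ?thesis
  proof (cases "j = j' \<and> l = l' \<and> al (i, j, d) \<and> al (j, l, e) \<and> al (l, m, f) \<and> al (i, m, d + e + f)")
    case True
    then have "al (i, l, d + e)" "al (j, m, e + f)" using al_left[of i j d l e m f] al_right[of i j d l e m f] by (auto simp: add.assoc al_def)
    then show ?thesis using True by (simp add: a add.assoc)
  next
    case False
    have "mu (mu a b) c = Oz" using False by (auto simp: a)
    moreover have "mu a (mu b c) = Oz" using False by (auto simp: a add.assoc)
    ultimately show ?thesis by simp
  qed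
qed

section \<open>The symmetric form\<close>

lemma al_deg: "al (i, j, d) \<Longrightarrow> d \<le> 2 * n - 1"
  by (auto simp: al_simps split: if_splits)

lemma al_bounds: "al (i, j, d) \<Longrightarrow> 1 \<le> i \<and> i \<le> n \<and> 1 \<le> j \<and> j \<le> n \<and> d \<le> 2 * n - 1"
  using al_deg by (auto simp: al_simps)

lemma al_dual: "al b \<Longrightarrow> al (dual b)"
proof (cases b)
  fix i j d assume b: "b = (i, j, d)" and a: "al b"
  have d: "d \<le> 2 * n - 1" using a al_deg b by simp
  define D where "D = 2 * n - 1 - d"
  have D: "D + d + 1 = 2 * n" using d n1 by (simp add: D_def)
  then have "even (j + i + D) \<longleftrightarrow> odd (i + j + d)" by presburger
  then show ?thesis using a D by (auto simp: b al_simps D_def[symmetric] split: if_splits)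
qed

lemma dual_dual: "al b \<Longrightarrow> dual (dual b) = b"
proof (cases b)
  fix i j d assume "b = (i, j, d)" "al b"
  then show ?thesis using al_deg[of i j d] n1 by simp
qed

lemma src_dual [simp]: "src (dual b) = tgt b" by (cases b) simp
lemma tgt_dual [simp]: "tgt (dual b) = src b" by (cases b) simp

text \<open>Both sides say that b w c is the socle element at the source of b. This cyclic
  invariance is the symmetry of the algebra.\<close>

lemma mu_eq_dual_iff:
  assumes "al b" "al w" "al c"
  shows "mu w c = dual b \<longleftrightarrow> mu b w = dual c"
proof (cases b, cases w, cases c)
  fix i j d j' l e l' m f
  assume a: "b = (i, j, d)" "w = (j', l, e)" "c = (l', m, f)"
  have d: "d \<le> 2 * n - 1" "f \<le> 2 * n - 1" using assms al_deg a by auto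
  have "dual b \<noteq> Oz" "dual c \<noteq> Oz" using assms al_dual al_neq_O by auto
  then have "mu w c = dual b \<longleftrightarrow> l = l' \<and> j' = j \<and> m = i \<and> e + f = 2 * n - 1 - d"
    using al_dual[OF assms(1)] assms by (auto simp: a)
  also have "\<dots> \<longleftrightarrow> j = j' \<and> i = m \<and> l = l' \<and> d + e = 2 * n - 1 - f" using d by auto
  also have "\<dots> \<longleftrightarrow> mu b w = dual c"
    using \<open>dual c \<noteq> Oz\<close> al_dual[OF assms(3)] assms by (auto simp: a)
  finally show ?thesis .
qed

lemma al_mu: "mu a b \<noteq> Oz \<Longrightarrow> al (mu a b)"
  by (cases a; cases b) (auto split: if_splits)

lemma mu_neq_O: "mu a b \<noteq> Oz \<Longrightarrow> al a \<and> al b \<and> tgt a = src b \<and> src (mu a b) = src a \<and> tgt (mu a b) = tgt b \<and> deg (mu a b) = deg a + deg b"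
  by (cases a; cases b) (auto split: if_splits)

lemma mu_dual_iff:
  assumes "al b" "al w" "al c"
  shows "mu w c = dual b \<longleftrightarrow> mu b w \<noteq> Oz \<and> c = dual (mu b w)"
  unfolding mu_eq_dual_iff[OF assms] using assms dual_dual al_mu al_neq_O al_dual by metis

lemma al_idt: "1 \<le> i \<Longrightarrow> i \<le> n \<Longrightarrow> al (idt i)" by (simp add: al_simps)

lemma al_src: "al b \<Longrightarrow> al (idt (src b))" "al b \<Longrightarrow> al (idt (tgt b))"
  using al_bounds by (cases b; auto intro: al_idt)+

lemma mu_idt_left [simp]: "al b \<Longrightarrow> src b = i \<Longrightarrow> mu (idt i) b = b"
  using al_src(1)[of b] by (cases b) auto
lemma mu_idt_right [simp]: "al b \<Longrightarrow> tgt b = i \<Longrightarrow> mu b (idt i) = b"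
  using al_src(2)[of b] by (cases b) auto

lemma theta_sq [simp]: "(theta b :: 'k) * theta b = 1"
  by (cases b) (simp add: theta_def flip: power_mult_distrib)
lemma theta_sq_power [simp]: "(theta b :: 'k) ^ k * theta b ^ k = 1"
  by (simp flip: power_mult_distrib)

lemma theta_mu: "mu a b \<noteq> Oz \<Longrightarrow> (theta (mu a b) :: 'k::field) = theta a * theta b"
proof -
  assume m: "mu a b \<noteq> Oz"
  obtain i j d l e where ab: "a = (i, j, d)" "b = (j, l, e)" using mu_neq_O[OF m] by (cases a; cases b) auto
  have "(-1) ^ (i + l + (d + e)) = (((-1) ^ (i + j + d) * (-1) ^ (j + l + e)) :: 'k)"
    by (simp add: power_add mult_ac)
  then show ?thesis using m by (auto simp: ab theta_def)
qed

section \<open>Words\<close>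

text \<open>A letter \<open>Oz\<close> makes the whole word zero. Thus \<open>mu\<close> may return
  a letter instead of a linear combination, and every face of a word is again a word or
  zero.\<close>

definition dw :: "tri list \<Rightarrow> (tri list \<Rightarrow>\<^sub>0 'k::field)" where
  "dw l = (if Oz \<in> set l then 0 else sg l)"

abbreviation cn :: "tri \<Rightarrow> (tri list \<Rightarrow>\<^sub>0 'k::field) \<Rightarrow> (tri list \<Rightarrow>\<^sub>0 'k)" where
  "cn x \<equiv> lext (\<lambda>w. dw (x # w))"
abbreviation sn :: "tri \<Rightarrow> (tri list \<Rightarrow>\<^sub>0 'k::field) \<Rightarrow> (tri list \<Rightarrow>\<^sub>0 'k)" where
  "sn x \<equiv> lext (\<lambda>w. dw (w @ [x]))"

text \<open>The bar differential \<open>bprime\<close> without and \<open>bE\<close> with the cyclic term \<open>wraparound\<close>; \<open>hm c\<close> and \<open>lm c\<close>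
  multiply the first letter on the left and the last letter on the right by c.\<close>

fun bprime :: "tri list \<Rightarrow> (tri list \<Rightarrow>\<^sub>0 'k::field)" where
  "bprime (x # y # l) = dw (mu x y # l) - cn x (bprime (y # l))"
| "bprime _ = 0"

definition hm :: "tri \<Rightarrow> tri list \<Rightarrow> (tri list \<Rightarrow>\<^sub>0 'k::field)" where
  "hm c l = (if l = [] then 0 else dw (mu c (hd l) # tl l))"
definition lm :: "tri \<Rightarrow> tri list \<Rightarrow> (tri list \<Rightarrow>\<^sub>0 'k::field)" where
  "lm c l = (if l = [] then 0 else dw (butlast l @ [mu (last l) c]))"
text \<open>It serves twice: as the cyclic face in \<open>bE\<close>, and as the map that closes the
  words of column one to cyclic words.\<close>

definition co :: "tri list \<Rightarrow> (tri list \<Rightarrow>\<^sub>0 'k::field)" where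
  "co l = (if length l \<le> 1 then 0 else dw (mu (last l) (hd l) # butlast (tl l)))"
definition bE :: "tri list \<Rightarrow> (tri list \<Rightarrow>\<^sub>0 'k::field)" where
  "bE l = bprime l + scp ((-1) ^ (length l - 1)) (co l)"

lemma dw_O [simp]: "Oz \<in> set l \<Longrightarrow> dw l = 0" by (simp add: dw_def)

lemma lext_dw: "(Oz \<in> set l \<Longrightarrow> f l = 0) \<Longrightarrow> lext f (dw l) = f l"
  by (simp add: dw_def)

lemma bprime_O [simp]: "Oz \<in> set l \<Longrightarrow> bprime l = 0"
proof (induction l rule: bprime.induct)
  case (1 x y l)
  show ?case
  proof (cases "Oz \<in> set (y # l)")
    case True
    then have "mu x y = Oz \<or> Oz \<in> set l" by auto
    then have "dw (mu x y # l) = 0" by (intro dw_O) auto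
    then show ?thesis using 1 True by simp
  next
    case False
    then have "x = Oz" using 1 by auto
    then show ?thesis by simp
  qed
qed auto

lemma hm_O [simp]: "Oz \<in> set l \<Longrightarrow> hm c l = 0"
  unfolding hm_def by (cases l) (auto intro!: dw_O)
lemma hm_O' [simp]: "hm Oz l = 0"
  unfolding hm_def by auto
lemma last_butlast_O: "Oz \<in> set l \<Longrightarrow> last l = Oz \<or> Oz \<in> set (butlast l)"
  by (cases l rule: rev_cases) auto
lemma lm_O [simp]: "Oz \<in> set l \<Longrightarrow> lm c l = 0"
  unfolding lm_def using last_butlast_O[of l] by (auto intro!: dw_O)
lemma lm_O' [simp]: "lm Oz l = 0"
  unfolding lm_def by auto
lemma co_O [simp]: "Oz \<in> set l \<Longrightarrow> co l = 0"
proof (cases "length l \<le> 1")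
  case False
  assume "Oz \<in> set l"
  with False obtain y m x where l: "l = y # m @ [x]"
    by (cases l; cases "tl l" rule: rev_cases) auto
  show ?thesis using \<open>Oz \<in> set l\<close> by (auto simp: co_def l intro!: dw_O)
qed (simp add: co_def)
lemma bE_O [simp]: "Oz \<in> set l \<Longrightarrow> bE l = 0" by (simp add: bE_def)

lemma lext_dw_simps [simp]:
  "lext bprime (dw l) = bprime l" "lext (hm c) (dw l) = hm c l" "lext (lm c) (dw l) = lm c l"
  "lext co (dw l) = co l" "lext bE (dw l) = bE l" "cn x (dw l) = dw (x # l)" "sn x (dw l) = dw (l @ [x])"
  by (rule lext_dw; simp)+

lemma hm_Cons: "hm c (y # l) = dw (mu c y # l)" by (simp add: hm_def)
lemma lm_snoc: "lm c (l @ [x]) = dw (l @ [mu x c])" by (simp add: lm_def)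
lemma co_ends: "co (y # l @ [x]) = dw (mu x y # l)" by (simp add: co_def)

lemma hm_hm: "lext (hm c) (hm c' l) = hm (mu c c') l"
  by (cases l) (simp_all add: hm_Cons mu_assoc hm_def)
lemma lm_lm: "lext (lm c) (lm c' l) = lm (mu c' c) l"
  by (cases l rule: rev_cases) (simp_all add: lm_snoc mu_assoc, simp_all add: lm_def)
lemma hm_lm: "lext (hm c) (lm c' l) = lext (lm c') (hm c l)"
proof (cases l)
  case (Cons y w)
  then show ?thesis by (cases w rule: rev_cases) (simp_all add: hm_def lm_def mu_assoc butlast_append)
qed (simp add: hm_def lm_def)

lemma bprime_Cons: "l \<noteq> [] \<Longrightarrow> bprime (y # l) = dw (mu y (hd l) # tl l) - cn y (bprime l)"
  by (cases l) auto

lemma bprime_snoc: "l \<noteq> [] \<Longrightarrow> bprime (l @ [x]) = sn x (bprime l) + scp ((-1) ^ (length l - 1)) (dw (butlast l @ [mu (last l) x]))"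
proof (induction l rule: bprime.induct)
  case (1 y z l)
  have c: "cn y (sn x w) = sn x (cn y w)" for w :: "tri list \<Rightarrow>\<^sub>0 'k" by (simp add: lext_lext)
  have "bprime ((y # z # l) @ [x]) = dw (mu y z # l @ [x]) - cn y (bprime ((z # l) @ [x]))" by simp
  also have "\<dots> = dw (mu y z # l @ [x]) - sn x (cn y (bprime (z # l)))
     - scp ((-1) ^ length l) (dw (y # butlast (z # l) @ [mu (last (z # l)) x]))"
    using 1 by (simp add: lext_lin c)
  also have "\<dots> = sn x (bprime (y # z # l)) + scp ((-1) ^ (Suc (length l))) (dw (butlast (y # z # l) @ [mu (last (y # z # l)) x]))"
    by (simp add: lext_lin)
  finally show ?case by simp
qed simp_all

lemma bprime_hm: "lext bprime (hm c l) = lext (hm c) (bprime l)"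
proof (induction l rule: bprime.induct)
  case (1 x y l)
  show ?case by (simp add: hm_Cons mu_assoc lext_lin lext_lext)
qed (simp_all add: hm_def)

lemma bprime_lm: "lext bprime (lm c l) = lext (lm c) (bprime l)"
proof (cases l rule: rev_cases)
  case (snoc w x)
  show ?thesis
  proof (cases "w = []")
    case False
    then show ?thesis by (simp add: snoc lm_snoc bprime_snoc lext_lin lext_lext mu_assoc)
  qed (simp add: snoc lm_def)
qed (simp add: lm_def)

text \<open>Prefixing a letter anticommutes with \<open>bprime\<close> up to the face that merges
  this letter; by induction this gives square zero.\<close>

lemma bprime_cn: "lext bprime (cn x z) = lext (hm x) z - cn x (lext bprime z)"
proof -
  have "lext bprime (cn x z) = lext (\<lambda>w. hm x w - cn x (bprime w)) z"
    unfolding lext_lext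
  proof (rule lext_cong)
    fix w show "lext bprime (dw (x # w)) = hm x w - cn x (bprime w)"
      by (cases w) (simp_all add: hm_def)
  qed
  then show ?thesis by (simp add: lext_linf lext_lext)
qed

lemma bprime_bprime: "lext bprime (bprime l) = 0"
proof (induction l rule: bprime.induct)
  case (1 x y l)
  have "lext bprime (bprime (x # y # l)) = bprime (mu x y # l) - (lext (hm x) (bprime (y # l)) - cn x (lext bprime (bprime (y # l))))"
    by (simp only: bprime.simps lext_diff lext_dw_simps bprime_cn)
  also have "lext (hm x) (bprime (y # l)) = bprime (mu x y # l)"
    by (simp flip: bprime_hm add: hm_Cons)
  also have "lext bprime (bprime (y # l)) = 0" by (rule 1)
  finally show ?case by simp
qed simp_all

lemma length_cases:
  obtains "length l \<le> 1" | y m x where "l = y # m @ [x]"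
proof (cases "length l \<le> 1")
  case False
  then obtain y w where l: "l = y # w" "w \<noteq> []" by (cases l) auto
  then obtain m x where "w = m @ [x]" by (cases w rule: rev_cases) auto
  then show thesis using l that by blast
qed (use that in blast)

lemma short_0: "length l \<le> 1 \<Longrightarrow> bprime l = 0" "length l \<le> 1 \<Longrightarrow> co l = 0" "length l \<le> 1 \<Longrightarrow> bE l = 0"
  by (cases l; cases "tl l"; simp add: co_def bE_def)+

text \<open>\<open>co\<close> is a chain map from words under \<open>bprime\<close> to words under
  \<open>bE\<close>: the faces that merge an inner letter with an end letter become the first and
  the cyclic face of the closed word.\<close>

lemma bE_co: "lext bE (co l) = lext co (bprime l)"
proof (cases l rule: length_cases)
  case 1
  then show ?thesis by (simp add: short_0)
next
  case (2 y m x)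
  show ?thesis
  proof (cases "m = []")
    case True
    then show ?thesis by (simp add: 2 co_def short_0)
  next
    case False
    let ?s = "scp ((-1) ^ (length m - 1)) :: _ \<Rightarrow> (tri list \<Rightarrow>\<^sub>0 'k)"
    have bpl: "bprime l = dw ((mu y (hd m) # tl m) @ [x]) - cn y (sn x (bprime m) + ?s (dw (butlast m @ [mu (last m) x])))"
      using False by (simp add: 2 bprime_Cons bprime_snoc)
    have "lext co (cn y (sn x (z :: tri list \<Rightarrow>\<^sub>0 'k))) = cn (mu x y) z" for z
      by (simp add: lext_lext co_ends)
    then have "lext co (bprime l) = dw (mu x (mu y (hd m)) # tl m) - cn (mu x y) (bprime m)
        - ?s (dw (mu (mu (last m) x) y # butlast m))"
      by (simp add: bpl lext_lin co_ends)
    moreover have "lext bE (co l) = bE (mu x y # m)" by (simp add: 2 co_ends)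
    moreover have "bE (mu x y # m) = dw (mu (mu x y) (hd m) # tl m) - cn (mu x y) (bprime m)
        + scp ((-1) ^ length m) (dw (mu (last m) (mu x y) # butlast m))"
      using False by (simp add: bE_def bprime_Cons co_def)
    moreover have "(-1 :: 'k) ^ length m = - ((-1) ^ (length m - 1))" using False by (cases m) auto
    ultimately show ?thesis by (simp add: mu_assoc)
  qed
qed

lemma bE_bE: "lext bE (bE l) = 0"
proof -
  \<comment> \<open>The sign of the cyclic face depends on the length, so it has to be known that
    every term of \<open>bprime l\<close> is one letter shorter.\<close>
  have k: "keys (bprime l :: tri list \<Rightarrow>\<^sub>0 'k) \<subseteq> {w. length w = length l - 1}" for l
  proof (induction l rule: bprime.induct)
    case (1 x y l)
    have "(bprime (x # y # l) :: tri list \<Rightarrow>\<^sub>0 'k) \<in> vs {w. length w = length (x # y # l) - 1}"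
      unfolding bprime.simps
    proof (intro vs_intros lext_mem subspace_vs)
      show "(dw (mu x y # l) :: tri list \<Rightarrow>\<^sub>0 'k) \<in> vs {w. length w = length (x # y # l) - 1}"
        by (auto simp: dw_def vs_intros)
      show "(dw (x # w) :: tri list \<Rightarrow>\<^sub>0 'k) \<in> vs {w. length w = length (x # y # l) - 1}"
        if "w \<in> keys (bprime (y # l) :: tri list \<Rightarrow>\<^sub>0 'k)" for w
        using that 1 by (auto simp: dw_def vs_intros)
    qed
    then show ?case by (simp add: vs_def)
  qed auto
  have "lext bE (bprime l) = lext (\<lambda>w. bprime w + scp ((-1) ^ (length l - 1 - 1)) (co w)) (bprime l :: tri list \<Rightarrow>\<^sub>0 'k)"
    using k[of l] by (intro lext_cong) (auto simp: bE_def)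
  then have "lext bE (bprime l :: tri list \<Rightarrow>\<^sub>0 'k) = scp ((-1) ^ (length l - 1 - 1)) (lext co (bprime l))"
    by (simp add: lext_linf bprime_bprime)
  then have "lext bE (bE l) = scp ((-1) ^ (length l - 1 - 1)) (lext co (bprime l)) + scp ((-1) ^ (length l - 1)) (lext co (bprime l :: tri list \<Rightarrow>\<^sub>0 'k))"
    by (simp add: bE_def[of l] lext_lin bE_co)
  also have "\<dots> = 0"
  proof (cases "length l \<le> 1")
    case False
    then have "(-1 :: 'k) ^ (length l - 1) = - ((-1) ^ (length l - 1 - 1))" by (cases "length l - 1") auto
    then show ?thesis by simp
  qed (simp add: short_0)
  finally show ?thesis .
qed

text \<open>In a cyclic word a factor behind the last letter is a factor in front of the first. So
  the untwisted commutators vanish after closing.\<close>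

lemma co_lm_hm: "lext co (lm c l) = lext co (hm c l)"
proof (cases l rule: length_cases)
  case 1
  then show ?thesis by (cases l) (auto simp: lm_def hm_def short_0)
next
  case (2 y m x)
  then show ?thesis using lm_snoc[of c "y # m" x] by (simp add: hm_Cons co_ends mu_assoc)
qed

section \<open>The double complex\<close>

text \<open>A cell (p,t,l) with p > 0 and l = y # m @ [x] stands for the element x, m, y of
  the tensor product of a bimodule resolution in degree p - 1, whose generator has tag t, with the
  bar construction; words of length one give the small complex.  Cells (0,t,l) span the cyclic bar complex.\<close>

text \<open>\<open>Tv v\<close> is the generator at the vertex v; \<open>TL v\<close> is the arrow from v to \<open>v - 1\<close> (the loop if \<open>v = 1\<close>) and
  \<open>TU v\<close> the arrow from v to \<open>v + 1\<close>.\<close>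

datatype tag = Tv nat | TL nat | TU nat

fun el :: "tag \<Rightarrow> tri" where
  "el (TL v) = (v, if v = 1 then 1 else v - 1, 1)"
| "el (TU v) = (v, Suc v, 1)"
| "el (Tv v) = Oz"

fun rv :: "tag \<Rightarrow> tag" where
  "rv (TL v) = (if v = 1 then TL 1 else TU (v - 1))"
| "rv (TU v) = TL (Suc v)"
| "rv (Tv v) = Tv v"

text \<open>With these signs the relation at v reads: the sum of \<open>mc c\<close> times c
  followed by its reverse, over the arrows c that leave v, is zero.\<close>

fun mc :: "tag \<Rightarrow> 'k" where
  "mc (TU v) = - 1" | "mc _ = 1"

fun ar :: "tag \<Rightarrow> bool" where
  "ar (TL v) \<longleftrightarrow> 1 \<le> v \<and> v \<le> n" | "ar (TU v) \<longleftrightarrow> 1 \<le> v \<and> v < n" | "ar (Tv v) \<longleftrightarrow> False"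

text \<open>Target and source of a generator. The word in a cell runs from \<open>rr t\<close> to
  \<open>ss t\<close>, so that the generator closes it to a cycle.\<close>

fun rr :: "tag \<Rightarrow> nat" where "rr (Tv v) = v" | "rr t = tgt (el t)"
fun ss :: "tag \<Rightarrow> nat" where "ss (Tv v) = v" | "ss t = src (el t)"

definition outs :: "nat \<Rightarrow> tag set" where "outs v = {c. ar c \<and> ss c = v}"
definition bas :: "nat \<Rightarrow> tri set" where "bas v = {b. al b \<and> src b = v}"

abbreviation HM where "HM c \<equiv> lext (hm c)"
abbreviation LM where "LM c \<equiv> lext (lm c)"
abbreviation BP where "BP \<equiv> lext bprime"
abbreviation CO where "CO \<equiv> lext co"
abbreviation BE where "BE \<equiv> lext bE"

type_synonym cell = "nat \<times> tag \<times> tri list"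

definition tg :: "nat \<Rightarrow> tag \<Rightarrow> (tri list \<Rightarrow>\<^sub>0 'k) \<Rightarrow> (cell \<Rightarrow>\<^sub>0 'k)" where
  "tg p t = lext (\<lambda>l. sg (p, t, l))"

text \<open>In positive degrees this is the periodic bimodule resolution, applied to the outer letters of a word:
  commutators with the arrows in degree 1 mod 3, the derivative of the preprojective relation in degree 2 mod 3,
  and the Casimir element of the symmetric form in degree 0 mod 3.  In degree 0 the word is closed up to a cyclic word.\<close>

definition dh :: "nat \<Rightarrow> tag \<Rightarrow> (tri list \<Rightarrow>\<^sub>0 'k) \<Rightarrow> (cell \<Rightarrow>\<^sub>0 'k)" where
  "dh p t w = (case t of
     Tv v \<Rightarrow> (if p = 0 then tg 0 (Tv 0) (CO w)
       else if p mod 3 = 0 then (\<Sum>b\<in>bas v. scp (theta b ^ (p div 3)) (tg p (Tv (tgt b)) (LM b (HM (dual b) w))))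
       else if p mod 3 = 2 then (\<Sum>c\<in>outs v. scp (mc c) (scp (theta (el c) ^ (p div 3)) (tg p c (HM (el (rv c)) w))
                                                + tg p (rv c) (LM (el c) w)))
       else 0)
   | _ \<Rightarrow> if p mod 3 = 1 then tg p (Tv (rr t)) (LM (el t) w) - scp (theta (el t) ^ (p div 3)) (tg p (Tv (ss t)) (HM (el t) w))
          else 0)"

text \<open>\<open>dh p\<close> is indexed by the column it maps to, so column p + 1 carries the
  generators of resolution degree p. The sign on \<open>bprime\<close> makes rows and columns
  anticommute.\<close>

fun D :: "cell \<Rightarrow> (cell \<Rightarrow>\<^sub>0 'k)" where
  "D (0, t, l) = tg 0 t (bE l)"
| "D (Suc p, t, l) = scp ((-1) ^ Suc p) (tg (Suc p) t (bprime l)) + dh p t (sg l)"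

lemma tg_sg [simp]: "tg p t (sg l) = sg (p, t, l)" by (simp add: tg_def)
lemma tg_lin: "tg p t (x + y) = tg p t x + tg p t y" "tg p t (x - y) = tg p t x - tg p t y"
  "tg p t (- x) = - tg p t x" "tg p t (scp c x) = scp c (tg p t x)" "tg p t 0 = 0"
  by (simp_all add: tg_def lext_lin)

lemma finite_bas [simp]: "finite {b. al b}" "finite (bas v)"
proof -
  have "{b. al b} \<subseteq> {..n} \<times> {..n} \<times> {..2 * n}" using al_bounds by fastforce
  then show 1: "finite {b. al b}" by (rule finite_subset) simp
  show "finite (bas v)" by (rule finite_subset[OF _ 1]) (auto simp: bas_def)
qed

lemma outs_eq: "1 \<le> v \<Longrightarrow> v \<le> n \<Longrightarrow> outs v = (if v < n then {TL v, TU v} else {TL v})"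
  unfolding outs_def set_eq_iff
proof
  fix c assume "1 \<le> v" "v \<le> n"
  then show "c \<in> {c. ar c \<and> ss c = v} \<longleftrightarrow> c \<in> (if v < n then {TL v, TU v} else {TL v})"
    by (cases c) auto
qed

lemma outs_empty: "\<not> (1 \<le> v \<and> v \<le> n) \<Longrightarrow> outs v = {}"
proof -
  have "\<not> (ar c \<and> ss c = v)" if "\<not> (1 \<le> v \<and> v \<le> n)" for c using that by (cases c) auto
  then show "\<not> (1 \<le> v \<and> v \<le> n) \<Longrightarrow> outs v = {}" by (auto simp: outs_def)
qed

lemma finite_outs [simp]: "finite (outs v)"
  by (cases "1 \<le> v \<and> v \<le> n") (auto simp: outs_eq outs_empty)

lemma ar_el: "ar c \<Longrightarrow> al (el c) \<and> src (el c) = ss c \<and> tgt (el c) = rr c \<and> deg (el c) = 1"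
  by (cases c) (auto simp: al_simps)

lemma ar_rv: "ar c \<Longrightarrow> ar (rv c) \<and> ss (rv c) = rr c \<and> rr (rv c) = ss c \<and> rv (rv c) = c"
  by (cases c) auto

lemma theta_rv: "ar c \<Longrightarrow> theta (el (rv c)) = (theta (el c) :: 'k)"
  by (cases c) (auto simp: theta_def)

text \<open>The identity that fixes the twist: for the loop, its own reverse, it holds because
  \<theta> is -1 there. It drives the cancellation in \<open>dh_23\<close>.\<close>

lemma mc_rv: "ar c \<Longrightarrow> mc (rv c) = - (theta (el c) * mc c)"
proof (cases c)
  case (TL v)
  assume "ar c"
  show ?thesis
  proof (cases "v = 1")
    case False
    then obtain u where "v = Suc (Suc u)" using TL \<open>ar c\<close> by (cases v; cases "v - 1") auto
    then show ?thesis by (simp add: TL theta_def power_add flip: power_mult_distrib)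
  qed (simp add: TL theta_def)
qed (auto simp: theta_def power_add simp flip: power_mult_distrib)

lemma mc_sq [simp]: "mc c * mc c = 1" by (cases c) auto

section \<open>Composites of consecutive horizontal maps\<close>

lemma dh_0: "dh 0 (Tv v) w = tg 0 (Tv 0) (CO w)" by (simp add: dh_def)
lemma dh_1: "ar c \<Longrightarrow> dh (Suc (3 * k)) c w = tg (Suc (3 * k)) (Tv (rr c)) (LM (el c) w)
    - scp (theta (el c) ^ k) (tg (Suc (3 * k)) (Tv (ss c)) (HM (el c) w))"
  by (cases c) (simp_all add: dh_def mod_Suc div_Suc)
lemma dh_2: "dh (Suc (Suc (3 * k))) (Tv v) w = (\<Sum>c\<in>outs v. scp (mc c) (scp (theta (el c) ^ k) (tg (Suc (Suc (3 * k))) c (HM (el (rv c)) w))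
                                                + tg (Suc (Suc (3 * k))) (rv c) (LM (el c) w)))"
  by (simp add: dh_def mod_Suc div_Suc)
lemma dh_3: "dh (Suc (Suc (Suc (3 * k)))) (Tv v) w =
    (\<Sum>b\<in>bas v. scp (theta b ^ Suc k) (tg (Suc (Suc (Suc (3 * k)))) (Tv (tgt b)) (LM b (HM (dual b) w))))"
  by (simp add: dh_def mod_Suc div_Suc)

lemma mod3_cases: obtains "p = (0::nat)" | k where "p = Suc (3 * k)" | k where "p = Suc (Suc (3 * k))" | k where "p = Suc (Suc (Suc (3 * k)))"
proof -
  define k where "k = (p - 1) div 3"
  have "p = 0 \<or> p = Suc (3 * k) \<or> p = Suc (Suc (3 * k)) \<or> p = Suc (Suc (Suc (3 * k)))"
    unfolding k_def by presburger
  then show thesis using that by blast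
qed

definition tag_ok :: "nat \<Rightarrow> tag \<Rightarrow> bool" where
  "tag_ok p t \<longleftrightarrow> (if p mod 3 = 1 then ar t else (\<exists>v. t = Tv v \<and> 1 \<le> v \<and> v \<le> n))"

lemma dh_bad: "\<not> (if p mod 3 = 1 then ar t else (\<exists>v. t = Tv v)) \<Longrightarrow> dh p t w = 0"
proof (cases t)
  case (TL v)
  assume a: "\<not> (if p mod 3 = 1 then ar t else (\<exists>v. t = Tv v))"
  have h: "hm (el (TL v)) l = 0" "lm (el (TL v)) l = 0" if "\<not> ar (TL v)" for l
  proof -
    have "\<not> al (el (TL v))" using that by (auto simp: al_simps)
    then have "mu (el (TL v)) y = Oz" "mu y (el (TL v)) = Oz" for y by (cases y; simp)+
    then show "hm (el (TL v)) l = 0" "lm (el (TL v)) l = 0" by (simp_all add: hm_def lm_def dw_def)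
  qed
  have hh: "HM (el (TL v)) w = 0" "LM (el (TL v)) w = 0" if "\<not> ar (TL v)"
    using h[OF that] by (auto simp: lext_def)
  show ?thesis using a hh by (auto simp: dh_def TL tg_lin simp del: ar.simps el.simps)
next
  case (TU v)
  assume a: "\<not> (if p mod 3 = 1 then ar t else (\<exists>v. t = Tv v))"
  have h: "hm (el (TU v)) l = 0" "lm (el (TU v)) l = 0" if "\<not> ar (TU v)" for l
  proof -
    have "\<not> al (el (TU v))" using that by (auto simp: al_simps)
    then have "mu (el (TU v)) y = Oz" "mu y (el (TU v)) = Oz" for y by (cases y; simp)+
    then show "hm (el (TU v)) l = 0" "lm (el (TU v)) l = 0" by (simp_all add: hm_def lm_def dw_def)
  qed
  have hh: "HM (el (TU v)) w = 0" "LM (el (TU v)) w = 0" if "\<not> ar (TU v)"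
    using h[OF that] by (auto simp: lext_def)
  show ?thesis using a hh by (auto simp: dh_def TU tg_lin simp del: ar.simps el.simps)
qed (auto simp: dh_def)

lemma dh_lin: "dh p t (x + y) = dh p t x + dh p t y" "dh p t (scp c x) = scp c (dh p t x)" "dh p t 0 = 0"
  by (simp_all add: dh_def lext_lin tg_lin sum.distrib pmv.scale_sum_right pmv.scale_right_distrib
       pmv.scale_right_diff_distrib mult.commute mult.left_commute algebra_simps split: tag.split)

lemma dh_sum: "dh p t (\<Sum>i\<in>I. f i) = (\<Sum>i\<in>I. dh p t (f i))"
  by (induction I rule: infinite_finite_induct) (auto simp: dh_lin)

lemma dh_lext: "dh p t (lext f w) = lext (\<lambda>l. dh p t (f l)) w"
  by (simp add: lext_def dh_sum dh_lin)

lemma lext_D_0: "lext D (tg 0 t w) = tg 0 t (BE w)"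
  by (simp add: tg_def lext_lext)

lemma lext_D_Suc: "lext D (tg (Suc p) t w) = scp ((-1) ^ Suc p) (tg (Suc p) t (BP w)) + dh p t w"
proof -
  have "lext D (tg (Suc p) t w) = lext (\<lambda>l. scp ((-1) ^ Suc p) (tg (Suc p) t (bprime l)) + dh p t (sg l)) w"
    by (simp add: tg_def lext_lext)
  also have "\<dots> = scp ((-1) ^ Suc p) (tg (Suc p) t (BP w)) + dh p t (lext sg w)"
    by (simp only: lext_linf dh_lext tg_def lext_lext)
  finally show ?thesis by simp
qed

lemma HM_Oz: "HM Oz w = 0" and LM_Oz: "LM Oz w = 0"
  by (simp_all add: lext_def)

lemma word_ops:
  "BP (HM c w) = HM c (BP w)" "BP (LM c w) = LM c (BP w)" "HM c (LM c' w) = LM c' (HM c w)"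
  "HM c (HM c' w) = HM (mu c c') w" "LM c (LM c' w) = LM (mu c' c) w" "BP (BP w) = 0"
  "BE (CO w) = CO (BP w)" "CO (LM c w) = CO (HM c w)" "BE (BE w) = 0" "HM Oz w = 0" "LM Oz w = 0"
  by (simp_all add: lext_lext bprime_hm bprime_lm hm_lm hm_hm lm_lm bprime_bprime bE_co co_lm_hm bE_bE HM_Oz LM_Oz)

text \<open>The two squares of arrows at a vertex are the same basis element with opposite signs
  \<open>mc\<close>. At v = n only one square remains, and (n,n,2) is not a basis element.\<close>

lemma arrow_square:
  assumes "1 \<le> v" "v \<le> n"
  shows "(\<Sum>c\<in>outs v. scp (mc c) (HM (mu (el c) (el (rv c))) w)) = 0"
    "(\<Sum>c\<in>outs v. scp (mc c) (LM (mu (el c) (el (rv c))) w)) = 0"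
proof -
  have L: "mu (el (TL v)) (el (rv (TL v))) = (if al (v, v, 2) then (v, v, 2) else Oz)"
    using assms by (auto simp: al_simps)
  have U: "mu (el (TU v)) (el (rv (TU v))) = (if al (v, v, 2) then (v, v, 2) else Oz)" if "v < n"
    using assms that by (auto simp: al_simps)
  have N: "\<not> al (v, v, 2)" if "\<not> v < n" using that assms by (auto simp: al_simps)
  show "(\<Sum>c\<in>outs v. scp (mc c) (HM (mu (el c) (el (rv c))) w)) = 0"
    using L U N assms by (auto simp: outs_eq word_ops simp del: el.simps rv.simps)
  show "(\<Sum>c\<in>outs v. scp (mc c) (LM (mu (el c) (el (rv c))) w)) = 0"
    using L U N assms by (auto simp: outs_eq word_ops simp del: el.simps rv.simps)
qed

lemma tg_sum: "tg p t (\<Sum>i\<in>I. f i) = (\<Sum>i\<in>I. tg p t (f i))"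
  by (simp add: tg_def lext_lin)

text \<open>For each arrow the two terms that act on both ends of the word cancel; what remains is
  the relation acting on one end, which is zero.\<close>

lemma dh_12:
  "(\<Sum>c\<in>outs v. scp (mc c) (scp (theta (el c) ^ k) (dh (Suc (3 * k)) c (HM (el (rv c)) w))
      + dh (Suc (3 * k)) (rv c) (LM (el c) w))) = 0" (is "?S = 0")
proof (cases "1 \<le> v \<and> v \<le> n")
  case True
  let ?p = "Suc (3 * k)"
  have "?S = (\<Sum>c\<in>outs v. tg ?p (Tv v) (scp (mc c) (LM (mu (el c) (el (rv c))) w))
              - tg ?p (Tv v) (scp (mc c) (HM (mu (el c) (el (rv c))) w)))"
  proof (rule sum.cong[OF refl])
    fix c assume "c \<in> outs v"
    then have c: "ar c" "ss c = v" by (auto simp: outs_def)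
    note r = ar_rv[OF c(1)]
    show "scp (mc c) (scp (theta (el c) ^ k) (dh ?p c (HM (el (rv c)) w)) + dh ?p (rv c) (LM (el c) w))
      = tg ?p (Tv v) (scp (mc c) (LM (mu (el c) (el (rv c))) w)) - tg ?p (Tv v) (scp (mc c) (HM (mu (el c) (el (rv c))) w))"
      using c r by (simp add: dh_1 word_ops theta_rv pmv.scale_right_distrib pmv.scale_right_diff_distrib tg_lin)
  qed
  also have "\<dots> = 0"
    unfolding sum_subtractf tg_sum[symmetric] arrow_square[OF conjunct1[OF True] conjunct2[OF True]] by simp
  finally show ?thesis .
qed (simp add: outs_empty)

lemma dual_mu_left: "mu b w \<noteq> Oz \<Longrightarrow> mu w (dual (mu b w)) = dual b"
  using mu_dual_iff[of b w "dual (mu b w)"] mu_neq_O[of b w] al_mu al_dual by blast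

lemma dual_mu_right: "mu w b \<noteq> Oz \<Longrightarrow> mu (dual (mu w b)) w = dual b"
proof -
  assume m: "mu w b \<noteq> Oz"
  then have a: "al w" "al b" "al (mu w b)" using mu_neq_O al_mu by blast+
  have "mu b (dual (mu w b)) = dual w" using dual_mu_left[OF m] .
  then show ?thesis using mu_eq_dual_iff[of b "dual (mu w b)" w] a al_dual by blast
qed

text \<open>An arrow can be moved from one factor of the Casimir element to the other. The sign that
  arises is that of \<open>mc_rv\<close>, and its extra \<theta> is absorbed by the exponent
  \<open>Suc k\<close>, one more than in the column below.\<close>

lemma dh_23:
  "(\<Sum>b\<in>bas v. scp (theta b ^ Suc k) (dh (Suc (Suc (3 * k))) (Tv (tgt b)) (LM b (HM (dual b) w)))) = 0" (is "?S = 0")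
proof -
  let ?p = "Suc (Suc (3 * k))"
  let ?P = "Sigma (bas v) (\<lambda>b. outs (tgt b))"
  define f where "f b c = scp (theta b ^ Suc k * mc c * theta (el c) ^ k) (tg ?p c (LM b (HM (mu (el (rv c)) (dual b)) w)))" for b c
  define g where "g b c = scp (theta b ^ Suc k * mc c) (tg ?p (rv c) (LM (mu b (el c)) (HM (dual b) w)))" for b c
  let ?Q1 = "{(b, c). (b, c) \<in> ?P \<and> mu (el (rv c)) (dual b) \<noteq> Oz}"
  let ?Q2 = "{(b, c). (b, c) \<in> ?P \<and> mu b (el c) \<noteq> Oz}"
  have fin: "finite ?P" by auto
  have "?S = (\<Sum>b\<in>bas v. \<Sum>c\<in>outs (tgt b). f b c + g b c)"
    by (simp add: dh_2 pmv.scale_sum_right pmv.scale_right_distrib f_def g_def word_ops mult.assoc)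
  also have "\<dots> = (\<Sum>(b, c)\<in>?P. f b c + g b c)" by (subst sum.Sigma) auto
  also have "\<dots> = (\<Sum>(b, c)\<in>?P. f b c) + (\<Sum>(b, c)\<in>?P. g b c)" by (simp add: case_prod_beta sum.distrib)
  also have "(\<Sum>(b, c)\<in>?P. f b c) = (\<Sum>(b, c)\<in>?Q1. f b c)"
    using fin by (intro sum.mono_neutral_right) (auto simp: f_def word_ops tg_lin)
  also have "(\<Sum>(b, c)\<in>?P. g b c) = (\<Sum>(b, c)\<in>?Q2. g b c)"
    using fin by (intro sum.mono_neutral_right) (auto simp: g_def word_ops tg_lin)
  also have "(\<Sum>(b, c)\<in>?Q1. f b c) = (\<Sum>(b, c)\<in>?Q2. - g b c)"
  \<comment> \<open>The arrow passes from one factor to the other: (b, c) goes to (bc, reverse of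
    c), and c times the dual of bc is the dual of b.\<close>
  proof (rule sym, rule sum.reindex_bij_witness[where
        j = "\<lambda>(b, c). (mu b (el c), rv c)" and i = "\<lambda>(b, c). (dual (mu (el (rv c)) (dual b)), rv c)"])
    fix x assume "x \<in> ?Q1"
    then obtain b c where x: "x = (b, c)" "b \<in> bas v" "c \<in> outs (tgt b)" "mu (el (rv c)) (dual b) \<noteq> Oz" by auto
    have c: "ar c" "ss c = tgt b" and b: "al b" "src b = v" using x by (auto simp: outs_def bas_def)
    note r = ar_rv[OF c(1)] and m = mu_neq_O[OF x(4)]
    have er: "al (el (rv c))" "src (el (rv c)) = rr c" using ar_el[of "rv c"] r by auto
    define b' where "b' = dual (mu (el (rv c)) (dual b))"
    have ab': "al b'" using al_dual al_mu[OF x(4)] by (simp add: b'_def)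
    have db': "dual b' = mu (el (rv c)) (dual b)" using dual_dual[OF al_mu[OF x(4)]] by (simp add: b'_def)
    have i: "mu b' (el (rv c)) = b"
      using dual_mu_right[OF x(4)] dual_dual[OF b(1)] by (simp add: b'_def)
    show "(case case x of (b, c) \<Rightarrow> (dual (mu (el (rv c)) (dual b)), rv c) of (b, c) \<Rightarrow> (mu b (el c), rv c)) = x"
      using i r by (simp add: x(1) b'_def)
    have "src b' = v" "tgt b' = rr c" using m b er r by (simp_all add: b'_def)
    then show "(case x of (b, c) \<Rightarrow> (dual (mu (el (rv c)) (dual b)), rv c)) \<in> ?Q2"
      using r b ab' i al_neq_O[OF b(1)] by (simp add: x(1) flip: b'_def) (simp add: bas_def outs_def)
  next
    fix x assume "x \<in> ?Q2"
    then obtain b c where x: "x = (b, c)" "b \<in> bas v" "c \<in> outs (tgt b)" "mu b (el c) \<noteq> Oz" by auto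
    have c: "ar c" "ss c = tgt b" and b: "al b" "src b = v" using x by (auto simp: outs_def bas_def)
    note r = ar_rv[OF c(1)] and m = mu_neq_O[OF x(4)] and e = ar_el[OF c(1)]
    have i: "mu (el c) (dual (mu b (el c))) = dual b" using dual_mu_left[OF x(4)] .
    show "(case case x of (b, c) \<Rightarrow> (mu b (el c), rv c) of (b, c) \<Rightarrow> (dual (mu (el (rv c)) (dual b)), rv c)) = x"
      using i r dual_dual[OF b(1)] by (simp add: x(1))
    show "(case x of (b, c) \<Rightarrow> (mu b (el c), rv c)) \<in> ?Q1"
      using r i m e b al_mu[OF x(4)] al_neq_O[OF al_dual[OF b(1)]] by (simp add: x(1)) (simp add: bas_def outs_def)
    have "(theta (mu b (el c)) :: 'k) ^ Suc k * mc (rv c) * theta (el (rv c)) ^ k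
       = - (theta b ^ Suc k * mc c * (theta (el c) * theta (el c)) * (theta (el c) ^ k * theta (el c) ^ k))"
      using c by (simp add: theta_mu[OF x(4)] theta_rv mc_rv power_mult_distrib algebra_simps del: theta_sq theta_sq_power)
    then have co: "(theta (mu b (el c)) :: 'k) ^ Suc k * mc (rv c) * theta (el (rv c)) ^ k = - (theta b ^ Suc k * mc c)"
      by simp
    show "(case case x of (b, c) \<Rightarrow> (mu b (el c), rv c) of (b, c) \<Rightarrow> f b c) = (case x of (b, c) \<Rightarrow> - g b c)"
      using r i co by (simp add: x(1) f_def g_def)
  qed
  also have "(\<Sum>(b, c)\<in>?Q2. - g b c) = - (\<Sum>(b, c)\<in>?Q2. g b c)" by (simp only: case_prod_unfold sum_negf)
  finally show ?thesis by simp
qed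

text \<open>The same transfer of an arrow, now for the twisted commutator. It works because the
  commutator and the Casimir map below it carry the same power of \<theta>.\<close>

lemma dh_31:
  assumes "ar c"
  shows "dh (Suc (Suc (Suc (3 * k)))) (Tv (rr c)) (LM (el c) w)
    - scp (theta (el c) ^ Suc k) (dh (Suc (Suc (Suc (3 * k)))) (Tv (ss c)) (HM (el c) w)) = 0"
proof -
  let ?p = "Suc (Suc (Suc (3 * k)))"
  define f where "f b = scp (theta b ^ Suc k) (tg ?p (Tv (tgt b)) (LM (mu (el c) b) (HM (dual b) w)))" for b
  define g where "g b = scp (theta (el c) ^ Suc k * theta b ^ Suc k) (tg ?p (Tv (tgt b)) (LM b (HM (mu (dual b) (el c)) w)))" for b
  let ?Q1 = "{b \<in> bas (rr c). mu (el c) b \<noteq> Oz}" and ?Q2 = "{b \<in> bas (ss c). mu (dual b) (el c) \<noteq> Oz}"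
  note e = ar_el[OF assms]
  have "dh ?p (Tv (rr c)) (LM (el c) w) = (\<Sum>b\<in>bas (rr c). f b)"
    by (simp add: dh_3 f_def word_ops)
  also have "\<dots> = (\<Sum>b\<in>?Q1. f b)"
    by (intro sum.mono_neutral_right) (auto simp: f_def word_ops tg_lin)
  also have "\<dots> = (\<Sum>b\<in>?Q2. g b)"
  proof (rule sum.reindex_bij_witness[where i = "\<lambda>b. dual (mu (dual b) (el c))" and j = "\<lambda>b. mu (el c) b"])
    fix b assume "b \<in> ?Q1"
    then have b: "al b" "src b = rr c" "mu (el c) b \<noteq> Oz" by (auto simp: bas_def)
    note m = mu_neq_O[OF b(3)]
    have i: "mu (dual (mu (el c) b)) (el c) = dual b" using dual_mu_right[OF b(3)] .
    show "dual (mu (dual (mu (el c) b)) (el c)) = b" using dual_dual[OF b(1)] i by simp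
    show "mu (el c) b \<in> ?Q2" using i m e al_mu[OF b(3)] al_neq_O[OF al_dual[OF b(1)]] by (simp add: bas_def)
    have "(theta (el c) :: 'k) ^ Suc k * theta (mu (el c) b) ^ Suc k = theta b ^ Suc k * (theta (el c) * theta (el c)) ^ Suc k"
      by (simp only: theta_mu[OF b(3)] power_mult_distrib mult_ac)
    then show "g (mu (el c) b) = f b" using m by (simp add: f_def g_def i)
  next
    fix b assume "b \<in> ?Q2"
    then have b: "al b" "src b = ss c" "mu (dual b) (el c) \<noteq> Oz" by (auto simp: bas_def)
    note m = mu_neq_O[OF b(3)]
    have "mu (el c) (dual (mu (dual b) (el c))) = dual (dual b)" using dual_mu_left[OF b(3)] .
    then show i: "mu (el c) (dual (mu (dual b) (el c))) = b" using dual_dual[OF b(1)] by simp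
    show "dual (mu (dual b) (el c)) \<in> ?Q1" using m b e i al_neq_O[OF b(1)] al_dual[OF al_mu[OF b(3)]] by (simp add: bas_def)
  qed
  also have "\<dots> = (\<Sum>b\<in>bas (ss c). g b)"
    by (intro sum.mono_neutral_left) (auto simp: g_def word_ops tg_lin)
  also have "\<dots> = scp (theta (el c) ^ Suc k) (dh ?p (Tv (ss c)) (HM (el c) w))"
    by (simp add: dh_3 g_def word_ops pmv.scale_sum_right)
  finally show ?thesis by simp
qed

lemma lext_D_dh: "lext D (dh p t w) = scp ((-1) ^ p) (dh p t (BP w))"
proof (cases p rule: mod3_cases)
  case 1
  show ?thesis by (cases t) (simp_all add: 1 dh_def lext_D_0 word_ops)
next
  case (2 k)
  show ?thesis
  proof (cases "ar t")
    case True
    show ?thesis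
    proof (cases k)
      case 0
      show ?thesis using True
        by (simp add: 2 dh_1 lext_lin lext_D_Suc word_ops tg_lin pmv.scale_right_diff_distrib) (simp add: 0 dh_0 word_ops)
    next
      case (Suc j)
      have k3: "3 * Suc j = Suc (Suc (Suc (3 * j)))" by simp
      have "lext D (dh p t w) = scp ((-1) ^ p) (dh p t (BP w)) + (dh (3 * k) (Tv (rr t)) (LM (el t) w)
          - scp (theta (el t) ^ k) (dh (3 * k) (Tv (ss t)) (HM (el t) w)))"
        using True
        by (simp add: 2 dh_1 lext_lin lext_D_Suc word_ops tg_lin pmv.scale_right_distrib pmv.scale_right_diff_distrib
             mult.commute[of _ "theta (el t) ^ k"])
      then show ?thesis using dh_31[OF True, of j w] by (simp only: Suc k3 add_0_right)
    qed
  qed (simp add: 2 dh_bad mod_Suc)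
next
  case (3 k)
  show ?thesis
  proof (cases "\<exists>v. t = Tv v")
    case True
    then obtain v where t: "t = Tv v" by blast
    have "lext D (dh p t w) = scp ((-1) ^ p) (dh p t (BP w)) + (\<Sum>c\<in>outs v. scp (mc c) (scp (theta (el c) ^ k) (dh (Suc (3 * k)) c (HM (el (rv c)) w))
      + dh (Suc (3 * k)) (rv c) (LM (el c) w)))"
      by (simp add: 3 t dh_2 lext_lin lext_D_Suc word_ops tg_lin pmv.scale_sum_right sum.distrib[symmetric] pmv.scale_right_distrib
          pmv.scale_right_diff_distrib mult.assoc[where 'a = 'k] mult.commute[where 'a = 'k] mult.left_commute[where 'a = 'k] add_ac)
    then show ?thesis by (simp only: dh_12 add_0_right)
  qed (simp add: 3 dh_bad mod_Suc)
next
  case (4 k)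
  show ?thesis
  proof (cases "\<exists>v. t = Tv v")
    case True
    then obtain v where t: "t = Tv v" by blast
    have "lext D (dh p t w) = scp ((-1) ^ p) (dh p t (BP w)) +
     (\<Sum>b\<in>bas v. scp (theta b ^ Suc k) (dh (Suc (Suc (3 * k))) (Tv (tgt b)) (LM b (HM (dual b) w))))"
      by (simp add: 4 t dh_3 lext_lin lext_D_Suc word_ops tg_lin pmv.scale_sum_right sum.distrib[symmetric] pmv.scale_right_distrib
          pmv.scale_right_diff_distrib mult.assoc[where 'a = 'k] mult.commute[where 'a = 'k] mult.left_commute[where 'a = 'k] add_ac)
    then show ?thesis by (simp only: dh_23 add_0_right)
  qed (simp add: 4 dh_bad mod_Suc)
qed

theorem D_D: "lext D (D x) = 0"
proof (cases x rule: D.cases)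
  case (1 t l)
  then show ?thesis using word_ops(9)[of "sg l"] by (simp add: lext_D_0 tg_lin)
next
  case (2 p t l)
  then show ?thesis using word_ops(6)[of "sg l"] by (simp add: lext_lin lext_D_Suc lext_D_dh tg_lin)
qed

section \<open>Grading\<close>

definition AL :: "nat \<Rightarrow> tri list set" where "AL m = {l. l \<noteq> [] \<and> (\<forall>b\<in>set l. al b) \<and> length l = m}"
definition path_words :: "nat \<Rightarrow> nat \<Rightarrow> nat \<Rightarrow> tri list set" where
  "path_words r s m = {l \<in> AL m. src (hd l) = r \<and> tgt (last l) = s}"

text \<open>CL p m contains the cells in column p and row m; in the column p = 0 the words are
  one letter shorter.\<close>

definition CL :: "nat \<Rightarrow> nat \<Rightarrow> cell set" where
  "CL p m = (if p = 0 then {(0, Tv 0, l) | l. l \<in> AL (m - 1)}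
     else {(p, t, l) | t l. tag_ok (p - 1) t \<and> l \<in> path_words (rr t) (ss t) m})"

text \<open>Column p and row m have total degree p + m - 2. Thus row one of column i + 1 and the
  cyclic words with i + 1 letters both lie in degree i.\<close>

definition XG :: "nat \<Rightarrow> cell set" where "XG i = (\<Union>p\<le>Suc i. CL p (Suc (Suc i) - p))"

lemma CL_XG: "p + m = Suc (Suc i) \<Longrightarrow> 0 < m \<Longrightarrow> x \<in> CL p m \<Longrightarrow> x \<in> XG i"
proof -
  assume a: "p + m = Suc (Suc i)" "0 < m" "x \<in> CL p m"
  then have "p \<le> Suc i" "Suc (Suc i) - p = m" by auto
  then show "x \<in> XG i" unfolding XG_def using a(3) by blast
qed

lemma XG_E:
  assumes "x \<in> XG i"
  obtains p m where "p + m = Suc (Suc i)" "0 < m" "x \<in> CL p m"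
proof -
  from assms obtain p where "p \<le> Suc i" "x \<in> CL p (Suc (Suc i) - p)" unfolding XG_def by blast
  then show thesis by (intro that[of p "Suc (Suc i) - p"]) auto
qed

lemma AL_0 [simp]: "AL 0 = {}" by (auto simp: AL_def)
lemma path_words_0 [simp]: "path_words r s 0 = {}" by (auto simp: path_words_def)
lemma CL_0 [simp]: "CL p 0 = {}" by (auto simp: CL_def)
lemma CL_01 [simp]: "CL 0 (Suc 0) = {}" by (auto simp: CL_def)

lemma dw_vs: "(Oz \<notin> set l \<Longrightarrow> l \<in> S) \<Longrightarrow> dw l \<in> vs S" by (simp add: dw_def vs_intros)

lemma hm_vs: "l \<in> path_words r s m \<Longrightarrow> hm c l \<in> vs (path_words (src c) s m)"
  unfolding hm_def
proof (cases l)
  case (Cons y w)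
  assume l: "l \<in> path_words r s m"
  have "dw (mu c y # w) \<in> vs (path_words (src c) s m)"
    by (rule dw_vs) (use l Cons al_mu[of c y] mu_neq_O[of c y] in \<open>auto simp: path_words_def AL_def split: if_splits\<close>)
  then show "(if l = [] then 0 else dw (mu c (hd l) # tl l)) \<in> vs (path_words (src c) s m)" using Cons by simp
qed (simp add: vs_intros)

lemma lm_vs: "l \<in> path_words r s m \<Longrightarrow> lm c l \<in> vs (path_words r (tgt c) m)"
proof (cases l rule: rev_cases)
  case (snoc w y)
  assume l: "l \<in> path_words r s m"
  have "dw (w @ [mu y c]) \<in> vs (path_words r (tgt c) m)"
  proof (rule dw_vs)
    assume "Oz \<notin> set (w @ [mu y c])"
    then show "w @ [mu y c] \<in> path_words r (tgt c) m"
      using l snoc al_mu[of y c] mu_neq_O[of y c] by (cases w) (auto simp: path_words_def AL_def)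
  qed
  then show "lm c l \<in> vs (path_words r (tgt c) m)" using snoc by (simp add: lm_snoc)
qed (simp add: vs_intros lm_def)

lemma bprime_vs: "l \<in> path_words r s (Suc m) \<Longrightarrow> bprime l \<in> vs (path_words r s m)"
proof (induction l arbitrary: r m rule: bprime.induct)
  case (1 x y l)
  have "dw (mu x y # l) \<in> vs (path_words r s m)"
    by (rule dw_vs) (use 1(2) al_mu[of x y] mu_neq_O[of x y] in \<open>auto simp: path_words_def AL_def split: if_splits\<close>)
  moreover have "cn x (bprime (y # l)) \<in> vs (path_words r s m)"
  proof (rule lext_vs[OF 1(1)])
    show "y # l \<in> path_words (src y) s (Suc (m - 1))" using 1(2) by (auto simp: path_words_def AL_def)
    show "dw (x # w) \<in> vs (path_words r s m)" if "w \<in> path_words (src y) s (m - 1)" for w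
      using 1(2) that by (intro dw_vs) (auto simp: path_words_def AL_def)
  qed
  ultimately show ?case by (simp add: vs_intros)
qed (simp_all add: vs_intros)

lemma AL_path_words: "l \<in> AL m \<Longrightarrow> l \<in> path_words (src (hd l)) (tgt (last l)) m" by (simp add: path_words_def)

lemma bprime_AL: "l \<in> AL (Suc m) \<Longrightarrow> bprime l \<in> vs (AL m)"
  using bprime_vs[OF AL_path_words] by (rule vs_mono[rotated]) (auto simp: path_words_def)

lemma co_vs: "l \<in> AL (Suc m) \<Longrightarrow> co l \<in> vs (AL m)"
proof (cases l rule: length_cases)
  case (2 y w x)
  assume l: "l \<in> AL (Suc m)"
  show ?thesis unfolding 2 co_ends
    by (rule dw_vs) (use l al_mu[of x y] in \<open>auto simp: AL_def 2\<close>)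
qed (simp add: short_0 vs_intros)

lemma bE_vs: "l \<in> AL (Suc m) \<Longrightarrow> bE l \<in> vs (AL m)"
  unfolding bE_def by (intro vs_intros bprime_AL co_vs)

lemma tg_vs: "w \<in> vs S \<Longrightarrow> (\<And>l. l \<in> S \<Longrightarrow> (p, t, l) \<in> X) \<Longrightarrow> tg p t w \<in> vs X"
  unfolding tg_def by (rule lext_vs) auto

lemma tg_CL: "w \<in> vs (path_words r s m) \<Longrightarrow> tag_ok p t \<Longrightarrow> rr t = r \<Longrightarrow> ss t = s \<Longrightarrow> tg (Suc p) t w \<in> vs (CL (Suc p) m)"
  by (rule tg_vs) (auto simp: CL_def)

lemma HM_vs: "w \<in> vs (path_words r s m) \<Longrightarrow> HM c w \<in> vs (path_words (src c) s m)"
  by (rule lext_vs) (auto intro: hm_vs)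
lemma LM_vs: "w \<in> vs (path_words r s m) \<Longrightarrow> LM c w \<in> vs (path_words r (tgt c) m)"
  by (rule lext_vs) (auto intro: lm_vs)

lemma tag_ok_1: "tag_ok (3 * k) t \<longleftrightarrow> (\<exists>v. t = Tv v \<and> 1 \<le> v \<and> v \<le> n)"
  "tag_ok (Suc (3 * k)) t \<longleftrightarrow> ar t"
  "tag_ok (Suc (Suc (3 * k))) t \<longleftrightarrow> (\<exists>v. t = Tv v \<and> 1 \<le> v \<and> v \<le> n)"
  "tag_ok (Suc (Suc (Suc (3 * k)))) t \<longleftrightarrow> (\<exists>v. t = Tv v \<and> 1 \<le> v \<and> v \<le> n)"
  "tag_ok 0 t \<longleftrightarrow> (\<exists>v. t = Tv v \<and> 1 \<le> v \<and> v \<le> n)"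
  by (auto simp: tag_ok_def mod_Suc)

lemma ar_bounds: "ar c \<Longrightarrow> 1 \<le> ss c \<and> ss c \<le> n \<and> 1 \<le> rr c \<and> rr c \<le> n" by (cases c) auto

lemma dh_vs:
  assumes "tag_ok p t" "w \<in> vs (path_words (rr t) (ss t) m)"
  shows "dh p t w \<in> vs (CL p m)"
proof (cases p rule: mod3_cases)
  case 1
  then obtain v where t: "t = Tv v" using assms by (auto simp: tag_ok_1)
  have "CO w \<in> vs (AL (m - 1))"
    using assms(2) by (rule lext_vs) (cases m; auto simp: path_words_def intro: co_vs)
  then show ?thesis by (simp add: 1 t dh_0) (rule tg_vs, auto simp: CL_def)
next
  case (2 k)
  have t: "ar t" using assms by (simp add: 2 tag_ok_1)
  show ?thesis unfolding 2 dh_1[OF t]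
    by (intro vs_intros tg_CL[OF LM_vs[OF assms(2)]] tg_CL[OF HM_vs[OF assms(2)]])
       (use ar_bounds[OF t] ar_el[OF t] in \<open>auto simp: tag_ok_1\<close>)
next
  case (3 k)
  then obtain v where t: "t = Tv v" using assms by (auto simp: tag_ok_1)
  have c: "ar c \<and> ss c = v" if "c \<in> outs v" for c using that by (simp add: outs_def)
  have w: "w \<in> vs (path_words v v m)" using assms(2) t by simp
  show ?thesis unfolding 3 t dh_2
  proof (intro vs_intros)
    fix c assume "c \<in> outs v"
    then have c: "ar c" "ss c = v" by (auto simp: outs_def)
    show "tg (Suc (Suc (3 * k))) c (HM (el (rv c)) w) \<in> vs (CL (Suc (Suc (3 * k))) m)"
      by (rule tg_CL[OF HM_vs[OF w]]) (use c ar_rv[OF c(1)] ar_el[of "rv c"] in \<open>auto simp: tag_ok_1\<close>)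
    show "tg (Suc (Suc (3 * k))) (rv c) (LM (el c) w) \<in> vs (CL (Suc (Suc (3 * k))) m)"
      by (rule tg_CL[OF LM_vs[OF w]]) (use c ar_rv[OF c(1)] ar_el[of c] in \<open>auto simp: tag_ok_1\<close>)
  qed
next
  case (4 k)
  then obtain v where t: "t = Tv v" using assms by (auto simp: tag_ok_1)
  have w: "w \<in> vs (path_words v v m)" using assms(2) t by simp
  show ?thesis unfolding 4 t dh_3
  proof (intro vs_intros)
    fix b assume "b \<in> bas v"
    then have b: "al b" "src b = v" by (auto simp: bas_def)
    show "tg (Suc (Suc (Suc (3 * k)))) (Tv (tgt b)) (LM b (HM (dual b) w)) \<in> vs (CL (Suc (Suc (Suc (3 * k)))) m)"
      by (rule tg_CL[OF LM_vs[OF HM_vs[OF w]]])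
        (use b al_bounds[of "fst b" "fst (snd b)" "snd (snd b)"] in \<open>cases b; auto simp: tag_ok_1\<close>)+
  qed
qed

section \<open>The horizontal and the vertical part of the differential\<close>

definition hdiff :: "cell \<Rightarrow> (cell \<Rightarrow>\<^sub>0 'k)" where
  "hdiff x = (case x of (p, t, l) \<Rightarrow> if p = 0 then 0 else dh (p - 1) t (sg l))"
definition vdiff :: "cell \<Rightarrow> (cell \<Rightarrow>\<^sub>0 'k)" where
  "vdiff x = (case x of (p, t, l) \<Rightarrow> if p = 0 then tg 0 t (bE l) else scp ((-1) ^ p) (tg p t (bprime l)))"

lemma D_split: "D x = vdiff x + hdiff x"
  by (cases x rule: D.cases) (simp_all add: vdiff_def hdiff_def)

lemma hdiff_tg: "lext hdiff (tg (Suc p) t w) = dh p t w"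
  using dh_lext[of p t sg w] by (simp add: tg_def lext_lext hdiff_def)

lemma hdiff_CL: "x \<in> CL (Suc p) m \<Longrightarrow> hdiff x \<in> vs (CL p m)"
  by (auto simp: CL_def[of "Suc p"] hdiff_def intro!: dh_vs)

lemma hdiff_CL0: "x \<in> CL 0 m \<Longrightarrow> hdiff x = 0"
  by (auto simp: CL_def hdiff_def)

lemma vdiff_CL: "x \<in> CL p m \<Longrightarrow> vdiff x \<in> vs (CL p (m - 1))"
proof (cases p)
  case 0
  assume "x \<in> CL p m"
  then obtain l where x: "x = (0, Tv 0, l)" "l \<in> AL (m - 1)" by (auto simp: CL_def 0)
  then obtain k where k: "m = Suc (Suc k)" by (cases m; cases "m - 1") auto
  show ?thesis using bE_vs[of l k] x unfolding vdiff_def by (auto simp: k 0 CL_def intro!: tg_vs)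
next
  case (Suc q)
  assume "x \<in> CL p m"
  then obtain t l where x: "x = (Suc q, t, l)" "tag_ok q t" "l \<in> path_words (rr t) (ss t) m" by (auto simp: CL_def Suc)
  then obtain k where k: "m = Suc k" by (cases m) auto
  show ?thesis using bprime_vs[of l "rr t" "ss t" k] x
    by (auto simp: k Suc vdiff_def intro!: vs_intros tg_CL)
qed

lemma D_XG0: "x \<in> XG 0 \<Longrightarrow> D x = 0"
proof (erule XG_E)
  fix p m assume a: "p + m = Suc (Suc 0)" "0 < m" "x \<in> CL p m"
  have 1: "vdiff x = 0"
  proof (cases p)
    case 0
    then have "vdiff x \<in> vs (CL 0 (Suc 0))" using vdiff_CL[OF a(3)] a by (cases m) auto
    then show ?thesis by (simp add: vs_def)
  next
    case (Suc q)
    then have "m = 1" using a by simp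
    then show ?thesis using vdiff_CL[OF a(3)] by (simp add: vs_def)
  qed
  have 2: "hdiff x = 0"
  proof (cases p)
    case 0
    then show ?thesis using hdiff_CL0 a by simp
  next
    case (Suc q)
    then have "m = 1" "q = 0" using a by simp_all
    then show ?thesis using hdiff_CL[OF a(3)[unfolded Suc]] by (simp add: vs_def)
  qed
  show "D x = 0" unfolding D_split using 1 2 by simp
qed

section \<open>The double complex and the bar complex\<close>

definition bar_cells :: "nat \<Rightarrow> cell set" where "bar_cells i = CL 0 (Suc (Suc i))"

text \<open>The extra degeneracy of the bar construction, which contracts every column of positive
  index.\<close>

definition bar_homotopy :: "cell \<Rightarrow> (cell \<Rightarrow>\<^sub>0 'k)" where
  "bar_homotopy x = (case x of (p, t, l) \<Rightarrow> if p = 0 then 0 else scp ((-1) ^ p) (tg p t (dw (idt (rr t) # l))))"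

lemma bar_homotopy_tg: "lext bar_homotopy (tg (Suc p) t w) = scp ((-1) ^ Suc p) (tg (Suc p) t (cn (idt (rr t)) w))"
proof -
  have "lext bar_homotopy (tg (Suc p) t w) = lext (\<lambda>l. scp ((-1) ^ Suc p) (tg (Suc p) t (dw (idt (rr t) # l)))) w"
    by (simp add: tg_def lext_lext bar_homotopy_def)
  also have "\<dots> = scp ((-1) ^ Suc p) (tg (Suc p) t (cn (idt (rr t)) w))"
    by (simp only: lext_scpf tg_def lext_lext)
  finally show ?thesis .
qed

lemma rr_bounds: "tag_ok p t \<Longrightarrow> 1 \<le> rr t \<and> rr t \<le> n \<and> 1 \<le> ss t \<and> ss t \<le> n"
  using ar_bounds[of t] by (auto simp: tag_ok_def split: if_splits)

lemma bar_homotopy_CL: "x \<in> CL (Suc p) m \<Longrightarrow> bar_homotopy x \<in> vs (CL (Suc p) (Suc m))"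
proof -
  assume "x \<in> CL (Suc p) m"
  then obtain t l where x: "x = (Suc p, t, l)" "tag_ok p t" "l \<in> path_words (rr t) (ss t) m" by (auto simp: CL_def)
  have "dw (idt (rr t) # l) \<in> vs (path_words (rr t) (ss t) (Suc m))"
    by (rule dw_vs) (use x rr_bounds[OF x(2)] in \<open>auto simp: path_words_def AL_def al_idt\<close>)
  then show ?thesis using x by (auto simp: bar_homotopy_def intro!: vs_intros tg_CL)
qed

text \<open>For the vertical differential the contraction of a positive column is exact; the
  horizontal differential adds only terms one column further left, so the column index serves as the
  rank.\<close>

theorem bar_quasi_iso: "qdim scp (cycles bar_cells D i) (boundaries bar_cells D i) d \<longleftrightarrow> qdim scp (cycles XG D i) (boundaries XG D i) d"
proof (rule morse_subcomplex[where h = bar_homotopy and rk = fst])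
  fix i x assume x: "x \<in> XG i" "x \<notin> bar_cells i"
  then obtain p m where pm: "p + m = Suc (Suc i)" "0 < m" "x \<in> CL p m" by (auto elim: XG_E)
  then obtain q where q: "p = Suc q" using x(2) by (cases p) (auto simp: bar_cells_def)
  then obtain t l where tl: "x = (Suc q, t, l)" "tag_ok q t" "l \<in> path_words (rr t) (ss t) m"
    using pm(3) by (auto simp: CL_def)
  show "bar_homotopy x \<in> vs (XG (Suc i))"
    using bar_homotopy_CL[OF pm(3)[unfolded q]] by (rule vs_mono[rotated]) (use CL_XG[of p "Suc m" "Suc i"] pm q in auto)
  let ?e = "idt (rr t)" and ?s = "scp ((-1) ^ Suc q) :: (cell \<Rightarrow>\<^sub>0 'k) \<Rightarrow> _"
  have l: "l \<noteq> []" "Oz \<notin> set l" "mu ?e (hd l) = hd l" using tl(3) by (auto simp: path_words_def AL_def)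
  have al_e: "al ?e" using rr_bounds[OF tl(2)] by (simp add: al_idt)
  then have el: "dw (?e # l) = sg (?e # l)" "dw l = sg l" using l al_neq_O by (auto simp: dw_def)
  have ss: "?s (?s z) = z" for z by (simp flip: power_add mult_2)
  have hx: "bar_homotopy x = ?s (tg (Suc q) t (sg (?e # l)))" by (simp add: bar_homotopy_def tl(1) el)
  have bpe: "bprime (?e # l) = sg l - cn ?e (bprime l)" using l el by (simp add: bprime_Cons)
  have 1: "lext D (bar_homotopy x) = sg x - tg (Suc q) t (cn ?e (bprime l)) + ?s (dh q t (sg (?e # l)))"
  proof -
    have "lext D (bar_homotopy x) = ?s (?s (tg (Suc q) t (bprime (?e # l))) + dh q t (sg (?e # l)))"
      by (simp only: hx lext_lin lext_D_Suc lext_sg)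
    then show ?thesis by (simp only: pmv.scale_right_distrib ss bpe tg_lin tg_sg) (simp add: tl(1))
  qed
  have 2: "lext bar_homotopy (D x) = tg (Suc q) t (cn ?e (bprime l)) + lext bar_homotopy (hdiff x)"
  proof -
    have "lext bar_homotopy (D x) = ?s (lext bar_homotopy (tg (Suc q) t (bprime l))) + lext bar_homotopy (hdiff x)"
      by (simp only: tl(1) D.simps lext_lin hdiff_def) simp
    then show ?thesis by (simp only: bar_homotopy_tg ss)
  qed
  let ?R = "?s (dh q t (sg (?e # l))) + lext bar_homotopy (hdiff x)"
  have eq: "lext D (bar_homotopy x) + lext bar_homotopy (D x) = sg x + ?R" unfolding 1 2 by simp
  have R1: "dh q t (sg (?e # l)) \<in> vs (CL q (Suc m))"
    by (rule dh_vs[OF tl(2)]) (use tl(3) al_e in \<open>auto simp: path_words_def AL_def\<close>)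
  have R2: "lext bar_homotopy (hdiff x) \<in> vs (CL q (Suc m))"
  proof (rule lext_vs[OF hdiff_CL[OF pm(3)[unfolded q]]])
    fix y assume "y \<in> CL q m"
    then show "bar_homotopy y \<in> vs (CL q (Suc m))"
    proof (cases q)
      case 0
      then show ?thesis using \<open>y \<in> CL q m\<close> by (auto simp: bar_homotopy_def CL_def vs_intros)
    next
      case (Suc q')
      then show ?thesis using \<open>y \<in> CL q m\<close> bar_homotopy_CL by simp
    qed
  qed
  have R: "?R \<in> vs (CL q (Suc m))" using R1 R2 by (intro vs_intros)
  show "\<exists>w\<in>vs (bar_cells i). \<exists>u\<in>vs {y \<in> XG i. fst y < fst x}. lext D (bar_homotopy x) + lext bar_homotopy (D x) = sg x + w + u"
  proof (cases q)
    case 0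
    \<comment> \<open>From column one the remainder falls into the bar column, so it counts as the
      part in the subcomplex.\<close>
    have "?R \<in> vs (bar_cells i)" using R pm q by (simp add: bar_cells_def 0)
    moreover have "lext D (bar_homotopy x) + lext bar_homotopy (D x) = sg x + ?R + 0" using eq by simp
    moreover have "0 \<in> vs {y \<in> XG i. fst y < fst x}" by (simp add: vs_intros)
    ultimately show ?thesis by blast
  next
    case (Suc q')
    have "CL q (Suc m) \<subseteq> {y \<in> XG i. fst y < fst x}"
      using CL_XG[of q "Suc m" i] pm q by (auto simp: tl(1)) (auto simp: CL_def split: if_splits)
    then have "?R \<in> vs {y \<in> XG i. fst y < fst x}" using R vs_mono by blast
    moreover have "lext D (bar_homotopy x) + lext bar_homotopy (D x) = sg x + 0 + ?R" using eq by simp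
    moreover have "0 \<in> vs (bar_cells i)" by (simp add: vs_intros)
    ultimately show ?thesis by blast
  qed
next
  show "bar_homotopy x = 0" if "x \<in> bar_cells i" for i x using that by (auto simp: bar_cells_def CL_def bar_homotopy_def)
  show "bar_cells i \<subseteq> XG i" for i using CL_XG[of 0 "Suc (Suc i)" i] by (auto simp: bar_cells_def)
  show "D x \<in> vs (bar_cells i)" if "x \<in> bar_cells (Suc i)" for i x
    using that vdiff_CL[of x 0 "Suc (Suc (Suc i))"] hdiff_CL0 by (simp add: bar_cells_def D_split)
  show "D x = 0" if "x \<in> bar_cells 0" for x
    using D_XG0 CL_XG[of 0 "Suc (Suc 0)" 0] that by (simp add: bar_cells_def)
qed (rule D_D)

section \<open>The double complex and the small complex\<close>

lemma al_evD: "al (i, j, d) \<Longrightarrow> even (i + j + d) \<Longrightarrow> 1 \<le> i \<and> i \<le> n \<and> 1 \<le> j \<and> j \<le> n \<and> i \<le> j + d \<and> j \<le> i + d \<and> d + i + j \<le> 2 * n"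
  unfolding al_simps by metis
lemma al_odD: "al (i, j, d) \<Longrightarrow> odd (i + j + d) \<Longrightarrow> 1 \<le> i \<and> i \<le> n \<and> 1 \<le> j \<and> j \<le> n \<and> i + j \<le> d + 1 \<and> d + 1 + i \<le> 2 * n + j \<and> d + 1 + j \<le> 2 * n + i"
  unfolding al_simps by metis
lemma al_evI: "even (i + j + d) \<Longrightarrow> 1 \<le> i \<Longrightarrow> i \<le> n \<Longrightarrow> 1 \<le> j \<Longrightarrow> j \<le> n \<Longrightarrow> i \<le> j + d \<Longrightarrow> j \<le> i + d \<Longrightarrow> d + i + j \<le> 2 * n \<Longrightarrow> al (i, j, d)"
  unfolding al_simps by metis
lemma al_odI: "odd (i + j + d) \<Longrightarrow> 1 \<le> i \<Longrightarrow> i \<le> n \<Longrightarrow> 1 \<le> j \<Longrightarrow> j \<le> n \<Longrightarrow> i + j \<le> d + 1 \<Longrightarrow> d + 1 + i \<le> 2 * n + j \<Longrightarrow> d + 1 + j \<le> 2 * n + i \<Longrightarrow> al (i, j, d)"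
  unfolding al_simps by metis

text \<open>A basis element of positive degree starts with an arrow. The canonical choice is
  \<open>TL\<close>; if removing it leaves no basis element, the end point lies too far up and
  \<open>TU\<close> serves.\<close>

lemma al_first_arrow:
  assumes "al (i, j, d)" "0 < d" "\<not> al (rr (TL i), j, d - 1)"
  shows "i < n \<and> al (Suc i, j, d - 1)"
proof -
  obtain e where e: "d = Suc e" using assms(2) by (cases d) auto
  have p: "even (Suc i + j + e) = even (i + j + Suc e)" by simp
  show ?thesis
  proof (cases "i = 1")
    case True
    have r: "\<not> al (i, j, e)" using assms(3) True by (simp add: e)
    show ?thesis
    proof (cases "even (i + j + Suc e)")
      case ev: True
      note H = al_evD[OF assms(1)[unfolded e] ev]
      have p: "odd (i + j + e)" "even (Suc i + j + e)" using ev by presburger+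
      have nb: "\<not> j \<le> e"
      proof
        assume "j \<le> e"
        then have "al (i, j, e)" using H True by (intro al_odI p) linarith+
        then show False using r by blast
      qed
      then have j2: "j = e + 2" using ev H True by presburger
      have "i < n" using H j2 True by linarith
      moreover have "al (Suc i, j, e)" using H j2 True by (intro al_evI p) linarith+
      ultimately show ?thesis by (simp add: e)
    next
      case od: False
      note H = al_odD[OF assms(1)[unfolded e] od]
      have p: "even (i + j + e)" using od by presburger
      have "al (i, j, e)" using H True by (intro al_evI p) linarith+
      then show ?thesis using r by blast
    qed
  next
    case False
    then obtain u where u: "i = Suc (Suc u)" using al_bounds[OF assms(1)] by (cases i; cases "i - 1") auto
    have r: "\<not> al (Suc u, j, e)" using assms(3) by (simp add: u e)
    show ?thesis
    proof (cases "even (i + j + Suc e)")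
      case ev: True
      note H = al_evD[OF assms(1)[unfolded e] ev]
      have p: "even (Suc u + j + e)" "even (Suc i + j + e)" using ev u by presburger+
      have nb: "\<not> j \<le> Suc u + e"
      proof
        assume "j \<le> Suc u + e"
        then have "al (Suc u, j, e)" using H u by (intro al_evI p) linarith+
        then show False using r by blast
      qed
      then have j3: "u + 3 + e \<le> j" using ev u by presburger
      have "i < n" using H j3 u by linarith
      moreover have "al (Suc i, j, e)" using H j3 u by (intro al_evI p) linarith+
      ultimately show ?thesis by (simp add: e)
    next
      case od: False
      note H = al_odD[OF assms(1)[unfolded e] od]
      have p: "odd (Suc u + j + e)" using od u by presburger
      have "al (Suc u, j, e)" using H u by (intro al_odI p) linarith+
      then show ?thesis using r by blast
    qed
  qed
qed

text \<open>Together with \<open>al_square'\<close> and \<open>al_prolong\<close> this is exactness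
  of the resolution on leading terms: if (i,j,d) is a basis element and d is not 2n - 1, then the
  neighbours of i (i itself through the loop if i = 1) that give a basis element ending in j in
  degree d + 1 are two if (i,j,d+2) is a basis element and one otherwise.\<close>

lemma al_square:
  assumes "i < n" "al (i, j, d)" "al (rr (TL i), j, Suc d)" "al (Suc i, j, Suc d)"
  shows "al (i, j, Suc (Suc d))"
proof -
  have p: "even (Suc i + j + Suc d) = even (i + j + d)" "even (i + j + Suc (Suc d)) = even (i + j + d)" by simp_all
  show ?thesis
  proof (cases "i = 1")
    case True
    have r: "rr (TL i) = i" using True by simp
    have p1: "even (i + j + Suc d) = (\<not> even (i + j + d))" by simp
    show ?thesis using assms True unfolding r al_simps p p1
      by (cases "even (i + j + d)"; simp only: if_True if_False simp_thms; auto; presburger)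
  next
    case False
    then obtain u where u: "i = Suc (Suc u)" using al_bounds[OF assms(2)] by (cases i; cases "i - 1") auto
    have r: "al (Suc u, j, Suc d)" using assms(3) by (simp add: u)
    show ?thesis
    proof (cases "even (i + j + d)")
      case ev: True
      have q: "even (Suc i + j + Suc d)" "even (Suc u + j + Suc d)" "even (i + j + Suc (Suc d))" using ev u by presburger+
      show ?thesis using al_evD[OF assms(4) q(1)] al_evD[OF assms(2) ev] by (intro al_evI q) linarith+
    next
      case od: False
      have q: "odd (Suc i + j + Suc d)" "odd (Suc u + j + Suc d)" "odd (i + j + Suc (Suc d))" using od u by presburger+
      show ?thesis using al_odD[OF assms(4) q(1)] al_odD[OF r q(2)] al_odD[OF assms(2) od] u by (intro al_odI q) linarith+
    qed
  qed
qed

lemma al_square':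
  assumes "al (i, j, d)" "al (i, j, Suc (Suc d))"
  shows "i < n \<and> al (rr (TL i), j, Suc d) \<and> al (Suc i, j, Suc d)"
proof -
  have p: "even (Suc i + j + Suc d) = even (i + j + d)" "even (i + j + Suc (Suc d)) = even (i + j + d)" by simp_all
  show ?thesis
  proof (cases "i = 1")
    case True
    have r: "rr (TL i) = i" using True by simp
    have p1: "even (i + j + Suc d) = (\<not> even (i + j + d))" by simp
    show ?thesis using assms True unfolding r al_simps p p1
      by (cases "even (i + j + d)"; simp only: if_True if_False simp_thms; auto; presburger)
  next
    case False
    then obtain u where u: "i = Suc (Suc u)" using al_bounds[OF assms(1)] by (cases i; cases "i - 1") auto
    have r: "rr (TL i) = Suc u" by (simp add: u)
    show ?thesis
    proof (cases "even (i + j + d)")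
      case ev: True
      have q: "even (Suc i + j + Suc d)" "even (Suc u + j + Suc d)" "even (i + j + Suc (Suc d))" using ev u by presburger+
      note H = al_evD[OF assms(2) q(3)] al_evD[OF assms(1) ev]
      have "i < n" using H by linarith
      moreover have "al (Suc i, j, Suc d)" using H by (intro al_evI q) linarith+
      moreover have "al (Suc u, j, Suc d)" using H u by (intro al_evI q) linarith+
      ultimately show ?thesis unfolding r by blast
    next
      case od: False
      have q: "odd (Suc i + j + Suc d)" "odd (Suc u + j + Suc d)" "odd (i + j + Suc (Suc d))" using od u by presburger+
      note H = al_odD[OF assms(2) q(3)] al_odD[OF assms(1) od]
      have "i < n" using H by linarith
      moreover have "al (Suc i, j, Suc d)" using H by (intro al_odI q) linarith+
      moreover have "al (Suc u, j, Suc d)" using H u by (intro al_odI q) linarith+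
      ultimately show ?thesis unfolding r by blast
    qed
  qed
qed

text \<open>Only the socle is killed by every arrow on the left. The lower neighbour works unless
  the upper bound on the degree is already attained, and then the upper one does.\<close>

lemma al_prolong:
  assumes "al (i, j, d)" "d \<noteq> 2 * n - 1"
  shows "al (rr (TL i), j, Suc d) \<or> (i < n \<and> al (Suc i, j, Suc d))"
proof -
  have p: "even (Suc i + j + Suc d) = even (i + j + d)" by simp
  show ?thesis
  proof (cases "i = 1")
    case True
    have r: "rr (TL i) = i" using True by simp
    show ?thesis
    proof (cases "even (i + j + d)")
      case ev: True
      note H = al_evD[OF assms(1) ev]
      have p: "odd (i + j + Suc d)" using ev by presburger
      have "al (i, j, Suc d)" using H True by (intro al_odI p) linarith+
      then show ?thesis unfolding r by blast
    next
      case od: False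
      note H = al_odD[OF assms(1) od]
      have p: "even (i + j + Suc d)" "odd (Suc i + j + Suc d)" using od by presburger+
      show ?thesis
      proof (cases "d + 2 + j \<le> 2 * n")
        case le: True
        have "al (i, j, Suc d)" using H True le by (intro al_evI p) linarith+
        then show ?thesis unfolding r by blast
      next
        case False
        then have D: "d + j = 2 * n" using H od True by presburger
        have "j \<noteq> 1" using D assms(2) by auto
        then have j: "2 \<le> j" using H by linarith
        have "i < n" using j H True by linarith
        moreover have "al (Suc i, j, Suc d)" using H D j True by (intro al_odI p) linarith+
        ultimately show ?thesis by blast
      qed
    qed
  next
    case False
    then obtain u where u: "i = Suc (Suc u)" using al_bounds[OF assms(1)] by (cases i; cases "i - 1") auto
    have r: "rr (TL i) = Suc u" by (simp add: u)
    show ?thesis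
    proof (cases "even (i + j + d)")
      case ev: True
      note H = al_evD[OF assms(1) ev]
      have p: "even (Suc u + j + Suc d)" using ev u by presburger
      have "al (Suc u, j, Suc d)" using H u by (intro al_evI p) linarith+
      then show ?thesis by (simp add: u)
    next
      case od: False
      note H = al_odD[OF assms(1) od]
      have p: "odd (Suc u + j + Suc d)" "odd (Suc i + j + Suc d)" using od u by presburger+
      show ?thesis
      proof (cases "d + 3 + j \<le> 2 * n + i")
        case True
        have "al (Suc u, j, Suc d)" using H u True by (intro al_odI p) linarith+
        then show ?thesis by (simp add: u)
      next
        case False
        then have D: "d + 1 + j = 2 * n + i" using H od by presburger
        have "i \<noteq> j" using D assms(2) by auto
        then have ij: "i < j" using D H by linarith
        have "i < n" using ij H by linarith
        moreover have "al (Suc i, j, Suc d)" using H D ij by (intro al_odI p) linarith+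
        ultimately show ?thesis by blast
      qed
    qed
  qed
qed

lemma al_top: "al (i, j, 2 * n - 1) \<Longrightarrow> i = j"
proof -
  assume a: "al (i, j, 2 * n - 1)"
  define D where "D = 2 * n - 1"
  have D: "Suc D = 2 * n" using n1 by (simp add: D_def)
  show "i = j" using a D unfolding al_simps D_def[symmetric]
    by (cases "even (i + j + D)"; simp only: if_True if_False simp_thms; linarith?)
       (presburger?)
qed

lemma al_bottom: "al (i, j, 0) \<Longrightarrow> i = j"
  by (auto simp: al_simps split: if_splits)

text \<open>The pairs of an arrow c and a following y that are not the chosen first-arrow
  factorization of cy, either because cy is zero or because \<open>hc\<close> splits off
  \<open>TL\<close> instead. These have to be matched with the next degree of the
  resolution.\<close>

definition noncanonical :: "tag \<Rightarrow> tri \<Rightarrow> bool" where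
  "noncanonical c y = (case y of (i, j, d) \<Rightarrow> \<not> al (ss c, j, Suc d) \<or> (c = TU (ss c) \<and> al (rr (TL (ss c)), j, d)))"

text \<open>For a noncanonical pair y itself starts with the reverse of c, so the cell that
  \<open>hc\<close> assigns exists.\<close>

lemma noncanonical_al:
  assumes "ar c" "al (rr c, j, d)" "noncanonical c (rr c, j, d)"
  shows "0 < d \<and> al (ss c, j, d - 1)"
proof -
  have *: "0 < d \<and> al (v, j, d - 1)" if v: "1 \<le> v" "v \<le> n" and a: "v < n \<and> al (Suc v, j, d) \<and> (\<not> al (v, j, Suc d) \<or> al (rr (TL v), j, d))
     \<or> al (rr (TL v), j, d) \<and> \<not> al (v, j, Suc d)" for v
  proof (cases d)
    case 0
    have TU1: "al (v, Suc v, Suc 0)" if "v < n" using ar_el[of "TU v"] that v by simp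
    have TL1: "al (v, rr (TL v), Suc 0)" using ar_el[of "TL v"] v by simp
    have ne: "rr (TL v) \<noteq> Suc v" using v by auto
    from a consider "v < n" "al (Suc v, j, 0)" "\<not> al (v, j, Suc 0) \<or> al (rr (TL v), j, 0)"
      | "al (rr (TL v), j, 0)" "\<not> al (v, j, Suc 0)"
      unfolding 0 by blast
    then have False
    proof cases
      case 1
      then have "j = Suc v" using al_bottom by metis
      then show ?thesis using 1 TU1 ne al_bottom by metis
    next
      case 2
      then have "j = rr (TL v)" using al_bottom by metis
      then show ?thesis using 2 TL1 by metis
    qed
    then show ?thesis ..
  next
    case (Suc e)
    have p: "even (Suc v + j + Suc e) = even (v + j + e)" "even (v + j + Suc (Suc e)) = even (v + j + e)" by simp_all
    show ?thesis
    \<comment> \<open>At v = 1 the lower neighbour is v itself, reached by the loop, which changes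
      the parity.\<close>
    proof (cases "v = 1")
      case True
      have r: "rr (TL v) = v" using True by simp
      consider "v < n" "al (Suc v, j, Suc e)" "\<not> al (v, j, Suc (Suc e))"
        | "al (Suc v, j, Suc e)" "al (v, j, Suc e)"
        | "al (v, j, Suc e)" "\<not> al (v, j, Suc (Suc e))"
        using a unfolding r Suc by blast
      then have "al (v, j, e)"
      proof cases
        case 1
        show ?thesis
        proof (cases "even (v + j + e)")
          case ev: True
          have q: "even (Suc v + j + Suc e)" "even (v + j + Suc (Suc e))" using ev by presburger+
          note H = al_evD[OF 1(2) q(1)]
          have "al (v, j, Suc (Suc e))" using H v by (intro al_evI q) linarith+
          then show ?thesis using 1 by blast
        next
          case od: False
          have q: "odd (Suc v + j + Suc e)" using od by presburger
          note H = al_odD[OF 1(2) q]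
          show ?thesis using H v True by (intro al_odI od) linarith+
        qed
      next
        case 2
        show ?thesis
        proof (cases "even (v + j + e)")
          case ev: True
          have q: "even (Suc v + j + Suc e)" "odd (v + j + Suc e)" using ev by presburger+
          show ?thesis using al_evD[OF 2(1) q(1)] al_odD[OF 2(2) q(2)] True by (intro al_evI ev) linarith+
        next
          case od: False
          have q: "odd (Suc v + j + Suc e)" "even (v + j + Suc e)" using od by presburger+
          show ?thesis using al_odD[OF 2(1) q(1)] al_evD[OF 2(2) q(2)] True by (intro al_odI od) linarith+
        qed
      next
        case 3
        show ?thesis
        proof (cases "even (v + j + e)")
          case ev: True
          have q: "odd (v + j + Suc e)" using ev by presburger
          show ?thesis using al_odD[OF 3(1) q] v True by (intro al_evI ev) linarith+
        next
          case od: False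
          have q: "even (v + j + Suc e)" "odd (v + j + Suc (Suc e))" using od by presburger+
          note H = al_evD[OF 3(1) q(1)]
          have "\<not> e + 3 + v \<le> 2 * n + j"
          proof
            assume "e + 3 + v \<le> 2 * n + j"
            then have "al (v, j, Suc (Suc e))" using H v True by (intro al_odI q) linarith+
            then show False using 3 by blast
          qed
          then have False using H True by linarith
          then show ?thesis ..
        qed
      qed
      then show ?thesis by (simp add: Suc)
    next
      case False
      then obtain u where u: "v = Suc (Suc u)" using v by (cases v; cases "v - 1") auto
      have r: "rr (TL v) = Suc u" by (simp add: u)
      consider "v < n" "al (Suc v, j, Suc e)" "\<not> al (v, j, Suc (Suc e))"
        | "al (Suc v, j, Suc e)" "al (Suc u, j, Suc e)"
        | "al (Suc u, j, Suc e)" "\<not> al (v, j, Suc (Suc e))"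
        using a unfolding r Suc by blast
      then have "al (v, j, e)"
      proof cases
        case 1
        show ?thesis
        proof (cases "even (v + j + e)")
          case ev: True
          have q: "even (Suc v + j + Suc e)" "even (v + j + Suc (Suc e))" using ev by presburger+
          note H = al_evD[OF 1(2) q(1)]
          have "al (v, j, Suc (Suc e))" using H v by (intro al_evI q) linarith+
          then show ?thesis using 1 by blast
        next
          case od: False
          have q: "odd (Suc v + j + Suc e)" "odd (v + j + Suc (Suc e))" using od by presburger+
          note H = al_odD[OF 1(2) q(1)]
          have "\<not> e + 3 + j \<le> 2 * n + v"
          proof
            assume "e + 3 + j \<le> 2 * n + v"
            then have "al (v, j, Suc (Suc e))" using H v by (intro al_odI q) linarith+
            then show False using 1 by blast
          qed
          then show ?thesis using H v od by (intro al_odI od) linarith+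
        qed
      next
        case 2
        show ?thesis
        proof (cases "even (v + j + e)")
          case ev: True
          have q: "even (Suc v + j + Suc e)" "even (Suc u + j + Suc e)" using ev u by presburger+
          show ?thesis using al_evD[OF 2(1) q(1)] al_evD[OF 2(2) q(2)] u by (intro al_evI ev) linarith+
        next
          case od: False
          have q: "odd (Suc v + j + Suc e)" "odd (Suc u + j + Suc e)" using od u by presburger+
          show ?thesis using al_odD[OF 2(1) q(1)] al_odD[OF 2(2) q(2)] u by (intro al_odI od) linarith+
        qed
      next
        case 3
        show ?thesis
        proof (cases "even (v + j + e)")
          case ev: True
          have q: "even (Suc u + j + Suc e)" "even (v + j + Suc (Suc e))" using ev u by presburger+
          note H = al_evD[OF 3(1) q(1)]
          have "\<not> e + 2 + v + j \<le> 2 * n"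
          proof
            assume "e + 2 + v + j \<le> 2 * n"
            then have "al (v, j, Suc (Suc e))" using H v u by (intro al_evI q) linarith+
            then show False using 3 by blast
          qed
          moreover have "e + v + j \<le> 2 * n" using H u by linarith
          ultimately have "e + v + j = 2 * n" using ev by presburger
          then show ?thesis using H v u by (intro al_evI ev) linarith+
        next
          case od: False
          have q: "odd (Suc u + j + Suc e)" "odd (v + j + Suc (Suc e))" using od u by presburger+
          note H = al_odD[OF 3(1) q(1)]
          have "\<not> e + 3 + v \<le> 2 * n + j"
          proof
            assume "e + 3 + v \<le> 2 * n + j"
            then have "al (v, j, Suc (Suc e))" using H v u by (intro al_odI q) linarith+
            then show False using 3 by blast
          qed
          moreover have "e + 1 + v \<le> 2 * n + j" using H u by linarith
          ultimately have "e + 1 + v = 2 * n + j" using od by presburger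
          then show ?thesis using H v u by (intro al_odI od) linarith+
        qed
      qed
      then show ?thesis by (simp add: Suc)
    qed
  qed
  show ?thesis
  proof (cases c)
    case (TL v)
    show ?thesis using *[of v] assms by (auto simp: TL noncanonical_def)
  next
    case (TU v)
    show ?thesis using *[of v] assms by (auto simp: TU noncanonical_def)
  qed (use assms in auto)
qed

text \<open>The leading terms of a contraction of the bimodule resolution: a generator times y is
  sent to a generator in the next degree times a shorter y, and (in degrees divisible by 3) the socle of the
  resolution in one period is the top of the next.\<close>

definition hc :: "nat \<Rightarrow> tag \<Rightarrow> tri \<Rightarrow> ('k \<times> tag \<times> tri) option" where
  "hc q t y = (case y of (i, j, d) \<Rightarrow>
     if q mod 3 = 0 then (if d = 0 then None
        else if al (rr (TL i), j, d - 1) then Some (- (theta (el (TL i)) ^ (q div 3)), TL i, (rr (TL i), j, d - 1))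
        else Some (- (theta (el (TU i)) ^ (q div 3)), TU i, (Suc i, j, d - 1)))
     else if q mod 3 = 1 then (if noncanonical t y then Some (mc t * theta (el t) ^ (q div 3), Tv (ss t), (ss t, j, d - 1)) else None)
     else (if d = 2 * n - 1 then Some (1, Tv i, idt i) else None))"

lemma hc_ok:
  assumes "tag_ok q t" "al y" "src y = rr t" "hc q t y = Some (a, t', y')"
  shows "al y' \<and> tag_ok (Suc q) t' \<and> src y' = rr t' \<and> ss t' = ss t \<and> (deg y' = 0 \<or> deg y' < deg y) \<and>
    (q mod 3 \<noteq> 2 \<longrightarrow> deg y' < deg y)"
proof -
  obtain i j d where y: "y = (i, j, d)" by (cases y)
  have b: "1 \<le> i" "i \<le> n" using assms(2) y al_bounds by auto
  have m: "Suc q mod 3 = (if q mod 3 = 2 then 0 else Suc (q mod 3))" by (simp add: mod_Suc)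
  have q: "q mod 3 = 0 \<or> q mod 3 = 1 \<or> q mod 3 = 2" by presburger
  then show ?thesis
  proof (elim disjE)
    assume q: "q mod 3 = 0"
    then obtain v where t: "t = Tv v" using assms(1) by (auto simp: tag_ok_def)
    have iv: "i = v" using assms(3) y t by simp
    show ?thesis
    proof (cases "al (rr (TL i), j, d - 1)")
      case True
      then have "t' = TL i" "y' = (rr (TL i), j, d - 1)" "0 < d"
        using assms(4) q unfolding hc_def y by (auto split: if_splits)
      then show ?thesis using True b by (auto simp: y t iv tag_ok_def m q)
    next
      case False
      then have *: "t' = TU i" "y' = (Suc i, j, d - 1)" "0 < d"
        using assms(4) q unfolding hc_def y by (auto split: if_splits)
      then show ?thesis using al_first_arrow[of i j d] False assms(2) b by (auto simp: y t iv tag_ok_def m q)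
    qed
  next
    assume q: "q mod 3 = 1"
    then have t: "ar t" using assms(1) by (auto simp: tag_ok_def)
    have ir: "i = rr t" using assms(3) y by simp
    have *: "noncanonical t y" "t' = Tv (ss t)" "y' = (ss t, j, d - 1)"
      using assms(4) q unfolding hc_def y by (auto split: if_splits)
    then show ?thesis using noncanonical_al[OF t, of j d] assms(2) ar_bounds[OF t] by (auto simp: y ir tag_ok_def m q)
  next
    assume q: "q mod 3 = 2"
    then obtain v where t: "t = Tv v" using assms(1) by (auto simp: tag_ok_def)
    have *: "t' = Tv i" "y' = idt i"
      using assms(4) q unfolding hc_def y by (auto split: if_splits)
    then show ?thesis using assms(3) al_idt b by (auto simp: y t tag_ok_def m q)
  qed
qed

text \<open>A cyclic word is opened at its first letter, which moves behind the others while an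
  idempotent takes its place; \<open>co\<close> undoes this. In positive columns only the generator
  and the first letter change, as in a contraction of one-sided modules, and the words of length
  one, the small complex, are sent to 0.\<close>

definition res_homotopy :: "cell \<Rightarrow> (cell \<Rightarrow>\<^sub>0 'k)" where
  "res_homotopy x = (case x of (p, t, l) \<Rightarrow>
     if p = 0 then (if l = [] then 0 else sg (1, Tv (tgt (hd l)), idt (tgt (hd l)) # tl l @ [hd l]))
     else if length l \<le> 1 then 0
     else (case hc (p - 1) t (hd l) of None \<Rightarrow> 0 | Some (a, t', y') \<Rightarrow> scp a (sg (Suc p, t', y' # tl l))))"

definition hval :: "nat \<Rightarrow> tag \<Rightarrow> tri \<Rightarrow> (tri list \<Rightarrow>\<^sub>0 'k) \<Rightarrow> (cell \<Rightarrow>\<^sub>0 'k)" where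
  "hval q t y z = (case hc q t y of None \<Rightarrow> 0 | Some (a, t', y') \<Rightarrow> scp a (tg (Suc (Suc q)) t' (cn y' z)))"

abbreviation WN :: "tri list set" where "WN \<equiv> {l. l \<noteq> []}"

lemma tg_cn: "tg p t (cn y z) = lext (\<lambda>w. tg p t (dw (y # w))) z"
  by (simp add: tg_def lext_lext)

lemma res_homotopy_cn:
  assumes "tag_ok q t" "al y" "src y = rr t" "z \<in> vs WN"
  shows "lext res_homotopy (tg (Suc q) t (cn y z)) = hval q t y z"
proof -
  have y: "y \<noteq> Oz" using assms(2) al_neq_O by blast
  have "lext res_homotopy (tg (Suc q) t (cn y z)) = lext (\<lambda>w. hval q t y (sg w)) z"
    unfolding tg_cn lext_lext
  proof (rule lext_cong)
    fix w assume "w \<in> keys z"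
    then have w: "w \<noteq> []" using assms(4) by (auto simp: vs_def)
    have y': "y' \<noteq> Oz" if "hc q t y = Some (a, t', y')" for a t' y'
      using hc_ok[OF assms(1-3) that] al_neq_O by blast
    show "lext res_homotopy (tg (Suc q) t (dw (y # w))) = hval q t y (sg w)"
      using y w y'
      by (cases "hc q t y"; cases "Oz \<in> set w") (auto simp: dw_def hval_def res_homotopy_def tg_lin Suc_le_eq)
  qed
  also have "\<dots> = hval q t y z"
  proof (cases "hc q t y")
    case (Some p)
    then show ?thesis by (cases p) (simp add: hval_def tg_cn lext_linf)
  qed (simp add: hval_def)
  finally show ?thesis .
qed

lemma HM_cn: "HM c (cn y z) = cn (mu c y) z"
  by (simp add: lext_lext hm_Cons)

lemma LM_cn: "z \<in> vs WN \<Longrightarrow> LM c (cn y z) = cn y (LM c z)"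
  unfolding lext_lext
proof (rule lext_cong)
  fix w assume "z \<in> vs WN" "w \<in> keys z"
  then have "w \<noteq> []" by (auto simp: vs_def)
  then show "LM c (dw (y # w)) = cn y (lm c w)"
    by (simp add: lm_def)
qed

lemma LM_WN: "z \<in> vs WN \<Longrightarrow> LM c z \<in> vs WN"
  by (rule lext_vs) (auto simp: lm_def intro: dw_vs)

text \<open>The admissible error terms: within a row the rank is the degree of the first
  letter.\<close>

definition LD :: "nat \<Rightarrow> cell set" where
  "LD d = {(p, t, l) | p t l. 0 < p \<and> l \<noteq> [] \<and> deg (hd l) < d}"

lemma tg_LD: "deg y < d \<Longrightarrow> tg (Suc p) t (cn y z) \<in> vs (LD d)"
  unfolding tg_cn
proof (rule lext_mem[OF subspace_vs])
  fix w assume "deg y < d"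
  then show "tg (Suc p) t (dw (y # w)) \<in> vs (LD d)"
    by (auto simp: dw_def tg_lin vs_intros LD_def)
qed

lemma hval_LD:
  assumes "tag_ok q t" "al y" "src y = rr t" "0 < d" "deg y \<le> d \<or> q mod 3 = 2 \<and> deg y \<noteq> 2 * n - 1 \<or> q mod 3 = 2 \<and> 0 < d"
  shows "hval q t y z \<in> vs (LD d)"
proof (cases "hc q t y")
  case (Some p)
  obtain a t' y' where p: "p = (a, t', y')" by (cases p)
  note h = hc_ok[OF assms(1-3) Some[unfolded p]]
  have q: "deg y' = 0" if "q mod 3 = 2"
    using that Some[unfolded p] by (cases y) (auto simp: hc_def split: if_splits)
  have "deg y' < d" using h q assms(4,5) by auto
  then show ?thesis using tg_LD[of y' d "Suc q" t' z] by (auto simp: hval_def Some p intro!: vs_intros)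
qed (simp add: hval_def vs_intros)

lemma res_homotopy_LD:
  assumes "tag_ok q t" "y = Oz \<or> al y \<and> src y = rr t" "0 < d" "y = Oz \<or> deg y \<le> d \<or> q mod 3 = 2" "z \<in> vs WN"
  shows "lext res_homotopy (tg (Suc q) t (cn y z)) \<in> vs (LD d)"
proof (cases "y = Oz")
  case True
  then show ?thesis by (simp add: tg_lin vs_intros)
next
  case False
  then have y: "al y" "src y = rr t" using assms by auto
  then show ?thesis unfolding res_homotopy_cn[OF assms(1) y assms(5)]
    using assms False by (intro hval_LD) auto
qed

lemma dh_cn_1: "ar c \<Longrightarrow> z \<in> vs WN \<Longrightarrow> dh (Suc (3 * k)) c (cn y z) = tg (Suc (3 * k)) (Tv (rr c)) (cn y (LM (el c) z))
    - scp (theta (el c) ^ k) (tg (Suc (3 * k)) (Tv (ss c)) (cn (mu (el c) y) z))"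
  by (simp add: dh_1 HM_cn LM_cn)
lemma dh_cn_2: "z \<in> vs WN \<Longrightarrow> dh (Suc (Suc (3 * k))) (Tv v) (cn y z) =
   (\<Sum>c\<in>outs v. scp (mc c) (scp (theta (el c) ^ k) (tg (Suc (Suc (3 * k))) c (cn (mu (el (rv c)) y) z))
                                                + tg (Suc (Suc (3 * k))) (rv c) (cn y (LM (el c) z))))"
  by (simp add: dh_2 HM_cn LM_cn)
lemma dh_cn_3: "z \<in> vs WN \<Longrightarrow> dh (Suc (Suc (Suc (3 * k)))) (Tv v) (cn y z) =
    (\<Sum>b\<in>bas v. scp (theta b ^ Suc k) (tg (Suc (Suc (Suc (3 * k)))) (Tv (tgt b)) (cn (mu (dual b) y) (LM b z))))"
  by (simp add: dh_3 HM_cn LM_cn)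

lemma theta_idt [simp]: "theta (idt v) = (1 :: 'k)"
  by (simp add: theta_def)

lemma mu_ok: "al b \<Longrightarrow> mu b y = Oz \<or> al (mu b y) \<and> src (mu b y) = src b"
  using al_mu[of b y] mu_neq_O[of b y] by auto

lemma bas_idt: "1 \<le> v \<Longrightarrow> v \<le> n \<Longrightarrow> idt v \<in> bas v"
  by (simp add: bas_def al_idt)

lemma deg_dual: "al b \<Longrightarrow> deg (dual b) = 2 * n - 1 - deg b" by (cases b) simp

lemma bas_deg0: "b \<in> bas v \<Longrightarrow> deg b = 0 \<Longrightarrow> b = idt v"
  by (cases b) (auto simp: bas_def dest: al_bottom)

lemma tg_cn_eq: "y \<noteq> Oz \<Longrightarrow> Oz \<notin> set w \<Longrightarrow> tg p t (cn y (sg w)) = sg (p, t, y # w)"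
  by (simp add: dw_def)

text \<open>Factors on the last letter leave the first one alone, and the homotopy then lowers its
  degree or gives 0. What remains is a computation with the first letter only, by the degree of the
  resolution mod 3.\<close>

lemma res_homotopy_loc:
  assumes t: "tag_ok q t" and yw: "y # w \<in> path_words (rr t) (ss t) m" and w: "w \<noteq> []"
  shows "lext hdiff (res_homotopy (Suc q, t, y # w)) + lext res_homotopy (hdiff (Suc q, t, y # w)) - sg (Suc q, t, y # w) \<in> vs (LD (deg y))"
proof -
  let ?x = "(Suc q, t, y # w)" and ?z = "sg w"
  have z: "?z \<in> vs WN" using w by simp
  have y: "al y" "src y = rr t" and wO: "Oz \<notin> set w" and wl: "al (last w)" "tgt (last w) = ss t"
    using yw w by (auto simp: path_words_def AL_def)
  have yO: "y \<noteq> Oz" using y al_neq_O by blast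
  have x: "tg (Suc q) t (cn y ?z) = sg ?x" using yO wO by (rule tg_cn_eq)
  have dx: "hdiff ?x = dh q t (cn y ?z)"
    using yO wO by (simp add: hdiff_def dw_def)
  have hx: "res_homotopy ?x = hval q t y ?z"
    using res_homotopy_cn[OF t y z] by (simp add: x del: lext_sg) (simp add: x)
  obtain i j d where yd: "y = (i, j, d)" by (cases y)
  have ir: "i = rr t" using y yd by simp
  have ib: "1 \<le> i" "i \<le> n" "d \<le> 2 * n - 1" using al_bounds y yd by auto
  have LMi: "LM (idt v) ?z = ?z" if "v = ss t" for v
  proof -
    have "dw (butlast w @ [mu (last w) (idt v)]) = sg w"
      using w wl that wO by (simp add: dw_def)
    then show ?thesis using w by (simp add: lm_def)
  qed
  note LMz = LM_WN[OF z]
  show ?thesis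
  proof (cases "q mod 3 = 0")
    case q: True
    define k where "k = q div 3"
    have qk: "q = 3 * k" using q unfolding k_def by presburger
    then obtain v where tv: "t = Tv v" using t by (auto simp: tag_ok_1)
    have iv: "i = v" using ir tv by simp
    have dxsum: "hdiff ?x = (\<Sum>b\<in>bas v. scp (theta b ^ k) (tg q (Tv (tgt b)) (cn (mu (dual b) y) (LM b ?z))))" if "k = Suc k'" for k'
    proof -
      have q': "q = Suc (Suc (Suc (3 * k')))" using qk that by simp
      show ?thesis unfolding dx unfolding tv q' that by (rule dh_cn_3[OF z])
    qed
    have bt: "tag_ok (Suc (Suc (3 * k'))) (Tv (tgt b))" if "b \<in> bas v" for b k'
      using that al_bounds[of "src b" "tgt b" "deg b"] by (cases b) (auto simp: bas_def tag_ok_1)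
    have ok: "mu (dual b) y' = Oz \<or> al (mu (dual b) y') \<and> src (mu (dual b) y') = rr (Tv (tgt b))" if "b \<in> bas v" for b y'
      using mu_ok[OF al_dual] that by (auto simp: bas_def)
    show ?thesis
    \<comment> \<open>An idempotent as first letter is the top of its period. The homotopy vanishes
      on it, and it is recovered from the differential: for k = 0 by closing and reopening the word,
      otherwise from the socle of the period before.\<close>
    proof (cases "d = 0")
      case d: True
      have yi: "y = idt v" using yd iv d al_bottom y by auto
      have h0: "res_homotopy ?x = 0" unfolding hx unfolding hval_def hc_def yd using q d by simp
      have "lext res_homotopy (hdiff ?x) = sg ?x"
      proof (cases k)
        case 0
        obtain w' b where wb: "w = w' @ [b]" using w by (cases w rule: rev_cases) auto
        have b: "al b" "tgt b = v" "b \<noteq> Oz" using wl wb tv al_neq_O by auto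
        have "hdiff ?x = tg 0 (Tv 0) (co (y # w))" by (simp add: hdiff_def qk 0 tv dh_0)
        also have "co (y # w) = sg (b # w')" using b wO by (simp add: wb co_ends yi dw_def)
        finally show ?thesis using b by (simp add: res_homotopy_def yi wb qk 0 tv)
      next
        case (Suc k')
        have q': "q = Suc (Suc (Suc (3 * k')))" by (simp add: qk Suc)
        \<comment> \<open>In the Casimir sum only b = \<open>idt v\<close> has its dual in the
          socle, and \<open>hc\<close> sends that socle back to an idempotent.\<close>
        have "lext res_homotopy (hdiff ?x) = (\<Sum>b\<in>bas v. if b = idt v then sg ?x else 0)"
          unfolding dxsum[OF Suc] lext_sum
        proof (rule sum.cong[OF refl])
          fix b assume b: "b \<in> bas v"
          have bb: "al b" "src b = v" using b by (auto simp: bas_def)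
          have db: "mu (dual b) y = dual b" using al_dual[OF bb(1)] bb yi by simp
          have "lext res_homotopy (tg q (Tv (tgt b)) (cn (dual b) (LM b ?z))) = hval (Suc (Suc (3 * k'))) (Tv (tgt b)) (dual b) (LM b ?z)"
            unfolding q' by (rule res_homotopy_cn[OF bt[OF b] al_dual[OF bb(1)] _ LMz]) simp
          also have "\<dots> = (if deg (dual b) = 2 * n - 1 then tg (Suc q) (Tv (tgt b)) (cn (idt (tgt b)) (LM b ?z)) else 0)"
            unfolding hval_def hc_def by (cases b) (simp add: q' mod_Suc)
          also have "deg (dual b) = 2 * n - 1 \<longleftrightarrow> b = idt v"
          proof
            assume "deg (dual b) = 2 * n - 1"
            then have "deg b = 0" using deg_dual[OF bb(1)] al_bounds[of "src b" "tgt b" "deg b"] bb n1 by (cases b) auto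
            then show "b = idt v" using bas_deg0[OF b] by simp
          qed simp
          finally have "lext res_homotopy (tg q (Tv (tgt b)) (cn (dual b) (LM b ?z)))
             = (if b = idt v then tg (Suc q) (Tv (tgt b)) (cn (idt (tgt b)) (LM b ?z)) else 0)" .
          moreover have "tg (Suc q) (Tv (tgt b)) (cn (idt (tgt b)) (LM b ?z)) = sg ?x" if "b = idt v"
            using LMi[of v] x yi tv that by simp
          ultimately show "lext res_homotopy (scp (theta b ^ k) (tg q (Tv (tgt b)) (cn (mu (dual b) y) (LM b ?z)))) = (if b = idt v then sg ?x else 0)"
            by (simp add: lext_lin db)
        qed
        also have "\<dots> = sg ?x" using bas_idt[of v] ib iv by simp
        finally show ?thesis .
      qed
      then show ?thesis using h0 by (simp add: vs_intros)
    next
      case d: False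
      have low: "lext res_homotopy (hdiff ?x) \<in> vs (LD (deg y))"
      proof (cases k)
        case 0
        obtain w' b where wb: "w = w' @ [b]" using w by (cases w rule: rev_cases) auto
        have "hdiff ?x = tg 0 (Tv 0) (dw (mu b y # w'))" by (simp add: hdiff_def qk 0 tv dh_0 wb co_ends)
        then have "lext res_homotopy (hdiff ?x) = (if Oz \<in> set (mu b y # w') then 0 else res_homotopy (0, Tv 0, mu b y # w'))"
          by (auto simp: dw_def tg_lin)
        moreover have "res_homotopy (0, Tv 0, mu b y # w') \<in> vs (LD (deg y))"
          using d by (simp add: res_homotopy_def LD_def yd)
        ultimately show ?thesis by (simp add: vs_intros)
      next
        case (Suc k')
        have q': "q = Suc (Suc (Suc (3 * k')))" by (simp add: qk Suc)
        show ?thesis unfolding dxsum[OF Suc] lext_sum lext_scp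
        proof (intro vs_intros)
          fix b assume b: "b \<in> bas v"
          show "lext res_homotopy (tg q (Tv (tgt b)) (cn (mu (dual b) y) (LM b ?z))) \<in> vs (LD (deg y))"
            unfolding q' by (rule res_homotopy_LD[OF bt[OF b] ok[OF b] _ _ LMz]) (use d yd in \<open>auto simp: mod_Suc\<close>)
        qed
      qed
      \<comment> \<open>The chosen first arrow, with y = c y1; the term of the commutator that
        multiplies by c on the left restores x.\<close>
      obtain c y1 where c: "hc q t y = Some (- (theta (el c) ^ k), c, y1)" "mu (el c) y1 = y" "ar c" "ss c = v" "deg y1 < deg y"
      proof (cases "al (rr (TL i), j, d - 1)")
        case True
        show thesis
          by (rule that[of "TL i" "(rr (TL i), j, d - 1)"]) (use True d q ib iv y yd ar_el[of "TL i"] in \<open>auto simp: hc_def k_def\<close>)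
      next
        case False
        then have "i < n" "al (Suc i, j, d - 1)" using al_first_arrow[of i j d] y yd d by auto
        then show thesis
          by (intro that[of "TU i" "(Suc i, j, d - 1)"]) (use False d q ib iv y yd ar_el[of "TU i"] in \<open>auto simp: hc_def k_def\<close>)
      qed
      have "lext hdiff (res_homotopy ?x) = scp (- (theta (el c) ^ k)) (dh (Suc (3 * k)) c (cn y1 ?z))"
        unfolding hx hval_def c(1) by (simp add: lext_lin hdiff_tg qk)
      also have "\<dots> = scp (- (theta (el c) ^ k)) (tg (Suc q) (Tv (rr c)) (cn y1 (LM (el c) ?z))) + sg ?x"
        unfolding dh_cn_1[OF c(3) z] c(2) c(4) using x by (simp add: pmv.scale_right_diff_distrib qk tv)
      finally have "lext hdiff (res_homotopy ?x) + lext res_homotopy (hdiff ?x) - sg ?x =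
         scp (- (theta (el c) ^ k)) (tg (Suc q) (Tv (rr c)) (cn y1 (LM (el c) ?z))) + lext res_homotopy (hdiff ?x)" by simp
      moreover have "scp (- (theta (el c) ^ k)) (tg (Suc q) (Tv (rr c)) (cn y1 (LM (el c) ?z))) + lext res_homotopy (hdiff ?x) \<in> vs (LD (deg y))"
        by (intro vs_intros low tg_LD[OF c(5)])
      ultimately show ?thesis by (simp only:)
    qed
  next
    case q0: False
    show ?thesis
    proof (cases "q mod 3 = 1")
      case q: True
      define k where "k = q div 3"
      have qk: "q = Suc (3 * k)" using q unfolding k_def by presburger
      have tc: "ar t" using t by (simp add: qk tag_ok_1)
      let ?v = "ss t"
      have vb: "1 \<le> ?v" "?v \<le> n" "1 \<le> rr t" "rr t \<le> n" using ar_bounds[OF tc] by auto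
      have et: "al (el t)" "src (el t) = ss t" "tgt (el t) = rr t" using ar_el[OF tc] by auto
      have mt: "mu (el t) y = (if al (?v, j, Suc d) then (?v, j, Suc d) else Oz)"
        using ar_el[OF tc] y yd ir by (cases "el t") auto
      have low: "lext res_homotopy (tg q (Tv (rr t)) (cn y (LM (el t) ?z))) \<in> vs (LD (deg y))"
      proof (cases "deg y = 0")
        case True
        then have "hc (3 * k) (Tv (rr t)) y = None" by (simp add: hc_def yd)
        moreover have "lext res_homotopy (tg (Suc (3 * k)) (Tv (rr t)) (cn y (LM (el t) ?z))) = hval (3 * k) (Tv (rr t)) y (LM (el t) ?z)"
          by (rule res_homotopy_cn) (use vb y LMz in \<open>auto simp: tag_ok_1\<close>)
        ultimately show ?thesis by (simp add: hval_def qk vs_intros)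
      next
        case False
        show ?thesis unfolding qk by (rule res_homotopy_LD) (use False y vb LMz in \<open>auto simp: tag_ok_1\<close>)
      qed
      have dx': "lext res_homotopy (hdiff ?x) = lext res_homotopy (tg q (Tv (rr t)) (cn y (LM (el t) ?z)))
          - scp (theta (el t) ^ k) (lext res_homotopy (tg q (Tv ?v) (cn (mu (el t) y) ?z)))"
        unfolding dx unfolding qk unfolding dh_cn_1[OF tc z] lext_lin by (rule refl)
      have hz: "lext res_homotopy (tg q (Tv ?v) (cn (mu (el t) y) ?z)) = hval (3 * k) (Tv ?v) (?v, j, Suc d) ?z" if "al (?v, j, Suc d)"
        unfolding mt qk if_P[OF that] by (rule res_homotopy_cn) (use that vb z in \<open>auto simp: tag_ok_1\<close>)
      have hz0: "lext res_homotopy (tg q (Tv ?v) (cn (mu (el t) y) ?z)) = 0" if "\<not> al (?v, j, Suc d)"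
        unfolding mt using that by (simp add: tg_lin)
      show ?thesis
      proof (cases "noncanonical t y")
        case nc: True
        let ?y = "(?v, j, d - 1)"
        have d: "0 < d" "al ?y" using noncanonical_al[OF tc, of j d] nc y yd ir by auto
        have "res_homotopy ?x = scp (mc t * theta (el t) ^ k) (tg (Suc (Suc q)) (Tv ?v) (cn ?y ?z))"
          unfolding hx hval_def hc_def using q nc by (simp add: yd k_def)
        then have "lext hdiff (res_homotopy ?x) = scp (mc t * theta (el t) ^ k) (dh (Suc (Suc (3 * k))) (Tv ?v) (cn ?y ?z))"
          by (simp add: lext_lin hdiff_tg qk)
        also have "\<dots> = (\<Sum>c\<in>outs ?v. scp (mc t * theta (el t) ^ k * mc c * theta (el c) ^ k) (tg (Suc q) c (cn (mu (el (rv c)) ?y) ?z)))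
           + (\<Sum>c\<in>outs ?v. scp (mc t * theta (el t) ^ k * mc c) (tg (Suc q) (rv c) (cn ?y (LM (el c) ?z))))"
          unfolding dh_cn_2[OF z]
          by (simp add: pmv.scale_sum_right pmv.scale_right_distrib sum.distrib qk mult.assoc[where 'a = 'k])
        finally have e1: "lext hdiff (res_homotopy ?x) = (\<Sum>c\<in>outs ?v. scp (mc t * theta (el t) ^ k * mc c * theta (el c) ^ k) (tg (Suc q) c (cn (mu (el (rv c)) ?y) ?z)))
           + (\<Sum>c\<in>outs ?v. scp (mc t * theta (el t) ^ k * mc c) (tg (Suc q) (rv c) (cn ?y (LM (el c) ?z))))" .
        have low2: "(\<Sum>c\<in>outs ?v. scp (mc t * theta (el t) ^ k * mc c) (tg (Suc q) (rv c) (cn ?y (LM (el c) ?z)))) \<in> vs (LD (deg y))"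
          using d by (intro vs_intros tg_LD) (auto simp: yd)
        have mrv: "mu (el (rv c)) ?y = (if al (rr c, j, d) then (rr c, j, d) else Oz)" if "c \<in> outs ?v" for c
        proof -
          have "ar c" "ss c = ?v" using that by (auto simp: outs_def)
          then show ?thesis using ar_el[of "rv c"] ar_rv[of c] d by (cases "el (rv c)") auto
        qed
        have tout: "t \<in> outs ?v" using tc by (simp add: outs_def)
        have mm: "mc t * theta (el t) ^ k * mc t * theta (el t) ^ k = 1"
        proof -
          have "mc t * theta (el t) ^ k * mc t * theta (el t) ^ k = (mc t * mc t) * (theta (el t) ^ k * theta (el t) ^ k)"
            by (simp only: mult_ac)
          then show ?thesis by simp
        qed
        have main: "scp (mc t * theta (el t) ^ k * mc t * theta (el t) ^ k) (tg (Suc q) t (cn (mu (el (rv t)) ?y) ?z)) = sg ?x"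
          unfolding mm mrv[OF tout] using y yd ir x by simp
        \<comment> \<open>The other arrow at the vertex. If ty is nonzero, its term cancels against
          the canonical factorization of ty; if ty is zero, \<open>al_square\<close> excludes
          it.\<close>
        have "(\<Sum>c\<in>outs ?v - {t}. scp (mc t * theta (el t) ^ k * mc c * theta (el c) ^ k) (tg (Suc q) c (cn (mu (el (rv c)) ?y) ?z)))
           = scp (theta (el t) ^ k) (lext res_homotopy (tg q (Tv ?v) (cn (mu (el t) y) ?z)))"
        proof (cases "al (?v, j, Suc d)")
          case True
          then have tU: "t = TU ?v" "al (rr (TL ?v), j, d)" using nc by (auto simp: noncanonical_def yd)
          have vn: "?v < n" using tU(1) tc by (cases t) auto
          have o: "outs ?v - {t} = {TL ?v}" using outs_eq[OF vb(1,2)] vn tU(1) by auto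
          have TLo: "TL ?v \<in> outs ?v" using outs_eq[OF vb(1,2)] by auto
          have "hval (3 * k) (Tv ?v) (?v, j, Suc d) ?z = scp (- (theta (el (TL ?v)) ^ k)) (tg (Suc q) (TL ?v) (cn (rr (TL ?v), j, d) ?z))"
            unfolding hval_def hc_def using tU(2) by (simp add: qk)
          moreover have "mc t = - 1" using tU(1) by (cases t) auto
          ultimately show ?thesis unfolding hz[OF True] o using mrv[OF TLo] tU(2)
            by (simp del: el.simps rr.simps)
        next
          case False
          have "mu (el (rv c)) ?y = Oz" if c: "c \<in> outs ?v - {t}" for c
          proof (rule ccontr)
            assume "mu (el (rv c)) ?y \<noteq> Oz"
            then have a: "al (rr c, j, d)" using mrv[of c] c by (metis DiffD1)
            obtain u where u: "u = ?v" by (rule that[OF refl])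
            have ub: "1 \<le> u" "u \<le> n" using vb(1,2) unfolding u by simp_all
            have cu1: "c \<in> outs u" using DiffD1[OF c] unfolding u .
            have cu2: "t \<in> outs u" using tout unfolding u .
            have cu3: "c \<noteq> t" using DiffD2[OF c] by (metis singletonI)
            have un: "u < n"
            proof (rule ccontr)
              assume nu: "\<not> u < n"
              have o: "outs u = {TL u}" by (rule trans[OF outs_eq[OF ub] if_not_P[OF nu]])
              have "c = TL u" "t = TL u" using cu1 cu2 unfolding o by (simp_all only: singleton_iff)
              then show False using cu3 by simp
            qed
            then have vn: "?v < n" unfolding u .
            have ou: "outs u = {TL u, TU u}" by (rule trans[OF outs_eq[OF ub] if_P[OF un]])
            have "c = TL u \<or> c = TU u" "t = TL u \<or> t = TU u" using cu1 cu2 unfolding ou by simp_all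
            then have "c = TL u \<and> t = TU u \<or> c = TU u \<and> t = TL u" using cu3 by metis
            moreover have "al (rr t, j, d)" using y(1) unfolding yd ir .
            moreover have "rr (TU u) = Suc u" by simp
            ultimately have "al (rr (TL u), j, d)" "al (Suc u, j, d)" using a by metis+
            then have "al (rr (TL ?v), j, d)" "al (Suc ?v, j, d)" by (simp_all only: u)
            then show False using al_square[OF vn, of j "d - 1"] d False by (cases d) auto
          qed
          then show ?thesis unfolding hz0[OF False] by (intro trans[OF sum.neutral]) (auto simp: tg_lin)
        qed
        then have sumeq: "(\<Sum>c\<in>outs ?v. scp (mc t * theta (el t) ^ k * mc c * theta (el c) ^ k) (tg (Suc q) c (cn (mu (el (rv c)) ?y) ?z)))
           = sg ?x + scp (theta (el t) ^ k) (lext res_homotopy (tg q (Tv ?v) (cn (mu (el t) y) ?z)))"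
          using main tout by (simp add: sum.remove)
        have "lext hdiff (res_homotopy ?x) + lext res_homotopy (hdiff ?x) - sg ?x =
            (\<Sum>c\<in>outs ?v. scp (mc t * theta (el t) ^ k * mc c) (tg (Suc q) (rv c) (cn ?y (LM (el c) ?z))))
            + lext res_homotopy (tg q (Tv (rr t)) (cn y (LM (el t) ?z)))"
          unfolding e1 sumeq dx' by simp
        moreover have "(\<Sum>c\<in>outs ?v. scp (mc t * theta (el t) ^ k * mc c) (tg (Suc q) (rv c) (cn ?y (LM (el c) ?z))))
            + lext res_homotopy (tg q (Tv (rr t)) (cn y (LM (el t) ?z))) \<in> vs (LD (deg y))"
          by (rule pmv.subspace_add[OF subspace_vs low2 low])
        ultimately show ?thesis by (simp only:)
      next
        \<comment> \<open>Here ty is nonzero and t is its chosen first arrow, so \<open>hc\<close>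
          applied to ty gives back t and y.\<close>
        case nc: False
        have h0: "res_homotopy ?x = 0" unfolding hx unfolding hval_def hc_def yd using q nc yd by simp
        have a: "al (?v, j, Suc d)" "\<not> (t = TU ?v \<and> al (rr (TL ?v), j, d))" using nc by (auto simp: noncanonical_def yd)
        have "hc (3 * k) (Tv ?v) (?v, j, Suc d) = Some (- (theta (el t) ^ k), t, y)"
        proof (cases t)
          case (TL u)
          then show ?thesis using y ir by (simp add: hc_def yd)
        next
          case (TU u)
          then show ?thesis using a y ir by (simp add: hc_def yd)
        qed (use tc in simp)
        then have "hval (3 * k) (Tv ?v) (?v, j, Suc d) ?z = scp (- (theta (el t) ^ k)) (sg ?x)"
          unfolding hval_def using x by (simp add: qk)
        then have "scp (theta (el t) ^ k) (lext res_homotopy (tg q (Tv ?v) (cn (mu (el t) y) ?z))) = - sg ?x"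
          unfolding hz[OF a(1)] by simp
        then have "lext hdiff (res_homotopy ?x) + lext res_homotopy (hdiff ?x) - sg ?x = lext res_homotopy (tg q (Tv (rr t)) (cn y (LM (el t) ?z)))"
          unfolding h0 dx' by simp
        then show ?thesis using low by simp
      qed
    next
      case q1: False
      define k where "k = q div 3"
      have q: "q mod 3 = 2" using q0 q1 by presburger
      have qk: "q = Suc (Suc (3 * k))" using q unfolding k_def by presburger
      then obtain v where tv: "t = Tv v" using t by (auto simp: tag_ok_1)
      have iv: "i = v" using ir tv by simp
      have mrv: "mu (el (rv c)) y = (if al (rr c, j, Suc d) then (rr c, j, Suc d) else Oz)" if "c \<in> outs v" for c
      proof -
        have "ar c" "ss c = v" using that by (auto simp: outs_def)
        then show ?thesis using ar_el[of "rv c"] ar_rv[of c] y by (cases "el (rv c)") (auto simp: yd iv)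
      qed
      have dx': "lext res_homotopy (hdiff ?x) = (\<Sum>c\<in>outs v. scp (mc c * theta (el c) ^ k) (lext res_homotopy (tg q c (cn (mu (el (rv c)) y) ?z))))
          + (\<Sum>c\<in>outs v. scp (mc c) (lext res_homotopy (tg q (rv c) (cn y (LM (el c) ?z)))))"
        unfolding dx unfolding qk tv unfolding dh_cn_2[OF z] lext_lin pmv.scale_right_distrib sum.distrib pmv.scale_scale
        by (rule refl)
      have low: "(\<Sum>c\<in>outs v. scp (mc c) (lext res_homotopy (tg q (rv c) (cn y (LM (el c) ?z))))) \<in> vs (LD (deg y))"
      proof (intro vs_intros)
        fix c assume "c \<in> outs v"
        then have c: "ar c" "ss c = v" by (auto simp: outs_def)
        have r: "tag_ok (Suc (3 * k)) (rv c)" "src y = rr (rv c)" using ar_rv[OF c(1)] c y tv by (auto simp: tag_ok_1)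
        have e: "lext res_homotopy (tg (Suc (Suc (3 * k))) (rv c) (cn y (LM (el c) ?z))) = hval (Suc (3 * k)) (rv c) y (LM (el c) ?z)"
          by (rule res_homotopy_cn[OF r(1) y(1) r(2) LMz])
        have "hval (Suc (3 * k)) (rv c) y (LM (el c) ?z) \<in> vs (LD (deg y))"
        proof (cases "hc (Suc (3 * k)) (rv c) y")
          case (Some p)
          obtain a t' y' where p: "p = (a, t', y')" by (cases p)
          have dy: "deg y' < deg y" using hc_ok[OF r(1) y(1) r(2) Some[unfolded p]] by (simp add: mod_Suc)
          show ?thesis unfolding hval_def Some p option.case prod.case by (intro vs_intros tg_LD[OF dy])
        qed (simp add: hval_def vs_intros)
        then show "lext res_homotopy (tg q (rv c) (cn y (LM (el c) ?z))) \<in> vs (LD (deg y))"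
          unfolding qk e .
      qed
      have hfirst: "lext res_homotopy (tg q c (cn (mu (el (rv c)) y) ?z)) =
         (if al (rr c, j, Suc d) \<and> noncanonical c (rr c, j, Suc d) then scp (mc c * theta (el c) ^ k) (sg ?x) else 0)" if c: "c \<in> outs v" for c
      proof (cases "al (rr c, j, Suc d)")
        case True
        have ac: "ar c" "ss c = v" using c by (auto simp: outs_def)
        have "lext res_homotopy (tg (Suc (Suc (3 * k))) c (cn (rr c, j, Suc d) ?z)) = hval (Suc (3 * k)) c (rr c, j, Suc d) ?z"
          by (rule res_homotopy_cn) (use ac True z in \<open>auto simp: tag_ok_1\<close>)
        then have "lext res_homotopy (tg q c (cn (mu (el (rv c)) y) ?z)) = hval (Suc (3 * k)) c (rr c, j, Suc d) ?z"
          unfolding mrv[OF c] qk using True by simp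
        also have "\<dots> = (if noncanonical c (rr c, j, Suc d) then scp (mc c * theta (el c) ^ k) (sg ?x) else 0)"
          using x ac by (auto simp: hval_def hc_def mod_Suc div_Suc yd iv tv qk)
        finally show ?thesis using True by simp
      qed (simp add: mrv[OF c] tg_lin)
      have sq: "scp (mc c * theta (el c) ^ k) (scp (mc c * theta (el c) ^ k) z') = z'" for c and z' :: "cell \<Rightarrow>\<^sub>0 'k"
      proof -
        have "(mc c * theta (el c) ^ k) * (mc c * theta (el c) ^ k) = (mc c * mc c) * (theta (el c) ^ k * theta (el c) ^ k)"
          by (simp only: mult_ac)
        then show ?thesis by simp
      qed
      \<comment> \<open>The arrows whose leading term returns to x; away from the socle there is
        exactly one, by the count of neighbours.\<close>
      let ?C = "{c \<in> outs v. al (rr c, j, Suc d) \<and> noncanonical c (rr c, j, Suc d)}"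
      have "(\<Sum>c\<in>outs v. scp (mc c * theta (el c) ^ k) (lext res_homotopy (tg q c (cn (mu (el (rv c)) y) ?z))))
         = (\<Sum>c\<in>outs v. if al (rr c, j, Suc d) \<and> noncanonical c (rr c, j, Suc d) then sg ?x else 0)"
      proof (rule sum.cong[OF refl])
        fix c assume c: "c \<in> outs v"
        show "scp (mc c * theta (el c) ^ k) (lext res_homotopy (tg q c (cn (mu (el (rv c)) y) ?z)))
          = (if al (rr c, j, Suc d) \<and> noncanonical c (rr c, j, Suc d) then sg ?x else 0)"
          unfolding hfirst[OF c]
        proof (cases "al (rr c, j, Suc d) \<and> noncanonical c (rr c, j, Suc d)")
          case True
          show "scp (mc c * theta (el c) ^ k) (if al (rr c, j, Suc d) \<and> noncanonical c (rr c, j, Suc d) then scp (mc c * theta (el c) ^ k) (sg ?x) else 0)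
            = (if al (rr c, j, Suc d) \<and> noncanonical c (rr c, j, Suc d) then sg ?x else 0)"
            unfolding if_P[OF True] by (rule sq)
        next
          case False
          show "scp (mc c * theta (el c) ^ k) (if al (rr c, j, Suc d) \<and> noncanonical c (rr c, j, Suc d) then scp (mc c * theta (el c) ^ k) (sg ?x) else 0)
            = (if al (rr c, j, Suc d) \<and> noncanonical c (rr c, j, Suc d) then sg ?x else 0)"
            unfolding if_not_P[OF False] by (rule pmv.scale_zero_right)
        qed
      qed
      also have "\<dots> = (\<Sum>c\<in>?C. sg ?x)"
        by (simp add: sum.inter_filter)
      finally have dx2: "lext res_homotopy (hdiff ?x) = (\<Sum>c\<in>?C. sg ?x) + (\<Sum>c\<in>outs v. scp (mc c) (lext res_homotopy (tg q (rv c) (cn y (LM (el c) ?z)))))"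
        unfolding dx' by simp
      have vb: "1 \<le> v" "v \<le> n" using ib iv by auto
      show ?thesis
      proof (cases "d = 2 * n - 1")
        case False
        have h0: "res_homotopy ?x = 0" unfolding hx unfolding hval_def hc_def yd using q False by simp
        have avd: "al (v, j, d)" using y yd iv by simp
        have "\<exists>c. ?C = {c}"
        proof (cases "al (v, j, Suc (Suc d))")
          case True
          note s = al_square'[OF avd True]
          have o: "outs v = {TL v, TU v}" using outs_eq[OF vb] s by simp
          have 1: "\<not> noncanonical (TL v) (rr (TL v), j, Suc d)" using True by (simp add: noncanonical_def)
          have 2: "noncanonical (TU v) (rr (TU v), j, Suc d)" using s by (simp add: noncanonical_def)
          have 3: "al (rr (TU v), j, Suc d)" using s by simp
          have "?C = {TU v}" unfolding o using 1 2 3 by (auto simp del: rr.simps)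
          then show ?thesis by blast
        next
          case nal: False
          have nc: "noncanonical c (rr c, j, Suc d)" if "c \<in> outs v" for c
            using nal that by (auto simp: noncanonical_def outs_def)
          consider "al (rr (TL v), j, Suc d)" "v < n" "al (Suc v, j, Suc d)"
            | "al (rr (TL v), j, Suc d)" "v < n \<longrightarrow> \<not> al (Suc v, j, Suc d)"
            | "\<not> al (rr (TL v), j, Suc d)" "v < n" "al (Suc v, j, Suc d)"
            using al_prolong[OF avd False] by blast
          then show ?thesis
          proof cases
            case 1
            then show ?thesis using al_square[of v j d] avd nal by blast
          next
            case 2
            have TLo: "TL v \<in> outs v" unfolding outs_eq[OF vb] by simp
            have "c = TL v" if c: "c \<in> outs v" "al (rr c, j, Suc d)" for c
            proof (rule ccontr)
              assume nTL: "c \<noteq> TL v"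
              then have vn: "v < n" and cU: "c = TU v" using c(1) unfolding outs_eq[OF vb] by (metis insertE empty_iff)+
              have "rr c = Suc v" unfolding cU by simp
              then show False using c(2) 2(2) vn by metis
            qed
            then have "?C = {TL v}" using TLo 2(1) nc by blast
            then show ?thesis by blast
          next
            case 3
            have o: "outs v = {TL v, TU v}" using outs_eq[OF vb] 3(2) by simp
            have TU: "TU v \<in> outs v" "al (rr (TU v), j, Suc d)" unfolding o using 3(3) by simp_all
            have "c = TU v" if "c \<in> outs v" "al (rr c, j, Suc d)" for c
              using that 3(1) unfolding o by blast
            then have "?C = {TU v}" using TU nc by blast
            then show ?thesis by blast
          qed
        qed
        then obtain c where C: "?C = {c}" by blast
        have "(\<Sum>c\<in>?C. sg ?x) = sg ?x" unfolding C by simp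
        then have "lext hdiff (res_homotopy ?x) + lext res_homotopy (hdiff ?x) - sg ?x = (\<Sum>c\<in>outs v. scp (mc c) (lext res_homotopy (tg q (rv c) (cn y (LM (el c) ?z)))))"
          unfolding h0 dx2 by simp
        then show ?thesis using low by simp
      next
        \<comment> \<open>The socle of a period. No arrow prolongs it, and it is matched with the
          idempotent of the next period: the Casimir term at \<open>idt v\<close> restores y, and
          all others have lower degree.\<close>
        case d: True
        have "?C = {}" using al_deg[of _ j "Suc d"] d n1 by fastforce
        then have dx3: "lext res_homotopy (hdiff ?x) = (\<Sum>c\<in>outs v. scp (mc c) (lext res_homotopy (tg q (rv c) (cn y (LM (el c) ?z)))))"
          unfolding dx2 by (simp only: sum.empty) simp
        have "res_homotopy ?x = tg (Suc (Suc q)) (Tv v) (cn (idt v) ?z)"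
          unfolding hx unfolding hval_def hc_def yd using q d iv by simp
        then have "lext hdiff (res_homotopy ?x) = dh (Suc (Suc (Suc (3 * k)))) (Tv v) (cn (idt v) ?z)"
          by (simp only: hdiff_tg qk)
        also have "\<dots> = (\<Sum>b\<in>bas v. scp (theta b ^ Suc k) (tg (Suc q) (Tv (tgt b)) (cn (dual b) (LM b ?z))))"
          unfolding dh_cn_3[OF z] qk
          by (rule sum.cong[OF refl]) (simp add: bas_def al_dual)
        also have "\<dots> = scp (theta (idt v) ^ Suc k) (tg (Suc q) (Tv v) (cn (dual (idt v)) (LM (idt v) ?z)))
            + (\<Sum>b\<in>bas v - {idt v}. scp (theta b ^ Suc k) (tg (Suc q) (Tv (tgt b)) (cn (dual b) (LM b ?z))))"
          using bas_idt[OF vb] by (simp add: sum.remove)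
        also have "dual (idt v) = y" using yd iv d al_top y by auto
        also have "scp (theta (idt v) ^ Suc k) (tg (Suc q) (Tv v) (cn y (LM (idt v) ?z))) = sg ?x"
          using LMi[of v] tv x by simp
        finally have fin: "lext hdiff (res_homotopy ?x) + lext res_homotopy (hdiff ?x) - sg ?x =
           (\<Sum>b\<in>bas v - {idt v}. scp (theta b ^ Suc k) (tg (Suc q) (Tv (tgt b)) (cn (dual b) (LM b ?z)))) + lext res_homotopy (hdiff ?x)"
          by simp
        have S: "(\<Sum>b\<in>bas v - {idt v}. scp (theta b ^ Suc k) (tg (Suc q) (Tv (tgt b)) (cn (dual b) (LM b ?z)))) \<in> vs (LD (deg y))"
        proof (intro vs_intros tg_LD)
          fix b assume b: "b \<in> bas v - {idt v}"
          then have "deg b \<noteq> 0" using bas_deg0 by blast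
          then show "deg (dual b) < deg y" using b deg_dual[of b] n1 by (auto simp: bas_def yd d)
        qed
        show ?thesis unfolding fin unfolding dx3 by (rule pmv.subspace_add[OF subspace_vs S low])
      qed
    qed
  qed
qed

definition small_cells :: "nat \<Rightarrow> cell set" where "small_cells i = CL (Suc i) (Suc 0)"

text \<open>The lexicographic order by row and then by degree of the first letter, packed into one
  number because degrees are below 2n. Words in column 0 are one letter shorter than their row,
  hence the \<open>Suc\<close>.\<close>

definition res_rank :: "cell \<Rightarrow> nat" where
  "res_rank x = (case x of (p, t, l) \<Rightarrow> if p = 0 then Suc (length l) * (2 * n) else length l * (2 * n) + deg (hd l))"

lemma CL_Suc_E:
  assumes "x \<in> CL (Suc q) m"
  obtains t l where "x = (Suc q, t, l)" "tag_ok q t" "l \<in> path_words (rr t) (ss t) m"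
  using assms by (auto simp: CL_def)

lemma CL_0_E:
  assumes "x \<in> CL 0 m"
  obtains l where "x = (0, Tv 0, l)" "l \<in> AL (m - 1)"
  using assms by (auto simp: CL_def)

lemma res_rank_CL: "x \<in> CL p m \<Longrightarrow> m * (2 * n) \<le> res_rank x \<and> res_rank x < Suc m * (2 * n)"
proof (cases p)
  case 0
  assume "x \<in> CL p m"
  then obtain l where l: "x = (0, Tv 0, l)" "l \<in> AL (m - 1)" unfolding 0 by (rule CL_0_E)
  then have m: "m = Suc (length l)" by (cases m) (auto simp: AL_def)
  show ?thesis using n1 unfolding m by (simp add: l res_rank_def)
next
  case (Suc q)
  assume "x \<in> CL p m"
  then obtain t l where l: "x = (Suc q, t, l)" "l \<in> path_words (rr t) (ss t) m" unfolding Suc by (rule CL_Suc_E)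
  have "al (hd l)" "length l = m" using l by (auto simp: path_words_def AL_def)
  then have "deg (hd l) < 2 * n" using al_bounds[of "src (hd l)" "tgt (hd l)" "deg (hd l)"] n1 by (cases "hd l") auto
  then show ?thesis using l \<open>length l = m\<close> by (simp add: res_rank_def)
qed

lemma res_homotopy_CL: "x \<in> CL p m \<Longrightarrow> res_homotopy x \<in> vs (CL (Suc p) m)"
proof (cases p)
  case 0
  assume "x \<in> CL p m"
  then obtain l where l: "x = (0, Tv 0, l)" "l \<in> AL (m - 1)" unfolding 0 by (rule CL_0_E)
  then have a: "l \<noteq> []" "al (hd l)" "Suc (length l) = m" by (cases m; auto simp: AL_def)+
  have v: "1 \<le> tgt (hd l) \<and> tgt (hd l) \<le> n" using a al_bounds by (cases "hd l") auto
  have "idt (tgt (hd l)) # tl l @ [hd l] \<in> path_words (tgt (hd l)) (tgt (hd l)) m"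
    using l a v by (cases l) (auto simp: path_words_def AL_def al_idt)
  then show ?thesis using l a v by (simp add: res_homotopy_def CL_def 0 tag_ok_1)
next
  case (Suc q)
  assume "x \<in> CL p m"
  then obtain t l where l: "x = (Suc q, t, l)" "tag_ok q t" "l \<in> path_words (rr t) (ss t) m" unfolding Suc by (rule CL_Suc_E)
  show ?thesis
  proof (cases "length l \<le> 1")
    case False
    then obtain y w where yw: "l = y # w" "w \<noteq> []" by (cases l) auto
    show ?thesis
    proof (cases "hc q t y")
      case (Some r)
      obtain a t' y' where r: "r = (a, t', y')" by (cases r)
      have y: "al y" "src y = rr t" using l yw by (auto simp: path_words_def AL_def)
      note h = hc_ok[OF l(2) y Some[unfolded r]]
      have "y' # w \<in> path_words (rr t') (ss t') m" using h l yw by (auto simp: path_words_def AL_def)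
      then have "(Suc (Suc q), t', y' # w) \<in> CL (Suc (Suc q)) m" using h by (simp add: CL_def)
      then show ?thesis using yw by (auto simp: l res_homotopy_def Some r Suc intro!: vs_intros)
    qed (use yw in \<open>simp add: l res_homotopy_def vs_intros\<close>)
  qed (simp add: l res_homotopy_def vs_intros)
qed

text \<open>The other filtration of the double complex: now the rows are contracted, and the
  vertical differential contributes only to lower rows.\<close>

theorem small_quasi_iso: "qdim scp (cycles small_cells D i) (boundaries small_cells D i) d \<longleftrightarrow> qdim scp (cycles XG D i) (boundaries XG D i) d"
proof (rule morse_subcomplex[where h = res_homotopy and rk = res_rank])
  fix i x assume x: "x \<in> XG i" "x \<notin> small_cells i"
  then obtain p m where pm: "p + m = Suc (Suc i)" "0 < m" "x \<in> CL p m" by (auto elim: XG_E)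
  then obtain k where m: "m = Suc (Suc k)" using x(2) by (cases m; cases "m - 1") (auto simp: small_cells_def)
  show "res_homotopy x \<in> vs (XG (Suc i))"
    using res_homotopy_CL[OF pm(3)] by (rule vs_mono[rotated]) (use CL_XG[of "Suc p" m "Suc i"] pm in auto)
  let ?lo = "{y \<in> XG i. res_rank y < res_rank x}"
  have "CL (Suc p) (Suc k) \<subseteq> ?lo"
  proof (intro subsetI CollectI conjI)
    fix y assume y: "y \<in> CL (Suc p) (Suc k)"
    show "res_rank y < res_rank x" using res_rank_CL[OF y] res_rank_CL[OF pm(3)] by (simp add: m)
    show "y \<in> XG i" using CL_XG[OF _ _ y, of i] pm m by simp
  qed
  note lo1 = vs_mono[OF this]
  have v1: "lext vdiff (res_homotopy x) \<in> vs ?lo"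
    by (intro lo1 lext_vs[OF res_homotopy_CL[OF pm(3)]]) (use vdiff_CL[of _ "Suc p" m] in \<open>simp add: m\<close>)
  have v2: "lext res_homotopy (vdiff x) \<in> vs ?lo"
    by (intro lo1 lext_vs[OF vdiff_CL[OF pm(3)]]) (use res_homotopy_CL[of _ p "Suc k"] in \<open>simp add: m\<close>)
  have "lext hdiff (res_homotopy x) + lext res_homotopy (hdiff x) - sg x \<in> vs ?lo"
  proof (cases p)
    case 0
    obtain l where l: "x = (0, Tv 0, l)" "l \<in> AL (m - 1)" using pm(3) unfolding 0 by (rule CL_0_E)
    have "Oz \<notin> set l" "l \<noteq> []" using l(2) al_O by (auto simp: AL_def)
    then obtain b w where bw: "l = b # w" "al b" "Oz \<notin> set l" using l(2) by (cases l) (auto simp: AL_def)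
    have "lext hdiff (res_homotopy x) = tg 0 (Tv 0) (co (idt (tgt b) # w @ [b]))"
      by (simp add: l bw res_homotopy_def hdiff_def dh_0)
    also have "\<dots> = sg x" using bw by (simp add: co_ends l dw_def)
    finally show ?thesis using hdiff_CL0 pm(3) by (simp add: 0 vs_intros)
  next
    case (Suc q)
    obtain t l where l: "x = (Suc q, t, l)" "tag_ok q t" "l \<in> path_words (rr t) (ss t) m"
      using pm(3) unfolding Suc by (rule CL_Suc_E)
    obtain y w where yw: "l = y # w" "w \<noteq> []" using l(3) by (cases l; cases "tl l") (auto simp: path_words_def AL_def m)
    have R1: "lext hdiff (res_homotopy x) + lext res_homotopy (hdiff x) - sg x \<in> vs (LD (deg y))"
      using res_homotopy_loc[OF l(2) l(3)[unfolded yw] yw(2)] by (simp add: l yw)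
    have R2: "lext hdiff (res_homotopy x) + lext res_homotopy (hdiff x) - sg x \<in> vs (CL p m)"
    proof (intro vs_intros)
      show "lext hdiff (res_homotopy x) \<in> vs (CL p m)"
        using res_homotopy_CL[OF pm(3)] hdiff_CL by (rule lext_vs)
      show "lext res_homotopy (hdiff x) \<in> vs (CL p m)"
        using hdiff_CL[OF pm(3)[unfolded Suc]] unfolding Suc by (rule lext_vs) (rule res_homotopy_CL)
    qed (use pm in simp)
    \<comment> \<open>The error stays in the row of x and its first letter has lower degree, so its
      rank is lower.\<close>
    have "CL p m \<inter> LD (deg y) \<subseteq> ?lo"
    proof
      fix z assume z: "z \<in> CL p m \<inter> LD (deg y)"
      then obtain t' l' where z': "z = (Suc q, t', l')" "l' \<in> path_words (rr t') (ss t') m" unfolding Suc by (auto elim: CL_Suc_E)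
      have "deg (hd l') < deg y" using z z' by (auto simp: LD_def)
      then have "res_rank z < res_rank x" using z' l yw by (auto simp: res_rank_def path_words_def AL_def)
      then show "z \<in> ?lo" using CL_XG[of p m i z] z pm by simp
    qed
    then show ?thesis using R1 R2 unfolding vs_def by blast
  qed
  then have "lext vdiff (res_homotopy x) + lext res_homotopy (vdiff x) + (lext hdiff (res_homotopy x) + lext res_homotopy (hdiff x) - sg x) \<in> vs ?lo"
    by (rule pmv.subspace_add[OF subspace_vs pmv.subspace_add[OF subspace_vs v1 v2]])
  moreover have "lext D (res_homotopy x) + lext res_homotopy (D x) = sg x + 0 + (lext vdiff (res_homotopy x) + lext res_homotopy (vdiff x) + (lext hdiff (res_homotopy x) + lext res_homotopy (hdiff x) - sg x))"
    by (simp add: D_split[abs_def] lext_plus lext_lin)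
  moreover have "0 \<in> vs (small_cells i)" by (simp add: vs_intros)
  ultimately show "\<exists>w\<in>vs (small_cells i). \<exists>u\<in>vs ?lo. lext D (res_homotopy x) + lext res_homotopy (D x) = sg x + w + u"
    by blast
next
  show "res_homotopy x = 0" if "x \<in> small_cells i" for i x
    using that by (auto simp: small_cells_def res_homotopy_def path_words_def AL_def elim!: CL_Suc_E)
  show "small_cells i \<subseteq> XG i" for i using CL_XG[of "Suc i" 1 i] by (auto simp: small_cells_def)
  show "D x \<in> vs (small_cells i)" if "x \<in> small_cells (Suc i)" for i x
  proof -
    have x: "x \<in> CL (Suc (Suc i)) (Suc 0)" using that by (simp add: small_cells_def)
    have "vdiff x = 0" using vdiff_CL[OF x] by (simp add: vs_def)
    then show ?thesis using hdiff_CL[OF x] by (simp add: D_split small_cells_def)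
  qed
  show "D x = 0" if "x \<in> small_cells 0" for x
    using D_XG0 CL_XG[of "Suc 0" "Suc 0" 0] that by (simp add: small_cells_def)
qed (rule D_D)

end

section \<open>The homology of the small complex\<close>

locale lalg2 = lalg n K for n :: nat and K :: "'k::field itself" +
  assumes two: "(2 :: 'k) \<noteq> 0"
begin

lemma half [simp]: "scp (1/2) (z + z) = (z :: 'x \<Rightarrow>\<^sub>0 'k)"
  using two by (intro poly_mapping_eqI) (simp add: lookup_add algebra_simps flip: mult_2)

text \<open>Chains rather than cells: outside the basis the value is 0, so that sums over v may run
  past the end and terms may drop out silently. The same holds for \<open>AA\<close>.\<close>

definition VV :: "nat \<Rightarrow> nat \<Rightarrow> nat \<Rightarrow> (cell \<Rightarrow>\<^sub>0 'k)" where
  "VV i v d = (if al (v, v, d) then sg (Suc i, Tv v, [(v, v, d)]) else 0)"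
definition AA :: "nat \<Rightarrow> tag \<Rightarrow> nat \<Rightarrow> (cell \<Rightarrow>\<^sub>0 'k)" where
  "AA i c d = (if ar c \<and> al (rr c, ss c, d) then sg (Suc i, c, [(rr c, ss c, d)]) else 0)"

section \<open>Loops and edges in the basis, and the differential on them\<close>

lemma al_loop: "al (v, v, d) \<longleftrightarrow> 1 \<le> v \<and> v \<le> n \<and> (if even d then d + 2 * v \<le> 2 * n else 2 * v \<le> d + 1 \<and> d + 1 \<le> 2 * n)"
proof -
  have "even (v + v + d) = even d" by simp
  then show ?thesis unfolding al_simps by (cases "even d") (auto dest: odd_pos)
qed

lemma al_edge: "al (v, Suc v, d) \<longleftrightarrow> 1 \<le> v \<and> v < n \<and> (if odd d then d + 2 * v + 1 \<le> 2 * n else 2 * v \<le> d \<and> d + 2 \<le> 2 * n)"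
proof -
  have "even (v + Suc v + d) = odd d" by simp
  then show ?thesis unfolding al_simps by (cases "even d") (auto dest: odd_pos)
qed

lemma al_one: "al (1, 1, d) \<longleftrightarrow> d + 1 \<le> 2 * n"
proof -
  have "d + 2 \<le> 2 * n \<longleftrightarrow> d + 1 \<le> 2 * n" if "even d" using that by presburger
  then show ?thesis using n1 unfolding al_loop by (auto dest: odd_pos)
qed

lemma AA_TL: "AA i (TL (Suc (Suc v))) d = (if al (Suc v, Suc (Suc v), d) then sg (Suc i, TL (Suc (Suc v)), [(Suc v, Suc (Suc v), d)]) else 0)"
  by (auto simp: AA_def al_edge)
lemma AA_TU: "AA i (TU v) d = (if al (v, Suc v, d) then sg (Suc i, TU v, [(Suc v, v, d)]) else 0)"
  by (auto simp: AA_def al_edge al_sym[of "Suc v"])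
lemma AA_1: "AA i (TL 1) d = (if d + 1 \<le> 2 * n then sg (Suc i, TL 1, [(1, 1, d)]) else 0)"
  using n1 al_one[of d] by (auto simp: AA_def)

lemma VV_0 [simp]: "VV i 0 d = 0" by (simp add: VV_def)
lemma VV_big [simp]: "n < v \<Longrightarrow> VV i v d = 0" by (simp add: VV_def al_loop)

text \<open>The part of the derivative of the relation that belongs to the edge between v - 1 and v.
  For v = 1 both directions of this edge are the loop, with relative sign (-1)^k, which makes the
  coefficient 0 or 2.\<close>

definition PP :: "nat \<Rightarrow> nat \<Rightarrow> nat \<Rightarrow> nat \<Rightarrow> (cell \<Rightarrow>\<^sub>0 'k)" where
  "PP i k v d = (if v = 1 then AA i (TL 1) d + scp ((-1) ^ k) (AA i (TL 1) d) else AA i (TL v) d + AA i (TU (v - 1)) d)"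

lemma D_single: "lext D (sg (Suc i, t, [b])) = dh i t (sg [b])"
  by (simp add: tg_lin)

lemma theta_1: "(theta (1, 1, 1) :: 'k) = -1" by (simp add: theta_def)
lemma theta_TL: "v \<noteq> 1 \<Longrightarrow> 1 \<le> v \<Longrightarrow> (theta (el (TL v)) :: 'k) = 1"
proof -
  assume "v \<noteq> 1" "1 \<le> v"
  then obtain u where "v = Suc (Suc u)" by (cases v; cases "v - 1") auto
  then show ?thesis by (simp add: theta_def power_add flip: power_mult_distrib)
qed
lemma theta_TU: "(theta (el (TU v)) :: 'k) = 1"
  by (simp add: theta_def power_add flip: power_mult_distrib)

lemma D_arrow:
  assumes c: "ar c" and b: "al (rr c, ss c, d)"
  shows "lext D (sg (Suc (Suc (3 * k)), c, [(rr c, ss c, d)])) =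
     VV (3 * k) (rr c) (Suc d) - scp (theta (el c) ^ k) (VV (3 * k) (ss c) (Suc d))"
proof -
  note e = ar_el[OF c]
  obtain i j f where ec: "el c = (i, j, f)" by (cases "el c")
  have m: "mu (rr c, ss c, d) (el c) = (if al (rr c, rr c, Suc d) then (rr c, rr c, Suc d) else Oz)"
    "mu (el c) (rr c, ss c, d) = (if al (ss c, ss c, Suc d) then (ss c, ss c, Suc d) else Oz)"
    using e b by (auto simp: ec)
  have "lm (el c) [(rr c, ss c, d)] = dw [mu (rr c, ss c, d) (el c)]"
    "hm (el c) [(rr c, ss c, d)] = dw [mu (el c) (rr c, ss c, d)]"
    by (simp_all add: lm_def hm_def)
  then show ?thesis unfolding D_single dh_1[OF c] VV_def m
    using al_neq_O by (auto simp: dw_def tg_lin)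
qed

lemma D_TL: "2 \<le> v \<Longrightarrow> AA (Suc (3 * k)) (TL v) d \<noteq> 0 \<Longrightarrow> lext D (AA (Suc (3 * k)) (TL v) d) = VV (3 * k) (v - 1) (Suc d) - VV (3 * k) v (Suc d)"
  using D_arrow[of "TL v" d k] theta_TL[of v] by (auto simp: AA_def simp del: el.simps split: if_splits) auto

lemma D_TU: "AA (Suc (3 * k)) (TU v) d \<noteq> 0 \<Longrightarrow> lext D (AA (Suc (3 * k)) (TU v) d) = VV (3 * k) (Suc v) (Suc d) - VV (3 * k) v (Suc d)"
  using D_arrow[of "TU v" d k] theta_TU[of v] by (auto simp: AA_def simp del: el.simps split: if_splits) auto

lemma D_TL1: "AA (Suc (3 * k)) (TL 1) d \<noteq> 0 \<Longrightarrow> lext D (AA (Suc (3 * k)) (TL 1) d) = VV (3 * k) 1 (Suc d) - scp ((-1) ^ k) (VV (3 * k) 1 (Suc d))"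
  using D_arrow[of "TL 1" d k] theta_1 by (auto simp: AA_def split: if_splits)

text \<open>A vertex sees its lower edge with sign 1 and its upper edge with sign -1, the values of
  \<open>mc\<close>.\<close>

lemma D_V2:
  assumes "al (v, v, d)"
  shows "lext D (VV (Suc (Suc (3 * k))) v d) = PP (Suc (3 * k)) k v (Suc d) - PP (Suc (3 * k)) k (Suc v) (Suc d)"
proof -
  let ?i = "Suc (3 * k)"
  have v: "1 \<le> v" "v \<le> n" using al_bounds[OF assms] by auto
  have c: "scp (mc c) (scp (theta (el c) ^ k) (tg (Suc ?i) c (HM (el (rv c)) (sg [(v, v, d)]))) + tg (Suc ?i) (rv c) (LM (el c) (sg [(v, v, d)])))
     = scp (mc c) (scp (theta (el c) ^ k) (AA ?i c (Suc d)) + AA ?i (rv c) (Suc d))" if "c \<in> outs v" for c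
  proof -
    have c: "ar c" "ss c = v" using that by (auto simp: outs_def)
    note r = ar_rv[OF c(1)]
    note e = ar_el[OF c(1)] and e' = ar_el[OF conjunct1[OF r]]
    have "mu (el (rv c)) (v, v, d) = (if al (rr c, v, Suc d) then (rr c, v, Suc d) else Oz)"
      using e' r c assms by (cases "el (rv c)") auto
    moreover have "mu (v, v, d) (el c) = (if al (v, rr c, Suc d) then (v, rr c, Suc d) else Oz)"
      using e r c assms by (cases "el c") auto
    ultimately show ?thesis using c r al_neq_O
      by (auto simp: lm_def hm_def dw_def AA_def tg_lin)
  qed
  have D1: "lext D (VV (Suc ?i) v d) = (\<Sum>c\<in>outs v. scp (mc c) (scp (theta (el c) ^ k) (AA ?i c (Suc d)) + AA ?i (rv c) (Suc d)))"
    using assms by (simp only: VV_def if_True D_single dh_2) (rule sum.cong[OF refl c])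
  have L: "scp (theta (el (TL v)) ^ k) (AA ?i (TL v) (Suc d)) + AA ?i (rv (TL v)) (Suc d) = PP ?i k v (Suc d)"
  proof (cases "v = 1")
    case True
    then show ?thesis by (simp add: PP_def theta_def add.commute)
  next
    case False
    then show ?thesis using theta_TL[of v] v by (simp add: PP_def del: el.simps)
  qed
  have U: "scp (theta (el (TU v)) ^ k) (AA ?i (TU v) (Suc d)) + AA ?i (rv (TU v)) (Suc d) = PP ?i k (Suc v) (Suc d)"
    using theta_TU[of v] v by (simp add: PP_def add.commute del: el.simps)
  have N: "PP ?i k (Suc v) (Suc d) = 0" if "\<not> v < n"
    using that v by (simp add: PP_def AA_def)
  show ?thesis unfolding D1 outs_eq[OF v] using L U N by (simp add: del: el.simps rv.simps)
qed

text \<open>Every vertex v has, for each parity, one basis element ending in w for every u \<ge> max v w.\<close>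

lemma sum_bas_parity:
  fixes f :: "nat \<Rightarrow> (cell \<Rightarrow>\<^sub>0 'k)"
  assumes v: "1 \<le> v"
  shows "(\<Sum>b\<in>{b \<in> bas v. even (v + tgt b + deg b)}. f (tgt b)) = (\<Sum>u=v..n. \<Sum>w=1..u. f w)" (is ?e)
    "(\<Sum>b\<in>{b \<in> bas v. odd (v + tgt b + deg b)}. f (tgt b)) = (\<Sum>u=v..n. \<Sum>w=1..u. f w)" (is ?o)
proof -
  define df where "df w = (if v \<le> w then w - v else v - w)" for w
  have R: "(\<Sum>u=v..n. \<Sum>w=1..u. f w) = (\<Sum>(u, w)\<in>(SIGMA u:{v..n}. {1..u}). f w)"
    by (rule sum.Sigma) auto
  show ?e unfolding R
  \<comment> \<open>The degree is the distance of v and w plus 2s, and the bound d + v + w \<le> 2n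
    says that u = n - s is at least v and w.\<close>
  proof (rule sum.reindex_bij_witness[where i = "\<lambda>(u, w). (v, w, df w + 2 * (n - u))" and j = "\<lambda>b. (n - (deg b - df (tgt b)) div 2, tgt b)"])
    fix b assume b: "b \<in> {b \<in> bas v. even (v + tgt b + deg b)}"
    obtain w d where bd: "b = (v, w, d)" using b by (cases b) (auto simp: bas_def)
    have a: "al (v, w, d)" and ev: "even (v + w + d)" using b bd by (auto simp: bas_def)
    note H = al_evD[OF a ev]
    have df: "df w \<le> d" using H by (auto simp: df_def)
    have par: "even (d - df w)" using ev df by (auto simp: df_def)
    then obtain s where s: "d = df w + 2 * s" using df by (metis dvdE le_add_diff_inverse)
    have sn: "s + v \<le> n" "s + w \<le> n" using H s by (auto simp: df_def split: if_splits)
    show "(case (n - (deg b - df (tgt b)) div 2, tgt b) of (u, w) \<Rightarrow> (v, w, df w + 2 * (n - u))) = b"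
      using sn by (simp add: bd s)
    show "(n - (deg b - df (tgt b)) div 2, tgt b) \<in> (SIGMA u:{v..n}. {1..u})"
      using sn H by (auto simp: bd s)
    show "(case (n - (deg b - df (tgt b)) div 2, tgt b) of (u, w) \<Rightarrow> f w) = f (tgt b)" by simp
  next
    fix x assume "x \<in> (SIGMA u:{v..n}. {1..u})"
    then obtain u w where x: "x = (u, w)" "v \<le> u" "u \<le> n" "1 \<le> w" "w \<le> u" by auto
    show "(n - (deg (case x of (u, w) \<Rightarrow> (v, w, df w + 2 * (n - u))) - df (tgt (case x of (u, w) \<Rightarrow> (v, w, df w + 2 * (n - u))))) div 2,
        tgt (case x of (u, w) \<Rightarrow> (v, w, df w + 2 * (n - u)))) = x"
      using x by simp
    have ev: "even (v + w + (df w + 2 * (n - u)))" by (auto simp: df_def)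
    have "al (v, w, df w + 2 * (n - u))"
      using x v by (intro al_evI ev) (auto simp: df_def)
    then show "(case x of (u, w) \<Rightarrow> (v, w, df w + 2 * (n - u))) \<in> {b \<in> bas v. even (v + tgt b + deg b)}"
      using ev by (simp add: x bas_def)
  qed
  show ?o unfolding R
  \<comment> \<open>In odd parity the shortest path passes the loop once and has length v + w - 1;
    again u = n - s.\<close>
  proof (rule sum.reindex_bij_witness[where i = "\<lambda>(u, w). (v, w, v + w - 1 + 2 * (n - u))" and j = "\<lambda>b. (n - (deg b + 1 - v - tgt b) div 2, tgt b)"])
    fix b assume b: "b \<in> {b \<in> bas v. odd (v + tgt b + deg b)}"
    obtain w d where bd: "b = (v, w, d)" using b by (cases b) (auto simp: bas_def)
    have a: "al (v, w, d)" and od: "odd (v + w + d)" using b bd by (auto simp: bas_def)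
    note H = al_odD[OF a od]
    have "even (d + 1 - (v + w))" using od H by auto
    then obtain s where "d + 1 - (v + w) = 2 * s" by (rule dvdE)
    then have s: "d = v + w - 1 + 2 * s" using H v by linarith
    have sn: "s + v \<le> n" "s + w \<le> n" using H s v by linarith+
    have q: "d + 1 - v - w = 2 * s" using s v by linarith
    show "(case (n - (deg b + 1 - v - tgt b) div 2, tgt b) of (u, w) \<Rightarrow> (v, w, v + w - 1 + 2 * (n - u))) = b"
      using sn s q by (simp add: bd)
    show "(n - (deg b + 1 - v - tgt b) div 2, tgt b) \<in> (SIGMA u:{v..n}. {1..u})"
      using sn H q by (auto simp: bd)
    show "(case (n - (deg b + 1 - v - tgt b) div 2, tgt b) of (u, w) \<Rightarrow> f w) = f (tgt b)" by simp
  next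
    fix x assume "x \<in> (SIGMA u:{v..n}. {1..u})"
    then obtain u w where x: "x = (u, w)" "v \<le> u" "u \<le> n" "1 \<le> w" "w \<le> u" by auto
    have "v + w - 1 + 2 * (n - u) + 1 - v - w = 2 * (n - u)" using v x by linarith
    then show "(n - (deg (case x of (u, w) \<Rightarrow> (v, w, v + w - 1 + 2 * (n - u))) + 1 - v - tgt (case x of (u, w) \<Rightarrow> (v, w, v + w - 1 + 2 * (n - u)))) div 2,
        tgt (case x of (u, w) \<Rightarrow> (v, w, v + w - 1 + 2 * (n - u)))) = x"
      using x by simp
    have od: "odd (v + w + (v + w - 1 + 2 * (n - u)))" using v by presburger
    have "al (v, w, v + w - 1 + 2 * (n - u))"
      using x v by (intro al_odI od) linarith+
    then show "(case x of (u, w) \<Rightarrow> (v, w, v + w - 1 + 2 * (n - u))) \<in> {b \<in> bas v. odd (v + tgt b + deg b)}"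
      using od by (simp add: x bas_def)
  qed
qed

text \<open>\<theta> is 1 on the even half of the basis and -1 on the odd half, and both halves have
  the same end points with the same multiplicities; hence the factor 1 + (-1)^k.\<close>

lemma sum_bas_theta:
  fixes f :: "nat \<Rightarrow> (cell \<Rightarrow>\<^sub>0 'k)"
  assumes v: "1 \<le> v"
  shows "(\<Sum>b\<in>bas v. scp (theta b ^ k) (f (tgt b))) = (\<Sum>u=v..n. \<Sum>w=1..u. f w) + scp ((-1) ^ k) (\<Sum>u=v..n. \<Sum>w=1..u. f w)"
proof -
  let ?E = "{b \<in> bas v. even (v + tgt b + deg b)}" and ?O = "{b \<in> bas v. odd (v + tgt b + deg b)}"
  have th: "(theta b :: 'k) = (-1) ^ (v + tgt b + deg b)" if "b \<in> bas v" for b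
    using that by (cases b) (auto simp: theta_def bas_def)
  have "(\<Sum>b\<in>bas v. scp (theta b ^ k) (f (tgt b))) = (\<Sum>b\<in>?E \<union> ?O. scp (theta b ^ k) (f (tgt b)))"
    by (rule sum.cong) auto
  also have "\<dots> = (\<Sum>b\<in>?E. scp (theta b ^ k) (f (tgt b))) + (\<Sum>b\<in>?O. scp (theta b ^ k) (f (tgt b)))"
    by (rule sum.union_disjoint) auto
  also have "(\<Sum>b\<in>?E. scp (theta b ^ k) (f (tgt b))) = (\<Sum>b\<in>?E. f (tgt b))"
    by (rule sum.cong) (auto simp: th)
  also have "(\<Sum>b\<in>?O. scp (theta b ^ k) (f (tgt b))) = scp ((-1) ^ k) (\<Sum>b\<in>?O. f (tgt b))"
    unfolding pmv.scale_sum_right by (rule sum.cong) (auto simp: th)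
  finally show ?thesis unfolding sum_bas_parity[OF v] .
qed

text \<open>The dual of b, a loop of degree d and b together have degree 2n - 1 + d, which exceeds
  that of the socle unless d = 0.\<close>

lemma D_V3:
  assumes "al (v, v, d)"
  shows "lext D (VV (Suc (Suc (Suc (3 * k)))) v d) = (if d = 0 then
      (\<Sum>u=v..n. \<Sum>w=1..u. VV (Suc (Suc (3 * k))) w (2 * n - 1))
        + scp ((-1) ^ Suc k) (\<Sum>u=v..n. \<Sum>w=1..u. VV (Suc (Suc (3 * k))) w (2 * n - 1)) else 0)"
proof -
  let ?i = "Suc (Suc (3 * k))"
  have v: "1 \<le> v" "v \<le> n" using al_bounds[OF assms] by auto
  have s: "tg (Suc ?i) (Tv (tgt b)) (LM b (HM (dual b) (sg [(v, v, d)]))) = (if d = 0 then VV ?i (tgt b) (2 * n - 1) else 0)" if b: "b \<in> bas v" for b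
  proof -
    obtain w e where be: "b = (v, w, e)" "al (v, w, e)" using b by (cases b) (auto simp: bas_def)
    have e: "e \<le> 2 * n - 1" "1 \<le> w" "w \<le> n" using al_bounds[OF be(2)] by auto
    have db: "al (w, v, 2 * n - 1 - e)" using al_dual[OF be(2)] by simp
    have soc: "al (w, w, 2 * n - 1)" using e n1 by (simp add: al_loop)
    have "LM b (HM (dual b) (sg [(v, v, d)])) = dw [mu (mu (dual b) (v, v, d)) b]"
      by (simp add: hm_def lm_def)
    moreover have "mu (mu (dual b) (v, v, d)) b = (if d = 0 then (w, w, 2 * n - 1) else Oz)"
    proof (cases "d = 0")
      case True
      have "mu (dual b) (v, v, d) = dual b" using True al_dual[OF be(2)] be mu_idt_right[of "dual b" v] by simp
      then show ?thesis using True e db be soc by simp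
    next
      case False
      have "\<not> al (w, w, 2 * n - 1 - e + d + e)" using False e al_deg[of w w "2 * n - 1 - e + d + e"] by auto
      then show ?thesis using False by (auto simp: be)
    qed
    ultimately have LB: "LM b (HM (dual b) (sg [(v, v, d)])) = dw [if d = 0 then (w, w, 2 * n - 1) else Oz]"
      by (simp only:)
    have "tgt b = w" by (simp add: be)
    then show ?thesis unfolding LB using soc al_neq_O[OF soc] by (simp add: dw_def VV_def tg_lin)
  qed
  have "lext D (VV (Suc ?i) v d) = (\<Sum>b\<in>bas v. scp (theta b ^ Suc k) (if d = 0 then VV ?i (tgt b) (2 * n - 1) else 0))"
    using assms by (simp only: VV_def if_True D_single dh_3) (intro sum.cong refl arg_cong[where f = "scp _"], use s in \<open>simp add: VV_def\<close>)
  then show ?thesis using sum_bas_theta[OF v(1), of "Suc k" "\<lambda>w. VV ?i w (2 * n - 1)"] by simp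
qed

lemma D_V0: "lext D (VV 0 v d) = 0"
  by (simp add: VV_def D_single dh_0 co_def tg_lin)

text \<open>The Casimir map sends an idempotent to a double sum of socle elements, over u from v to
  n and w from 1 to u. First differences remove the outer sum and second differences the inner one,
  so for odd k the boundary of \<open>dll\<close> is twice a single socle element.\<close>

definition dl :: "nat \<Rightarrow> nat \<Rightarrow> (cell \<Rightarrow>\<^sub>0 'k)" where "dl i v = VV i v 0 - VV i (Suc v) 0"
definition dll :: "nat \<Rightarrow> nat \<Rightarrow> (cell \<Rightarrow>\<^sub>0 'k)" where "dll i v = dl i v - (if v = 1 then 0 else dl i (v - 1))"

text \<open>Like \<open>hc\<close>, this was found by inverting the leading term of the differential in each degree
  mod 6; the classes \<open>hom_rep\<close> below are the cells that are left over.\<close>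

definition small_homotopy :: "cell \<Rightarrow> (cell \<Rightarrow>\<^sub>0 'k)" where
  "small_homotopy x = (case x of (p, t, l) \<Rightarrow> let i = p - 1; k = i div 3; d = deg (hd l) in
     if i mod 3 = 0 then (case t of Tv v \<Rightarrow> if d = 0 then 0
          else if even d then AA (Suc i) (TL (Suc v)) (d - 1)
          else if v = 1 then (if even k then 0 else scp (1/2) (AA (Suc i) (TL 1) (d - 1)))
          else - AA (Suc i) (TL v) (d - 1) | _ \<Rightarrow> 0)
     else if i mod 3 = 1 then (case t of
          TU u \<Rightarrow> if odd d then VV (Suc i) (Suc u) (d - 1) else - VV (Suc i) u (d - 1)
        | TL v \<Rightarrow> if v = 1 \<and> even k \<and> odd d then scp (1/2) (VV (Suc i) 1 (d - 1)) else 0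
        | _ \<Rightarrow> 0)
     else (case t of Tv v \<Rightarrow> if odd k \<and> d = 2 * n - 1 then scp (1/2) (dll (Suc i) v) else 0 | _ \<Rightarrow> 0))"

text \<open>These four equivalences are the matchings behind \<open>small_homotopy\<close>: by
  parity, a loop at v or at v + 1 is paired with the edge between v and v + 1 in the adjacent
  degree, and one is in the basis exactly when the other is.\<close>

lemma al_E1: "even d \<Longrightarrow> 0 < d \<Longrightarrow> al (v, Suc v, d - 1) \<longleftrightarrow> al (v, v, d)"
  unfolding al_edge al_loop by auto
lemma al_E2: "odd d \<Longrightarrow> 1 \<le> v \<Longrightarrow> al (v, Suc v, d - 1) \<longleftrightarrow> al (Suc v, Suc v, d)"
  unfolding al_edge al_loop by (cases d) auto
lemma al_E3: "odd d \<Longrightarrow> 1 \<le> v \<Longrightarrow> al (v, Suc v, d) \<longleftrightarrow> al (Suc v, Suc v, d - 1)"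
  unfolding al_edge al_loop by (cases d) auto
lemma al_E4: "even d \<Longrightarrow> d + 2 \<le> 2 * n \<Longrightarrow> 1 \<le> v \<Longrightarrow> al (v, Suc v, d) \<longleftrightarrow> 0 < d \<and> al (v, v, d - 1)"
  unfolding al_edge al_loop by (cases d) auto

lemma AA_TLS: "1 \<le> v \<Longrightarrow> AA i (TL (Suc v)) d = (if al (v, Suc v, d) then sg (Suc i, TL (Suc v), [(v, Suc v, d)]) else 0)"
  using AA_TL[of i "v - 1" d] by simp

lemmas AA_1' = AA_1[unfolded One_nat_def]

lemma S3e: "even d \<Longrightarrow> 0 < d \<Longrightarrow> 1 \<le> v \<Longrightarrow> lext small_homotopy (VV (3 * k) v d) = AA (Suc (3 * k)) (TL (Suc v)) (d - 1)"
  using al_E1[of d v] by (simp add: VV_def small_homotopy_def AA_TLS)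
lemma S3o: "odd d \<Longrightarrow> 1 \<le> v \<Longrightarrow> lext small_homotopy (VV (3 * k) (Suc v) d) = - AA (Suc (3 * k)) (TL (Suc v)) (d - 1)"
  using al_E2[of d v] odd_pos[of d] by (auto simp: VV_def small_homotopy_def AA_TLS Let_def)
lemma S3o1: "odd d \<Longrightarrow> lext small_homotopy (VV (3 * k) 1 d) = (if even k then 0 else scp (1/2) (AA (Suc (3 * k)) (TL 1) (d - 1)))"
proof -
  assume d: "odd d"
  then have e: "d - 1 + 1 \<le> 2 * n \<longleftrightarrow> d + 1 \<le> 2 * n" by presburger
  show ?thesis using d al_one[of d] odd_pos[OF d] unfolding AA_1 e by (simp add: VV_def small_homotopy_def AA_1' Let_def)
qed
lemma S30: "lext small_homotopy (VV (3 * k) v 0) = 0"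
  by (simp add: VV_def small_homotopy_def)
lemma S1L: "2 \<le> v \<Longrightarrow> lext small_homotopy (AA (Suc (3 * k)) (TL v) d) = 0"
  by (simp add: AA_def small_homotopy_def mod_Suc)
lemma S1Uo: "odd d \<Longrightarrow> 1 \<le> v \<Longrightarrow> lext small_homotopy (AA (Suc (3 * k)) (TU v) d) = VV (Suc (Suc (3 * k))) (Suc v) (d - 1)"
  using al_E3[of d v] by (simp add: AA_TU VV_def small_homotopy_def mod_Suc)
lemma S1Ue: "even d \<Longrightarrow> d + 2 \<le> 2 * n \<Longrightarrow> 1 \<le> v \<Longrightarrow> 0 < d \<Longrightarrow> lext small_homotopy (AA (Suc (3 * k)) (TU v) d) = - VV (Suc (Suc (3 * k))) v (d - 1)"
  using al_E4[of d v] by (simp add: AA_TU VV_def small_homotopy_def mod_Suc)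
lemma S11: "lext small_homotopy (AA (Suc (3 * k)) (TL 1) d) = (if even k \<and> odd d then scp (1/2) (VV (Suc (Suc (3 * k))) 1 (d - 1)) else 0)"
proof (cases "d + 1 \<le> 2 * n")
  case False
  then have "\<not> al (1, 1, d - 1)" if "odd d" using that al_loop[of 1 "d - 1"] by (auto elim!: oddE)
  then show ?thesis using False by (auto simp: AA_1' VV_def)
qed (simp add: AA_1' small_homotopy_def mod_Suc div_Suc Let_def)
lemma S2: "lext small_homotopy (VV (Suc (Suc (3 * k))) v d) = (if al (v, v, d) \<and> odd k \<and> d = 2 * n - 1 then scp (1/2) (dll (Suc (Suc (Suc (3 * k)))) v) else 0)"
  by (auto simp: VV_def small_homotopy_def mod_Suc div_Suc)

text \<open>The boundary of an edge is a difference of neighbouring loops, so a match leaves an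
  error at a neighbour, above in one parity and below in the other. The rank measures the distance
  to the end in that direction.\<close>

definition small_rank :: "cell \<Rightarrow> nat" where
  "small_rank x = (case x of (p, t, l) \<Rightarrow> let d = deg (hd l) in case t of
      Tv v \<Rightarrow> if even d then n - v else v
    | TL v \<Rightarrow> if odd d then n - v else v
    | TU u \<Rightarrow> if odd d then n - Suc u else Suc u)"

lemma VV_small_cells: "i mod 3 \<noteq> 1 \<Longrightarrow> VV i v d \<in> vs (small_cells i)"
  using al_bounds[of v v d] by (auto simp: VV_def small_cells_def CL_def tag_ok_def path_words_def AL_def vs_intros)
lemma AA_small_cells: "i mod 3 = 1 \<Longrightarrow> AA i c d \<in> vs (small_cells i)"
  by (auto simp: AA_def small_cells_def CL_def tag_ok_def path_words_def AL_def vs_intros)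

definition LS :: "nat \<Rightarrow> nat \<Rightarrow> cell set" where "LS i r = {y \<in> small_cells i. small_rank y < r}"

lemma VV_low: "i mod 3 \<noteq> 1 \<Longrightarrow> (al (v, v, d) \<Longrightarrow> (if even d then n - v else v) < r) \<Longrightarrow> VV i v d \<in> vs (LS i r)"
  using VV_small_cells[of i v d] by (auto simp: VV_def LS_def small_rank_def vs_intros split: if_splits)
lemma TLS_low: "i mod 3 = 1 \<Longrightarrow> 1 \<le> v \<Longrightarrow> (al (v, Suc v, d) \<Longrightarrow> (if odd d then n - Suc v else Suc v) < r) \<Longrightarrow> AA i (TL (Suc v)) d \<in> vs (LS i r)"
  using AA_small_cells[of i "TL (Suc v)" d] by (auto simp: AA_TLS LS_def small_rank_def vs_intros split: if_splits)
lemma TU_low: "i mod 3 = 1 \<Longrightarrow> 1 \<le> v \<Longrightarrow> (al (v, Suc v, d) \<Longrightarrow> (if odd d then n - Suc v else Suc v) < r) \<Longrightarrow> AA i (TU v) d \<in> vs (LS i r)"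
  using AA_small_cells[of i "TU v" d] by (auto simp: AA_TU LS_def small_rank_def vs_intros split: if_splits)
lemma TL1_low: "i mod 3 = 1 \<Longrightarrow> (if odd d then n - 1 else 1) < r \<Longrightarrow> AA i (TL 1) d \<in> vs (LS i r)"
  using AA_small_cells[of i "TL 1" d] by (auto simp: AA_1' LS_def small_rank_def vs_intros split: if_splits)

text \<open>For odd d an edge outside the basis has both adjacent loops outside as well, so the
  formula is unconditional and sums over all vertices telescope.\<close>

lemma D_TLS_odd:
  assumes "odd d" "1 \<le> v"
  shows "lext D (AA (Suc (3 * k)) (TL (Suc v)) d) = VV (3 * k) v (Suc d) - VV (3 * k) (Suc v) (Suc d)"
proof (cases "al (v, Suc v, d)")
  case True
  then show ?thesis using assms D_TL[of "Suc v" k d] by (simp add: AA_TLS) (metis keys_sg insert_not_empty keys_zero)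
next
  case False
  then have "\<not> al (v, v, Suc d)" "\<not> al (Suc v, Suc v, Suc d)" using assms unfolding al_edge al_loop by auto
  then show ?thesis using False assms by (simp add: AA_TLS VV_def)
qed

lemma sg_neq_0 [simp]: "(sg x :: 'x \<Rightarrow>\<^sub>0 'k) \<noteq> 0"
  by (metis keys_sg insert_not_empty keys_zero)

lemma D_TLS: "1 \<le> v \<Longrightarrow> al (v, Suc v, d) \<Longrightarrow> lext D (AA (Suc (3 * k)) (TL (Suc v)) d) = VV (3 * k) v (Suc d) - VV (3 * k) (Suc v) (Suc d)"
  using D_TL[of "Suc v" k d] by (simp add: AA_TLS)

lemma D_TUS: "al (v, Suc v, d) \<Longrightarrow> lext D (AA (Suc (3 * k)) (TU v) d) = VV (3 * k) (Suc v) (Suc d) - VV (3 * k) v (Suc d)"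
  using D_TU[of k v d] by (simp add: AA_TU)

lemma PP_zero: "PP i k v (2 * n) = 0"
proof -
  have "\<not> al (a, b, 2 * n)" for a b using al_deg[of a b "2 * n"] n1 by auto
  then show ?thesis by (simp add: PP_def AA_def)
qed

lemma PP_Suc: "1 \<le> v \<Longrightarrow> PP i k (Suc v) d = AA i (TL (Suc v)) d + AA i (TU v) d"
  by (simp add: PP_def)
lemma PP_1: "PP i k 1 d = AA i (TL 1) d + scp ((-1) ^ k) (AA i (TL 1) d)"
  by (simp add: PP_def)

lemma PP_last: "PP i k (Suc n) d = 0"
  using n1 by (simp add: PP_def AA_def)

lemma D_V2_even:
  assumes "even d" "1 \<le> v" "v \<le> n"
  shows "lext D (VV (Suc (Suc (3 * k))) v d) = PP (Suc (3 * k)) k v (Suc d) - PP (Suc (3 * k)) k (Suc v) (Suc d)"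
proof (cases "al (v, v, d)")
  case False
  then have d: "2 * n < d + 2 * v" using assms by (simp add: al_loop)
  have 1: "\<not> al (v, Suc v, Suc d)" using d assms by (simp add: al_edge)
  have 2: "PP (Suc (3 * k)) k v (Suc d) = 0"
  proof (cases "v = 1")
    case True
    then show ?thesis using d by (simp add: PP_1[unfolded One_nat_def] AA_1[unfolded One_nat_def])
  next
    case False
    then obtain u where u: "v = Suc u" "1 \<le> u" using assms by (cases v) auto
    have "\<not> al (u, Suc u, Suc d)" using d assms u by (simp add: al_edge)
    then show ?thesis using u by (simp add: PP_Suc AA_TLS AA_TU)
  qed
  show ?thesis using False 1 2 assms by (simp add: PP_Suc AA_TLS AA_TU VV_def)
qed (rule D_V2)

definition TT :: "nat \<Rightarrow> nat \<Rightarrow> (cell \<Rightarrow>\<^sub>0 'k)" where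
  "TT i v = (\<Sum>u=v..n. \<Sum>w=1..u. VV i w (2 * n - 1))"

lemma D_V30: "1 \<le> v \<Longrightarrow> v \<le> Suc n \<Longrightarrow> lext D (VV (Suc (Suc (Suc (3 * k)))) v 0) =
   TT (Suc (Suc (3 * k))) v + scp ((-1) ^ Suc k) (TT (Suc (Suc (3 * k))) v)"
  using D_V3[of v 0 k] by (cases "v = Suc n") (auto simp: TT_def al_idt)

lemma D_dl: "odd k \<Longrightarrow> 1 \<le> v \<Longrightarrow> v \<le> n \<Longrightarrow> lext D (dl (Suc (Suc (Suc (3 * k)))) v) = scp 2 (\<Sum>w=1..v. VV (Suc (Suc (3 * k))) w (2 * n - 1))"
proof -
  assume a: "odd k" "1 \<le> v" "v \<le> n"
  have "TT (Suc (Suc (3 * k))) v = (\<Sum>w=1..v. VV (Suc (Suc (3 * k))) w (2 * n - 1)) + TT (Suc (Suc (3 * k))) (Suc v)"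
    using a unfolding TT_def by (simp add: sum.atLeast_Suc_atMost)
  moreover have "scp (2 :: 'k) z = z + z" for z :: "cell \<Rightarrow>\<^sub>0 'k"
    by (intro poly_mapping_eqI) (simp add: lookup_add)
  moreover have "lext D (VV (Suc (Suc (Suc (3 * k)))) v 0) = TT (Suc (Suc (3 * k))) v + TT (Suc (Suc (3 * k))) v"
    using D_V30[of v k] a by simp
  moreover have "lext D (VV (Suc (Suc (Suc (3 * k)))) (Suc v) 0) = TT (Suc (Suc (3 * k))) (Suc v) + TT (Suc (Suc (3 * k))) (Suc v)"
    using D_V30[of "Suc v" k] a by simp
  ultimately show ?thesis by (simp add: dl_def lext_diff)
qed

lemma D_dll: "odd k \<Longrightarrow> 1 \<le> v \<Longrightarrow> v \<le> n \<Longrightarrow> lext D (scp (1/2) (dll (Suc (Suc (Suc (3 * k)))) v)) = VV (Suc (Suc (3 * k))) v (2 * n - 1)"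
proof -
  assume a: "odd k" "1 \<le> v" "v \<le> n"
  have "lext D (dll (Suc (Suc (Suc (3 * k)))) v) = scp 2 (VV (Suc (Suc (3 * k))) v (2 * n - 1))"
  proof (cases "v = 1")
    case True
    then show ?thesis using D_dl[OF a] by (simp add: dll_def)
  next
    case False
    then obtain u where u: "v = Suc u" "1 \<le> u" using a by (cases v) auto
    then show ?thesis using D_dl[OF a] D_dl[of k u] a by (simp add: dll_def lext_lin pmv.scale_right_distrib)
  qed
  then show ?thesis using two by (simp add: lext_lin)
qed

lemma sum_dll: "1 \<le> u \<Longrightarrow> (\<Sum>w=1..u. dll i w) = dl i u"
proof (induction u rule: nat_induct_at_least)
  case base
  then show ?case by (simp add: dll_def)
next
  case (Suc m)
  then show ?case by (simp add: dll_def)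
qed

lemma sum_dl: "v \<le> m \<Longrightarrow> (\<Sum>u=v..m. dl i u) = VV i v 0 - VV i (Suc m) 0"
  by (induction m rule: nat_induct_at_least) (simp_all add: dl_def)

text \<open>The second differences telescope back over the double sum and return the idempotent at
  v, because the one at n + 1 is 0.\<close>

lemma small_homotopy_TT: "odd k \<Longrightarrow> 1 \<le> v \<Longrightarrow> v \<le> n \<Longrightarrow> lext small_homotopy (TT (Suc (Suc (3 * k))) v) = scp (1/2) (VV (Suc (Suc (Suc (3 * k)))) v 0)"
proof -
  assume a: "odd k" "1 \<le> v" "v \<le> n"
  let ?i = "Suc (Suc (3 * k))"
  have soc: "al (w, w, 2 * n - 1)" if "1 \<le> w" "w \<le> n" for w using that by (auto simp: al_loop)
  have "lext small_homotopy (TT ?i v) = (\<Sum>u=v..n. \<Sum>w=1..u. scp (1/2) (dll (Suc ?i) w))"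
    unfolding TT_def lext_sum using a soc by (intro sum.cong refl) (auto simp: S2)
  also have "\<dots> = scp (1/2) (\<Sum>u=v..n. \<Sum>w=1..u. dll (Suc ?i) w)" by (simp add: pmv.scale_sum_right)
  also have "(\<Sum>u=v..n. \<Sum>w=1..u. dll (Suc ?i) w) = (\<Sum>u=v..n. dl (Suc ?i) u)"
    using a by (intro sum.cong refl sum_dll) auto
  finally show ?thesis using a by (simp add: sum_dl)
qed

section \<open>Representatives of the homology classes\<close>

definition hom_index :: "nat \<Rightarrow> nat set" where "hom_index i = (if i = 0 then {..<2 * n} else {..<n})"

text \<open>For even k: odd powers of the loop, even powers on the loop generator, and the socle
  elements. For odd k: idempotents, odd powers on the loop generator corrected to cycles, and sums
  of the loops of one even degree over all vertices. In degree 0 the idempotents are added, since no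
  Casimir map leaves that degree.\<close>

definition hom_rep :: "nat \<Rightarrow> nat \<Rightarrow> (cell \<Rightarrow>\<^sub>0 'k)" where
  "hom_rep i j = (if i mod 3 = 0 then
        (if even (i div 3) then (if j < n then VV i 1 (2 * j + 1) else VV i (Suc (j - n)) 0) else VV i (Suc j) 0)
     else if i mod 3 = 1 then
        (if even (i div 3) then AA i (TL 1) (2 * j)
         else AA i (TL 1) (2 * j + 1) - scp 2 (\<Sum>v=2..n. AA i (TL v) (2 * j + 1)))
     else (if even (i div 3) then VV i (Suc j) (2 * n - 1) else (\<Sum>v=1..n. VV i v (2 * j))))"

definition hom_span :: "nat \<Rightarrow> (cell \<Rightarrow>\<^sub>0 'k) set" where
  "hom_span i = {\<Sum>j\<in>hom_index i. scp (c j) (hom_rep i j) | c. True}"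

lemma finite_hom_index [simp]: "finite (hom_index i)" by (simp add: hom_index_def)

lemma hom_rep_hom_span: "j \<in> hom_index i \<Longrightarrow> hom_rep i j \<in> hom_span i"
proof -
  assume j: "j \<in> hom_index i"
  have "(\<Sum>l\<in>hom_index i. scp (if l = j then 1 else 0) (hom_rep i l)) = (\<Sum>l\<in>hom_index i. if l = j then hom_rep i l else 0)"
    by (intro sum.cong) auto
  also have "\<dots> = hom_rep i j" using j by (simp add: sum.delta')
  finally show ?thesis unfolding hom_span_def by (auto intro!: exI[of _ "\<lambda>l. if l = j then 1 else 0"])
qed

lemma subspace_hom_span: "pmv.subspace (hom_span i)"
proof (unfold pmv.subspace_def, intro conjI ballI allI)
  have mem: "(\<Sum>j\<in>hom_index i. scp (c j) (hom_rep i j)) \<in> hom_span i" for c unfolding hom_span_def by blast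
  show "0 \<in> hom_span i" using mem[of "\<lambda>_. 0"] by simp
  fix x assume "x \<in> hom_span i"
  then obtain c where x: "x = (\<Sum>j\<in>hom_index i. scp (c j) (hom_rep i j))" unfolding hom_span_def by blast
  show "scp a x \<in> hom_span i" for a using mem[of "\<lambda>j. a * c j"] by (simp add: x pmv.scale_sum_right)
  fix y assume "y \<in> hom_span i"
  then obtain c' where y: "y = (\<Sum>j\<in>hom_index i. scp (c' j) (hom_rep i j))" unfolding hom_span_def by blast
  show "x + y \<in> hom_span i" using mem[of "\<lambda>j. c j + c' j"] by (simp add: x y pmv.scale_left_distrib sum.distrib)
qed

lemma lext_hom_span_0: "(\<And>j. j \<in> hom_index i \<Longrightarrow> lext f (hom_rep i j) = 0) \<Longrightarrow> w \<in> hom_span i \<Longrightarrow> lext f w = 0"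
  unfolding hom_span_def by (auto simp: lext_lin)

lemma mod3_cases':
  fixes i :: nat
  obtains k where "i = 3 * k" | k where "i = Suc (3 * k)" | k where "i = Suc (Suc (3 * k))"
proof -
  define k where "k = i div 3"
  have "i = 3 * k \<or> i = Suc (3 * k) \<or> i = Suc (Suc (3 * k))"
    unfolding k_def by presburger
  then show thesis using that by blast
qed

lemma hom_rep_3: "hom_rep (3 * k) j = (if even k then (if j < n then VV (3 * k) 1 (2 * j + 1) else VV (3 * k) (Suc (j - n)) 0) else VV (3 * k) (Suc j) 0)"
  "hom_rep (Suc (3 * k)) j = (if even k then AA (Suc (3 * k)) (TL 1) (2 * j)
         else AA (Suc (3 * k)) (TL 1) (2 * j + 1) - scp 2 (\<Sum>v=2..n. AA (Suc (3 * k)) (TL v) (2 * j + 1)))"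
  "hom_rep (Suc (Suc (3 * k))) j = (if even k then VV (Suc (Suc (3 * k))) (Suc j) (2 * n - 1) else (\<Sum>v=1..n. VV (Suc (Suc (3 * k))) v (2 * j)))"
  by (simp_all add: hom_rep_def mod_Suc div_Suc)

lemma D_V3k_0:
  assumes "d \<noteq> 0 \<or> k = 0 \<or> odd k"
  shows "lext D (VV (3 * k) v d) = 0"
proof (cases k)
  case 0
  then show ?thesis by (simp add: D_V0)
next
  case (Suc k')
  show ?thesis
  proof (cases "al (v, v, d)")
    case True
    have k3: "3 * k = Suc (Suc (Suc (3 * k')))" by (simp add: Suc)
    show ?thesis unfolding k3 using D_V3[OF True, of k'] assms Suc by auto
  qed (simp add: VV_def)
qed

lemma telescope_2:
  fixes f :: "nat \<Rightarrow> 'v::ab_group_add"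
  shows "1 \<le> m \<Longrightarrow> (\<Sum>v=2..m. f (v - 1) - f v) = f 1 - f m"
  by (induction m rule: nat_induct_at_least) simp_all

lemma D_hom_rep: "j \<in> hom_index i \<Longrightarrow> lext D (hom_rep i j) = 0"
proof (cases i rule: mod3_cases')
  case (1 k)
  assume j: "j \<in> hom_index i"
  show ?thesis
  proof (cases "even k \<and> \<not> j < n")
    case True
    then have "k = 0" using j by (auto simp: hom_index_def 1 split: if_splits)
    then show ?thesis unfolding 1 hom_rep_3 using True D_V3k_0[where k = k and v = "Suc (j - n)" and d = 0] by simp
  next
    case False
    then show ?thesis by (auto simp: 1 hom_rep_3 D_V3k_0 simp del: One_nat_def)
  qed
next
  case (2 k)
  assume j: "j \<in> hom_index i"
  then have jn: "j < n" by (simp add: hom_index_def 2)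
  show ?thesis
  proof (cases "even k")
    case True
    then show ?thesis using D_TL1[of k "2 * j"] jn by (simp add: 2 hom_rep_3 AA_1[unfolded One_nat_def])
  next
    case False
    let ?d = "2 * j + 1"
    \<comment> \<open>The boundaries of the edges telescope to the loop at vertex 1, while the loop
      generator has twice this boundary since k is odd. This is the origin of the coefficient 2 in
      \<open>hom_rep\<close>.\<close>
    have "(\<Sum>v=2..n. lext D (AA (Suc (3 * k)) (TL v) ?d)) = (\<Sum>v=2..n. VV (3 * k) (v - 1) (Suc ?d) - VV (3 * k) v (Suc ?d))"
    proof (rule sum.cong[OF refl])
      fix v assume "v \<in> {2..n}"
      then obtain u where "v = Suc u" "1 \<le> u" by (cases v) auto
      then show "lext D (AA (Suc (3 * k)) (TL v) ?d) = VV (3 * k) (v - 1) (Suc ?d) - VV (3 * k) v (Suc ?d)"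
        using D_TLS_odd[of ?d u k] by simp
    qed
    also have "\<dots> = VV (3 * k) 1 (Suc ?d) - VV (3 * k) n (Suc ?d)"
      by (rule telescope_2[OF n1])
    also have "VV (3 * k) n (Suc ?d) = 0" by (simp add: VV_def al_loop)
    finally have s: "(\<Sum>v=2..n. lext D (AA (Suc (3 * k)) (TL v) ?d)) = VV (3 * k) 1 (Suc ?d)" by simp
    have "AA (Suc (3 * k)) (TL 1) ?d \<noteq> 0" using jn by (simp add: AA_1')
    note t = D_TL1[OF this]
    have S: "lext D (\<Sum>v=2..n. AA (Suc (3 * k)) (TL v) ?d) = VV (3 * k) 1 (Suc ?d)"
      unfolding lext_sum by (rule s)
    have "scp (2 :: 'k) z = z + z" for z :: "cell \<Rightarrow>\<^sub>0 'k"
      by (intro poly_mapping_eqI) (simp add: lookup_add)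
    then show ?thesis unfolding 2 hom_rep_3 if_not_P[OF False] lext_diff lext_scp S t using False by simp
  qed
next
  case (3 k)
  assume j: "j \<in> hom_index i"
  then have jn: "j < n" by (simp add: hom_index_def 3)
  show ?thesis
  proof (cases "even k")
    case True
    have a: "al (Suc j, Suc j, 2 * n - 1)" using jn by (simp add: al_loop)
    have "Suc (2 * n - 1) = 2 * n" using n1 by simp
    then show ?thesis using True D_V2[OF a, of k] by (simp add: 3 hom_rep_3 PP_zero)
  next
    case False
    \<comment> \<open>Telescoping over all vertices leaves the loop term, which is 0 for odd k, and
      the term beyond n, where there is no edge.\<close>
    have "(\<Sum>v=1..m. lext D (VV (Suc (Suc (3 * k))) v (2 * j))) = PP (Suc (3 * k)) k 1 (Suc (2 * j)) - PP (Suc (3 * k)) k (Suc m) (Suc (2 * j))" if "m \<le> n" for m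
      using that by (induction m) (simp_all add: D_V2_even)
    then show ?thesis using False by (simp add: 3 hom_rep_3 lext_sum PP_last PP_1[unfolded One_nat_def])
  qed
qed

lemma small_homotopy_hom_rep: "j \<in> hom_index i \<Longrightarrow> lext small_homotopy (hom_rep i j) = 0"
proof (cases i rule: mod3_cases')
  case (1 k)
  then show ?thesis by (simp add: hom_rep_3 S3o1 S30 del: One_nat_def)
next
  case (2 k)
  have "lext small_homotopy (\<Sum>v=2..n. AA (Suc (3 * k)) (TL v) (2 * j + 1)) = 0"
    unfolding lext_sum by (rule sum.neutral) (simp add: S1L)
  then show ?thesis by (simp add: 2 hom_rep_3 S11 lext_diff lext_scp del: One_nat_def)
next
  case (3 k)
  have "2 * j \<noteq> 2 * n - Suc 0" using n1 by presburger
  then show ?thesis by (simp add: 3 hom_rep_3 S2 lext_sum)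
qed

lemma hom_rep_small_cells: "hom_rep i j \<in> vs (small_cells i)"
  unfolding hom_rep_def by (auto intro!: vs_intros VV_small_cells AA_small_cells)

section \<open>The local condition, one kind of cell at a time\<close>

definition small_local :: "nat \<Rightarrow> nat \<Rightarrow> (cell \<Rightarrow>\<^sub>0 'k) \<Rightarrow> bool" where
  "small_local i r X \<longleftrightarrow> (\<exists>w\<in>hom_span i. \<exists>u\<in>vs (LS i r). lext D (lext small_homotopy X) + lext small_homotopy (lext D X) = X + w + u)"

lemma small_local_I: "lext D (lext small_homotopy X) + lext small_homotopy (lext D X) = X + w + u \<Longrightarrow> w \<in> hom_span i \<Longrightarrow> u \<in> vs (LS i r) \<Longrightarrow> small_local i r X"
  unfolding small_local_def by blast

lemma small_local_low: "lext D (lext small_homotopy X) + lext small_homotopy (lext D X) = X + u \<Longrightarrow> u \<in> vs (LS i r) \<Longrightarrow> small_local i r X"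
  using pmv.subspace_0[OF subspace_hom_span] by (intro small_local_I[of X 0 u]) auto

lemma small_local_mem: "X \<in> hom_span i \<Longrightarrow> lext D (lext small_homotopy X) = 0 \<Longrightarrow> lext D X = 0 \<Longrightarrow> small_local i r X"
  using pmv.subspace_neg[OF subspace_hom_span, of X i]
  by (intro small_local_I[of X "- X" 0]) (auto simp: vs_intros)

lemma half_half [simp]: "scp (1/2) z + scp (1/2) z = (z :: 'x \<Rightarrow>\<^sub>0 'k)"
  using half[of z] by (simp only: pmv.scale_right_distrib)

lemma scp_2: "scp (2 :: 'k) z = z + z" for z :: "'x \<Rightarrow>\<^sub>0 'k"
  by (intro poly_mapping_eqI) (simp add: lookup_add)

lemma loc_3k:
  assumes a: "al (v, v, d)"
  shows "small_local (3 * k) (if even d then n - v else v) (VV (3 * k) v d)"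
proof -
  let ?X = "VV (3 * k) v d"
  have v: "1 \<le> v" "v \<le> n" using al_bounds[OF a] by auto
  have m: "(3 * k) mod 3 \<noteq> 1" by simp
  have eWm: "hom_rep (3 * k) j \<in> hom_span (3 * k)" if "j < n \<or> k = 0 \<and> j < 2 * n" for j
    using that by (intro hom_rep_hom_span) (auto simp: hom_index_def)
  consider "d = 0" "k = 0 \<or> odd k" | "d = 0" "k \<noteq> 0" "even k" | "d \<noteq> 0" "even d" | "odd d" "v = 1" | "odd d" "v \<noteq> 1"
    by blast
  then show ?thesis
  proof cases
    case 1
    have "?X \<in> hom_span (3 * k)"
    proof (cases "k = 0")
      case True
      have "VV 0 v 0 = hom_rep 0 (v - 1 + n)" using v by (simp add: hom_rep_def)
      moreover have "v - 1 + n < 2 * n" using v by simp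
      ultimately show ?thesis using eWm[of "v - 1 + n"] True 1 by (simp del: One_nat_def)
    next
      case False
      then have "?X = hom_rep (3 * k) (v - 1)" using v 1 by (simp add: hom_rep_3)
      moreover have "v - 1 < n" using v by simp
      ultimately show ?thesis using eWm[of "v - 1"] by (simp del: One_nat_def)
    qed
    then show ?thesis using 1 by (intro small_local_mem) (simp_all add: S30 D_V3k_0)
  next
    \<comment> \<open>For even k > 0 the idempotents are not cycles: the Casimir map sends them to
      twice \<open>TT\<close>, and the homotopy leads back.\<close>
    case 2
    then obtain k' where k': "k = Suc k'" "odd k'" by (cases k) auto
    have k3: "3 * k = Suc (Suc (Suc (3 * k')))" by (simp add: k')
    have D: "lext D (VV (3 * k) v 0) = TT (Suc (Suc (3 * k'))) v + TT (Suc (Suc (3 * k'))) v"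
      unfolding k3 using D_V30[of v k'] v k' by simp
    have "lext small_homotopy (lext D (VV (3 * k) v 0)) = VV (3 * k) v 0"
      unfolding D lext_add small_homotopy_TT[OF k'(2) v] unfolding k3 by simp
    then show ?thesis using 2 by (intro small_local_low[of _ 0]) (simp_all add: S30 vs_intros)
  next
    case 3
    have e: "al (v, Suc v, d - 1)" using al_E1[of d v] 3 a by simp
    have "lext D (lext small_homotopy ?X) = ?X - VV (3 * k) (Suc v) d"
      using 3 v D_TLS[OF v(1) e] by (simp add: S3e)
    moreover have "lext D ?X = 0" using 3 by (simp add: D_V3k_0)
    moreover have "- VV (3 * k) (Suc v) d \<in> vs (LS (3 * k) (n - v))"
      by (intro vs_intros VV_low m) (use 3 in \<open>auto simp: al_loop\<close>)
    ultimately show ?thesis using 3 by (intro small_local_low[of _ "- VV (3 * k) (Suc v) d"]) auto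
  next
    case 4
    show ?thesis
    proof (cases "even k")
      case True
      obtain j where j: "d = 2 * j + 1" using 4 by (auto elim: oddE)
      have "d + 1 \<le> 2 * n" using a 4 by (simp add: al_loop)
      then have jn: "j < n" using j by simp
      then have "?X = hom_rep (3 * k) j" using True by (simp add: hom_rep_3 j 4)
      then have "?X \<in> hom_span (3 * k)" using eWm[of j] jn by simp
      then show ?thesis using 4 True by (intro small_local_mem) (simp_all add: S3o1[unfolded One_nat_def] D_V3k_0 odd_pos)
    next
      case False
      have d: "d + 1 \<le> 2 * n" using a 4 by (simp add: al_loop)
      have nz: "AA (Suc (3 * k)) (TL 1) (d - 1) \<noteq> 0" using d 4 by (simp add: AA_1')
      have d1: "Suc (d - 1) = d" using 4 odd_pos by simp
      \<comment> \<open>For odd k the twisted commutator with the loop doubles instead of vanishing,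
        so one half of the loop cell has boundary X.\<close>
      have "lext D (AA (Suc (3 * k)) (TL 1) (d - 1)) = ?X + ?X"
        using D_TL1[OF nz] 4 False unfolding d1 by simp
      then have "lext D (lext small_homotopy ?X) = ?X"
        using 4 False S3o1[of d k] by (simp add: lext_scp)
      then show ?thesis using 4 by (intro small_local_low[of _ 0]) (simp_all add: D_V3k_0 vs_intros odd_pos)
    qed
  next
    case 5
    then obtain u where u: "v = Suc u" "1 \<le> u" using v by (cases v) auto
    have e: "al (u, Suc u, d - 1)" using al_E2[of d u] 5 u a by simp
    have d1: "Suc (d - 1) = d" using 5 odd_pos by simp
    have "lext D (lext small_homotopy ?X) = ?X - VV (3 * k) u d"
      using 5 u D_TLS[OF u(2) e, of k] unfolding d1 by (simp add: S3o lext_uminus)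
    moreover have "lext D ?X = 0" using 5 by (simp add: D_V3k_0 odd_pos)
    moreover have "- VV (3 * k) u d \<in> vs (LS (3 * k) v)"
      by (intro vs_intros VV_low m) (use 5 u in auto)
    ultimately show ?thesis using 5 by (intro small_local_low[of _ "- VV (3 * k) u d"]) auto
  qed
qed

text \<open>The homotopy vanishes on these edges, and they are recovered from their boundary: by
  parity, its lower or its upper end is matched with the edge itself.\<close>

lemma loc_TL:
  assumes v: "1 \<le> v" and a: "al (v, Suc v, d)"
  shows "small_local (Suc (3 * k)) (if odd d then n - Suc v else Suc v) (AA (Suc (3 * k)) (TL (Suc v)) d)"
proof -
  let ?i = "Suc (3 * k)"
  let ?X = "AA ?i (TL (Suc v)) d"
  have m: "?i mod 3 = 1" by (simp add: mod_Suc)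
  have vn: "v < n" using a by (simp add: al_edge)
  have h: "lext small_homotopy ?X = 0" using S1L[of "Suc v" k d] v by simp
  note D = D_TLS[OF v a, of k]
  show ?thesis
  proof (cases "odd d")
    case True
    have "lext small_homotopy (lext D ?X) = ?X - AA ?i (TL (Suc (Suc v))) d"
      unfolding D lext_diff using True v by (simp add: S3e)
    moreover have "- AA ?i (TL (Suc (Suc v))) d \<in> vs (LS ?i (n - Suc v))"
      by (intro vs_intros TLS_low m) (use True v in \<open>auto simp: al_edge\<close>)
    ultimately show ?thesis using True h by (intro small_local_low[of _ "- AA ?i (TL (Suc (Suc v))) d"]) simp_all
  next
    case False
    have 1: "lext small_homotopy (VV (3 * k) (Suc v) (Suc d)) = - ?X" using False v by (simp add: S3o)
    have 2: "lext small_homotopy (VV (3 * k) v (Suc d)) \<in> vs (LS ?i (Suc v))"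
    proof (cases "v = 1")
      case True
      have "AA ?i (TL 1) d \<in> vs (LS ?i (Suc v))" using False v by (intro TL1_low m) auto
      then show ?thesis using S3o1[of "Suc d" k] False True by (auto simp: vs_intros)
    next
      case vv: False
      then obtain u where u: "v = Suc u" "1 \<le> u" using v by (cases v) auto
      have "AA ?i (TL v) d \<in> vs (LS ?i (Suc v))" using False u by (auto intro!: TLS_low m)
      then show ?thesis using S3o[of "Suc d" u k] False u by (simp add: vs_intros)
    qed
    show ?thesis using False h 1 2 by (intro small_local_low[of _ "lext small_homotopy (VV (3 * k) v (Suc d))"]) (simp_all add: D lext_diff)
  qed
qed

text \<open>The boundary of the matched loop contains both generators of the edge; applying the
  homotopy to the boundary of X removes the \<open>TL\<close> generator and leaves X.\<close>

lemma loc_TU: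
  assumes v: "1 \<le> v" and a: "al (v, Suc v, d)"
  shows "small_local (Suc (3 * k)) (if odd d then n - Suc v else Suc v) (AA (Suc (3 * k)) (TU v) d)"
proof -
  let ?i = "Suc (3 * k)" and ?j = "Suc (Suc (3 * k))"
  let ?X = "AA ?i (TU v) d"
  have m: "?i mod 3 = 1" by (simp add: mod_Suc)
  have vn: "v < n" using a by (simp add: al_edge)
  note D = D_TUS[OF a, of k]
  show ?thesis
  proof (cases "odd d")
    case True
    have d1: "Suc (d - 1) = d" using True odd_pos by simp
    have b: "al (Suc v, Suc v, d - 1)" using al_E3[OF True v] a by simp
    have "lext D (lext small_homotopy ?X) = PP ?i k (Suc v) d - PP ?i k (Suc (Suc v)) d"
      using D_V2[OF b, of k] S1Uo[OF True v, of k] unfolding d1 by simp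
    moreover have "lext small_homotopy (lext D ?X) = AA ?i (TL (Suc (Suc v))) d - AA ?i (TL (Suc v)) d"
      unfolding D lext_diff using True v by (simp add: S3e)
    ultimately have "lext D (lext small_homotopy ?X) + lext small_homotopy (lext D ?X) = ?X + (- AA ?i (TU (Suc v)) d)"
      using v by (simp add: PP_Suc)
    moreover have "- AA ?i (TU (Suc v)) d \<in> vs (LS ?i (n - Suc v))"
      by (intro vs_intros TU_low m) (use True v in \<open>auto simp: al_edge\<close>)
    ultimately show ?thesis using True by (intro small_local_low) auto
  next
    case False
    have d: "d + 2 \<le> 2 * n" using a False by (simp add: al_edge)
    have b: "0 < d" "al (v, v, d - 1)" using al_E4[of d v] a d False v by auto
    have d1: "Suc (d - 1) = d" using b by simp
    have h1: "lext D (lext small_homotopy ?X) = - (PP ?i k v d - PP ?i k (Suc v) d)"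
      using D_V2[OF b(2), of k] S1Ue[of d v k] False d v b(1) unfolding d1 by (simp add: lext_uminus)
    have h2: "lext small_homotopy (lext D ?X) = - AA ?i (TL (Suc v)) d - lext small_homotopy (VV (3 * k) v (Suc d))"
      unfolding D lext_diff using False v by (simp add: S3o)
    have low: "- PP ?i k v d - lext small_homotopy (VV (3 * k) v (Suc d)) \<in> vs (LS ?i (Suc v))"
    proof (cases "v = 1")
      case True
      have A: "AA ?i (TL 1) d \<in> vs (LS ?i (Suc v))" using False v by (intro TL1_low m) auto
      have "PP ?i k v d \<in> vs (LS ?i (Suc v))" using A unfolding True PP_1 by (intro vs_intros)
      moreover have "lext small_homotopy (VV (3 * k) v (Suc d)) \<in> vs (LS ?i (Suc v))"
        using S3o1[of "Suc d" k] False True A by (auto simp: vs_intros)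
      ultimately show ?thesis by (intro vs_intros)
    next
      case vv: False
      then obtain u where u: "v = Suc u" "1 \<le> u" using v by (cases v) auto
      have "- PP ?i k v d - lext small_homotopy (VV (3 * k) v (Suc d)) = - AA ?i (TU u) d"
        using S3o[of "Suc d" u k] False u by (simp add: PP_Suc)
      moreover have "AA ?i (TU u) d \<in> vs (LS ?i (Suc v))" using False u by (intro TU_low m) auto
      ultimately show ?thesis by (simp add: vs_intros)
    qed
    have "lext D (lext small_homotopy ?X) + lext small_homotopy (lext D ?X) = ?X + (- PP ?i k v d - lext small_homotopy (VV (3 * k) v (Suc d)))"
      unfolding h1 h2 using v by (simp add: PP_Suc)
    then show ?thesis using low False by (intro small_local_low) auto
  qed
qed

lemma loc_TL1:
  assumes a: "d + 1 \<le> 2 * n"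
  shows "small_local (Suc (3 * k)) (if odd d then n - 1 else 1) (AA (Suc (3 * k)) (TL 1) d)"
proof -
  let ?i = "Suc (3 * k)" and ?j = "Suc (Suc (3 * k))"
  let ?X = "AA ?i (TL 1) d"
  have m: "?i mod 3 = 1" by (simp add: mod_Suc)
  have nz: "?X \<noteq> 0" using a by (simp add: AA_1')
  note D = D_TL1[OF nz]
  have eWm: "hom_rep ?i j \<in> hom_span ?i" if "j < n" for j
    using that by (intro hom_rep_hom_span) (auto simp: hom_index_def)
  have lowL: "AA ?i (TL u) d \<in> vs (LS ?i (n - 1))" if "odd d" "2 \<le> u" for u
  proof -
    obtain u' where u: "u = Suc u'" "1 \<le> u'" using \<open>2 \<le> u\<close> by (cases u) auto
    show ?thesis unfolding u(1) using that u by (intro TLS_low m) (auto simp: al_edge)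
  qed
  consider "even k" "even d" | "even k" "odd d" | "odd k" "even d" | "odd k" "odd d" by blast
  then show ?thesis
  proof cases
    case 1
    obtain j where j: "d = 2 * j" using 1 by (auto elim: evenE)
    have "?X = hom_rep ?i j" using 1 by (simp add: hom_rep_3 j)
    moreover have "j < n" using a j by simp
    ultimately have "?X \<in> hom_span ?i" using eWm by simp
    then show ?thesis using 1 D S11[of k d] by (intro small_local_mem) simp_all
  next
    case 2
    have d1: "Suc (d - 1) = d" using 2 odd_pos by simp
    have b: "al (1, 1, d - 1)" using al_one[of "d - 1"] a by simp
    \<comment> \<open>For even k the loop enters once for each direction, with equal signs; halving
      restores X and leaves an error on the first edge.\<close>
    have "lext D (VV ?j 1 (d - 1)) = ?X + ?X - PP ?i k 2 d"
      using D_V2[OF b, of k] 2 unfolding d1 PP_1 by (simp add: numeral_2_eq_2)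
    then have "lext D (lext small_homotopy ?X) = ?X + scp (- (1/2)) (PP ?i k 2 d)"
      using 2 S11[of k d] by (simp add: lext_scp pmv.scale_right_diff_distrib)
    moreover have "lext D ?X = 0" using 2 D by simp
    moreover have "PP ?i k 2 d \<in> vs (LS ?i (n - 1))"
    proof -
      have "AA ?i (TU 1) d \<in> vs (LS ?i (n - 1))" using 2 by (intro TU_low m) (auto simp: al_edge)
      then show ?thesis using lowL[of 2] 2 by (simp add: PP_def vs_intros)
    qed
    ultimately show ?thesis using 2 by (intro small_local_low[of _ "scp (- (1/2)) (PP ?i k 2 d)"]) (auto intro!: vs_intros)
  next
    case 3
    have "lext small_homotopy (lext D ?X) = ?X"
      unfolding D using 3 S3o1[of "Suc d" k] by (simp add: lext_lin)
    moreover have "lext small_homotopy ?X = 0" using 3 S11[of k d] by simp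
    ultimately show ?thesis using 3 by (intro small_local_low[of _ 0]) (simp_all add: vs_intros)
  next
    case 4
    obtain j where j: "d = 2 * j + 1" using 4 by (auto elim: oddE)
    have jn: "j < n" using a j by simp
    \<comment> \<open>For odd k and d this loop cell is the leading term of a class; the correction
      lives on edges of lower rank.\<close>
    define S where "S = (\<Sum>v=2..n. AA ?i (TL v) d)"
    have w: "hom_rep ?i j = ?X - scp 2 S" using 4 by (simp add: hom_rep_3 j S_def)
    have "Suc 1 = (2 :: nat)" by simp
    then have "lext small_homotopy (VV (3 * k) 1 (Suc d)) = AA ?i (TL 2) d" using 4 S3e[of "Suc d" 1 k] by (simp del: One_nat_def)
    then have "lext small_homotopy (lext D ?X) = scp 2 (AA ?i (TL 2) d)"
      unfolding D using 4 by (simp add: lext_lin scp_2 del: One_nat_def)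
    then have "lext D (lext small_homotopy ?X) + lext small_homotopy (lext D ?X) = ?X + (- hom_rep ?i j) + (scp 2 (AA ?i (TL 2) d) - scp 2 S)"
      using 4 S11[of k d] by (simp add: w)
    moreover have "- hom_rep ?i j \<in> hom_span ?i" using eWm[OF jn] by (rule pmv.subspace_neg[OF subspace_hom_span])
    moreover have "scp 2 (AA ?i (TL 2) d) - scp 2 S \<in> vs (LS ?i (n - 1))"
      unfolding S_def using lowL 4 by (intro vs_intros) auto
    ultimately have "small_local ?i (n - 1) ?X" by (rule small_local_I)
    then show ?thesis using 4 by simp
  qed
qed

lemma small_homotopy_PP_odd: "odd d \<Longrightarrow> 1 \<le> v \<Longrightarrow> lext small_homotopy (PP (Suc (3 * k)) k (Suc v) d) = VV (Suc (Suc (3 * k))) (Suc v) (d - 1)"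
  using S1L[of "Suc v" k d] by (simp add: PP_Suc lext_add S1Uo)
lemma small_homotopy_PP_odd1: "odd d \<Longrightarrow> lext small_homotopy (PP (Suc (3 * k)) k 1 d) = (if even k then VV (Suc (Suc (3 * k))) 1 (d - 1) else 0)"
  unfolding PP_1 using S11[of k d] by (simp add: lext_add lext_scp flip: pmv.scale_right_distrib)
lemma small_homotopy_PP_even: "even d \<Longrightarrow> d + 2 \<le> 2 * n \<Longrightarrow> 0 < d \<Longrightarrow> 1 \<le> v \<Longrightarrow> lext small_homotopy (PP (Suc (3 * k)) k (Suc v) d) = - VV (Suc (Suc (3 * k))) v (d - 1)"
  using S1L[of "Suc v" k d] by (simp add: PP_Suc lext_add S1Ue)
lemma small_homotopy_PP_even1: "even d \<Longrightarrow> lext small_homotopy (PP (Suc (3 * k)) k 1 d) = 0"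
  unfolding PP_1 using S11[of k d] by (simp add: lext_add lext_scp)

lemma loc_3k2:
  assumes a: "al (v, v, d)"
  shows "small_local (Suc (Suc (3 * k))) (if even d then n - v else v) (VV (Suc (Suc (3 * k))) v d)"
proof -
  let ?i = "Suc (3 * k)" and ?j = "Suc (Suc (3 * k))"
  let ?X = "VV ?j v d"
  have v: "1 \<le> v" "v \<le> n" using al_bounds[OF a] by auto
  have m: "?j mod 3 \<noteq> 1" by (simp add: mod_Suc)
  have eWm: "hom_rep ?j l \<in> hom_span ?j" if "l < n" for l
    using that by (intro hom_rep_hom_span) (auto simp: hom_index_def)
  note D = D_V2[OF a, of k]
  show ?thesis
  proof (cases "even d")
    case True
    have dn: "d \<noteq> 2 * n - 1" using True n1 by presburger
    have h: "lext small_homotopy ?X = 0" using dn by (simp add: S2)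
    have hs: "lext small_homotopy (PP ?i k (Suc v) (Suc d)) = VV ?j (Suc v) d" using small_homotopy_PP_odd[of "Suc d" v k] True v by simp
    have low: "VV ?j u d \<in> vs (LS ?j (n - v))" if "v < u" for u
      by (intro VV_low m) (use True that in \<open>auto simp: al_loop\<close>)
    show ?thesis
    proof (cases "v = 1 \<and> odd k")
      \<comment> \<open>For odd k the contribution of the loop cancels, so the cell at vertex 1
        stays unmatched; it is the leading term of the sum over all vertices.\<close>
      case vk: True
      obtain l where l: "d = 2 * l" using True by (auto elim: evenE)
      have "d + 2 * 1 \<le> 2 * n" using a vk True by (auto simp: al_loop)
      then have ln: "l < n" using l by simp
      have w: "hom_rep ?j l = (\<Sum>v=1..n. VV ?j v d)" using vk by (simp add: hom_rep_3 l)
      also have "\<dots> = ?X + (\<Sum>v=2..n. VV ?j v d)" using n1 vk by (simp add: sum.atLeast_Suc_atMost numeral_2_eq_2)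
      finally have w: "hom_rep ?j l = ?X + (\<Sum>v=2..n. VV ?j v d)" .
      have "lext small_homotopy (lext D ?X) = - VV ?j (Suc v) d"
        unfolding D lext_diff hs using small_homotopy_PP_odd1[of "Suc d" k] vk True by simp
      then have "lext D (lext small_homotopy ?X) + lext small_homotopy (lext D ?X) = ?X + (- hom_rep ?j l) + ((\<Sum>v=2..n. VV ?j v d) - VV ?j (Suc v) d)"
        unfolding w using h by simp
      moreover have "- hom_rep ?j l \<in> hom_span ?j" using eWm[OF ln] by (rule pmv.subspace_neg[OF subspace_hom_span])
      moreover have "(\<Sum>v=2..n. VV ?j v d) - VV ?j (Suc v) d \<in> vs (LS ?j (n - v))"
        using low vk by (intro vs_intros) auto
      ultimately have "small_local ?j (n - v) ?X" by (rule small_local_I)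
      then show ?thesis using True by simp
    next
      case False
      have "lext small_homotopy (PP ?i k v (Suc d)) = ?X"
      proof (cases "v = 1")
        case v1: True
        then show ?thesis using False small_homotopy_PP_odd1[of "Suc d" k] True by simp
      next
        case v1: False
        then obtain u where "v = Suc u" "1 \<le> u" using v by (cases v) auto
        then show ?thesis using small_homotopy_PP_odd[of "Suc d" u k] True by simp
      qed
      then have "lext D (lext small_homotopy ?X) + lext small_homotopy (lext D ?X) = ?X + (- VV ?j (Suc v) d)"
        unfolding D lext_diff hs using h by simp
      then show ?thesis using True low[of "Suc v"] by (intro small_local_low[of _ "- VV ?j (Suc v) d"]) (auto simp: vs_intros)
    qed
  next
    case od: False
    have d0: "d + 1 \<le> 2 * n" using a od by (simp add: al_loop)
    show ?thesis
    proof (cases "d = 2 * n - 1")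
      case False
      then have d2: "Suc d + 2 \<le> 2 * n" using d0 od by presburger
      have h: "lext small_homotopy ?X = 0" using False by (simp add: S2)
      have hs: "lext small_homotopy (PP ?i k (Suc v) (Suc d)) = - ?X" using small_homotopy_PP_even[of "Suc d" v k] d2 od v by simp
      have "lext small_homotopy (PP ?i k v (Suc d)) \<in> vs (LS ?j v)"
      proof (cases "v = 1")
        case v1: True
        then show ?thesis using small_homotopy_PP_even1[of "Suc d" k] od by (simp add: vs_intros)
      next
        case v1: False
        then obtain u where u: "v = Suc u" "1 \<le> u" using v by (cases v) auto
        have "VV ?j u d \<in> vs (LS ?j v)" by (intro VV_low m) (use od u in auto)
        then show ?thesis using small_homotopy_PP_even[of "Suc d" u k] d2 od u by (simp add: vs_intros)
      qed
      moreover have "lext D (lext small_homotopy ?X) + lext small_homotopy (lext D ?X) = ?X + lext small_homotopy (PP ?i k v (Suc d))"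
        unfolding D lext_diff hs using h by simp
      ultimately show ?thesis using od by (intro small_local_low) auto
    next
      \<comment> \<open>The socle is a class for even k; for odd k it is the boundary of half a
        second difference of idempotents.\<close>
      case True
      have "Suc d = 2 * n" using True n1 by simp
      then have D0: "lext D ?X = 0" using D by (simp add: PP_zero)
      show ?thesis
      proof (cases "even k")
        case ev: True
        have "?X = hom_rep ?j (v - 1)" using ev v True by (simp add: hom_rep_3)
        moreover have "v - 1 < n" using v by simp
        ultimately have "?X \<in> hom_span ?j" using eWm[of "v - 1"] by (simp del: One_nat_def)
        then show ?thesis using ev D0 by (intro small_local_mem) (simp_all add: S2)
      next
        case False
        have "lext small_homotopy ?X = scp (1/2) (dll (Suc ?j) v)" using False True a by (simp add: S2)
        then have "lext D (lext small_homotopy ?X) = ?X" using D_dll[OF False v] True by simp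
        then show ?thesis using D0 by (intro small_local_low[of _ 0]) (simp_all add: vs_intros)
      qed
    qed
  qed
qed

lemma small_cells_E:
  assumes "x \<in> small_cells i"
  obtains t b where "x = (Suc i, t, [b])" "tag_ok i t" "al b" "src b = rr t" "tgt b = ss t"
proof -
  obtain t l where x: "x = (Suc i, t, l)" "tag_ok i t" "l \<in> path_words (rr t) (ss t) (Suc 0)"
    using assms unfolding small_cells_def by (rule CL_Suc_E)
  then obtain b where "l = [b]" by (cases l; cases "tl l") (auto simp: path_words_def AL_def)
  then show thesis using that x by (auto simp: path_words_def AL_def)
qed

lemma loc_small_cells:
  assumes "x \<in> small_cells i"
  shows "small_local i (small_rank x) (sg x)"
proof -
  obtain t b where x: "x = (Suc i, t, [b])" "tag_ok i t" "al b" "src b = rr t" "tgt b = ss t"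
    using assms by (rule small_cells_E)
  obtain d where b: "b = (rr t, ss t, d)" using x by (cases b) auto
  show ?thesis
  proof (cases i rule: mod3_cases')
    case (1 k)
    then obtain v where t: "t = Tv v" using x by (auto simp: tag_ok_1)
    have "sg x = VV (3 * k) v d" using x(3) by (simp add: x(1) t b VV_def 1)
    then show ?thesis using loc_3k[of v d k] x(3) by (simp add: x(1) t b 1 small_rank_def)
  next
    case (3 k)
    then obtain v where t: "t = Tv v" using x by (auto simp: tag_ok_1)
    have "sg x = VV (Suc (Suc (3 * k))) v d" using x(3) by (simp add: x(1) t b VV_def 3)
    then show ?thesis using loc_3k2[of v d k] x(3) by (simp add: x(1) t b 3 small_rank_def)
  next
    case (2 k)
    have t: "ar t" using x(2) by (simp add: 2 tag_ok_1)
    then have X: "sg x = AA (Suc (3 * k)) t d" using x(3) by (simp add: x(1) b AA_def 2)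
    show ?thesis
    proof (cases t)
      case (TL v)
      show ?thesis
      proof (cases "v = 1")
        case True
        have "d + 1 \<le> 2 * n" using x(3) al_one[of d] by (simp add: b TL True)
        from loc_TL1[OF this, of k] show ?thesis unfolding X by (cases "even d") (simp_all add: x(1) b TL True 2 small_rank_def)
      next
        case False
        then obtain u where u: "v = Suc u" "1 \<le> u" using t TL by (cases v) auto
        have "al (u, Suc u, d)" using x(3) u by (simp add: b TL)
        from loc_TL[OF u(2) this, of k] show ?thesis unfolding X by (simp add: x(1) b TL u 2 small_rank_def)
      qed
    next
      case (TU v)
      have v: "1 \<le> v" using t TU by simp
      have "al (v, Suc v, d)" using x(3) al_sym[of "Suc v" v d] by (simp add: b TU)
      from loc_TU[OF v this, of k] show ?thesis unfolding X by (simp add: x(1) b TU 2 small_rank_def)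
    qed (use t in simp)
  qed
qed

lemma small_homotopy_small_cells: "x \<in> small_cells i \<Longrightarrow> small_homotopy x \<in> vs (small_cells (Suc i))"
proof -
  assume "x \<in> small_cells i"
  then obtain t b where x: "x = (Suc i, t, [b])" by (rule small_cells_E)
  consider "i mod 3 = 0" | "i mod 3 = 1" | "i mod 3 = 2" by linarith
  then show ?thesis
  proof cases
    case 1
    then have m: "Suc i mod 3 = 1" by (simp add: mod_Suc)
    show ?thesis unfolding x small_homotopy_def Let_def using 1 AA_small_cells[OF m]
      by (auto simp: vs_intros split: tag.split)
  next
    case 2
    then have m: "Suc i mod 3 \<noteq> 1" by (simp add: mod_Suc)
    show ?thesis unfolding x small_homotopy_def Let_def using 2 VV_small_cells[OF m]
      by (auto simp: vs_intros split: tag.split)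
  next
    case 3
    then have m: "Suc i mod 3 \<noteq> 1" by (simp add: mod_Suc)
    show ?thesis unfolding x small_homotopy_def Let_def using 3 VV_small_cells[OF m]
      by (auto simp: dll_def dl_def vs_intros split: tag.split)
  qed
qed

lemma hom_rep_independent:
  assumes 0: "(\<Sum>j\<in>hom_index i. scp (c j) (hom_rep i j)) = 0" and j: "j \<in> hom_index i"
  shows "c j = 0"
proof -
  \<comment> \<open>A coordinate that separates the j-th class from the others: sums over vertices
    are detected at vertex 1, corrected classes at the loop.\<close>
  have "\<exists>\<xi>. lookup (hom_rep i j) \<xi> = 1 \<and> (\<forall>l\<in>hom_index i. l \<noteq> j \<longrightarrow> lookup (hom_rep i l) \<xi> = 0)"
  proof (cases i rule: mod3_cases')
    case (1 k)
    show ?thesis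
    proof (cases "even k")
      case True
      have JJ: "l < n \<or> k = 0 \<and> l < 2 * n" if "l \<in> hom_index i" for l using that 1 by (auto simp: hom_index_def split: if_splits)
      show ?thesis
      proof (cases "j < n")
        case jn: True
        show ?thesis
          by (rule exI[of _ "(Suc i, Tv 1, [(1, 1, 2 * j + 1)])"])
             (use True jn in \<open>auto simp: 1 hom_rep_3 VV_def lookup_sg al_loop\<close>)
      next
        case jn: False
        show ?thesis
          by (rule exI[of _ "(Suc i, Tv (Suc (j - n)), [(Suc (j - n), Suc (j - n), 0)])"])
             (use True jn JJ[OF j] in \<open>auto simp: 1 hom_rep_def VV_def lookup_sg al_loop\<close>)
      qed
    next
      case False
      have "j < n" using j False 1 by (auto simp: hom_index_def split: if_splits)
      then show ?thesis
        by (intro exI[of _ "(Suc i, Tv (Suc j), [(Suc j, Suc j, 0)])"])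
           (use False in \<open>auto simp: 1 hom_rep_3 VV_def lookup_sg al_loop\<close>)
    qed
  next
    case (2 k)
    have jn: "j < n" using j 2 by (auto simp: hom_index_def)
    show ?thesis
    proof (cases "even k")
      case True
      then show ?thesis using jn
        by (intro exI[of _ "(Suc i, TL 1, [(1, 1, 2 * j)])"]) (auto simp: 2 hom_rep_3 AA_1' lookup_sg)
    next
      case False
      have z: "lookup (AA (Suc (3 * k)) (TL v) d) (Suc i, TL 1, [(1, 1, d')]) = 0" if "v \<in> {2..n}" for v d d'
        using that by (auto simp: AA_def lookup_sg)
      then have "lookup (\<Sum>v=2..n. AA (Suc (3 * k)) (TL v) d) (Suc i, TL 1, [(1, 1, d')]) = 0" for d d'
        unfolding lookup_sum by (intro sum.neutral) blast
      then show ?thesis using jn False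
        by (intro exI[of _ "(Suc i, TL 1, [(1, 1, 2 * j + 1)])"]) (auto simp: 2 hom_rep_3 AA_1' lookup_sg lookup_minus)
    qed
  next
    case (3 k)
    have jn: "j < n" using j 3 by (auto simp: hom_index_def)
    show ?thesis
    proof (cases "even k")
      case True
      then show ?thesis using jn
        by (intro exI[of _ "(Suc i, Tv (Suc j), [(Suc j, Suc j, 2 * n - 1)])"]) (auto simp: 3 hom_rep_3 VV_def lookup_sg al_loop)
    next
      case False
      have e: "lookup (\<Sum>v=1..n. VV (Suc (Suc (3 * k))) v (2 * l)) (Suc i, Tv 1, [(1, 1, 2 * j)]) = (if l = j then 1 else 0)" for l
      proof -
        have "lookup (\<Sum>v=1..n. VV (Suc (Suc (3 * k))) v (2 * l)) (Suc i, Tv 1, [(1, 1, 2 * j)])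
          = (\<Sum>v=1..n. if v = 1 then (if l = j then 1 else 0) else 0)"
          unfolding lookup_sum using jn by (intro sum.cong) (auto simp: VV_def lookup_sg al_loop 3)
        then show ?thesis using n1 by simp
      qed
      show ?thesis using False
        by (intro exI[of _ "(Suc i, Tv 1, [(1, 1, 2 * j)])"]) (simp add: 3 hom_rep_3 e[unfolded 3 One_nat_def])
    qed
  qed
  then obtain \<xi> where \<xi>: "lookup (hom_rep i j) \<xi> = 1" "\<And>l. l \<in> hom_index i \<Longrightarrow> l \<noteq> j \<Longrightarrow> lookup (hom_rep i l) \<xi> = 0" by blast
  have "0 = lookup (\<Sum>l\<in>hom_index i. scp (c l) (hom_rep i l)) \<xi>" using 0 by simp
  also have "\<dots> = (\<Sum>l\<in>hom_index i. if l = j then c l else 0)"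
    unfolding lookup_sum using \<xi> by (intro sum.cong) auto
  also have "\<dots> = c j" using j by simp
  finally show ?thesis by simp
qed

text \<open>The representatives span a subcomplex with zero differential, so its homology is the
  span itself.\<close>

theorem small_homology: "qdim scp (cycles small_cells D i) (boundaries small_cells D i) (if i = 0 then 2 * n else n)"
proof -
  have z: "lext D w = 0" "lext small_homotopy w = 0" if "w \<in> hom_span i" for w i
    using lext_hom_span_0[OF D_hom_rep that] lext_hom_span_0[OF small_homotopy_hom_rep that] by simp_all
  have "qdim scp {w \<in> hom_span i. lext D w = 0} (lext D ` hom_span (Suc i)) (card (hom_index i)) \<longleftrightarrow> qdim scp (cycles small_cells D i) (boundaries small_cells D i) (card (hom_index i))"
  proof (rule morse_quasi_iso[where h = small_homotopy and rk = small_rank])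
    show "hom_span i \<subseteq> vs (small_cells i)" for i
      unfolding hom_span_def by (auto intro!: vs_intros hom_rep_small_cells)
    show "\<exists>w\<in>hom_span i. \<exists>u\<in>vs {y \<in> small_cells i. small_rank y < small_rank x}. lext D (small_homotopy x) + lext small_homotopy (D x) = sg x + w + u" if "x \<in> small_cells i" for i x
      using loc_small_cells[OF that] by (simp add: small_local_def LS_def)
  qed (use z small_homotopy_small_cells D_D subspace_hom_span pmv.subspace_0[OF subspace_hom_span] in auto)
  moreover have "{w \<in> hom_span i. lext D w = 0} = hom_span i" using z by auto
  moreover have "lext D ` hom_span (Suc i) = {0}" using z pmv.subspace_0[OF subspace_hom_span[of "Suc i"]] by auto
  moreover have "qdim scp (hom_span i) {0} (card (hom_index i))"
    by (rule qdim_family[OF pmv.vector_space_axioms finite_hom_index _ hom_span_def]) (use hom_rep_independent in blast)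
  moreover have "card (hom_index i) = (if i = 0 then 2 * n else n)" by (simp add: hom_index_def)
  ultimately show ?thesis by simp
qed

corollary bar_homology: "qdim scp (cycles bar_cells D i) (boundaries bar_cells D i) (if i = 0 then 2 * n else n)"
  using small_homology bar_quasi_iso small_quasi_iso by blast

end

section \<open>Paths modulo the preprojective relations\<close>

context lalg
begin

fun plen :: "path \<Rightarrow> nat" where "plen (Triv v) = 0" | "plen (Pth as) = length as"

text \<open>Only a_i counts, with weight i: the two paths in the relation at v > 1 then have weights
  v - 1 and v, and the square of the loop has weight 0 = v - 1 as well.\<close>

fun wt :: "arr \<Rightarrow> nat" where "wt (Ar i) = i" | "wt _ = 0"

text \<open>The sign turns the relations into equalities of paths, so that all nonzero paths with the same end points
  and the same length become equal.\<close>

fun path_sign :: "path \<Rightarrow> 'k" where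
  "path_sign (Triv v) = 1" | "path_sign (Pth as) = (-1) ^ sum_list (map wt as)"

definition cls :: "path \<Rightarrow> tri" where "cls p = (psrc p, ptgt p, plen p)"
definition nform :: "path \<Rightarrow> tri" where "nform p = (if al (cls p) then cls p else Oz)"

abbreviation linked :: "arr list \<Rightarrow> bool" where "linked \<equiv> successively (\<lambda>a b. atgt a = asrc b)"

section \<open>The triples that come from paths\<close>

lemma valid_Pth: "valid_path n (Pth as) \<longleftrightarrow> as \<noteq> [] \<and> (\<forall>a\<in>set as. valid_arr n a) \<and> linked as"
  by (auto simp: successively_conv_nth)

lemma arr_bounds: "valid_arr n a \<Longrightarrow> 1 \<le> asrc a \<and> asrc a \<le> n \<and> 1 \<le> atgt a \<and> atgt a \<le> n"
  using n1 by (cases a) auto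

lemma valid_bounds: "valid_path n p \<Longrightarrow> 1 \<le> psrc p \<and> psrc p \<le> n \<and> 1 \<le> ptgt p \<and> ptgt p \<le> n"
proof (cases p)
  case (Pth as)
  assume "valid_path n p"
  then have "as \<noteq> []" "valid_arr n (hd as)" "valid_arr n (last as)" using Pth by (auto simp: valid_Pth)
  then show ?thesis using arr_bounds Pth by auto
qed simp

lemma pcat_props:
  assumes "valid_path n p" "valid_path n q" "ptgt p = psrc q"
  shows "valid_path n (pcat p q)" "psrc (pcat p q) = psrc p" "ptgt (pcat p q) = ptgt q"
    "plen (pcat p q) = plen p + plen q" "path_sign (pcat p q) = path_sign p * path_sign q"
proof -
  have "valid_path n (pcat p q) \<and> psrc (pcat p q) = psrc p \<and> ptgt (pcat p q) = ptgt q \<and>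
    plen (pcat p q) = plen p + plen q \<and> path_sign (pcat p q) = path_sign p * path_sign q"
  proof (cases p; cases q)
    fix as bs assume pq: "p = Pth as" "q = Pth bs"
    have "as \<noteq> []" "bs \<noteq> []" using assms pq by (auto simp: valid_Pth)
    then show ?thesis using assms pq
      by (auto simp: valid_Pth successively_append_iff power_add simp del: valid_path.simps)
  qed (use assms in auto)
  then show "valid_path n (pcat p q)" "psrc (pcat p q) = psrc p" "ptgt (pcat p q) = ptgt q"
    "plen (pcat p q) = plen p + plen q" "path_sign (pcat p q) = path_sign p * path_sign q" by simp_all
qed

lemma pcat_assoc: "pcat (pcat p q) r = pcat p (pcat q r)"
  if "valid_path n p" "valid_path n q" "valid_path n r" "ptgt p = psrc q" "ptgt q = psrc r"
  using that by (cases p; cases q; cases r) auto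

lemma path_snoc:
  assumes "valid_path n p" "plen p = Suc d"
  obtains p' c where "p = pcat p' (Pth [c])" "valid_path n p'" "valid_arr n c" "ptgt p' = asrc c" "plen p' = d"
proof -
  obtain as where p: "p = Pth as" using assms(2) by (cases p) auto
  then obtain bs c where as: "as = bs @ [c]" using assms by (cases as rule: rev_cases) auto
  show thesis
  proof (cases "bs = []")
    case True
    then show thesis using that[of "Triv (asrc c)" c] assms p as arr_bounds[of c] by auto
  next
    case False
    then show thesis using that[of "Pth bs" c] assms p as
      by (auto simp: valid_Pth successively_append_iff simp del: valid_path.simps)
  qed
qed

lemma walkable_arrow: "valid_arr n c \<Longrightarrow> walkable (asrc c, atgt c, 1)"
  using n1 by (cases c) (auto simp: walkable.simps)

lemma walkable_path: "valid_path n p \<Longrightarrow> walkable (cls p)"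
proof (induction "plen p" arbitrary: p)
  case 0
  then obtain v where "p = Triv v" by (cases p) auto
  then show ?case using 0 by (simp add: cls_def walkable.simps)
next
  case (Suc d)
  obtain p' c where pc: "p = pcat p' (Pth [c])" "valid_path n p'" "valid_arr n c" "ptgt p' = asrc c" "plen p' = d"
    using path_snoc[OF Suc.prems] Suc.hyps(2) by metis
  have "walkable (psrc p', asrc c, d)" using Suc.hyps(1)[of p'] pc by (simp add: cls_def)
  from walkable_comp[OF this walkable_arrow[OF pc(3)]] show ?case
    using pcat_props[OF pc(2), of "Pth [c]"] pc by (simp add: cls_def)
qed

text \<open>The converse of \<open>walkable_path\<close>. The last arrow comes from the side of i if
  j is not yet i, and otherwise, or if the sheet has to change, from below, with the loop at vertex
  1.\<close>

lemma path_ex: "walkable (i, j, d) \<Longrightarrow> \<exists>p. valid_path n p \<and> cls p = (i, j, d)"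
proof (induction d arbitrary: j)
  case 0
  then have "i = j" by (auto simp: walkable.simps split: if_splits)
  then show ?case using 0 by (intro exI[of _ "Triv i"]) (auto simp: walkable.simps cls_def)
next
  case (Suc d)
  note w = Suc.prems
  have b: "1 \<le> i" "i \<le> n" "1 \<le> j" "j \<le> n" using w by (auto simp: walkable.simps)
  have "\<exists>c. valid_arr n c \<and> atgt c = j \<and> walkable (i, asrc c, d)"
  proof (cases "even (i + j + Suc d)")
    case ev: True
    then have H: "i \<le> j + Suc d" "j \<le> i + Suc d" using w unfolding walkable.simps by metis+
    consider "i < j" | "j < i" | "i = j" "2 \<le> j" | "i = j" "j = 1" using b by linarith
    then show ?thesis
    proof cases
      case 1
      then obtain u where u: "j = Suc u" "1 \<le> u" using b by (cases j) auto
      have "even (i + u + d)" using ev u by simp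
      then have "walkable (i, u, d)" using H u b 1 by (simp add: walkable.simps)
      then show ?thesis using u b by (intro exI[of _ "Ar u"]) auto
    next
      case 2
      have "even (i + Suc j + d)" using ev by simp
      then have "walkable (i, Suc j, d)" using H b 2 by (simp add: walkable.simps)
      then show ?thesis using 2 b by (intro exI[of _ "Ab j"]) auto
    next
      case 3
      then obtain u where u: "j = Suc u" "1 \<le> u" by (cases j) auto
      have e: "even (i + u + d)" using ev u by simp
      have "odd d" using ev 3 by simp
      then have "1 \<le> d" by (cases d) auto
      then have "walkable (i, u, d)" using e H u b 3 by (simp add: walkable.simps)
      then show ?thesis using u b by (intro exI[of _ "Ar u"]) auto
    next
      case 4
      have o: "odd (i + 1 + d)" "odd d" using ev 4 by simp_all
      then have "1 \<le> d" by (cases d) auto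
      then have "walkable (i, 1, d)" using o 4 b by (simp add: walkable.simps)
      then show ?thesis using 4 by (intro exI[of _ Eps]) auto
    qed
  next
    case od: False
    then have H: "i + j \<le> Suc d + 1" using w unfolding walkable.simps by metis
    show ?thesis
    proof (cases "j = 1")
      case True
      have "even (i + 1 + d)" using od True by simp
      then have "walkable (i, 1, d)" using H b True by (simp add: walkable.simps)
      then show ?thesis using True by (intro exI[of _ Eps]) auto
    next
      case False
      then obtain u where u: "j = Suc u" "1 \<le> u" using b by (cases j) auto
      have "odd (i + u + d)" using od u by simp
      then have "walkable (i, u, d)" using H u b by (simp add: walkable.simps)
      then show ?thesis using u b by (intro exI[of _ "Ar u"]) auto
    qed
  qed
  then obtain c where c: "valid_arr n c" "atgt c = j" "walkable (i, asrc c, d)" by blast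
  obtain p where p: "valid_path n p" "cls p = (i, asrc c, d)" using Suc.IH[OF c(3)] by blast
  have q: "ptgt p = psrc (Pth [c])" using p by (simp add: cls_def)
  have "valid_path n (pcat p (Pth [c])) \<and> cls (pcat p (Pth [c])) = (i, j, Suc d)"
    using pcat_props[OF p(1) _ q] c p by (simp add: cls_def)
  then show ?case by blast
qed

lemma walkable_sym: "walkable (i, j, d) \<longleftrightarrow> walkable (j, i, d)"
  by (auto simp: walkable.simps add.commute add.left_commute)

lemma unkilled_sym: "unkilled (i, j, d) \<longleftrightarrow> unkilled (j, i, d)"
  by (auto simp: unkilled.simps add.commute add.left_commute)

lemma nform_pcat:
  assumes "valid_path n p" "valid_path n q" "ptgt p = psrc q"
  shows "nform (pcat p q) = mu (nform p) (nform q)"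
proof -
  note c = pcat_props[OF assms]
  note w = walkable_path[OF assms(1)] walkable_path[OF assms(2)]
  have "al (cls p) \<and> al (cls q)" if "al (cls (pcat p q))"
  proof -
    have u: "unkilled (psrc p, ptgt q, plen p + plen q)" using that c by (simp add: cls_def al_def)
    have 1: "unkilled (psrc p, ptgt p, plen p)" using unkilled_left[OF u, of "ptgt p"] w assms by (simp add: cls_def)
    have u': "unkilled (ptgt q, psrc p, plen q + plen p)" using u unkilled_sym by (simp add: add.commute)
    have "walkable (psrc q, psrc p, plen p)" using w(1) walkable_sym assms(3) by (simp add: cls_def)
    then have "unkilled (psrc q, ptgt q, plen q)" using unkilled_left[OF u', of "psrc q"] unkilled_sym by blast
    then show ?thesis using 1 w by (simp add: cls_def al_def)
  qed
  then show ?thesis using assms c by (auto simp: nform_def cls_def)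
qed

lemma nform_pmult:
  assumes "valid_path n p" "valid_path n q"
  shows "(case pmult p q of Some r \<Rightarrow> nform r | None \<Rightarrow> Oz) = mu (nform p) (nform q)"
  using nform_pcat[OF assms] by (auto simp: pmult_def nform_def cls_def)

section \<open>The ideal of relations on finitely supported maps\<close>

definition path_prod :: "path \<Rightarrow> path \<Rightarrow> (path \<Rightarrow>\<^sub>0 'k)" where
  "path_prod p q = (if ptgt p = psrc q then sg (pcat p q) else 0)"

definition poly_prod :: "(path \<Rightarrow>\<^sub>0 'k) \<Rightarrow> (path \<Rightarrow>\<^sub>0 'k) \<Rightarrow> (path \<Rightarrow>\<^sub>0 'k)" where
  "poly_prod X Y = lext (\<lambda>p. lext (path_prod p) Y) X"

definition r1 :: "nat \<Rightarrow> path" where "r1 v = (if v = 1 then Pth [Eps, Eps] else Pth [Ab (v - 1), Ar (v - 1)])"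
definition r2 :: "nat \<Rightarrow> path" where "r2 v = Pth [Ar v, Ab v]"
definition rel_poly :: "nat \<Rightarrow> (path \<Rightarrow>\<^sub>0 'k)" where
  "rel_poly v = sg (r1 v) + (if v < n then sg (r2 v) else 0)"

definition rel_ideal :: "(path \<Rightarrow>\<^sub>0 'k) set" where
  "rel_ideal = pmv.span {poly_prod (poly_prod (sg p) (rel_poly v)) (sg q) | p q v. valid_path n p \<and> valid_path n q \<and> 1 \<le> v \<and> v \<le> n}"

definition gen :: "path \<Rightarrow> nat \<Rightarrow> path \<Rightarrow> (path \<Rightarrow>\<^sub>0 'k)" where
  "gen p v q = sg (pcat (pcat p (r1 v)) q) + (if v < n then sg (pcat (pcat p (r2 v)) q) else 0)"

lemma r1_props: "1 \<le> v \<Longrightarrow> v \<le> n \<Longrightarrow> valid_path n (r1 v) \<and> psrc (r1 v) = v \<and> ptgt (r1 v) = v \<and> plen (r1 v) = 2 \<and> path_sign (r1 v) = (-1) ^ (v - 1)"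
  by (auto simp: r1_def valid_Pth simp del: valid_path.simps)

lemma r2_props: "1 \<le> v \<Longrightarrow> v < n \<Longrightarrow> valid_path n (r2 v) \<and> psrc (r2 v) = v \<and> ptgt (r2 v) = v \<and> plen (r2 v) = 2 \<and> path_sign (r2 v) = (-1) ^ v"
  by (auto simp: r2_def valid_Pth simp del: valid_path.simps)

lemma poly_prod_sg [simp]: "poly_prod (sg p) (sg q) = path_prod p q" by (simp add: poly_prod_def)
lemma poly_prod_add: "poly_prod (X + Y) Z = poly_prod X Z + poly_prod Y Z" "poly_prod Z (X + Y) = poly_prod Z X + poly_prod Z Y"
  "poly_prod 0 Z = 0" "poly_prod Z 0 = 0" "poly_prod (scp c X) Z = scp c (poly_prod X Z)"
  by (simp_all add: poly_prod_def lext_lin lext_linf)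

lemma gen_eq:
  assumes "valid_path n p" "valid_path n q" "1 \<le> v" "v \<le> n"
  shows "poly_prod (poly_prod (sg p) (rel_poly v)) (sg q) = (if ptgt p = v \<and> psrc q = v then gen p v q else 0)"
proof -
  note a = r1_props[OF assms(3,4)]
  have 1: "poly_prod (path_prod p (r1 v)) (sg q) = (if ptgt p = v \<and> psrc q = v then sg (pcat (pcat p (r1 v)) q) else 0)"
    using a assms pcat_props(3)[OF assms(1), of "r1 v"] by (auto simp: path_prod_def poly_prod_add)
  have 2: "poly_prod (path_prod p (r2 v)) (sg q) = (if ptgt p = v \<and> psrc q = v then sg (pcat (pcat p (r2 v)) q) else 0)" if "v < n"
    using r2_props[OF assms(3) that] assms pcat_props(3)[OF assms(1), of "r2 v"] by (auto simp: path_prod_def poly_prod_add)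
  show ?thesis using 1 2 by (auto simp: rel_poly_def gen_def poly_prod_add)
qed

lemma subspace_rel_ideal: "pmv.subspace rel_ideal" unfolding rel_ideal_def by (rule pmv.subspace_span)

lemma gen_rel_ideal: "valid_path n p \<Longrightarrow> valid_path n q \<Longrightarrow> 1 \<le> v \<Longrightarrow> v \<le> n \<Longrightarrow> ptgt p = v \<Longrightarrow> psrc q = v \<Longrightarrow> gen p v q \<in> rel_ideal"
  unfolding rel_ideal_def using gen_eq[of p q v] by (intro pmv.span_base) force

lemma rel_ideal_induct [consumes 1, case_names zero gen]:
  assumes "X \<in> rel_ideal" "P 0"
    "\<And>c p v q Y. valid_path n p \<Longrightarrow> valid_path n q \<Longrightarrow> 1 \<le> v \<Longrightarrow> v \<le> n \<Longrightarrow> ptgt p = v \<Longrightarrow> psrc q = v \<Longrightarrow> P Y \<Longrightarrow> P (scp c (gen p v q) + Y)"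
  shows "P X"
  using assms(1) unfolding rel_ideal_def
proof (induction rule: pmv.span_induct_alt)
  case (step c x y)
  then obtain p q v where x: "x = poly_prod (poly_prod (sg p) (rel_poly v)) (sg q)" "valid_path n p" "valid_path n q" "1 \<le> v" "v \<le> n" by blast
  show ?case using x gen_eq[OF x(2-5)] assms(3)[of p q v y c] step(2) by (cases "ptgt p = v \<and> psrc q = v") auto
qed (rule assms(2))

text \<open>Absorbing a path into the right factor of a generator gives another generator or 0. It
  lets congruences of paths be extended by a last arrow.\<close>

lemma rel_ideal_right:
  assumes "X \<in> rel_ideal" "valid_path n c"
  shows "poly_prod X (sg c) \<in> rel_ideal"
  using assms(1)
proof (induction rule: rel_ideal_induct)
  case zero
  then show ?case by (simp add: poly_prod_add pmv.subspace_0[OF subspace_rel_ideal])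
next
  case (gen a p v q Y)
  note R1 = r1_props[OF gen(3,4)]
  have pr1: "valid_path n (pcat p (r1 v))" "ptgt (pcat p (r1 v)) = v" using pcat_props[OF gen(1), of "r1 v"] R1 gen by auto
  have "poly_prod (gen p v q) (sg c) \<in> rel_ideal"
  proof (cases "ptgt q = psrc c")
    case True
    have q: "valid_path n (pcat q c)" "psrc (pcat q c) = v" using pcat_props[OF gen(2) assms(2) True] gen by auto
    have 1: "path_prod (pcat (pcat p (r1 v)) q) c = sg (pcat (pcat p (r1 v)) (pcat q c))"
      using pcat_props(3)[OF pr1(1) gen(2)] pr1 gen True pcat_assoc[OF pr1(1) gen(2) assms(2)] by (simp add: path_prod_def)
    have 2: "path_prod (pcat (pcat p (r2 v)) q) c = sg (pcat (pcat p (r2 v)) (pcat q c))" if "v < n"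
    proof -
      note R2 = r2_props[OF gen(3) that]
      have pr2: "valid_path n (pcat p (r2 v))" "ptgt (pcat p (r2 v)) = v" using pcat_props[OF gen(1), of "r2 v"] R2 gen by auto
      show ?thesis using pcat_props(3)[OF pr2(1) gen(2)] pr2 gen True pcat_assoc[OF pr2(1) gen(2) assms(2)] by (simp add: path_prod_def)
    qed
    have "poly_prod (gen p v q) (sg c) = lalg.gen n p v (pcat q c)"
      using 1 2 by (simp add: gen_def poly_prod_add)
    then show ?thesis using gen_rel_ideal[OF gen(1) q(1) gen(3,4,5) q(2)] by simp
  next
    case False
    have 1: "path_prod (pcat (pcat p (r1 v)) q) c = 0"
      using pcat_props(3)[OF pr1(1) gen(2)] pr1 gen False by (simp add: path_prod_def)
    have 2: "path_prod (pcat (pcat p (r2 v)) q) c = 0" if "v < n"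
    proof -
      note R2 = r2_props[OF gen(3) that]
      have pr2: "valid_path n (pcat p (r2 v))" "ptgt (pcat p (r2 v)) = v" using pcat_props[OF gen(1), of "r2 v"] R2 gen by auto
      show ?thesis using pcat_props(3)[OF pr2(1) gen(2)] pr2 gen False by (simp add: path_prod_def)
    qed
    have "poly_prod (gen p v q) (sg c) = 0" using 1 2 by (simp add: gen_def poly_prod_add)
    then show ?thesis by (simp add: pmv.subspace_0[OF subspace_rel_ideal])
  qed
  then show ?case using gen(7) by (simp add: poly_prod_add pmv.subspace_add[OF subspace_rel_ideal] pmv.subspace_scale[OF subspace_rel_ideal])
qed

lemma path_sign_sq [simp]: "path_sign p * path_sign p = 1"
  by (cases p) (simp_all flip: power_mult_distrib)

definition peq :: "path \<Rightarrow> path \<Rightarrow> bool" where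
  "peq p q \<longleftrightarrow> scp (path_sign p) (sg p) - scp (path_sign q) (sg q) \<in> rel_ideal"

lemma peq_refl: "peq p p" by (simp add: peq_def pmv.subspace_0[OF subspace_rel_ideal])
lemma peq_sym: "peq p q \<Longrightarrow> peq q p"
  using pmv.subspace_neg[OF subspace_rel_ideal, of "scp (path_sign p) (sg p) - scp (path_sign q) (sg q)"] by (simp add: peq_def)
lemma peq_trans: "peq p q \<Longrightarrow> peq q r \<Longrightarrow> peq p r"
  using pmv.subspace_add[OF subspace_rel_ideal, of "scp (path_sign p) (sg p) - scp (path_sign q) (sg q)" "scp (path_sign q) (sg q) - scp (path_sign r) (sg r)"]
  by (simp add: peq_def)

lemma peq_right:
  assumes "peq p q" "valid_path n p" "valid_path n q" "valid_path n c" "ptgt p = psrc c" "ptgt q = psrc c"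
  shows "peq (pcat p c) (pcat q c)"
proof -
  have "poly_prod (scp (path_sign p) (sg p) - scp (path_sign q) (sg q)) (sg c) \<in> rel_ideal" using assms(1,4) unfolding peq_def by (intro rel_ideal_right)
  also have "poly_prod (scp (path_sign p) (sg p) - scp (path_sign q) (sg q)) (sg c) = scp (path_sign p) (sg (pcat p c)) - scp (path_sign q) (sg (pcat q c))"
    using assms by (simp add: poly_prod_def lext_lin path_prod_def)
  finally have "scp (path_sign c) (scp (path_sign p) (sg (pcat p c)) - scp (path_sign q) (sg (pcat q c))) \<in> rel_ideal"
    by (rule pmv.subspace_scale[OF subspace_rel_ideal])
  then show ?thesis using pcat_props(5)[OF assms(2,4,5)] pcat_props(5)[OF assms(3,4,6)]
    by (simp add: peq_def pmv.scale_right_diff_distrib mult.commute)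
qed

text \<open>The signs of the two paths are opposite, so the sum in the relation becomes the
  difference in \<open>peq\<close>.\<close>

lemma peq_rel:
  assumes "valid_path n x" "ptgt x = v" "v < n"
  shows "peq (pcat x (r1 v)) (pcat x (r2 v))"
proof -
  have v: "1 \<le> v" using valid_bounds[OF assms(1)] assms(2) by simp
  note R1 = r1_props[OF v less_imp_le[OF assms(3)]] and R2 = r2_props[OF v assms(3)]
  have t: "pcat (pcat x (r1 v)) (Triv v) = pcat x (r1 v)" "pcat (pcat x (r2 v)) (Triv v) = pcat x (r2 v)"
    by (cases x; simp add: r1_def r2_def)+
  have "gen x v (Triv v) \<in> rel_ideal" by (rule gen_rel_ideal) (use assms v in auto)
  then have "scp (path_sign x * (-1) ^ (v - 1)) (sg (pcat x (r1 v)) + sg (pcat x (r2 v))) \<in> rel_ideal"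
    using assms(3) by (intro pmv.subspace_scale[OF subspace_rel_ideal]) (simp add: gen_def t)
  moreover have "(-1 :: 'k) ^ v = - ((-1) ^ (v - 1))" using v by (cases v) auto
  ultimately show ?thesis
    using pcat_props(5)[OF assms(1), of "r1 v"] pcat_props(5)[OF assms(1), of "r2 v"] R1 R2 assms
    by (simp add: peq_def pmv.scale_right_distrib)
qed

fun rva :: "arr \<Rightarrow> arr" where "rva Eps = Eps" | "rva (Ar i) = Ab i" | "rva (Ab i) = Ar i"

lemma rva_props: "valid_arr n c \<Longrightarrow> valid_arr n (rva c) \<and> asrc (rva c) = atgt c \<and> atgt (rva c) = asrc c"
  by (cases c) auto

lemma rva_rel:
  assumes "valid_arr n c" "valid_arr n c'" "atgt c = atgt c'" "c \<noteq> c'"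
  shows "atgt c < n \<and> {Pth [rva c, c], Pth [rva c', c']} = {r1 (atgt c), r2 (atgt c)}"
  using assms by (cases c; cases c') (auto simp: r1_def r2_def)

text \<open>Walks of the same length that reach both neighbours of a vertex are long enough to turn
  back, so a walk one step shorter reaches the vertex itself. It provides the common part x in
  \<open>parallel_paths\<close>.\<close>

lemma walkable_back:
  assumes c: "valid_arr n c" "valid_arr n c'" "atgt c = atgt c'" "c \<noteq> c'"
    and w: "walkable (i, asrc c, d)" "walkable (i, asrc c', d)"
  shows "0 < d \<and> walkable (i, atgt c, d - 1)"
proof -
  have *: "0 < d \<and> walkable (i, j, d - 1)" if "walkable (i, j - 1, d)" "walkable (i, Suc j, d)" "2 \<le> j" for j
  proof (cases "even (i + (j - 1) + d)")
    case ev: True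
    have e: "even (i + Suc j + d)" using ev that(3) by presburger
    have H: "1 \<le> i" "i \<le> n" "i \<le> j - 1 + d" "Suc j \<le> n" "Suc j \<le> i + d" using that ev e by (simp_all add: walkable.simps)
    have d: "0 < d" using H that(3) by linarith
    have "even (i + j + (d - 1))" using ev that(3) d by presburger
    then show ?thesis using H d that(3) by (simp add: walkable.simps)
  next
    case od: False
    have e: "odd (i + Suc j + d)" using od that(3) by presburger
    have H: "1 \<le> i" "i \<le> n" "Suc j \<le> n" "i + Suc j \<le> d + 1" using that od e by (simp_all add: walkable.simps)
    have d: "0 < d" using H that(3) by linarith
    have "odd (i + j + (d - 1))" using od that(3) d by presburger
    then show ?thesis using H d that(3) by (simp add: walkable.simps)
  qed
  have **: "0 < d \<and> walkable (i, 1, d - 1)" if "walkable (i, 1, d)" "walkable (i, 2, d)"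
  proof (cases "even (i + 1 + d)")
    case ev: True
    have e: "odd (i + 2 + d)" using ev by presburger
    have H: "1 \<le> i" "i \<le> n" "i + 2 \<le> d + 1" using that(2) e by (simp_all add: walkable.simps)
    have d: "0 < d" using H by linarith
    have "odd (i + 1 + (d - 1))" using ev d by presburger
    then show ?thesis using H d n1 by (simp add: walkable.simps)
  next
    case od: False
    have e: "even (i + 2 + d)" using od by presburger
    have H: "1 \<le> i" "i \<le> n" "i + 1 \<le> d + 1" "2 \<le> i + d" using that od e by (simp_all add: walkable.simps)
    have d: "0 < d" using H by linarith
    have "even (i + 1 + (d - 1))" using od d by presburger
    then show ?thesis using H d n1 by (simp add: walkable.simps)
  qed
  show ?thesis
  proof (cases c)
    case Eps
    then have "c' = Ab 1" using c by (cases c') auto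
    then show ?thesis using ** w Eps by (simp add: numeral_2_eq_2)
  next
    case (Ar a)
    then have "c' = Ab (Suc a)" using c by (cases c') auto
    then show ?thesis using *[of "Suc a"] w Ar c by simp
  next
    case (Ab a)
    show ?thesis
    proof (cases c')
      case Eps
      then show ?thesis using ** w Ab c by (simp add: numeral_2_eq_2)
    next
      case (Ar b)
      then show ?thesis using *[of a] w Ab c by auto
    qed (use Ab c in auto)
  qed
qed

text \<open>Induction on the length. If the last arrows c and c' differ, both paths can be changed
  before the last arrow so that they first reach the common end and then make a detour over c or c';
  the two detours are the two sides of the relation there.\<close>

lemma parallel_paths:
  assumes "valid_path n p" "valid_path n q" "cls p = cls q"
  shows "peq p q"
  using assms
proof (induction "plen p" arbitrary: p q)
  case 0
  then have "p = q" by (cases p; cases q) (auto simp: cls_def)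
  then show ?case by (simp add: peq_refl)
next
  case (Suc d)
  have lq: "plen q = Suc d" using Suc by (simp add: cls_def)
  obtain p' c where pc: "p = pcat p' (Pth [c])" "valid_path n p'" "valid_arr n c" "ptgt p' = asrc c" "plen p' = d"
    using path_snoc[OF Suc.prems(1)] Suc.hyps(2) by metis
  obtain q' c' where qc: "q = pcat q' (Pth [c'])" "valid_path n q'" "valid_arr n c'" "ptgt q' = asrc c'" "plen q' = d"
    using path_snoc[OF Suc.prems(2) lq] by metis
  have c: "psrc p' = psrc q'" "atgt c = atgt c'"
    using Suc.prems(3) pcat_props[OF pc(2), of "Pth [c]"] pcat_props[OF qc(2), of "Pth [c']"] pc qc by (auto simp: cls_def)
  show ?case
  proof (cases "c = c'")
    case True
    have "peq p' q'" using Suc.hyps(1)[of p' q'] pc qc c True by (simp add: cls_def)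
    then show ?thesis unfolding pc(1) qc(1) True using pc qc True by (intro peq_right) auto
  next
    case False
    have w: "walkable (psrc p', asrc c, d)" "walkable (psrc p', asrc c', d)"
      using walkable_path[OF pc(2)] walkable_path[OF qc(2)] pc qc c by (auto simp: cls_def)
    have d: "0 < d" "walkable (psrc p', atgt c, d - 1)" using walkable_back[OF pc(3) qc(3) c(2) False w] by auto
    obtain x where x: "valid_path n x" "cls x = (psrc p', atgt c, d - 1)" using path_ex[OF d(2)] by blast
    have xt: "ptgt x = atgt c" "psrc x = psrc p'" "plen x = d - 1" using x(2) by (simp_all add: cls_def)
    have y: "peq (pcat p' (Pth [e])) (pcat x (Pth [rva e, e]))" if e: "valid_arr n e" "atgt e = atgt c" and p': "valid_path n p'" "ptgt p' = asrc e" "psrc p' = psrc x" "plen p' = d" for e p'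
    proof -
      note r = rva_props[OF e(1)]
      have a: "ptgt x = psrc (Pth [rva e])" using r e xt by simp
      note P = pcat_props[OF x(1) _ a]
      have "peq p' (pcat x (Pth [rva e]))"
        by (rule Suc.hyps(1)) (use P r p' d xt in \<open>auto simp: cls_def\<close>)
      then have "peq (pcat p' (Pth [e])) (pcat (pcat x (Pth [rva e])) (Pth [e]))"
        using P r p' e by (intro peq_right) auto
      moreover have "pcat (pcat x (Pth [rva e])) (Pth [e]) = pcat x (Pth [rva e, e])" by (cases x) auto
      ultimately show ?thesis by simp
    qed
    have 1: "peq p (pcat x (Pth [rva c, c]))" unfolding pc(1) using pc xt by (intro y) auto
    have 2: "peq q (pcat x (Pth [rva c', c']))" unfolding qc(1) using qc xt c by (intro y) auto
    note R = rva_rel[OF pc(3) qc(3) c(2) False]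
    have "peq (pcat x (r1 (atgt c))) (pcat x (r2 (atgt c)))" using peq_rel[OF x(1) xt(1)] R by blast
    then have "peq (pcat x (Pth [rva c, c])) (pcat x (Pth [rva c', c']))"
      using R peq_sym by (auto simp: doubleton_eq_iff)
    then show ?thesis using 1 2 peq_trans peq_sym by blast
  qed
qed

text \<open>A walk that is too long can be rerouted through n with a detour of length two there. The
  relation at n is a single path, so \<open>zero_path\<close> puts the walk into the ideal.\<close>

lemma walkable_via_n:
  assumes w: "walkable (i, j, d)" and u: "\<not> unkilled (i, j, d)"
  shows "\<exists>e f. walkable (i, n, e) \<and> walkable (n, j, f) \<and> d = e + 2 + f"
proof (cases "even (i + j + d)")
  case ev: True
  have b: "1 \<le> i" "i \<le> n" "1 \<le> j" "j \<le> n" using w by (auto simp: walkable.simps)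
  have "2 * n < d + i + j" using u ev by (simp add: unkilled.simps)
  then have "2 * n + 2 \<le> d + i + j" using ev by presburger
  \<comment> \<open>The first part goes straight to n in n - i steps; what is left after the detour
    is long enough to reach j.\<close>
  then have f0: "d = (n - i) + 2 + (d - 2 - (n - i))" "n - j \<le> d - 2 - (n - i)" using b by linarith+
  define f where "f = d - 2 - (n - i)"
  have f: "d = (n - i) + 2 + f" "n - j \<le> f" using f0 unfolding f_def by blast+
  have "walkable (i, n, n - i)" using b by (simp add: walkable.simps)
  moreover have "walkable (n, j, f)"
  proof -
    have "i + d = n + 2 + f" using f(1) b by linarith
    then have "even (n + j + f)" using ev by presburger
    then show ?thesis using f b by (simp add: walkable.simps)
  qed
  ultimately show ?thesis using f by blast
next
  case od: False
  have b: "1 \<le> i" "i \<le> n" "1 \<le> j" "j \<le> n" using w by (auto simp: walkable.simps)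
  have "2 * n + j < d + 1 + i \<or> 2 * n + i < d + 1 + j" using u od by (auto simp: unkilled.simps)
  then show ?thesis
  proof
    assume "2 * n + j < d + 1 + i"
    then have "2 * n + j + 1 \<le> d + i" using od by presburger
    then have f: "d = (n - i) + 2 + (d - 2 - (n - i))" "n + j \<le> (d - 2 - (n - i)) + 1" using b by linarith+
    define f where "f = d - 2 - (n - i)"
    have "i + d = n + 2 + f" using f(1) b unfolding f_def by linarith
    then have "odd (n + j + f)" using od by presburger
    then have "walkable (n, j, f)" using f(2) b n1 by (simp add: walkable.simps f_def)
    moreover have "walkable (i, n, n - i)" using b by (simp add: walkable.simps)
    ultimately show ?thesis using f(1) unfolding f_def by blast
  next
    assume "2 * n + i < d + 1 + j"
    then have "2 * n + i + 1 \<le> d + j" using od by presburger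
    then have f: "d = (d - 2 - (n - j)) + 2 + (n - j)" "n + i \<le> (d - 2 - (n - j)) + 1" using b by linarith+
    define f where "f = d - 2 - (n - j)"
    have "j + d = n + 2 + f" using f(1) b unfolding f_def by linarith
    then have "odd (i + n + f)" using od by presburger
    then have "walkable (i, n, f)" using f(2) b n1 by (simp add: walkable.simps f_def)
    moreover have "walkable (n, j, n - j)" using b by (simp add: walkable.simps)
    ultimately show ?thesis using f(1) unfolding f_def by blast
  qed
qed

lemma zero_path:
  assumes p: "valid_path n p" and z: "\<not> al (cls p)"
  shows "sg p \<in> rel_ideal"
proof -
  obtain i j d where c: "cls p = (i, j, d)" by (cases "cls p")
  have "walkable (i, j, d)" "\<not> unkilled (i, j, d)" using walkable_path[OF p] z by (auto simp: c al_def)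
  then obtain e f where ef: "walkable (i, n, e)" "walkable (n, j, f)" "d = e + 2 + f" using walkable_via_n by blast
  obtain x where x: "valid_path n x" "cls x = (i, n, e)" using path_ex[OF ef(1)] by blast
  obtain y where y: "valid_path n y" "cls y = (n, j, f)" using path_ex[OF ef(2)] by blast
  have xs: "psrc x = i" "ptgt x = n" "plen x = e" and ys: "psrc y = n" "ptgt y = j" "plen y = f"
    using x y by (auto simp: cls_def)
  note R = r1_props[OF n1 le_refl]
  have a: "ptgt x = psrc (r1 n)" using R xs by simp
  note P = pcat_props[OF x(1) conjunct1[OF R] a]
  have b: "ptgt (pcat x (r1 n)) = psrc y" using P R ys by simp
  note Q = pcat_props[OF P(1) y(1) b]
  let ?q = "pcat (pcat x (r1 n)) y"
  have "gen x n y \<in> rel_ideal" by (rule gen_rel_ideal) (use x y xs ys n1 in auto)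
  then have q: "sg ?q \<in> rel_ideal" by (simp add: gen_def)
  have "cls ?q = cls p" using Q P R xs ys ef by (simp add: cls_def[of ?q] c)
  then have "peq p ?q" using parallel_paths[OF p Q(1)] by simp
  then have "scp (path_sign p) (sg p) - scp (path_sign ?q) (sg ?q) + scp (path_sign ?q) (sg ?q) \<in> rel_ideal"
    unfolding peq_def using pmv.subspace_scale[OF subspace_rel_ideal q] by (intro pmv.subspace_add[OF subspace_rel_ideal])
  then have "scp (path_sign p) (sg p) \<in> rel_ideal" by simp
  from pmv.subspace_scale[OF subspace_rel_ideal this, of "path_sign p"] show ?thesis by simp
qed

definition std_path :: "tri \<Rightarrow> path" where "std_path b = (SOME p. valid_path n p \<and> cls p = b)"

lemma std_path_props: "al b \<Longrightarrow> valid_path n (std_path b) \<and> cls (std_path b) = b \<and> nform (std_path b) = b"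
proof -
  assume a: "al b"
  then have "walkable b" by (simp add: al_def)
  then have "\<exists>p. valid_path n p \<and> cls p = b" using path_ex by (cases b) auto
  from someI_ex[OF this] show ?thesis using a by (simp add: std_path_def[symmetric] nform_def)
qed

definition reduced :: "path \<Rightarrow> (path \<Rightarrow>\<^sub>0 'k)" where
  "reduced p = (if nform p = Oz then 0 else scp (path_sign p * path_sign (std_path (nform p))) (sg (std_path (nform p))))"

lemma reduced_rel_ideal:
  assumes p: "valid_path n p"
  shows "sg p - reduced p \<in> rel_ideal"
proof (cases "al (cls p)")
  case True
  then have nform: "nform p = cls p" "nform p \<noteq> Oz" using al_neq_O by (auto simp: nform_def)
  have "peq p (std_path (cls p))" using parallel_paths[OF p] std_path_props[OF True] by simp
  then have "scp (path_sign p) (scp (path_sign p) (sg p) - scp (path_sign (std_path (cls p))) (sg (std_path (cls p)))) \<in> rel_ideal"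
    unfolding peq_def by (rule pmv.subspace_scale[OF subspace_rel_ideal])
  then show ?thesis using nform by (simp add: reduced_def pmv.scale_right_diff_distrib)
next
  case False
  then show ?thesis using zero_path[OF p] by (simp add: reduced_def nform_def)
qed

end

section \<open>The Hochschild chain complex\<close>

context lalg
begin

section \<open>The definitions in terms of finitely supported maps\<close>

lemma supp_lookup [simp]: "supp (lookup Z) = keys Z" by (auto simp: supp_def in_keys_iff)
lemma smul_lookup: "smul c (lookup Z) = lookup (scp c Z)" by (rule ext) (simp add: smul_def)
lemma plus_lookup: "lookup Y + lookup Z = lookup (Y + Z)" by (rule ext) (simp add: lookup_add)
lemma zero_lookup: "lookup 0 = 0" by (rule ext) simp
lemma sum_lookup: "(\<Sum>i\<in>I. lookup (f i)) = lookup (\<Sum>i\<in>I. f i)"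
  by (induction I rule: infinite_finite_induct) (simp_all add: zero_lookup plus_lookup)
lemma bp_lookup: "bp p = lookup (sg p)" by (rule ext) (simp add: bp_def lookup_sg)

lemma lookup_ex: "finite (supp f) \<Longrightarrow> \<exists>Z. f = lookup Z"
proof -
  assume "finite (supp f)"
  then have "f = lookup (Abs_poly_mapping f)" by (simp add: supp_def)
  then show ?thesis by blast
qed

lemma lookup_vs: "{f :: _ \<Rightarrow> 'k. finite (supp f) \<and> supp f \<subseteq> X} = lookup ` vs X"
proof (intro set_eqI iffI)
  fix f :: "_ \<Rightarrow> 'k" assume f: "f \<in> {f. finite (supp f) \<and> supp f \<subseteq> X}"
  then obtain Z where "f = lookup Z" using lookup_ex by blast
  then show "f \<in> lookup ` vs X" using f by (simp add: vs_def)
next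
  fix f :: "_ \<Rightarrow> 'k" assume "f \<in> lookup ` vs X"
  then show "f \<in> {f. finite (supp f) \<and> supp f \<subseteq> X}" by (auto simp: vs_def)
qed

lemma subspace_lookup:
  fixes S :: "('b \<Rightarrow>\<^sub>0 'k) set"
  assumes "pmv.subspace S"
  shows "fnv.subspace (lookup ` S)"
proof (unfold fnv.subspace_def, intro conjI ballI allI)
  show "0 \<in> lookup ` S" using pmv.subspace_0[OF assms] by (metis zero_lookup imageI)
  fix x :: "'b \<Rightarrow> 'k" assume "x \<in> lookup ` S"
  then obtain X where X: "x = lookup X" "X \<in> S" by blast
  show "smul c x \<in> lookup ` S" for c using pmv.subspace_scale[OF assms X(2)] by (simp add: X(1) smul_lookup)
  fix y :: "'b \<Rightarrow> 'k" assume "y \<in> lookup ` S"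
  then obtain Y where Y: "y = lookup Y" "Y \<in> S" by blast
  show "x + y \<in> lookup ` S" using pmv.subspace_add[OF assms X(2) Y(2)] by (simp add: X(1) Y(1) plus_lookup)
qed

lemma Ten_lookup: "(Ten n m :: 'k ten set) = lookup ` vs {w. validw n m w}" by (simp add: Ten_def lookup_vs)
lemma KQ_lookup: "(KQ n :: 'k kq set) = lookup ` vs {p. valid_path n p}" by (simp add: KQ_def lookup_vs)

lemma lspan_lookup: "lspan (lookup ` S) = lookup ` pmv.span S"
proof (intro set_eqI iffI)
  fix f assume "f \<in> lspan (lookup ` S)"
  then show "f \<in> lookup ` pmv.span S"
  proof induction
    case lspan_zero
    then show ?case using pmv.span_zero zero_lookup by (metis imageI)
  next
    case (lspan_step x y c)
    then obtain X Y where "x = lookup X" "X \<in> S" "y = lookup Y" "Y \<in> pmv.span S" by blast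
    then have "smul c x + y = lookup (scp c X + Y)" "scp c X + Y \<in> pmv.span S"
      by (simp_all add: smul_lookup plus_lookup pmv.span_add pmv.span_scale pmv.span_base)
    then show ?case by blast
  qed
next
  fix f assume "f \<in> lookup ` pmv.span S"
  then obtain Z where Z: "f = lookup Z" "Z \<in> pmv.span S" by blast
  have "lookup Z \<in> lspan (lookup ` S)"
    using Z(2)
  proof (induction rule: pmv.span_induct_alt)
    case base
    show ?case unfolding zero_lookup by (rule lspan_zero)
  next
    case (step c x y)
    have "smul c (lookup x) + lookup y \<in> lspan (lookup ` S)" using step by (intro lspan.lspan_step) auto
    then show ?case by (simp add: smul_lookup plus_lookup)
  qed
  then show "f \<in> lspan (lookup ` S)" using Z by simp
qed

lemma lookup_lext: "lookup (lext f z) r = (\<Sum>x\<in>keys z. lookup z x * lookup (f x) r)"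
  by (simp add: lext_def lookup_sum)

lemma lookup_path_prod: "lookup (path_prod p q) r = (if pmult p q = Some r then 1 else 0)"
  by (simp add: path_prod_def pmult_def lookup_sg)

lemma kqmult_lookup: "kqmult (lookup X) (lookup Y) = lookup (poly_prod X Y)"
proof
  fix r
  have "lookup (poly_prod X Y) r = (\<Sum>p\<in>keys X. \<Sum>q\<in>keys Y. lookup X p * lookup Y q * (if pmult p q = Some r then 1 else 0))"
    by (simp add: poly_prod_def lookup_lext lookup_path_prod sum_distrib_left mult.assoc)
  also have "\<dots> = (\<Sum>(p, q)\<in>keys X \<times> keys Y. if pmult p q = Some r then lookup X p * lookup Y q else 0)"
    unfolding sum.cartesian_product by (rule sum.cong) auto
  also have "\<dots> = (\<Sum>(p, q)\<in>{(p, q). p \<in> keys X \<and> q \<in> keys Y \<and> pmult p q = Some r}. lookup X p * lookup Y q)"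
    by (rule sum.mono_neutral_cong_right) (auto split: if_splits)
  finally show "kqmult (lookup X) (lookup Y) r = lookup (poly_prod X Y) r" by (simp add: kqmult_def)
qed

lemma rel_lookup: "rel n v = lookup (rel_poly v)"
  by (simp add: rel_def rel_poly_def r1_def r2_def bp_lookup plus_lookup zero_lookup[symmetric])

lemma Iideal_lookup: "Iideal n = lookup ` rel_ideal"
proof -
  have "{kqmult (kqmult (bp p) (rel n v)) (bp q) | p q v.
           valid_path n p \<and> valid_path n q \<and> 1 \<le> v \<and> v \<le> n}
     = lookup ` {poly_prod (poly_prod (sg p) (rel_poly v)) (sg q) | p q v. valid_path n p \<and> valid_path n q \<and> 1 \<le> v \<and> v \<le> n}"
    by (auto simp: bp_lookup rel_lookup kqmult_lookup image_iff)
  then show ?thesis by (simp only: Iideal_def rel_ideal_def lspan_lookup)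
qed

definition tensor_ins :: "path list \<Rightarrow> path list \<Rightarrow> (path \<Rightarrow>\<^sub>0 'k) \<Rightarrow> (path list \<Rightarrow>\<^sub>0 'k)" where
  "tensor_ins u v = lext (\<lambda>p. sg (u @ p # v))"

lemma tens_Nil: "tens [] w = (if w = [] then 1 else 0)"
  by (simp add: tens_def)

lemma tens_Cons: "tens (x # xs) w = (case w of [] \<Rightarrow> 0 | p # w' \<Rightarrow> x p * tens xs w')"
  by (cases w) (simp_all add: tens_def prod.lessThan_Suc_shift del: prod.lessThan_Suc)

lemma tens_basis: "tens (map bp v) w = (if w = v then 1 else 0 :: 'k)"
proof (induction v arbitrary: w)
  case (Cons a v)
  then show ?case by (cases w) (auto simp: tens_Cons bp_def)
qed (simp add: tens_Nil)

lemma tens_insert: "tens (map bp u @ x # map bp v) w =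
    (if \<exists>p. w = u @ p # v then x (w ! length u) else 0 :: 'k)"
proof (induction u arbitrary: w)
  case Nil
  then show ?case by (cases w) (auto simp: tens_Cons tens_basis)
next
  case (Cons a u)
  then show ?case by (cases w) (auto simp: tens_Cons bp_def)
qed

lemma tens_lookup: "tens (map bp u @ [lookup X] @ map bp v) = lookup (tensor_ins u v X)"
proof
  fix w
  have "lookup (tensor_ins u v X) w = (\<Sum>p\<in>keys X. lookup X p * (if u @ p # v = w then 1 else 0))"
    by (simp add: tensor_ins_def lookup_lext lookup_sg)
  also have "\<dots> = (if \<exists>p. w = u @ p # v then lookup X (w ! length u) else 0)"
  proof (cases "\<exists>p. w = u @ p # v")
    case True
    then obtain p where p: "w = u @ p # v" by blast
    have "(\<Sum>q\<in>keys X. lookup X q * (if u @ q # v = w then 1 else 0)) = (\<Sum>q\<in>keys X. if q = p then lookup X q else 0)"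
      by (rule sum.cong) (auto simp: p)
    also have "\<dots> = lookup X p" by (simp add: in_keys_iff)
    finally show ?thesis using True by (simp add: p)
  next
    case False
    then have "u @ q # v \<noteq> w" for q by metis
    then show ?thesis using False by simp
  qed
  finally show "tens (map bp u @ [lookup X] @ map bp v) w = lookup (tensor_ins u v X) w"
    by (simp add: tens_insert)
qed

definition tensor_ideal :: "nat \<Rightarrow> (path list \<Rightarrow>\<^sub>0 'k) set" where
  "tensor_ideal m = pmv.span {tensor_ins u v X | u v X. X \<in> rel_ideal \<and> Suc (length u + length v) = m \<and> (\<forall>p\<in>set (u @ v). valid_path n p)}"

lemma subspace_tensor_ideal: "pmv.subspace (tensor_ideal m)" unfolding tensor_ideal_def by (rule pmv.subspace_span)

lemma Nsub_lookup: "Nsub n m = lookup ` tensor_ideal m"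
proof -
  have "{tens (map bp ps1 @ [x] @ map bp ps2) | ps1 x ps2.
                 x \<in> Iideal n \<and> Suc (length ps1 + length ps2) = m \<and> (\<forall>p\<in>set (ps1 @ ps2). valid_path n p)}
    = lookup ` {tensor_ins u v X | u v X. X \<in> rel_ideal \<and> Suc (length u + length v) = m \<and> (\<forall>p\<in>set (u @ v). valid_path n p)}"
    (is "?L = lookup ` ?R")
  proof (intro set_eqI iffI)
    fix f assume "f \<in> ?L"
    then obtain u x v where f: "f = tens (map bp u @ [x] @ map bp v)" "x \<in> Iideal n" "Suc (length u + length v) = m" "\<forall>p\<in>set (u @ v). valid_path n p" by blast
    then obtain X where "x = lookup X" "X \<in> rel_ideal" by (auto simp: Iideal_lookup)
    then have "f = lookup (tensor_ins u v X)" "tensor_ins u v X \<in> ?R" using f tens_lookup[of u X v] by blast+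
    then show "f \<in> lookup ` ?R" by blast
  next
    fix f assume "f \<in> lookup ` ?R"
    then obtain u v X where "f = lookup (tensor_ins u v X)" "X \<in> rel_ideal" "Suc (length u + length v) = m" "\<forall>p\<in>set (u @ v). valid_path n p" by blast
    then show "f \<in> ?L" using tens_lookup[of u X v, symmetric] by (auto simp: Iideal_lookup)
  qed
  then show ?thesis by (simp only: Nsub_def tensor_ideal_def lspan_lookup)
qed

section \<open>The projection from path words to words in the basis\<close>

definition word_sign :: "path list \<Rightarrow> 'k" where "word_sign w = prod_list (map path_sign w)"
text \<open>The projection from tensor powers of the path algebra to those of \<Lambda>, in the
  basis; \<open>sec\<close> is its section through the chosen paths.\<close>

definition phi :: "path list \<Rightarrow> (tri list \<Rightarrow>\<^sub>0 'k)" where "phi w = scp (word_sign w) (dw (map nform w))"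
abbreviation Phi where "Phi \<equiv> lext phi"

definition sec :: "tri list \<Rightarrow> (path list \<Rightarrow>\<^sub>0 'k)" where
  "sec l = scp (word_sign (map std_path l)) (sg (map std_path l))"

lemma word_sign_simps [simp]: "word_sign [] = 1" "word_sign (p # w) = path_sign p * word_sign w" "word_sign (u @ v) = word_sign u * word_sign v"
  by (simp_all add: word_sign_def)
lemma word_sign_sq [simp]: "word_sign w * word_sign w = 1"
proof (induction w)
  case (Cons p w)
  have "word_sign (p # w) * word_sign (p # w) = (path_sign p * path_sign p) * (word_sign w * word_sign w)" by (simp only: word_sign_simps mult_ac)
  then show ?case using Cons by simp
qed simp

definition wrap :: "tri list \<Rightarrow> tri list \<Rightarrow> tri list \<Rightarrow> (tri list \<Rightarrow>\<^sub>0 'k)" where "wrap u v l = dw (u @ l @ v)"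

definition class_of :: "(path \<Rightarrow>\<^sub>0 'k) \<Rightarrow> (tri list \<Rightarrow>\<^sub>0 'k)" where
  "class_of = lext (\<lambda>p. scp (path_sign p) (dw [nform p]))"

text \<open>Both terms have the same normal form and opposite signs. At v = n the single term
  contains the factor (n,n,2), which is not a basis element.\<close>

lemma class_of_gen:
  assumes "valid_path n p" "valid_path n q" "1 \<le> v" "v \<le> n" "ptgt p = v" "psrc q = v"
  shows "class_of (gen p v q) = 0"
proof -
  note R1 = r1_props[OF assms(3,4)]
  have 1: "valid_path n (pcat p (r1 v))" "ptgt (pcat p (r1 v)) = v" "path_sign (pcat p (r1 v)) = path_sign p * (-1) ^ (v - 1)"
    using pcat_props[OF assms(1), of "r1 v"] R1 assms by auto
  have s1: "path_sign (pcat (pcat p (r1 v)) q) = path_sign p * (-1) ^ (v - 1) * path_sign q" using pcat_props(5)[OF 1(1) assms(2)] 1 assms by simp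
  have n1': "nform (pcat (pcat p (r1 v)) q) = mu (mu (nform p) (nform (r1 v))) (nform q)"
    using nform_pcat[OF 1(1) assms(2)] nform_pcat[OF assms(1), of "r1 v"] R1 1 assms by simp
  have r1: "nform (r1 v) = (if al (v, v, 2) then (v, v, 2) else Oz)" using R1 by (simp add: nform_def cls_def)
  show ?thesis
  proof (cases "v < n")
    case True
    note R2 = r2_props[OF assms(3) True]
    have 2: "valid_path n (pcat p (r2 v))" "ptgt (pcat p (r2 v)) = v" "path_sign (pcat p (r2 v)) = path_sign p * (-1) ^ v"
      using pcat_props[OF assms(1), of "r2 v"] R2 assms by auto
    have s2: "path_sign (pcat (pcat p (r2 v)) q) = path_sign p * (-1) ^ v * path_sign q" using pcat_props(5)[OF 2(1) assms(2)] 2 assms by simp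
    have n2: "nform (pcat (pcat p (r2 v)) q) = mu (mu (nform p) (nform (r2 v))) (nform q)"
      using nform_pcat[OF 2(1) assms(2)] nform_pcat[OF assms(1), of "r2 v"] R2 2 assms by simp
    have "nform (r2 v) = nform (r1 v)" using R1 R2 by (simp add: nform_def cls_def)
    moreover have "(-1 :: 'k) ^ v = - ((-1) ^ (v - 1))" using assms(3) by (cases v) auto
    ultimately show ?thesis using True by (simp add: gen_def class_of_def lext_add s1 s2 n1' n2)
  next
    case False
    then have "v = n" using assms by simp
    then have "\<not> al (v, v, 2)" using n1 by (simp add: al_simps)
    then show ?thesis using False by (simp add: gen_def class_of_def n1' r1)
  qed
qed

lemma class_of_rel_ideal: "X \<in> rel_ideal \<Longrightarrow> class_of X = 0"
proof (induction rule: rel_ideal_induct)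
  case (gen c p v q Y)
  then show ?case using class_of_gen[of p q v] by (simp add: class_of_def lext_lin)
qed (simp add: class_of_def)

lemma Phi_ins: "Phi (tensor_ins u v X) = scp (word_sign u * word_sign v) (lext (wrap (map nform u) (map nform v)) (class_of X))"
proof -
  have "lext (wrap (map nform u) (map nform v)) (dw [nform p]) = dw (map nform u @ nform p # map nform v)" for p
    by (subst lext_dw) (simp_all add: wrap_def)
  then have "scp (word_sign u * word_sign v) (lext (wrap (map nform u) (map nform v)) (class_of X)) = lext (\<lambda>p. scp (word_sign u * word_sign v) (scp (path_sign p) (dw (map nform u @ nform p # map nform v)))) X"
    by (simp add: class_of_def lext_lext lext_scp flip: lext_scpf)
  also have "\<dots> = Phi (tensor_ins u v X)"
    unfolding tensor_ins_def lext_lext by (rule lext_cong) (simp add: phi_def mult_ac)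
  finally show ?thesis by simp
qed

lemma gen_valid: "X \<in> rel_ideal \<Longrightarrow> X \<in> vs {p. valid_path n p}"
proof (induction rule: rel_ideal_induct)
  case (gen c p v q Y)
  have "sg (pcat (pcat p (r1 v)) q) \<in> vs {p. valid_path n p}"
    using r1_props[OF gen(3,4)] pcat_props[OF gen(1), of "r1 v"] gen pcat_props(1)[of "pcat p (r1 v)" q] by simp
  moreover have "sg (pcat (pcat p (r2 v)) q) \<in> vs {p. valid_path n p}" if "v < n"
    using r2_props[OF gen(3) that] pcat_props[OF gen(1), of "r2 v"] gen pcat_props(1)[of "pcat p (r2 v)" q] by simp
  ultimately show ?case using gen(7) by (auto simp: gen_def intro!: vs_intros)
qed (simp add: vs_intros)

lemma tensor_ideal_kernel:
  assumes "N \<in> tensor_ideal m"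
  shows "Phi N = 0 \<and> N \<in> vs {w. validw n m w}"
  using assms unfolding tensor_ideal_def
proof (induction rule: pmv.span_induct_alt)
  case base
  then show ?case by (simp add: vs_intros)
next
  case (step c x y)
  then obtain u v X where x: "x = tensor_ins u v X" "X \<in> rel_ideal" "Suc (length u + length v) = m" "\<forall>p\<in>set (u @ v). valid_path n p" by blast
  have "Phi x = 0" by (simp add: x Phi_ins class_of_rel_ideal)
  moreover have "x \<in> vs {w. validw n m w}"
    unfolding x(1) tensor_ins_def by (rule lext_vs[OF gen_valid[OF x(2)]]) (use x in \<open>auto simp: validw_def\<close>)
  ultimately show ?case using step by (simp add: lext_lin vs_intros)
qed

definition pre :: "path list \<Rightarrow> (path list \<Rightarrow>\<^sub>0 'k) \<Rightarrow> (path list \<Rightarrow>\<^sub>0 'k)" where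
  "pre u = lext (\<lambda>w. sg (u @ w))"

lemma tensor_ins_tensor_ideal: "X \<in> rel_ideal \<Longrightarrow> Suc (length u + length v) = m \<Longrightarrow> \<forall>p\<in>set (u @ v). valid_path n p \<Longrightarrow> tensor_ins u v X \<in> tensor_ideal m"
  unfolding tensor_ideal_def by (rule pmv.span_base) blast

lemma nform_cases: "nform p = Oz \<or> al (nform p)" by (simp add: nform_def)

text \<open>The letters are exchanged for the chosen paths one at a time, and each exchange alters
  the tensor by one with a factor in the ideal. The prefix \<open>u\<close> holds the letters
  already exchanged.\<close>

lemma sec_word_pre:
  assumes "\<forall>p\<in>set u. valid_path n p" "\<forall>p\<in>set w. valid_path n p" "w \<noteq> []"
  shows "pre u (sg w - lext sec (phi w)) \<in> tensor_ideal (length u + length w)"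
  using assms
proof (induction w arbitrary: u)
  case (Cons p w)
  let ?m = "length u + length (p # w)"
  have p: "valid_path n p" using Cons.prems by simp
  have I: "tensor_ins u w (sg p - reduced p) \<in> tensor_ideal ?m"
    using Cons.prems by (intro tensor_ins_tensor_ideal reduced_rel_ideal[OF p]) auto
  have I': "tensor_ins u w (sg p - reduced p) = sg (u @ p # w) - tensor_ins u w (reduced p)" by (simp add: tensor_ins_def lext_lin)
  have ps: "pre u (sg (p # w)) = sg (u @ p # w)" by (simp add: pre_def)
  show ?case
  proof (cases "nform p = Oz")
    case True
    then have "phi (p # w) = 0" by (simp add: phi_def)
    then show ?thesis using I I' True by (simp add: reduced_def tensor_ins_def pre_def lext_lin)
  next
    case False
    then have a: "al (nform p)" using nform_cases by blast
    define c where "c = std_path (nform p)"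
    have c: "valid_path n c" "nform c = nform p" using std_path_props[OF a] by (simp_all add: c_def)
    let ?s = "path_sign p * path_sign c"
    have irp: "tensor_ins u w (reduced p) = scp ?s (sg ((u @ [c]) @ w))" using False by (simp add: reduced_def tensor_ins_def lext_lin c_def)
    have sp: "lext sec (phi (p # w)) = scp ?s (pre [c] (lext sec (phi w)))"
    proof (cases "Oz \<in> set (map nform w)")
      case True
      then show ?thesis by (simp add: phi_def pre_def)
    next
      case oz: False
      then have "dw (map nform (p # w)) = sg (map nform (p # w))" "dw (map nform w) = sg (map nform w)" using False by (auto simp: dw_def)
      then show ?thesis by (simp add: phi_def pre_def lext_lin sec_def c_def mult_ac)
    qed
    have pp: "pre u (pre [c] z) = pre (u @ [c]) z" for z by (simp add: pre_def lext_lext)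
    have eq: "pre u (sg (p # w) - lext sec (phi (p # w))) = tensor_ins u w (sg p - reduced p) + scp ?s (pre (u @ [c]) (sg w - lext sec (phi w)))"
    proof -
      have "pre u (sg (p # w) - lext sec (phi (p # w))) = sg (u @ p # w) - scp ?s (pre (u @ [c]) (lext sec (phi w)))"
        unfolding sp by (simp add: pp[symmetric]) (simp add: pre_def lext_lin)
      moreover have "pre (u @ [c]) (sg w - lext sec (phi w)) = sg ((u @ [c]) @ w) - pre (u @ [c]) (lext sec (phi w))"
        by (simp add: pre_def lext_lin)
      ultimately show ?thesis unfolding I' irp by (simp add: pmv.scale_right_diff_distrib)
    qed
    have "pre (u @ [c]) (sg w - lext sec (phi w)) \<in> tensor_ideal ?m"
    proof (cases "w = []")
      case True
      then show ?thesis by (simp add: phi_def dw_def sec_def pre_def lext_lin pmv.subspace_0[OF subspace_tensor_ideal])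
    next
      case False
      then show ?thesis using Cons.IH[of "u @ [c]"] Cons.prems c by simp
    qed
    then show ?thesis unfolding eq using I by (intro pmv.subspace_add[OF subspace_tensor_ideal] pmv.subspace_scale[OF subspace_tensor_ideal])
  qed
qed simp

lemma sec_Phi:
  assumes T: "T \<in> vs {w. validw n (Suc m) w}"
  shows "T - lext sec (Phi T) \<in> tensor_ideal (Suc m)"
proof -
  have "T - lext sec (Phi T) = lext (\<lambda>w. sg w - lext sec (phi w)) T"
    by (simp add: lext_linf lext_lext)
  also have "\<dots> \<in> tensor_ideal (Suc m)"
  proof (rule lext_mem[OF subspace_tensor_ideal])
    fix w assume "w \<in> keys T"
    then have w: "validw n (Suc m) w" using T by (auto simp: vs_def)
    then have "w \<noteq> []" by (auto simp: validw_def)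
    then show "sg w - lext sec (phi w) \<in> tensor_ideal (Suc m)" using sec_word_pre[of "[]" w] w by (simp add: validw_def pre_def)
  qed
  finally show ?thesis .
qed

lemma Phi_sec: "z \<in> vs (AL m) \<Longrightarrow> Phi (lext sec z) = z"
proof -
  assume z: "z \<in> vs (AL m)"
  have "Phi (lext sec z) = lext sg z"
    unfolding lext_lext
  proof (rule lext_cong)
    fix l assume "l \<in> keys z"
    then have l: "\<forall>b\<in>set l. al b" using z by (auto simp: vs_def AL_def)
    then have "map nform (map std_path l) = l" using std_path_props by (simp add: map_idI)
    moreover have "Oz \<notin> set l" using l al_O by blast
    ultimately show "Phi (sec l) = sg l" by (simp add: sec_def phi_def lext_lin dw_def)
  qed
  then show ?thesis by simp
qed

lemma sec_valid: "z \<in> vs (AL m) \<Longrightarrow> lext sec z \<in> vs {w. validw n m w}"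
  by (rule lext_vs) (auto simp: sec_def AL_def validw_def std_path_props intro!: vs_intros)

lemma Phi_AL: "T \<in> vs {w. validw n (Suc m) w} \<Longrightarrow> Phi T \<in> vs (AL (Suc m))"
proof (rule lext_vs)
  fix w assume "w \<in> {w. validw n (Suc m) w}"
  then have w: "validw n (Suc m) w" by simp
  have "dw (map nform w) \<in> vs (AL (Suc m))"
  proof (rule dw_vs)
    assume "Oz \<notin> set (map nform w)"
    then have "\<forall>b\<in>set (map nform w). al b" using nform_cases by (metis ex_map_conv)
    then show "map nform w \<in> AL (Suc m)" using w by (auto simp: AL_def validw_def)
  qed
  then show "phi w \<in> vs (AL (Suc m))" by (simp add: phi_def vs_intros)
qed

text \<open>If \<open>Phi T\<close> is 0, then T equals its difference from \<open>sec\<close> of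
  \<open>Phi T\<close>, which lies in the span of tensors with a factor in the ideal.\<close>

lemma Phi_kernel: "T \<in> vs {w. validw n (Suc m) w} \<Longrightarrow> Phi T = 0 \<longleftrightarrow> T \<in> tensor_ideal (Suc m)"
  using sec_Phi[of T m] tensor_ideal_kernel[of T "Suc m"] by (cases "Phi T = 0") auto

section \<open>The Hochschild boundary on words\<close>

definition hoch_bd :: "nat \<Rightarrow> path list \<Rightarrow> (path list \<Rightarrow>\<^sub>0 'k)" where
  "hoch_bd m w = (\<Sum>j<m. scp ((-1) ^ j) (tensor_ins (take j w) (drop (Suc (Suc j)) w) (path_prod (w ! j) (w ! Suc j))))
     + scp ((-1) ^ m) (tensor_ins [] (take (m - 1) (drop 1 w)) (path_prod (w ! m) (w ! 0)))"

lemma pm_lookup: "pm p q = lookup (path_prod p q)"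
  by (auto simp: pm_def path_prod_def pmult_def bp_lookup zero_lookup)

lemma bbasis_lookup: "bbasis m w = lookup (hoch_bd m w)"
proof -
  have "tens (pm (w ! m) (w ! 0) # map bp (take (m - 1) (drop 1 w))) = lookup (tensor_ins [] (take (m - 1) (drop 1 w)) (path_prod (w ! m) (w ! 0)))"
    using tens_lookup[of "[]" "path_prod (w ! m) (w ! 0)" "take (m - 1) (drop 1 w)"] by (simp add: pm_lookup)
  then show ?thesis unfolding bbasis_def hoch_bd_def pm_lookup tens_lookup by (simp only: smul_lookup sum_lookup plus_lookup)
qed

lemma bd_lookup: "bd m (lookup T) = lookup (if m = 0 then 0 else lext (hoch_bd m) T)"
  by (simp add: bd_def bbasis_lookup smul_lookup sum_lookup zero_lookup lext_def)

lemma bprime_sum: "bprime l = (\<Sum>j<length l - 1. scp ((-1) ^ j) (dw (take j l @ mu (l ! j) (l ! Suc j) # drop (Suc (Suc j)) l)))"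
proof (induction l rule: bprime.induct)
  case (1 x y l)
  have "bprime (x # y # l) = dw (mu x y # l) - (\<Sum>j<length (y # l) - 1. scp ((-1) ^ j) (dw (x # take j (y # l) @ mu ((y # l) ! j) ((y # l) ! Suc j) # drop (Suc (Suc j)) (y # l))))"
    by (simp only: bprime.simps 1 lext_sum lext_scp lext_dw_simps)
  also have "\<dots> = (\<Sum>j<Suc (length (y # l) - 1). scp ((-1) ^ j) (dw (take j (x # y # l) @ mu ((x # y # l) ! j) ((x # y # l) ! Suc j) # drop (Suc (Suc j)) (x # y # l))))"
    unfolding sum.lessThan_Suc_shift by (simp add: sum_negf del: sum.lessThan_Suc)
  finally show ?case by simp
qed simp_all

lemma Phi_pm:
  assumes "valid_path n p" "valid_path n q"
  shows "Phi (tensor_ins u v (path_prod p q)) = scp (word_sign u * path_sign p * path_sign q * word_sign v) (dw (map nform u @ mu (nform p) (nform q) # map nform v))"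
proof (cases "ptgt p = psrc q")
  case True
  then show ?thesis using pcat_props(5)[OF assms True] nform_pcat[OF assms True]
    by (simp add: path_prod_def tensor_ins_def phi_def mult_ac)
next
  case False
  then have "mu (nform p) (nform q) = Oz" using nform_pmult[OF assms] by (simp add: pmult_def)
  then show ?thesis using False by (simp add: path_prod_def tensor_ins_def)
qed

lemma Phi_hoch_bd:
  assumes w: "validw n (Suc m) w" and m: "0 < m"
  shows "Phi (hoch_bd m w) = lext bE (phi w)"
proof -
  have lw: "length w = Suc m" and vw: "\<And>j. j \<le> m \<Longrightarrow> valid_path n (w ! j)" using w by (auto simp: validw_def)
  let ?l = "map nform w"
  have t: "Phi (tensor_ins (take j w) (drop (Suc (Suc j)) w) (path_prod (w ! j) (w ! Suc j))) =
      scp (word_sign w) (dw (take j ?l @ mu (?l ! j) (?l ! Suc j) # drop (Suc (Suc j)) ?l))" if j: "j < m" for j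
  proof -
    have "w = take j w @ w ! j # w ! Suc j # drop (Suc (Suc j)) w"
      using j lw by (metis Cons_nth_drop_Suc Suc_lessD Suc_mono append_take_drop_id)
    then have "word_sign w = word_sign (take j w) * path_sign (w ! j) * path_sign (w ! Suc j) * word_sign (drop (Suc (Suc j)) w)"
      by (metis word_sign_simps(2,3) mult.assoc)
    then show ?thesis using Phi_pm[OF vw vw, of j "Suc j"] j lw by (simp add: take_map drop_map)
  qed
  have l: "Phi (tensor_ins [] (take (m - 1) (drop 1 w)) (path_prod (w ! m) (w ! 0))) = scp (word_sign w) (co ?l)"
  proof -
    obtain a c b where wabc: "w = a # c @ [b]" using lw m by (cases w rule: length_cases) auto
    then have "length c = m - 1" using lw by simp
    then have e: "w ! m = b" "w ! 0 = a" "take (m - 1) (drop 1 w) = c" using m by (auto simp: wabc nth_append nth_Cons split: nat.split)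
    have "Phi (tensor_ins [] c (path_prod b a)) = scp (word_sign w) (dw (mu (nform b) (nform a) # map nform c))"
      using Phi_pm[of b a "[]" c] vw[of m] vw[of 0] e by (simp add: wabc mult_ac)
    then show ?thesis unfolding e by (simp add: wabc co_def)
  qed
  have "Phi (hoch_bd m w) = scp (word_sign w) (bprime ?l) + scp ((-1) ^ m) (scp (word_sign w) (co ?l))"
    unfolding hoch_bd_def lext_add lext_sum lext_scp l bprime_sum pmv.scale_sum_right
    using t lw by (simp add: mult.commute)
  also have "\<dots> = scp (word_sign w) (bE ?l)" using lw by (simp add: bE_def pmv.scale_right_distrib mult.commute)
  also have "\<dots> = lext bE (phi w)" by (simp add: phi_def lext_scp)
  finally show ?thesis .
qed

definition bar_words :: "nat \<Rightarrow> tri list set" where "bar_words i = AL (Suc i)"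

lemma tg_inj: "tg p t w = 0 \<Longrightarrow> w = 0"
proof (rule poly_mapping_eqI)
  fix l assume "tg p t w = 0"
  then have "lookup (tg p t w) (p, t, l) = 0" by simp
  moreover have "lookup (tg p t w) (p, t, l) = (\<Sum>x\<in>keys w. if x = l then lookup w x else 0)"
    unfolding tg_def lookup_lext by (intro sum.cong) (auto simp: lookup_sg)
  ultimately show "lookup w l = lookup 0 l" by (simp add: in_keys_iff split: if_splits)
qed

lemma words_homology:
  assumes "qdim scp (cycles bar_cells D i) (boundaries bar_cells D i) d"
  shows "qdim scp (cycles bar_words bE i) (boundaries bar_words bE i) d"
proof (rule qdim_rel[where R = "\<lambda>x y. x = tg 0 (Tv 0) y", OF pmv.vector_space_axioms pmv.vector_space_axioms _ _ _ _ _ _ _ _ assms])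
  have vsE: "tg 0 (Tv 0) y \<in> vs (bar_cells j)" if "y \<in> vs (bar_words j)" for y j
    using that by (rule tg_vs) (auto simp: bar_cells_def CL_def bar_words_def)
  have ex: "\<exists>y\<in>vs (bar_words j). x = tg 0 (Tv 0) y" if "x \<in> vs (bar_cells j)" for x j
  proof (intro bexI)
    show "lext (\<lambda>c. sg (snd (snd c))) x \<in> vs (bar_words j)"
      using that by (rule lext_vs) (auto simp: bar_cells_def CL_def bar_words_def)
    have "tg 0 (Tv 0) (lext (\<lambda>c. sg (snd (snd c))) x) = lext sg x"
      unfolding tg_def lext_lext using that by (intro lext_cong) (auto simp: vs_def bar_cells_def CL_def)
    then show "x = tg 0 (Tv 0) (lext (\<lambda>c. sg (snd (snd c))) x)" by simp
  qed
  have inj: "y = z" if "tg 0 (Tv 0) y = tg 0 (Tv 0) z" for y z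
    using tg_inj[of 0 "Tv 0" "y - z"] that by (simp add: tg_lin)
  show "\<exists>x'\<in>cycles bar_words bE i. x = tg 0 (Tv 0) x'" if x: "x \<in> cycles bar_cells D i" for x
  proof -
    obtain y where y: "y \<in> vs (bar_words i)" "x = tg 0 (Tv 0) y" using ex[of x i] x by (auto simp: cycles_def)
    then have "tg 0 (Tv 0) (BE y) = 0" using x by (simp add: cycles_def lext_D_0)
    then show ?thesis using y tg_inj by (auto simp: cycles_def)
  qed
  show "\<exists>x\<in>cycles bar_cells D i. x = tg 0 (Tv 0) x'" if "x' \<in> cycles bar_words bE i" for x'
    using that vsE by (auto simp: cycles_def lext_D_0 tg_lin)
  show "x \<in> boundaries bar_cells D i \<longleftrightarrow> x' \<in> boundaries bar_words bE i" if "x = tg 0 (Tv 0) x'" for x x'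
  proof
    assume "x \<in> boundaries bar_cells D i"
    then obtain y where y: "y \<in> vs (bar_words (Suc i))" "x = lext D (tg 0 (Tv 0) y)" using ex by (auto simp: boundaries_def)
    then have "x' = BE y" using that by (intro inj) (simp add: lext_D_0)
    then show "x' \<in> boundaries bar_words bE i" using y by (auto simp: boundaries_def)
  next
    assume "x' \<in> boundaries bar_words bE i"
    then obtain y where "y \<in> vs (bar_words (Suc i))" "x' = BE y" by (auto simp: boundaries_def)
    then show "x \<in> boundaries bar_cells D i" using that vsE unfolding boundaries_def by (intro image_eqI[of _ _ "tg 0 (Tv 0) y"]) (auto simp: lext_D_0)
  qed
qed (auto simp: tg_lin pmv.subspace_0)

text \<open>A chain is related to its word by \<open>Phi\<close>; \<open>sec\<close> provides
  preimages, and by \<open>Phi_kernel\<close> their ambiguity is exactly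
  \<open>Nsub\<close>.\<close>

theorem hochschild_homology:
  assumes q: "qdim scp (cycles bar_words bE i) (boundaries bar_words bE i) d"
  shows "dim_HH_hom_is TYPE('k) n i d"
proof -
  have bE0: "bE l = 0" if "l \<in> AL (Suc 0)" for l
    using that by (intro short_0) (simp add: AL_def)
  have Phi_bd: "Phi (if m = 0 then 0 else lext (hoch_bd m) T) = lext bE (Phi T)" if T: "T \<in> vs {w. validw n (Suc m) w}" for T m
  proof (cases "m = 0")
    case True
    have "lext bE (Phi T) = lext (\<lambda>_. 0) (Phi T)"
      using Phi_AL[OF T] bE0 True by (intro lext_cong) (auto simp: vs_def)
    then show ?thesis using True by simp
  next
    case False
    then show ?thesis unfolding lext_lext if_not_P[OF False] using T Phi_hoch_bd by (intro lext_cong) (auto simp: vs_def)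
  qed
  have hoch_bd_valid: "hoch_bd m w \<in> vs {w. validw n m w}" if w: "validw n (Suc m) w" and m: "0 < m" for m w
  proof -
    have lw: "length w = Suc m" and vw: "\<And>j. j \<le> m \<Longrightarrow> valid_path n (w ! j)" using w by (auto simp: validw_def)
    have P: "path_prod p q \<in> vs {p. valid_path n p}" if "valid_path n p" "valid_path n q" for p q
      using pcat_props(1)[OF that] by (auto simp: path_prod_def vs_intros)
    have I: "tensor_ins u v X \<in> vs {w. validw n m w}" if "X \<in> vs {p. valid_path n p}" "Suc (length u + length v) = m" "\<forall>p\<in>set (u @ v). valid_path n p" for u v X
      unfolding tensor_ins_def using that(1) by (rule lext_vs) (use that in \<open>auto simp: validw_def\<close>)
    have s: "\<forall>p\<in>set (take j w @ drop j' w). valid_path n p" "\<forall>p\<in>set ([] @ take j (drop j' w)). valid_path n p" for j j'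
      using w by (auto simp: validw_def dest: in_set_takeD in_set_dropD)
    show ?thesis unfolding hoch_bd_def
      by (intro vs_intros I P vw s) (use lw m in auto)
  qed
  let ?bd = "\<lambda>m. lext (hoch_bd m)"
  have bd0: "lext (hoch_bd (Suc m)) T \<in> vs {w. validw n (Suc m) w}" if "T \<in> vs {w. validw n (Suc (Suc m)) w}" for T m
    using that by (rule lext_vs) (use hoch_bd_valid in auto)
  have Z: "(HHh_Z n i :: 'k ten set) = lookup ` {T \<in> vs {w. validw n (Suc i) w}. lext bE (Phi T) = 0}"
  proof -
    have "bd i (lookup T) \<in> Nsub n i \<longleftrightarrow> lext bE (Phi T) = 0" if T: "T \<in> vs {w. validw n (Suc i) w}" for T
    proof (cases i)
      case 0
      have "0 \<in> tensor_ideal 0" by (rule pmv.subspace_0[OF subspace_tensor_ideal])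
      then have "bd i (lookup T) \<in> Nsub n i" by (auto simp: 0 bd_lookup Nsub_lookup image_iff)
      then show ?thesis using Phi_bd[OF T] by (simp add: 0)
    next
      case (Suc m)
      have "bd i (lookup T) \<in> Nsub n i \<longleftrightarrow> lext (hoch_bd i) T \<in> tensor_ideal i" by (auto simp: Suc bd_lookup Nsub_lookup image_iff)
      also have "\<dots> \<longleftrightarrow> Phi (lext (hoch_bd i) T) = 0" using Phi_kernel[OF bd0[of T m]] T by (simp add: Suc)
      finally show ?thesis using Phi_bd[OF T] by (simp add: Suc)
    qed
    then show ?thesis by (auto simp: HHh_Z_def Ten_lookup)
  qed
  have B: "lookup T \<in> HHh_B n i \<longleftrightarrow> Phi T \<in> boundaries bar_words bE i" if T: "T \<in> vs {w. validw n (Suc i) w}" for T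
  proof
    assume "lookup T \<in> HHh_B n i"
    then obtain S N where SN: "lookup T = bd (Suc i) (lookup S) + lookup N" "S \<in> vs {w. validw n (Suc (Suc i)) w}" "N \<in> tensor_ideal (Suc i)"
      by (auto simp: HHh_B_def Ten_lookup Nsub_lookup)
    then have "T = lext (hoch_bd (Suc i)) S + N" by (simp add: bd_lookup plus_lookup)
    then have "Phi T = lext bE (Phi S)" using Phi_bd[OF SN(2)] tensor_ideal_kernel[OF SN(3)] by (simp add: lext_add)
    then show "Phi T \<in> boundaries bar_words bE i" using Phi_AL[OF SN(2)] by (auto simp: boundaries_def bar_words_def)
  next
    assume "Phi T \<in> boundaries bar_words bE i"
    then obtain y where y: "y \<in> vs (AL (Suc (Suc i)))" "Phi T = lext bE y" by (auto simp: boundaries_def bar_words_def)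
    \<comment> \<open>A chain above y; the defect of its boundary is killed by \<open>Phi\<close>,
      hence lies in \<open>Nsub\<close>.\<close>
    define S where "S = lext sec y"
    have S: "S \<in> vs {w. validw n (Suc (Suc i)) w}" "Phi S = y" using sec_valid[OF y(1)] Phi_sec[OF y(1)] by (simp_all add: S_def)
    define N where "N = T - lext (hoch_bd (Suc i)) S"
    have "Phi N = 0" using Phi_bd[OF S(1)] S(2) y(2) by (simp add: N_def lext_lin)
    moreover have "N \<in> vs {w. validw n (Suc i) w}" using bd0[OF S(1)] T by (simp add: N_def vs_intros)
    ultimately have N: "N \<in> tensor_ideal (Suc i)" using Phi_kernel by blast
    have "lookup T = bd (Suc i) (lookup S) + lookup N" by (simp add: N_def bd_lookup plus_lookup)
    then show "lookup T \<in> HHh_B n i" using S(1) N unfolding HHh_B_def Ten_lookup Nsub_lookup by blast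
  qed
  define R where "R = (\<lambda>z t. \<exists>T\<in>vs {w. validw n (Suc i) w}. t = lookup T \<and> z = Phi T)"
  have "qdim smul (HHh_Z n i :: 'k ten set) (HHh_B n i) d"
  proof (rule qdim_rel[where R = R, OF pmv.vector_space_axioms fnv.vector_space_axioms _ _ _ _ _ _ _ _ q])
    show "R (x + y) (x' + y')" if "R x x'" "R y y'" for x x' y y'
      using that unfolding R_def by (auto simp: plus_lookup lext_add vs_intros intro!: bexI[of _ "_ + _"])
    show "R (scp c x) (smul c x')" if "R x x'" for c x x'
      using that unfolding R_def by (auto simp: smul_lookup lext_scp vs_intros intro!: bexI[of _ "scp c _"])
    show "\<exists>x'\<in>HHh_Z n i. R x x'" if "x \<in> cycles bar_words bE i" for x
    proof -
      have x: "x \<in> vs (AL (Suc i))" "lext bE x = 0" using that by (auto simp: cycles_def bar_words_def)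
      then show ?thesis unfolding R_def Z using sec_valid[OF x(1)] Phi_sec[OF x(1)]
        by (intro bexI[of _ "lookup (lext sec x)"] bexI[of _ "lext sec x"]) auto
    qed
    show "\<exists>x\<in>cycles bar_words bE i. R x x'" if "x' \<in> HHh_Z n i" for x'
      using that Phi_AL unfolding R_def Z by (auto simp: cycles_def bar_words_def)
    show "x \<in> boundaries bar_words bE i \<longleftrightarrow> x' \<in> HHh_B n i" if "R x x'" for x x'
      using that B unfolding R_def by auto
    show "fnv.subspace (HHh_Z n i :: 'k ten set)" unfolding Z
      by (rule subspace_lookup) (auto simp: pmv.subspace_def lext_lin vs_intros)
    show "(0 :: 'k ten) \<in> HHh_B n i" using B[of 0] pmv.subspace_0[OF subspace_boundaries, of bar_words bE i] by (simp add: zero_lookup vs_intros)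
  qed simp
  then show ?thesis by (simp add: dim_HH_hom_is_def has_qdim_qdim)
qed

end

section \<open>The Hochschild cochain complex\<close>

context lalg
begin

section \<open>Cochains as families of finitely supported maps\<close>

definition mk_coch :: "(path list \<Rightarrow> (path \<Rightarrow>\<^sub>0 'k)) \<Rightarrow> 'k coch" where
  "mk_coch F = (\<lambda>(w, p). lookup (F w) p)"

abbreviation VP :: "(path \<Rightarrow>\<^sub>0 'k) set" where "VP \<equiv> vs {p. valid_path n p}"

definition is_cochain :: "nat \<Rightarrow> (path list \<Rightarrow> (path \<Rightarrow>\<^sub>0 'k)) \<Rightarrow> bool" where
  "is_cochain m F \<longleftrightarrow> (\<forall>w. F w \<in> VP) \<and> (\<forall>w. \<not> validw n m w \<longrightarrow> F w = 0) \<and> (\<forall>N\<in>tensor_ideal m. lext F N \<in> rel_ideal)"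

lemma ev_mk_coch: "ev (mk_coch F) w = lookup (F w)"
  by (rule ext) (simp add: ev_def mk_coch_def)

lemma mk_coch_inj: "mk_coch F = mk_coch G \<longleftrightarrow> F = G"
proof
  assume a: "mk_coch F = mk_coch G"
  show "F = G"
  proof
    fix w
    have "lookup (F w) = lookup (G w)" using arg_cong[OF a, of "\<lambda>f. ev f w"] by (simp add: ev_mk_coch)
    then show "F w = G w" by (simp add:)
  qed
qed simp

lemma mk_coch_add: "mk_coch F + mk_coch G = mk_coch (\<lambda>w. F w + G w)"
  by (auto simp: mk_coch_def fun_eq_iff lookup_add)
lemma mk_coch_scp: "smul c (mk_coch F) = mk_coch (\<lambda>w. scp c (F w))"
  by (auto simp: mk_coch_def fun_eq_iff smul_def)
lemma mk_coch_0: "0 = mk_coch (\<lambda>w. 0)"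
  by (auto simp: mk_coch_def fun_eq_iff)

lemma fext_mk_coch: "fext (mk_coch F) (lookup T) = lookup (lext F T)"
  by (simp add: fext_def ev_mk_coch smul_lookup sum_lookup lext_def)

lemma lookup_mem: "lookup Z \<in> lookup ` S \<longleftrightarrow> Z \<in> S"
  by (auto simp:)

lemma Coch_mk_coch: "Coch n m = mk_coch ` {F. is_cochain m F}"
proof (intro set_eqI iffI)
  fix f :: "'k coch" assume f: "f \<in> Coch n m"
  have "\<exists>Z. ev f w = lookup Z" for w using f by (auto simp: Coch_def KQ_lookup)
  then obtain F where F: "\<And>w. ev f w = lookup (F w)" by metis
  have fm: "f = mk_coch F"
  proof
    fix x show "f x = mk_coch F x" using fun_cong[OF F[of "fst x"], of "snd x"] by (cases x) (simp add: ev_def mk_coch_def)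
  qed
  have "is_cochain m F"
    using f unfolding Coch_def fm by (auto simp: is_cochain_def ev_mk_coch KQ_lookup lookup_mem Nsub_lookup Iideal_lookup fext_mk_coch zero_lookup[symmetric])
  then show "f \<in> mk_coch ` {F. is_cochain m F}" using fm by blast
next
  fix f :: "'k coch" assume "f \<in> mk_coch ` {F. is_cochain m F}"
  then show "f \<in> Coch n m"
    unfolding Coch_def by (auto simp: is_cochain_def ev_mk_coch KQ_lookup lookup_mem Nsub_lookup Iideal_lookup fext_mk_coch zero_lookup[symmetric])
qed

lemma is_cochain_add: "is_cochain m F \<Longrightarrow> is_cochain m G \<Longrightarrow> is_cochain m (\<lambda>w. F w + G w)"
  by (auto simp: is_cochain_def vs_intros lext_plus pmv.subspace_add[OF subspace_rel_ideal])
lemma is_cochain_scp: "is_cochain m F \<Longrightarrow> is_cochain m (\<lambda>w. scp c (F w))"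
  by (auto simp: is_cochain_def vs_intros lext_scpf pmv.subspace_scale[OF subspace_rel_ideal])
lemma is_cochain_minus: "is_cochain m F \<Longrightarrow> is_cochain m G \<Longrightarrow> is_cochain m (\<lambda>w. F w - G w)"
  by (auto simp: is_cochain_def vs_intros lext_minusf pmv.subspace_diff[OF subspace_rel_ideal])
lemma is_cochain_0: "is_cochain m (\<lambda>w. 0)"
  by (auto simp: is_cochain_def vs_intros pmv.subspace_0[OF subspace_rel_ideal])

text \<open>The coordinate at b of the image of X in the algebra.\<close>

definition cf :: "tri \<Rightarrow> (path \<Rightarrow>\<^sub>0 'k) \<Rightarrow> 'k" where "cf b X = lookup (class_of X) [b]"

lemma cf_lin: "cf b (X + Y) = cf b X + cf b Y" "cf b (X - Y) = cf b X - cf b Y" "cf b (scp c X) = c * cf b X"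
  "cf b 0 = 0" "cf b (\<Sum>i\<in>I. f i) = (\<Sum>i\<in>I. cf b (f i))"
  by (simp_all add: cf_def class_of_def lext_lin lookup_add lookup_minus lookup_sum)

lemma cf_lext: "cf b (lext F T) = (\<Sum>w\<in>keys T. lookup T w * cf b (F w))"
  by (simp add: lext_def cf_lin)

lemma cf_sg: "b \<noteq> Oz \<Longrightarrow> cf b (sg p) = (if nform p = b then path_sign p else 0)"
  by (auto simp: cf_def class_of_def dw_def lookup_sg)

text \<open>Coordinates at duals are all coordinates, since \<open>dual\<close> is an involution of
  the basis. If they vanish, X equals its difference from its reduction, which lies in the
  ideal.\<close>

lemma rel_ideal_iff:
  assumes X: "X \<in> VP"
  shows "X \<in> rel_ideal \<longleftrightarrow> (\<forall>b. al b \<longrightarrow> cf (dual b) X = 0)"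
proof
  assume "X \<in> rel_ideal"
  then show "\<forall>b. al b \<longrightarrow> cf (dual b) X = 0" using class_of_rel_ideal by (simp add: cf_def)
next
  assume c: "\<forall>b. al b \<longrightarrow> cf (dual b) X = 0"
  have cb: "cf b X = 0" if "al b" for b
    using c[rule_format, OF al_dual[OF that]] dual_dual[OF that] by simp
  have pi0: "class_of X = 0"
  proof (rule poly_mapping_eqI)
    fix l
    have pv: "class_of X \<in> vs {[b] | b. al b}"
      unfolding class_of_def using X
    proof (rule lext_vs)
      fix p assume "p \<in> {p. valid_path n p}"
      show "scp (path_sign p) (dw [nform p]) \<in> vs {[b] | b. al b}"
        using nform_cases[of p] by (intro vs_intros dw_vs) fastforce
    qed
    show "lookup (class_of X) l = lookup 0 l"
    proof (cases "l \<in> keys (class_of X)")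
      case True
      then obtain b where "l = [b]" "al b" using pv by (auto simp: vs_def)
      then show ?thesis using cb by (simp add: cf_def)
    qed (simp add: in_keys_iff)
  qed
  define s1 where "s1 l = scp (path_sign (std_path (hd l))) (sg (std_path (hd l)))" for l
  have "reduced p = lext s1 (scp (path_sign p) (dw [nform p]))" for p
    by (auto simp: reduced_def lext_lin dw_def s1_def)
  then have "reduced = (\<lambda>p. lext s1 (scp (path_sign p) (dw [nform p])))" by (rule ext)
  then have "lext reduced X = lext s1 (class_of X)" by (simp only: class_of_def lext_lext)
  then have r0: "lext reduced X = 0" by (simp add: pi0)
  have "X = lext (\<lambda>p. sg p - reduced p) X" by (simp add: lext_minusf r0)
  also have "\<dots> \<in> rel_ideal" using X reduced_rel_ideal by (intro lext_mem[OF subspace_rel_ideal]) (auto simp: vs_def)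
  finally show "X \<in> rel_ideal" .
qed

text \<open>A cochain f becomes the functional sending \<open>b # w\<close> to the coefficient of f(w) at the dual of b.\<close>

definition to_dual :: "nat \<Rightarrow> (path list \<Rightarrow> (path \<Rightarrow>\<^sub>0 'k)) \<Rightarrow> tri list \<Rightarrow> 'k" where
  "to_dual m F l = (if l \<in> AL (Suc m) then word_sign (map std_path (tl l)) * cf (dual (hd l)) (F (map std_path (tl l))) else 0)"

lemma to_dual_Oz: "Oz \<in> set l \<Longrightarrow> to_dual m F l = 0"
  using al_O by (auto simp: to_dual_def AL_def)

lemma pair_dw: "(Oz \<in> set l \<Longrightarrow> g l = 0) \<Longrightarrow> pair g (dw l) = g l"
  by (simp add: dw_def)

lemma dual_neq_Oz: "al b \<Longrightarrow> dual b \<noteq> Oz"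
  using al_dual al_neq_O by blast

text \<open>A cochain sends tensors with a factor in the ideal into the ideal, so modulo the ideal
  its value at w depends only on the signed normal forms of the letters.\<close>

lemma cf_coch:
  assumes F: "is_cochain m F" and w: "validw n m w" and b: "al b"
  shows "cf (dual b) (F w) = word_sign w * to_dual m F (b # map nform w)"
proof -
  have "sg w - lext sec (phi w) \<in> tensor_ideal m"
  proof (cases "w = []")
    case True
    then show ?thesis using w by (simp add: phi_def dw_def sec_def pmv.subspace_0[OF subspace_tensor_ideal])
  next
    case False
    then show ?thesis using sec_word_pre[of "[]" w] w by (simp add: validw_def pre_def)
  qed
  then have "lext F (sg w - lext sec (phi w)) \<in> rel_ideal" using F by (simp add: is_cochain_def)
  then have "cf (dual b) (lext F (sg w - lext sec (phi w))) = 0" using b class_of_rel_ideal by (simp add: cf_def)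
  then have e: "cf (dual b) (F w) = cf (dual b) (lext F (lext sec (phi w)))" by (simp add: lext_diff cf_lin)
  show ?thesis
  proof (cases "Oz \<in> set (map nform w)")
    case True
    then have "phi w = 0" by (simp add: phi_def)
    then show ?thesis using e True to_dual_Oz[of "b # map nform w" m F] by (simp add: cf_lin)
  next
    case False
    then have a: "\<forall>b\<in>set (map nform w). al b" using nform_cases by (metis ex_map_conv)
    have "b # map nform w \<in> AL (Suc m)" using a b w by (auto simp: AL_def validw_def)
    then show ?thesis using e False by (simp add: phi_def dw_def sec_def lext_lin cf_lin to_dual_def mult.assoc)
  qed
qed

lemma cf_coch_lext:
  assumes F: "is_cochain m F" and T: "T \<in> vs {w. validw n m w}" and b: "al b"
  shows "cf (dual b) (lext F T) = pair (\<lambda>l. to_dual m F (b # l)) (Phi T)"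
proof -
  have "pair (\<lambda>l. to_dual m F (b # l)) (phi w) = word_sign w * to_dual m F (b # map nform w)" for w
    unfolding phi_def pair_scp by (subst pair_dw) (simp_all add: to_dual_Oz)
  then show ?thesis unfolding cf_lext pair_lext pair_def[of _ T] using T cf_coch[OF F _ b]
    by (intro sum.cong) (auto simp: vs_def)
qed

section \<open>The coboundary as the transpose of \<open>bE\<close>\<close>

definition cobd :: "nat \<Rightarrow> (path list \<Rightarrow> (path \<Rightarrow>\<^sub>0 'k)) \<Rightarrow> path list \<Rightarrow> (path \<Rightarrow>\<^sub>0 'k)" where
  "cobd m F w = poly_prod (sg (w ! 0)) (F (drop 1 w))
     + (\<Sum>j\<in>{1..m}. scp ((-1) ^ j) (lext F (tensor_ins (take (j - 1) w) (drop (Suc j) w) (path_prod (w ! (j - 1)) (w ! j)))))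
     + scp ((-1) ^ Suc m) (poly_prod (F (take m w)) (sg (w ! m)))"

lemma cob_mk_coch: "cob n m (mk_coch F) = mk_coch (\<lambda>w. if validw n (Suc m) w then cobd m F w else 0)"
proof
  fix x :: "path list \<times> path"
  obtain w p where x: "x = (w, p)" by (cases x)
  have "kqmult (bp (w ! 0)) (ev (mk_coch F) (drop 1 w))
        + (\<Sum>j\<in>{1..m}. smul ((-1) ^ j)
             (fext (mk_coch F) (tens (map bp (take (j - 1) w) @ [pm (w ! (j - 1)) (w ! j)] @ map bp (drop (Suc j) w)))))
        + smul ((-1) ^ Suc m) (kqmult (ev (mk_coch F) (take m w)) (bp (w ! m))) = lookup (cobd m F w)"
    unfolding pm_lookup tens_lookup fext_mk_coch ev_mk_coch bp_lookup kqmult_lookup smul_lookup sum_lookup plus_lookup cobd_def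
    by (rule refl)
  then show "cob n m (mk_coch F) x = mk_coch (\<lambda>w. if validw n (Suc m) w then cobd m F w else 0) x"
    unfolding x cob_def mk_coch_def prod.case by simp
qed

lemma path_prod_VP: "valid_path n p \<Longrightarrow> valid_path n q \<Longrightarrow> path_prod p q \<in> VP"
  using pcat_props(1)[of p q] by (auto simp: path_prod_def vs_intros)

lemma poly_prod_VP: "X \<in> VP \<Longrightarrow> Y \<in> VP \<Longrightarrow> poly_prod X Y \<in> VP"
  unfolding poly_prod_def by (rule lext_vs, assumption, rule lext_vs, assumption) (use path_prod_VP in auto)

lemma tensor_ins_valid: "X \<in> VP \<Longrightarrow> Suc (length u + length v) = m \<Longrightarrow> \<forall>p\<in>set (u @ v). valid_path n p \<Longrightarrow> tensor_ins u v X \<in> vs {w. validw n m w}"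
  unfolding tensor_ins_def by (rule lext_vs) (auto simp: validw_def)

lemma cobd_VP:
  assumes F: "is_cochain m F" and w: "validw n (Suc m) w"
  shows "cobd m F w \<in> VP"
proof -
  have FV: "F u \<in> VP" for u using F by (simp add: is_cochain_def)
  have v: "valid_path n (w ! j)" if "j \<le> m" for j using w that by (auto simp: validw_def)
  show ?thesis unfolding cobd_def
    by (intro vs_intros poly_prod_VP FV lext_mem[OF subspace_vs]) (use v in auto)
qed

lemma class_of_path_prod: "valid_path n p \<Longrightarrow> valid_path n q \<Longrightarrow> class_of (path_prod p q) = scp (path_sign p * path_sign q) (dw [mu (nform p) (nform q)])"
proof (cases "ptgt p = psrc q")
  case True
  assume "valid_path n p" "valid_path n q"
  then show ?thesis using True pcat_props(5)[of p q] nform_pcat[of p q] by (simp add: path_prod_def class_of_def)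
next
  case False
  assume "valid_path n p" "valid_path n q"
  then have "mu (nform p) (nform q) = Oz" using nform_pmult[of p q] False by (simp add: pmult_def)
  then show ?thesis using False by (simp add: path_prod_def class_of_def)
qed

lemma cf_path_prod:
  assumes "valid_path n p" "valid_path n q" "al b"
  shows "cf (dual b) (path_prod p q) = (if mu (nform p) (nform q) = dual b then path_sign p * path_sign q else 0)"
  using dual_neq_Oz[OF assms(3)] by (auto simp: cf_def class_of_path_prod[OF assms(1,2)] dw_def lookup_sg)

text \<open>By cyclic invariance of the form, the coefficient of the dual of b in pX comes from that
  of the dual of bp in X. This turns the first outer term of the coboundary into a face of b #
  w.\<close>

lemma cf_left:
  assumes p: "valid_path n p" and X: "X \<in> VP" and b: "al b"
  shows "cf (dual b) (poly_prod (sg p) X) = (if mu b (nform p) \<noteq> Oz then path_sign p * cf (dual (mu b (nform p))) X else 0)"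
proof -
  have q: "cf (dual b) (path_prod p q) = (if mu b (nform p) \<noteq> Oz then path_sign p * cf (dual (mu b (nform p))) (sg q) else 0)" if "valid_path n q" for q
  proof (cases "al (nform p) \<and> al (nform q)")
    case True
    then show ?thesis using mu_dual_iff[of b "nform p" "nform q"] b dual_neq_Oz[OF al_mu, of b "nform p"]
      by (auto simp: cf_path_prod[OF p that b] cf_sg)
  next
    case False
    then have "nform p = Oz \<or> nform q = Oz" using nform_cases by blast
    then show ?thesis using dual_neq_Oz[OF b] dual_neq_Oz[OF al_mu, of b "nform p"]
      by (auto simp: cf_path_prod[OF p that b] cf_sg)
  qed
  have "cf (dual b) (poly_prod (sg p) X) = (\<Sum>q\<in>keys X. lookup X q * (if mu b (nform p) \<noteq> Oz then path_sign p * cf (dual (mu b (nform p))) (sg q) else 0))"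
    unfolding poly_prod_def lext_sg cf_lext using X q by (intro sum.cong) (auto simp: vs_def)
  also have "\<dots> = (if mu b (nform p) \<noteq> Oz then path_sign p * cf (dual (mu b (nform p))) (lext sg X) else 0)"
    unfolding cf_lext by (simp add: sum_distrib_left mult.left_commute)
  finally show ?thesis by simp
qed

text \<open>The mirror image, in which cyclic invariance carries p around to the left of b; it
  yields the cyclic face.\<close>

lemma cf_right:
  assumes p: "valid_path n p" and X: "X \<in> VP" and b: "al b"
  shows "cf (dual b) (poly_prod X (sg p)) = (if mu (nform p) b \<noteq> Oz then path_sign p * cf (dual (mu (nform p) b)) X else 0)"
proof -
  have q: "cf (dual b) (path_prod q p) = (if mu (nform p) b \<noteq> Oz then path_sign p * cf (dual (mu (nform p) b)) (sg q) else 0)" if "valid_path n q" for q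
  proof (cases "al (nform p) \<and> al (nform q)")
    case True
    have "mu (nform q) (nform p) = dual b \<longleftrightarrow> mu b (nform q) = dual (nform p)" using mu_eq_dual_iff True b by blast
    also have "\<dots> \<longleftrightarrow> mu (nform p) b \<noteq> Oz \<and> nform q = dual (mu (nform p) b)" using mu_dual_iff True b by blast
    finally show ?thesis using dual_neq_Oz[OF al_mu, of "nform p" b]
      by (auto simp: cf_path_prod[OF that p b] cf_sg)
  next
    case False
    then have "nform p = Oz \<or> nform q = Oz" using nform_cases by blast
    then show ?thesis using dual_neq_Oz[OF b] dual_neq_Oz[OF al_mu, of "nform p" b]
      by (auto simp: cf_path_prod[OF that p b] cf_sg)
  qed
  have "cf (dual b) (poly_prod X (sg p)) = (\<Sum>q\<in>keys X. lookup X q * (if mu (nform p) b \<noteq> Oz then path_sign p * cf (dual (mu (nform p) b)) (sg q) else 0))"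
    unfolding poly_prod_def lext_sg cf_lext using X q by (intro sum.cong) (auto simp: vs_def)
  also have "\<dots> = (if mu (nform p) b \<noteq> Oz then path_sign p * cf (dual (mu (nform p) b)) (lext sg X) else 0)"
    unfolding cf_lext by (simp add: sum_distrib_left mult.left_commute)
  finally show ?thesis by simp
qed

text \<open>The first outer term is the face that merges b with the first letter, the inner terms
  are the inner faces of b # w shifted by one place, and the last outer term is the cyclic
  face.\<close>

lemma cf_cobd:
  assumes F: "is_cochain m F" and w: "validw n (Suc m) w" and b: "al b"
  shows "cf (dual b) (cobd m F w) = word_sign w * pair (to_dual m F) (bE (b # map nform w))"
proof -
  let ?G = "to_dual m F" and ?l = "map nform w"
  have lw: "length w = Suc m" and vw: "\<And>j. j \<le> m \<Longrightarrow> valid_path n (w ! j)" and sw: "\<forall>p\<in>set w. valid_path n p"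
    using w by (auto simp: validw_def)
  have FV: "F u \<in> VP" for u using F by (simp add: is_cochain_def)
  have pG: "pair ?G (dw l) = ?G l" for l by (rule pair_dw) (rule to_dual_Oz)
  obtain p0 w1 where w1: "w = p0 # w1" using lw by (cases w) auto
  obtain w2 pm where w2: "w = w2 @ [pm]" using lw by (cases w rule: rev_cases) auto
  have t0: "cf (dual b) (poly_prod (sg (w ! 0)) (F (drop 1 w))) = word_sign w * ?G (mu b (?l ! 0) # drop 1 ?l)"
  proof -
    have v: "valid_path n p0" "validw n m w1" using w lw by (auto simp: w1 validw_def)
    have "cf (dual b) (poly_prod (sg p0) (F w1)) = path_sign p0 * word_sign w1 * ?G (mu b (nform p0) # map nform w1)"
    proof (cases "mu b (nform p0) = Oz")
      case True
      then show ?thesis using cf_left[OF v(1) FV b, of w1] to_dual_Oz[of "Oz # map nform w1" m F] by simp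
    next
      case False
      then show ?thesis using cf_left[OF v(1) FV b, of w1] cf_coch[OF F v(2) al_mu[OF False]] by simp
    qed
    then show ?thesis by (simp add: w1)
  qed
  have tm: "cf (dual b) (poly_prod (F (take m w)) (sg (w ! m))) = word_sign w * ?G (mu (last ?l) b # butlast ?l)"
  proof -
    have e: "take m w = w2" "w ! m = pm" using lw by (auto simp: w2 nth_append)
    have v: "valid_path n pm" "validw n m w2" using w lw by (auto simp: w2 validw_def)
    have "cf (dual b) (poly_prod (F w2) (sg pm)) = word_sign w2 * path_sign pm * ?G (mu (nform pm) b # map nform w2)"
    proof (cases "mu (nform pm) b = Oz")
      case True
      then show ?thesis using cf_right[OF v(1) FV b, of w2] to_dual_Oz[of "Oz # map nform w2" m F] by simp
    next
      case False
      then show ?thesis using cf_right[OF v(1) FV b, of w2] cf_coch[OF F v(2) al_mu[OF False]] by simp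
    qed
    then show ?thesis unfolding e by (simp add: w2 butlast_append)
  qed
  have tj: "cf (dual b) (lext F (tensor_ins (take (j - 1) w) (drop (Suc j) w) (path_prod (w ! (j - 1)) (w ! j))))
      = word_sign w * ?G (b # take (j - 1) ?l @ mu (?l ! (j - 1)) (?l ! j) # drop (Suc j) ?l)" if j: "j \<in> {1..m}" for j
  proof -
    obtain i where i: "j = Suc i" "i < m" using j by (cases j) auto
    have "w = take i w @ w ! i # w ! Suc i # drop (Suc (Suc i)) w"
      using i lw by (metis Cons_nth_drop_Suc Suc_lessD Suc_mono append_take_drop_id)
    then have s: "word_sign w = word_sign (take i w) * path_sign (w ! i) * path_sign (w ! Suc i) * word_sign (drop (Suc (Suc i)) w)"
      by (metis word_sign_simps(2,3) mult.assoc)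
    have V: "tensor_ins (take i w) (drop (Suc (Suc i)) w) (path_prod (w ! i) (w ! Suc i)) \<in> vs {w. validw n m w}"
      by (rule tensor_ins_valid[OF path_prod_VP[OF vw vw]]) (use i lw sw in \<open>auto dest: in_set_takeD in_set_dropD\<close>)
    have "pair (\<lambda>l. ?G (b # l)) (dw (map nform (take i w) @ mu (nform (w ! i)) (nform (w ! Suc i)) # map nform (drop (Suc (Suc i)) w)))
       = ?G (b # map nform (take i w) @ mu (nform (w ! i)) (nform (w ! Suc i)) # map nform (drop (Suc (Suc i)) w))"
      by (rule pair_dw) (simp add: to_dual_Oz)
    then show ?thesis using cf_coch_lext[OF F V b] Phi_pm[OF vw vw, of i "Suc i" "take i w" "drop (Suc (Suc i)) w"] i lw s
      by (simp add: pair_scp take_map drop_map)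
  qed
  have "cf (dual b) (cobd m F w) = word_sign w * (?G (mu b (?l ! 0) # drop 1 ?l)
      + (\<Sum>j\<in>{1..m}. (-1) ^ j * ?G (b # take (j - 1) ?l @ mu (?l ! (j - 1)) (?l ! j) # drop (Suc j) ?l))
      + (-1) ^ Suc m * ?G (mu (last ?l) b # butlast ?l))"
    unfolding cobd_def cf_lin t0 tm using tj by (simp add: sum_distrib_left algebra_simps)
  also have "?G (mu b (?l ! 0) # drop 1 ?l)
      + (\<Sum>j\<in>{1..m}. (-1) ^ j * ?G (b # take (j - 1) ?l @ mu (?l ! (j - 1)) (?l ! j) # drop (Suc j) ?l)) = pair ?G (bprime (b # ?l))"
  proof -
    have "pair ?G (bprime (b # ?l)) = (\<Sum>j<Suc m. (-1) ^ j * ?G (take j (b # ?l) @ mu ((b # ?l) ! j) ((b # ?l) ! Suc j) # drop (Suc (Suc j)) (b # ?l)))"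
      unfolding bprime_sum using lw by (simp add: pair_lin pG del: sum.lessThan_Suc)
    also have "\<dots> = ?G (mu b (?l ! 0) # drop 1 ?l) + (\<Sum>j<m. (-1) ^ Suc j * ?G (b # take j ?l @ mu (?l ! j) (?l ! Suc j) # drop (Suc (Suc j)) ?l))"
      unfolding sum.lessThan_Suc_shift by simp
    also have "(\<Sum>j<m. (-1) ^ Suc j * ?G (b # take j ?l @ mu (?l ! j) (?l ! Suc j) # drop (Suc (Suc j)) ?l))
       = (\<Sum>j\<in>{1..m}. (-1) ^ j * ?G (b # take (j - 1) ?l @ mu (?l ! (j - 1)) (?l ! j) # drop (Suc j) ?l))"
      by (rule sum.reindex_bij_witness[where i = "\<lambda>j. j - 1" and j = Suc]) auto
    finally show ?thesis by simp
  qed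
  also have "(-1) ^ Suc m * ?G (mu (last ?l) b # butlast ?l) = pair ?G (scp ((-1) ^ (length (b # ?l) - 1)) (co (b # ?l)))"
  proof -
    have "co (b # ?l) = dw (mu (last ?l) b # butlast ?l)" using lw by (cases w rule: rev_cases) (simp_all add: co_def)
    then show ?thesis using lw by (simp only: pair_scp pG length_Cons length_map diff_Suc_1)
  qed
  finally show ?thesis by (simp add: bE_def pair_add)
qed

text \<open>The inverse of \<open>to_dual\<close> modulo the ideal.\<close>

definition from_dual :: "nat \<Rightarrow> (tri list \<Rightarrow> 'k) \<Rightarrow> path list \<Rightarrow> (path \<Rightarrow>\<^sub>0 'k)" where
  "from_dual m h w = (if validw n m w then (\<Sum>b\<in>{b. al b}. scp (word_sign w * h (b # map nform w) * path_sign (std_path (dual b))) (sg (std_path (dual b)))) else 0)"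

lemma cf_from_dual:
  assumes w: "validw n m w" and b: "al b"
  shows "cf (dual b) (from_dual m h w) = word_sign w * h (b # map nform w)"
proof -
  have "cf (dual b) (from_dual m h w) = (\<Sum>a\<in>{b. al b}. word_sign w * h (a # map nform w) * path_sign (std_path (dual a)) * cf (dual b) (sg (std_path (dual a))))"
    using w by (simp add: from_dual_def cf_lin)
  also have "\<dots> = (\<Sum>a\<in>{b. al b}. if a = b then word_sign w * h (b # map nform w) else 0)"
  proof (rule sum.cong[OF refl])
    fix a assume "a \<in> {b. al b}"
    then have a: "al a" by simp
    have "nform (std_path (dual a)) = dual a" using std_path_props[OF al_dual[OF a]] by simp
    moreover have "dual a = dual b \<longleftrightarrow> a = b" using dual_dual a b by metis
    ultimately show "word_sign w * h (a # map nform w) * path_sign (std_path (dual a)) * cf (dual b) (sg (std_path (dual a))) = (if a = b then word_sign w * h (b # map nform w) else 0)"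
      using cf_sg[OF dual_neq_Oz[OF b], of "std_path (dual a)"] by (simp add: mult.assoc)
  qed
  also have "\<dots> = word_sign w * h (b # map nform w)" using b by simp
  finally show ?thesis .
qed

lemma from_dual_VP: "from_dual m h w \<in> VP"
proof -
  have "sg (std_path (dual b)) \<in> VP" if "al b" for b using std_path_props[OF al_dual[OF that]] by simp
  then show ?thesis by (auto simp: from_dual_def intro!: vs_intros)
qed

text \<open>Coordinates that depend on w only through its sign and normal forms factor through
  \<open>Phi\<close>, and \<open>Phi\<close> kills N.\<close>

lemma lext_rel_ideal_I:
  assumes F: "\<And>w. F w \<in> VP" and N: "N \<in> tensor_ideal m" and h0: "\<And>b l. Oz \<in> set l \<Longrightarrow> h b l = 0"
    and c: "\<And>w b. validw n m w \<Longrightarrow> al b \<Longrightarrow> cf (dual b) (F w) = word_sign w * h b (map nform w)"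
  shows "lext F N \<in> rel_ideal"
proof -
  note K = tensor_ideal_kernel[OF N]
  have V: "lext F N \<in> VP" by (rule lext_mem[OF subspace_vs F])
  have "cf (dual b) (lext F N) = 0" if b: "al b" for b
  proof -
    have "pair (h b) (phi w) = word_sign w * h b (map nform w)" for w
      unfolding phi_def pair_scp by (subst pair_dw) (simp_all add: h0)
    then have "cf (dual b) (lext F N) = pair (h b) (Phi N)"
      unfolding cf_lext pair_lext pair_def[of _ N] using K c[OF _ b] by (intro sum.cong) (auto simp: vs_def)
    then show ?thesis using K by simp
  qed
  then show ?thesis using rel_ideal_iff[OF V] by blast
qed

lemma is_cochain_from_dual:
  assumes "\<And>l. Oz \<in> set l \<Longrightarrow> h l = 0"
  shows "is_cochain m (from_dual m h)"
  unfolding is_cochain_def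
proof (intro conjI allI ballI impI)
  show "lext (from_dual m h) N \<in> rel_ideal" if "N \<in> tensor_ideal m" for N
    by (rule lext_rel_ideal_I[OF from_dual_VP that, of "\<lambda>b l. h (b # l)"]) (use assms cf_from_dual in auto)
  show "from_dual m h w \<in> VP" for w by (rule from_dual_VP)
  show "from_dual m h w = 0" if "\<not> validw n m w" for w using that by (simp add: from_dual_def)
qed

lemma to_dual_from_dual:
  assumes "supp h \<subseteq> AL (Suc m)"
  shows "to_dual m (from_dual m h) = h"
proof
  fix l
  show "to_dual m (from_dual m h) l = h l"
  proof (cases "l \<in> AL (Suc m)")
    case True
    then obtain b v where l: "l = b # v" "al b" "\<forall>a\<in>set v. al a" "length v = m" by (cases l) (auto simp: AL_def)
    have v: "validw n m (map std_path v)" using l std_path_props by (auto simp: validw_def)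
    have "map nform (map std_path v) = v" using l std_path_props by (simp add: map_idI)
    then have "cf (dual b) (from_dual m h (map std_path v)) = word_sign (map std_path v) * h l" using cf_from_dual[OF v l(2), of h] l by simp
    then show ?thesis using True by (simp add: to_dual_def l flip: mult.assoc)
  next
    case False
    then show ?thesis using assms by (auto simp: to_dual_def supp_def)
  qed
qed

lemma to_dual_supp: "supp (to_dual m F) \<subseteq> bar_words m" by (auto simp: supp_def to_dual_def bar_words_def)

lemma cobd_rel_ideal_iff:
  assumes F: "is_cochain m F"
  shows "(\<forall>w. validw n (Suc m) w \<longrightarrow> cobd m F w \<in> rel_ideal) \<longleftrightarrow> (\<forall>x\<in>bar_words (Suc m). pair (to_dual m F) (bE x) = 0)"
proof
  assume L: "\<forall>w. validw n (Suc m) w \<longrightarrow> cobd m F w \<in> rel_ideal"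
  show "\<forall>x\<in>bar_words (Suc m). pair (to_dual m F) (bE x) = 0"
  proof
    fix x assume "x \<in> bar_words (Suc m)"
    then obtain b v where l: "x = b # v" "al b" "\<forall>a\<in>set v. al a" "length v = Suc m" by (cases x) (auto simp: AL_def bar_words_def)
    have v: "validw n (Suc m) (map std_path v)" using l std_path_props by (auto simp: validw_def)
    have e: "map nform (map std_path v) = v" using l std_path_props by (simp add: map_idI)
    have "cf (dual b) (cobd m F (map std_path v)) = 0" using L v rel_ideal_iff[OF cobd_VP[OF F v]] l by blast
    then have "word_sign (map std_path v) * (word_sign (map std_path v) * pair (to_dual m F) (bE x)) = 0" using cf_cobd[OF F v l(2)] e l by simp
    then show "pair (to_dual m F) (bE x) = 0" by (simp flip: mult.assoc)
  qed
next
  assume R: "\<forall>x\<in>bar_words (Suc m). pair (to_dual m F) (bE x) = 0"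
  show "\<forall>w. validw n (Suc m) w \<longrightarrow> cobd m F w \<in> rel_ideal"
  proof (intro allI impI)
    fix w assume w: "validw n (Suc m) w"
    have "cf (dual b) (cobd m F w) = 0" if b: "al b" for b
    proof (cases "Oz \<in> set (map nform w)")
      case True
      then have "Oz \<in> set (b # map nform w)" by simp
      then show ?thesis using cf_cobd[OF F w b] by (simp only: bE_O pair_0 mult_zero_right)
    next
      case False
      then have a: "\<forall>b\<in>set (map nform w). al b" using nform_cases by (metis ex_map_conv)
      have "b # map nform w \<in> bar_words (Suc m)" using a b w by (auto simp: AL_def validw_def bar_words_def)
      then show ?thesis using cf_cobd[OF F w b] R by simp
    qed
    then show "cobd m F w \<in> rel_ideal" using rel_ideal_iff[OF cobd_VP[OF F w]] by blast
  qed
qed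

lemma is_cochain_cobd:
  assumes F: "is_cochain m F"
  shows "is_cochain (Suc m) (\<lambda>w. if validw n (Suc m) w then cobd m F w else 0)"
  unfolding is_cochain_def
proof (intro conjI allI ballI impI)
  have V: "(if validw n (Suc m) w then cobd m F w else 0) \<in> VP" for w using cobd_VP[OF F] by (simp add: vs_intros)
  then show "(if validw n (Suc m) w then cobd m F w else 0) \<in> VP" for w .
  show "lext (\<lambda>w. if validw n (Suc m) w then cobd m F w else 0) N \<in> rel_ideal" if "N \<in> tensor_ideal (Suc m)" for N
    by (rule lext_rel_ideal_I[OF V that, of "\<lambda>b l. pair (to_dual m F) (bE (b # l))"]) (use cf_cobd[OF F] in auto)
qed auto

lemma to_dual_rel_ideal_iff:
  assumes F: "is_cochain m F"
  shows "(\<forall>w. F w \<in> rel_ideal) \<longleftrightarrow> to_dual m F = (\<lambda>_. 0)"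
proof
  assume "\<forall>w. F w \<in> rel_ideal"
  then show "to_dual m F = (\<lambda>_. 0)" by (intro ext) (simp add: to_dual_def cf_def class_of_rel_ideal)
next
  assume t: "to_dual m F = (\<lambda>_. 0)"
  show "\<forall>w. F w \<in> rel_ideal"
  proof
    fix w
    show "F w \<in> rel_ideal"
    proof (cases "validw n m w")
      case True
      have "F w \<in> VP" using F by (simp add: is_cochain_def)
      then show ?thesis using rel_ideal_iff cf_coch[OF F True] t by (metis mult_zero_right)
    next
      case False
      then show ?thesis using F pmv.subspace_0[OF subspace_rel_ideal] by (simp add: is_cochain_def)
    qed
  qed
qed

lemma to_dual_cobd:
  assumes F: "is_cochain m F" and x: "x \<in> bar_words (Suc m)"
  shows "to_dual (Suc m) (\<lambda>w. if validw n (Suc m) w then cobd m F w else 0) x = pair (to_dual m F) (bE x)"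
proof -
  obtain b v where l: "x = b # v" "al b" "\<forall>a\<in>set v. al a" "length v = Suc m" using x by (cases x) (auto simp: AL_def bar_words_def)
  have v: "validw n (Suc m) (map std_path v)" using l std_path_props by (auto simp: validw_def)
  have e: "map nform (map std_path v) = v" using l std_path_props by (simp add: map_idI)
  have "to_dual (Suc m) (\<lambda>w. if validw n (Suc m) w then cobd m F w else 0) x = word_sign (map std_path v) * cf (dual b) (cobd m F (map std_path v))"
    using x v by (simp add: to_dual_def bar_words_def l)
  also have "\<dots> = word_sign (map std_path v) * (word_sign (map std_path v) * pair (to_dual m F) (bE x))" using cf_cobd[OF F v l(2)] e l by simp
  finally show ?thesis by (simp flip: mult.assoc)
qed

lemma to_dual_add: "to_dual m (\<lambda>w. F w + G w) = to_dual m F + to_dual m G"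
  by (rule ext) (simp add: to_dual_def cf_lin algebra_simps)
lemma to_dual_diff: "to_dual m (\<lambda>w. F w - G w) x = to_dual m F x - to_dual m G x"
  by (simp add: to_dual_def cf_lin algebra_simps)
lemma to_dual_scp: "to_dual m (\<lambda>w. scp c (F w)) = smul c (to_dual m F)"
  by (rule ext) (simp add: to_dual_def cf_lin smul_def)

text \<open>\<open>qdim_dual\<close> computes the cohomology of functionals on words, and
  \<open>to_dual\<close> identifies these with cochains modulo cochains that take values in the
  ideal.\<close>

theorem hochschild_cohomology:
  assumes q: "qdim scp (cycles bar_words bE i) (boundaries bar_words bE i) d"
  shows "dim_HH_coh_is TYPE('k) n i d"
proof -
  let ?Z = "{g. supp g \<subseteq> bar_words i \<and> (\<forall>x\<in>bar_words (Suc i). pair g (bE x) = 0)}"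
  let ?B = "{g. supp g \<subseteq> bar_words i \<and> (\<exists>h. \<forall>x\<in>bar_words i. g x = pair h (bE x))}"
  have qd: "qdim smul ?Z ?B d"
    by (rule qdim_dual[OF bE_bE _ q]) (auto simp: bar_words_def intro: bE_vs)
  have Z: "(HHc_Z n i :: 'k coch set) = mk_coch ` {F. is_cochain i F \<and> to_dual i F \<in> ?Z}"
  proof -
    have "(\<forall>w. ev (cob n i (mk_coch F)) w \<in> Iideal n) \<longleftrightarrow> to_dual i F \<in> ?Z" if F: "is_cochain i F" for F
    proof -
      have "(\<forall>w. ev (cob n i (mk_coch F)) w \<in> Iideal n) \<longleftrightarrow> (\<forall>w. validw n (Suc i) w \<longrightarrow> cobd i F w \<in> rel_ideal)"
        unfolding cob_mk_coch ev_mk_coch Iideal_lookup lookup_mem using pmv.subspace_0[OF subspace_rel_ideal] by auto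
      then show ?thesis using cobd_rel_ideal_iff[OF F] to_dual_supp by auto
    qed
    then show ?thesis by (auto simp: HHc_Z_def Coch_mk_coch)
  qed
  have B: "mk_coch F \<in> HHc_B n i \<longleftrightarrow> to_dual i F \<in> ?B" if F: "is_cochain i F" for F
  proof
    assume "mk_coch F \<in> HHc_B n i"
    then obtain G H where GH: "mk_coch F = (if i = 0 then 0 else cob n (i - 1) (mk_coch G)) + mk_coch H" "is_cochain (i - 1) G" "is_cochain i H"
      "\<forall>w. ev (mk_coch H) w \<in> Iideal n" by (auto simp: HHc_B_def Coch_mk_coch)
    have "\<forall>w. H w \<in> rel_ideal" using GH(4) by (simp add: ev_mk_coch Iideal_lookup lookup_mem)
    then have H0: "to_dual i H = (\<lambda>_. 0)" using to_dual_rel_ideal_iff[OF GH(3)] by blast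
    show "to_dual i F \<in> ?B"
    proof (cases i)
      case 0
      then have "F = H" using GH(1) by (simp add: mk_coch_inj)
      then show ?thesis using H0 to_dual_supp[of i F] by (auto simp: 0 intro!: exI[of _ "\<lambda>_. 0"]) (simp add: pair_def)
    next
      case (Suc m)
      then have "mk_coch F = mk_coch (\<lambda>w. (if validw n (Suc m) w then cobd m G w else 0) + H w)" using GH(1) by (simp add: cob_mk_coch mk_coch_add)
      then have "to_dual i F = to_dual i (\<lambda>w. if validw n (Suc m) w then cobd m G w else 0) + to_dual i H" by (simp add: mk_coch_inj to_dual_add)
      then have "\<forall>x\<in>bar_words i. to_dual i F x = pair (to_dual m G) (bE x)" using to_dual_cobd[of m G] GH(2) H0 by (simp add: Suc)
      then show ?thesis using to_dual_supp by blast
    qed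
  next
    assume "to_dual i F \<in> ?B"
    then obtain h where h: "\<And>x. x \<in> bar_words i \<Longrightarrow> to_dual i F x = pair h (bE x)" by blast
    show "mk_coch F \<in> HHc_B n i"
    proof (cases i)
      \<comment> \<open>\<open>bE\<close> is 0 on words of one letter, so in degree 0 the functional
        vanishes and the cochain takes values in the ideal.\<close>
      case 0
      have "bE x = 0" if "x \<in> bar_words 0" for x using that by (intro short_0) (simp add: bar_words_def AL_def)
      then have "to_dual i F x = 0" for x using h[of x] by (cases "x \<in> bar_words i") (auto simp: 0 to_dual_def bar_words_def)
      then have "to_dual i F = (\<lambda>_. 0)" by blast
      then have I: "\<forall>w. F w \<in> rel_ideal" using to_dual_rel_ideal_iff[OF F] by blast
      have "mk_coch F = (if i = 0 then 0 else cob n (i - 1) (mk_coch (\<lambda>_. 0))) + mk_coch F" using 0 by simp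
      moreover have "mk_coch (\<lambda>_. 0) \<in> Coch n (i - 1)" "mk_coch F \<in> Coch n i" using is_cochain_0 F by (auto simp: Coch_mk_coch)
      moreover have "\<forall>w. ev (mk_coch F) w \<in> Iideal n" using I by (simp add: ev_mk_coch Iideal_lookup lookup_mem)
      ultimately show ?thesis unfolding HHc_B_def by blast
    next
      case (Suc m)
      \<comment> \<open>Values outside the basis words are cut off so that \<open>from_dual\<close>
        yields a cochain; the pairing with \<open>bE x\<close> sees only basis words.\<close>
      define h' where "h' l = (if l \<in> AL (Suc m) then h l else 0)" for l
      have h'O: "h' l = 0" if "Oz \<in> set l" for l using that al_O by (auto simp: h'_def AL_def)
      have h's: "supp h' \<subseteq> AL (Suc m)" by (auto simp: supp_def h'_def)
      define G where "G = from_dual m h'"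
      have G: "is_cochain m G" "to_dual m G = h'" using is_cochain_from_dual[OF h'O] to_dual_from_dual[OF h's] by (simp_all add: G_def)
      define C where "C w = (if validw n (Suc m) w then cobd m G w else 0)" for w
      define H where "H w = F w - C w" for w
      have C: "is_cochain i C" using is_cochain_cobd[OF G(1)] by (simp add: C_def[abs_def] Suc)
      have H: "is_cochain i H" unfolding H_def using F C by (rule is_cochain_minus)
      have "to_dual i H x = 0" for x
      proof (cases "x \<in> bar_words i")
        case True
        have "bE x \<in> vs (AL (Suc m))" using bE_vs[of x "Suc m"] True by (simp add: bar_words_def Suc)
        then have "pair h' (bE x) = pair h (bE x)" by (intro pair_cong) (auto simp: h'_def vs_def)
        moreover have "to_dual i C x = pair h' (bE x)" using to_dual_cobd[OF G(1), of x] True G(2) by (simp add: C_def[abs_def] Suc)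
        ultimately show ?thesis using h[OF True] by (simp add: H_def[abs_def] to_dual_diff)
      qed (simp add: to_dual_def bar_words_def)
      then have "to_dual i H = (\<lambda>_. 0)" by blast
      then have I: "\<forall>w. H w \<in> rel_ideal" using to_dual_rel_ideal_iff[OF H] by blast
      have "mk_coch F = (if i = 0 then 0 else cob n (i - 1) (mk_coch G)) + mk_coch H"
        by (simp add: Suc cob_mk_coch mk_coch_add mk_coch_inj H_def C_def)
      moreover have "mk_coch G \<in> Coch n (i - 1)" "mk_coch H \<in> Coch n i" using G(1) H by (auto simp: Coch_mk_coch Suc)
      moreover have "\<forall>w. ev (mk_coch H) w \<in> Iideal n" using I by (simp add: ev_mk_coch Iideal_lookup lookup_mem)
      ultimately show ?thesis unfolding HHc_B_def by blast
    qed
  qed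
  have sZ: "fnv.subspace ?Z"
    unfolding fnv.subspace_def
  proof (intro conjI ballI allI)
    show "0 \<in> ?Z" by (auto simp: supp_def pair_def)
    have pa: "pair (x + y) z = pair x z + pair y z" for x y :: "tri list \<Rightarrow> 'k" and z by (simp add: pair_def algebra_simps sum.distrib)
    have ps: "pair (smul c x) z = c * pair x z" for x :: "tri list \<Rightarrow> 'k" and z c by (simp add: pair_def smul_def sum_distrib_left mult.left_commute)
    fix x assume x: "x \<in> ?Z"
    show "smul c x \<in> ?Z" for c using x by (auto simp: supp_def ps) (auto simp: smul_def)
    fix y assume y: "y \<in> ?Z"
    have "supp (x + y) \<subseteq> supp x \<union> supp y" by (auto simp: supp_def)
    then show "x + y \<in> ?Z" using x y by (auto simp: pa)
  qed
  have ZZ: "to_dual i F \<in> ?Z \<Longrightarrow> to_dual i G \<in> ?Z \<Longrightarrow> to_dual i (\<lambda>w. F w + G w) \<in> ?Z" "to_dual i F \<in> ?Z \<Longrightarrow> to_dual i (\<lambda>w. scp c (F w)) \<in> ?Z" for F G c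
    unfolding to_dual_add to_dual_scp using fnv.subspace_add[OF sZ] fnv.subspace_scale[OF sZ] by blast+
  define R where "R = (\<lambda>g f. \<exists>F. is_cochain i F \<and> f = mk_coch F \<and> g = to_dual i F)"
  have "qdim smul (HHc_Z n i :: 'k coch set) (HHc_B n i) d"
  proof (rule qdim_rel[where R = R, OF fnv.vector_space_axioms fnv.vector_space_axioms _ _ _ _ _ _ _ _ qd])
    show "R (x + y) (x' + y')" if r: "R x x'" "R y y'" for x x' y y'
    proof -
      obtain F where F: "is_cochain i F" "x' = mk_coch F" "x = to_dual i F" using r(1) unfolding R_def by blast
      obtain G where G: "is_cochain i G" "y' = mk_coch G" "y = to_dual i G" using r(2) unfolding R_def by blast
      show ?thesis unfolding R_def F(2,3) G(2,3) mk_coch_add to_dual_add[symmetric] using is_cochain_add[OF F(1) G(1)] by blast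
    qed
    show "R (smul c x) (smul c x')" if r: "R x x'" for c x x'
    proof -
      obtain F where F: "is_cochain i F" "x' = mk_coch F" "x = to_dual i F" using r unfolding R_def by blast
      show ?thesis unfolding R_def F(2,3) mk_coch_scp to_dual_scp[symmetric] using is_cochain_scp[OF F(1), of c] by blast
    qed
    show "\<exists>x'\<in>HHc_Z n i. R x x'" if x: "x \<in> ?Z" for x
    proof -
      have s: "supp x \<subseteq> AL (Suc i)" using x by (simp add: bar_words_def)
      have "x l = 0" if l: "Oz \<in> set l" for l
      proof (rule ccontr)
        assume "x l \<noteq> 0"
        then have "l \<in> AL (Suc i)" using s by (auto simp: supp_def)
        then have "al Oz" using l by (auto simp: AL_def)
        then show False by simp
      qed
      then have c: "is_cochain i (from_dual i x)" by (rule is_cochain_from_dual)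
      then have "R x (mk_coch (from_dual i x))" unfolding R_def using to_dual_from_dual[OF s] by metis
      moreover have "mk_coch (from_dual i x) \<in> mk_coch ` {F. is_cochain i F \<and> to_dual i F \<in> ?Z}" using c x to_dual_from_dual[OF s] by simp
      ultimately show ?thesis unfolding Z by blast
    qed
    show "\<exists>x\<in>?Z. R x x'" if "x' \<in> HHc_Z n i" for x'
      using that unfolding R_def Z by blast
    show "x \<in> ?B \<longleftrightarrow> x' \<in> HHc_B n i" if "R x x'" for x x'
      using that B unfolding R_def by blast
    show "fnv.subspace ?Z" by (rule sZ)
    show "fnv.subspace (HHc_Z n i :: 'k coch set)"
      unfolding Z fnv.subspace_def
    proof (intro conjI ballI allI)
      have "to_dual i (\<lambda>_. 0) = 0" by (rule ext) (simp add: to_dual_def cf_lin)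
      then have "to_dual i (\<lambda>_. 0) \<in> ?Z" using fnv.subspace_0[OF sZ] by simp
      then show "0 \<in> mk_coch ` {F. is_cochain i F \<and> to_dual i F \<in> ?Z}" using is_cochain_0 mk_coch_0 by blast
      fix x assume "x \<in> mk_coch ` {F. is_cochain i F \<and> to_dual i F \<in> ?Z}"
      then obtain F where F: "x = mk_coch F" "is_cochain i F" "to_dual i F \<in> ?Z" by blast
      show "smul c x \<in> mk_coch ` {F. is_cochain i F \<and> to_dual i F \<in> ?Z}" for c
        unfolding F(1) mk_coch_scp using is_cochain_scp[OF F(2)] ZZ(2)[OF F(3)] by blast
      fix y assume "y \<in> mk_coch ` {F. is_cochain i F \<and> to_dual i F \<in> ?Z}"
      then obtain G where G: "y = mk_coch G" "is_cochain i G" "to_dual i G \<in> ?Z" by blast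
      show "x + y \<in> mk_coch ` {F. is_cochain i F \<and> to_dual i F \<in> ?Z}"
        unfolding F(1) G(1) mk_coch_add using is_cochain_add[OF F(2) G(2)] ZZ(1)[OF F(3) G(3)] by blast
    qed
    have "to_dual i (\<lambda>_. 0) = 0" by (rule ext) (simp add: to_dual_def cf_lin)
    moreover have "(0 :: tri list \<Rightarrow> 'k) \<in> ?B" by (auto simp: supp_def pair_def intro!: exI[of _ "\<lambda>_. 0"])
    ultimately show "0 \<in> (HHc_B n i :: 'k coch set)" using B[OF is_cochain_0] by (metis mk_coch_0)
  qed
  then show ?thesis by (simp add: dim_HH_coh_is_def has_qdim_qdim)
qed

end

theorem theorem4p4:
  fixes n :: nat
  assumes "alg_closed TYPE('k::field)"
    and "(2::'k) \<noteq> 0"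
    and "n \<ge> 1"
  shows "dim_HH_coh_is TYPE('k) n 0 (2 * n) \<and> dim_HH_hom_is TYPE('k) n 0 (2 * n)
       \<and> (\<forall>i>0. dim_HH_coh_is TYPE('k) n i n \<and> dim_HH_hom_is TYPE('k) n i n)"
proof -
  interpret lalg2 n "TYPE('k)" by unfold_locales (use assms in auto)
  have q: "qdim scp (cycles bar_words bE i) (boundaries bar_words bE i) (if i = 0 then 2 * n else n)" for i
    by (rule words_homology[OF bar_homology])
  show ?thesis
    using hochschild_homology[OF q] hochschild_cohomology[OF q] by (metis gr_implies_not0)
qed

end
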